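(* Let $d\ge2$. There exists a continuous function $a^{**}:(d/4,\infty)\to(-\infty,a_c)$ such that for any $\gamma>d/4$ and any $a\in[a^{**}(\gamma),a_c)$ there is a radially symmetric extremal for the weighted logarithmic Hardy inequality with parameters $(\gamma,a)$, while for $a<a^{**}(\gamma)$ no extremal of the weighted logarithmic Hardy inequality with parameters $(\gamma,a)$ is radially symmetric. Moreover, $a^{**}(\gamma)\ge\tilde a(\gamma)$ for any $\gamma\in(d/4,\infty)$.
   Context: Notation: $a_c=\frac{d-2}{2}$, $\Lambda(a)=(a-a_c)^2$, and $\tilde a(\gamma):=a_c-\frac12\sqrt{(d-1)(4\gamma-1)}$. For $a<a_c$, $\mathcal D^{1,2}_a(\mathbb R^d)$ is the completion of the set of smooth functions with compact support in $\mathbb R^d\setminus\{0\}$ with respect to the norm given by $\||x|^{-a}\nabla u\|_{L^2(\mathbb R^d)}^2+\||x|^{-(a+1)}u\|_{L^2(\mathbb R^d)}^2$. For $a<a_c$, $\gamma\ge d/4$ (and $\gamma>1/2$ if $d=2$), $\mathsf C_{\rm WLH}(\gamma,\Lambda)$ with $\Lambda=\Lambda(a)$ is the optimal (smallest) constant in the weighted logarithmic Hardy inequality with parameters $(\gamma,a)$: $$\int_{\mathbb R^d}\frac{|u|^2}{|x|^{2(a+1)}}\log\left(|x|^{d-2-2a}|u|^2\right)dx\le2\gamma\log\left[\mathsf C_{\rm WLH}(\gamma,\Lambda)\int_{\mathbb R^d}\frac{|\nabla u|^2}{|x|^{2a}}\,dx\right]$$ for all $u\in\mathcal D^{1,2}_a(\mathbb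 R^d)$ normalized by $\int_{\mathbb R^d}\frac{|u|^2}{|x|^{2(a+1)}}\,dx=1$. An extremal is a normalized function $u$ for which equality holds (with the optimal constant). *)

theory Defs
  imports "HOL-Analysis.Analysis"
begin

fun C_k :: "nat \<Rightarrow> ('a::euclidean_space \<Rightarrow> real) \<Rightarrow> bool" where
  "C_k 0 f \<longleftrightarrow> continuous_on UNIV f"
| "C_k (Suc k) f \<longleftrightarrow> (\<forall>x. f differentiable at x) \<and>
     (\<forall>v. C_k k (\<lambda>x. frechet_derivative f (at x) v))"

definition smooth :: "('a::euclidean_space \<Rightarrow> real) \<Rightarrow> bool" where
  "smooth f \<longleftrightarrow> (\<forall>k. C_k k f)"

definition support :: "('a::euclidean_space \<Rightarrow> real) \<Rightarrow> 'a set" where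
  "support f = closure {x. f x \<noteq> 0}"

definition test_function :: "('a::euclidean_space \<Rightarrow> real) \<Rightarrow> bool" where
  "test_function f \<longleftrightarrow> smooth f \<and> compact (support f) \<and> 0 \<notin> support f"

definition gradient :: "('a::euclidean_space \<Rightarrow> real) \<Rightarrow> 'a \<Rightarrow> 'a" where
  "gradient f x = (THE D. GDERIV f x :> D)"

definition a_c :: "nat \<Rightarrow> real" where
  "a_c d = (real d - 2) / 2"

definition a_tilde :: "nat \<Rightarrow> real \<Rightarrow> real" where
  "a_tilde d \<gamma> = a_c d - sqrt ((real d - 1) * (4 * \<gamma> - 1)) / 2"

text \<open>
  The completion of the test functions for the norm
  \<open>\<parallel> |x|^(-a) \<nabla>u \<parallel>\<^sup>2 + \<parallel> |x|^(-(a+1)) u \<parallel>\<^sup>2\<close>, realised as a space of functions: its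
  elements are the limits \<open>u\<close> of sequences of test functions in the weighted \<open>L\<^sup>2\<close> space whose
  gradients converge to some \<open>g\<close> in the other weighted \<open>L\<^sup>2\<close> space. The field \<open>g\<close> is the
  (weak) gradient of \<open>u\<close>; integration by parts against test functions shows that it is
  determined by \<open>u\<close> up to null sets.
\<close>

definition D12 :: "real \<Rightarrow> ('a::euclidean_space \<Rightarrow> real) \<Rightarrow> ('a \<Rightarrow> 'a) \<Rightarrow> bool" where
  "D12 a u g \<longleftrightarrow> u \<in> borel_measurable lborel \<and> g \<in> borel_measurable lborel \<and>
     (\<exists>\<phi> :: nat \<Rightarrow> 'a \<Rightarrow> real. (\<forall>n. test_function (\<phi> n)) \<and>
       (\<lambda>n. \<integral>\<^sup>+x. ennreal ((norm x powr (- a) * norm (gradient (\<phi> n) x - g x))\<^sup>2) \<partial>lborel)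
         \<longlonglongrightarrow> 0 \<and>
       (\<lambda>n. \<integral>\<^sup>+x. ennreal ((norm x powr (- (a + 1)) * \<bar>\<phi> n x - u x\<bar>)\<^sup>2) \<partial>lborel)
         \<longlonglongrightarrow> 0)"

definition normalized :: "real \<Rightarrow> ('a::euclidean_space \<Rightarrow> real) \<Rightarrow> bool" where
  "normalized a u \<longleftrightarrow> (\<integral>x. \<bar>u x\<bar>\<^sup>2 / norm x powr (2 * (a + 1)) \<partial>lborel) = 1"

definition dirichlet_energy :: "real \<Rightarrow> ('a::euclidean_space \<Rightarrow> 'a) \<Rightarrow> real" where
  "dirichlet_energy a g = (\<integral>x. (norm (g x))\<^sup>2 / norm x powr (2 * a) \<partial>lborel)"

text \<open>
  The integral of a function as positive part minus negative part. For normalized \<open>u\<close> in the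
  above space the positive part of the entropy integrand below is integrable, but the negative
  part need not be: the entropy can be \<open>-\<infinity>\<close>, in which case the inequality is trivially true
  (the Bochner integral would wrongly yield \<open>0\<close>).
\<close>

definition extended_integral :: "('a::euclidean_space \<Rightarrow> real) \<Rightarrow> ereal" where
  "extended_integral f =
     enn2ereal (\<integral>\<^sup>+x. ennreal (f x) \<partial>lborel) - enn2ereal (\<integral>\<^sup>+x. ennreal (- f x) \<partial>lborel)"

definition entropy :: "real \<Rightarrow> ('a::euclidean_space \<Rightarrow> real) \<Rightarrow> ereal" where
  "entropy a u = extended_integral (\<lambda>x. \<bar>u x\<bar>\<^sup>2 / norm x powr (2 * (a + 1)) *
     ln (norm x powr (real DIM('a) - 2 - 2 * a) * \<bar>u x\<bar>\<^sup>2))"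

definition WLH_holds :: "'a::euclidean_space itself \<Rightarrow> real \<Rightarrow> real \<Rightarrow> real \<Rightarrow> bool" where
  "WLH_holds T \<gamma> a C \<longleftrightarrow> (\<forall>(u :: 'a \<Rightarrow> real) g. D12 a u g \<and> normalized a u \<longrightarrow>
     entropy a u \<le> ereal (2 * \<gamma> * ln (C * dirichlet_energy a g)))"

definition C_WLH :: "'a::euclidean_space itself \<Rightarrow> real \<Rightarrow> real \<Rightarrow> real" where
  "C_WLH T \<gamma> a = Inf {C. C > 0 \<and> WLH_holds T \<gamma> a C}"

definition WLH_extremal :: "real \<Rightarrow> real \<Rightarrow> ('a::euclidean_space \<Rightarrow> real) \<Rightarrow> bool" where
  "WLH_extremal \<gamma> a u \<longleftrightarrow> normalized a u \<and> (\<exists>g. D12 a u g \<and>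
     entropy a u = ereal (2 * \<gamma> * ln (C_WLH TYPE('a) \<gamma> a * dirichlet_energy a g)))"

text \<open>Radial symmetry of an almost-everywhere equivalence class.\<close>

definition radially_symmetric :: "('a::euclidean_space \<Rightarrow> real) \<Rightarrow> bool" where
  "radially_symmetric u \<longleftrightarrow> (\<exists>f :: real \<Rightarrow> real. AE x in lborel. u x = f (norm x))"

end

theory Submission
  imports Defs "HOL-Probability.Probability" "HOL-Real_Asymp.Real_Asymp"
begin

text \<open>
  Write \<open>x = e\<^sup>s w\<close> with \<open>|w| = 1\<close> and \<open>W(s,w) = sqrt |S| e\<^sup>k\<^sup>s u(x)\<close>, where \<open>k = a\<^sub>c - a\<close> and \<open>|S|\<close> is
  the area of the unit sphere. The weighted logarithmic Hardy inequality becomes an inequality on the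
  cylinder: with \<open>W\<^sup>2\<close> a probability density for the product of \<open>ds\<close> and the uniform probability
  on the sphere, it compares the entropy of \<open>W\<^sup>2\<close> with \<open>2\<gamma>\<close> times the logarithm of the mean
  of \<open>W\<^sub>s\<^sup>2 + |\<nabla>\<^sub>w W|\<^sup>2 + k\<^sup>2 W\<^sup>2\<close>. The parameter \<open>a\<close> only enters through \<open>\<Lambda> = k\<^sup>2\<close>.

  Radial functions are those with \<open>W = W(s)\<close>; among them Gaussians are optimal by the logarithmic
  Sobolev inequality on the line, which gives an explicit constant \<open>WLH_const \<gamma> \<Lambda>\<close>. The idea of the
  proof is that this constant is the best one for all functions if and only if the inequality
    \<open>Ent(\<psi>\<^sup>2) \<le> \<alpha> ln (1 + \<parallel>\<nabla>\<psi>\<parallel>\<^sup>2 / \<Lambda>)\<close>, with \<open>\<alpha> = 2\<gamma> - 1/2\<close>,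
  holds for all \<open>\<psi>\<close> on the sphere with mean square 1 (\<open>sphere_log_ineq\<close>, \<open>WLH_const_attained_iff\<close>).
  In one direction, the entropy of \<open>W\<^sup>2\<close> is that of its marginal on the line, bounded by a transport
  argument (\<open>entropy_le_by_gaussian_transport\<close>), plus the mean entropy of its slices, bounded by the
  spherical inequality with the logarithm replaced by its tangents; the free parameters, namely the
  Gaussian variance and the point of tangency, are then adjusted to the total energy
  (\<open>test_function_WLH\<close>). In the other direction one inserts products of a Gaussian in \<open>s\<close> and a
  function \<open>\<psi>\<close> on the sphere (\<open>optimal_product_function\<close>).

  The spherical inequality is monotone in \<open>\<Lambda>\<close>, so everything is governed by the largest admissible
  \<open>\<Lambda>\<close>, the \<open>critical_parameter\<close>, and the threshold is \<open>a\<^sub>c\<close> minus its square root. It is positive,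
  that is, some \<open>\<Lambda>\<close> is admissible for each \<open>\<alpha> > (d-1)/2\<close> (\<open>sphere_log_ineq_exists\<close>): for large
  energies this is a Sobolev inequality, whose critical exponent on the \<open>(d-1)\<close>-dimensional sphere
  corresponds to \<open>\<alpha> = (d-1)/2\<close>, and for small energies it is a Poincare inequality. It is at most
  \<open>(d-1)\<alpha>/2\<close>, as linearization at the constant function shows, whence the comparison with
  \<open>a_tilde\<close>. It is continuous in \<open>\<alpha>\<close>: from the right because the inequality is closed, from the
  left because for bounded energies a smaller \<open>\<Lambda>\<close> can be traded for a smaller \<open>\<alpha>\<close> and for large
  energies \<open>\<Lambda>\<close> is irrelevant.

  Beyond the threshold a radial extremal cannot exist: on radial functions the inequality holds with
  \<open>WLH_const\<close> (\<open>radial_WLH\<close>), so attaining the optimal constant there would make the two constants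
  equal, hence the spherical inequality true. Since the entropy need not be finite on the
  completion, passing from test functions to limits requires truncation (\<open>WLH_limit\<close>).
\<close>

section \<open>Smooth functions on open sets\<close>

fun Ck_on :: "nat \<Rightarrow> 'a::euclidean_space set \<Rightarrow> ('a \<Rightarrow> real) \<Rightarrow> bool" where
  "Ck_on 0 S f \<longleftrightarrow> continuous_on S f"
| "Ck_on (Suc k) S f \<longleftrightarrow> (\<forall>x\<in>S. f differentiable at x) \<and>
     (\<forall>v. Ck_on k S (\<lambda>x. frechet_derivative f (at x) v))"

definition smooth_on :: "'a::euclidean_space set \<Rightarrow> ('a \<Rightarrow> real) \<Rightarrow> bool" where
  "smooth_on S f \<longleftrightarrow> (\<forall>k. Ck_on k S f)"

lemma Ck_on_UNIV: "Ck_on k UNIV f \<longleftrightarrow> C_k k f" by (induction k arbitrary: f) auto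

lemma smooth_on_UNIV: "smooth_on UNIV f \<longleftrightarrow> smooth f" by (simp add: smooth_on_def smooth_def Ck_on_UNIV)

lemma Ck_on_cong:
  assumes "open S" "Ck_on k S f" "\<And>x. x \<in> S \<Longrightarrow> f x = g x"
  shows "Ck_on k S g" using assms(2,3)
proof (induction k arbitrary: f g)
  case 0
  thus ?case by (simp cong: continuous_on_cong)
next
  case (Suc k)
  have D: "(g has_derivative frechet_derivative f (at x)) (at x)" if "x \<in> S" for x
  proof (rule has_derivative_transform_within_open[OF _ assms(1) that])
    show "(f has_derivative frechet_derivative f (at x)) (at x)"
      using Suc.prems(1) that by (simp add: frechet_derivative_works[symmetric])
  qed (use Suc.prems(2) in auto)
  hence "frechet_derivative f (at x) v = frechet_derivative g (at x) v" if "x \<in> S" for x v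
    using frechet_derivative_at[OF D[OF that]] by simp
  moreover have "Ck_on k S (\<lambda>x. frechet_derivative f (at x) v)" for v using Suc.prems(1) by simp
  ultimately have "Ck_on k S (\<lambda>x. frechet_derivative g (at x) v)" for v by (rule Suc.IH[rotated])
  with D show ?case by (auto simp: differentiable_def)
qed

lemma Ck_on_SucI:
  assumes "open S" "\<And>x. x \<in> S \<Longrightarrow> (f has_derivative f' x) (at x)"
    and "\<And>v. Ck_on k S (\<lambda>x. f' x v)"
  shows "Ck_on (Suc k) S f"
proof -
  have "f' x v = frechet_derivative f (at x) v" if "x \<in> S" for x v using frechet_derivative_at[OF assms(2)[OF that]] by simp
  hence "Ck_on k S (\<lambda>x. frechet_derivative f (at x) v)" for v by (rule Ck_on_cong[OF assms(1) assms(3)])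
  with assms(2) show ?thesis by (auto simp: differentiable_def)
qed

lemma Ck_on_SucD:
  assumes "Ck_on (Suc k) S f"
  shows "\<exists>f'. (\<forall>x\<in>S. (f has_derivative f' x) (at x)) \<and> (\<forall>v. Ck_on k S (\<lambda>x. f' x v))"
  using assms by (intro exI[of _ "\<lambda>x. frechet_derivative f (at x)"]) (simp add: frechet_derivative_works[symmetric])

lemma Ck_on_Suc_imp: "open S \<Longrightarrow> Ck_on (Suc k) S f \<Longrightarrow> Ck_on k S f"
proof (induction k arbitrary: f)
  case 0
  thus ?case by (auto simp: continuous_on_eq_continuous_at differentiable_imp_continuous_within)
next
  case (Suc k)
  thus ?case by (metis Ck_on.simps(2))
qed

lemma Ck_on_subset: "Ck_on k S f \<Longrightarrow> T \<subseteq> S \<Longrightarrow> Ck_on k T f" by (induction k arbitrary: f) (auto intro: continuous_on_subset)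

lemma Ck_on_Un: "open S \<Longrightarrow> open T \<Longrightarrow> Ck_on k S f \<Longrightarrow> Ck_on k T f \<Longrightarrow> Ck_on k (S \<union> T) f"
  by (induction k arbitrary: f) (auto intro: continuous_on_open_Un)

lemma Ck_on_const: "open S \<Longrightarrow> Ck_on k S (\<lambda>x. c)"
proof (induction k arbitrary: c)
  case (Suc k)
  show ?case by (rule Ck_on_SucI[OF Suc.prems, where f' = "\<lambda>_ _. 0"]) (simp_all add: Suc)
qed simp

lemma Ck_on_add:
  assumes "open S" "Ck_on k S f" "Ck_on k S g" shows "Ck_on k S (\<lambda>x. f x + g x)" using assms(2,3)
proof (induction k arbitrary: f g)
  case (Suc k)
  obtain f' where f': "\<And>x. x \<in> S \<Longrightarrow> (f has_derivative f' x) (at x)" "\<And>v. Ck_on k S (\<lambda>x. f' x v)"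
    using Ck_on_SucD[OF Suc.prems(1)] by blast
  obtain g' where g': "\<And>x. x \<in> S \<Longrightarrow> (g has_derivative g' x) (at x)" "\<And>v. Ck_on k S (\<lambda>x. g' x v)"
    using Ck_on_SucD[OF Suc.prems(2)] by blast
  show ?case by (rule Ck_on_SucI[OF assms(1), where f' = "\<lambda>x v. f' x v + g' x v"])
       (auto intro!: Suc.IH has_derivative_add f' g')
qed (auto intro: continuous_intros)

lemma Ck_on_mult:
  assumes "open S" "Ck_on k S f" "Ck_on k S g" shows "Ck_on k S (\<lambda>x. f x * g x)" using assms(2,3)
proof (induction k arbitrary: f g)
  case (Suc k)
  have fg: "Ck_on k S f" "Ck_on k S g" using Suc.prems Ck_on_Suc_imp[OF assms(1)] by auto
  obtain f' where f': "\<And>x. x \<in> S \<Longrightarrow> (f has_derivative f' x) (at x)" "\<And>v. Ck_on k S (\<lambda>x. f' x v)"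
    using Ck_on_SucD[OF Suc.prems(1)] by blast
  obtain g' where g': "\<And>x. x \<in> S \<Longrightarrow> (g has_derivative g' x) (at x)" "\<And>v. Ck_on k S (\<lambda>x. g' x v)"
    using Ck_on_SucD[OF Suc.prems(2)] by blast
  show ?case by (rule Ck_on_SucI[OF assms(1), where f' = "\<lambda>x v. f x * g' x v + f' x v * g x"])
       (auto intro!: has_derivative_mult f' g' Ck_on_add Suc.IH fg assms(1))
qed (auto intro: continuous_intros)

lemma Ck_on_sum:
  assumes "open S" "finite I" "\<And>i. i \<in> I \<Longrightarrow> Ck_on k S (f i)"
  shows "Ck_on k S (\<lambda>x. \<Sum>i\<in>I. f i x)" using assms(2,3) by (induction I rule: finite_induct) (auto intro: Ck_on_const Ck_on_add assms(1))

lemma Ck_on_linear: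
  assumes "bounded_linear f" "open S" shows "Ck_on k S f"
proof (cases k)
  case 0
  thus ?thesis using assms by (simp add: linear_continuous_on)
next
  case (Suc m)
  have "Ck_on (Suc m) S f" by (rule Ck_on_SucI[OF assms(2), where f' = "\<lambda>_. f"])
       (auto intro: bounded_linear_imp_has_derivative assms Ck_on_const)
  thus ?thesis by (simp add: Suc)
qed

text \<open>The chain rule through the coordinates of the inner map: the derivative of \<open>f \<circ> F\<close> is a sum
  of products of functions to which the induction hypothesis applies.\<close>

lemma Ck_on_compose:
  fixes F :: "'a::euclidean_space \<Rightarrow> 'b::euclidean_space"
  assumes S: "open S" and T: "open T" and FT: "\<And>x. x \<in> S \<Longrightarrow> F x \<in> T"
    and "Ck_on k T f" and "\<And>b. b \<in> Basis \<Longrightarrow> Ck_on k S (\<lambda>x. F x \<bullet> b)"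
  shows "Ck_on k S (\<lambda>x. f (F x))" using assms(4,5)
proof (induction k arbitrary: f)
  case 0
  hence "continuous_on S F"  by (intro continuous_on_componentwise[THEN iffD2]) auto
  thus ?case using 0 FT by (auto intro!: continuous_on_compose2[of T f S F])
next
  case (Suc k)
  obtain f' where
    f': "\<And>x. x \<in> T \<Longrightarrow> (f has_derivative f' x) (at x)" "\<And>v. Ck_on k T (\<lambda>x. f' x v)" using Ck_on_SucD[OF Suc.prems(1)] by blast
  have "\<forall>b\<in>Basis. \<exists>G. (\<forall>x\<in>S. ((\<lambda>x. F x \<bullet> b) has_derivative G x) (at x)) \<and> (\<forall>v. Ck_on k S (\<lambda>x. G x v))"
    using Suc.prems(2) by (intro ballI Ck_on_SucD)
  then obtain G where G: "\<And>b x. b \<in> Basis \<Longrightarrow> x \<in> S \<Longrightarrow> ((\<lambda>x. F x \<bullet> b) has_derivative G b x) (at x)"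
    "\<And>b v. b \<in> Basis \<Longrightarrow> Ck_on k S (\<lambda>x. G b x v)" by metis
  define D where "D x v = (\<Sum>b\<in>Basis. G b x v *\<^sub>R b)" for x v
  have DF: "(F has_derivative D x) (at x)" if "x \<in> S" for x
  proof -
    have "((\<lambda>x. \<Sum>b\<in>Basis. (F x \<bullet> b) *\<^sub>R b) has_derivative D x) (at x)"
      unfolding D_def by (intro has_derivative_sum has_derivative_scaleR_left G that)
    thus ?thesis by (simp add: euclidean_representation)
  qed
  have DfF: "((\<lambda>x. f (F x)) has_derivative (\<lambda>v. \<Sum>b\<in>Basis. f' (F x) b * G b x v)) (at x)"
    if "x \<in> S" for x
  proof -
    have lin: "linear (f' (F x))" using f'(1)[OF FT[OF that]] has_derivative_linear by blast
    have "((\<lambda>x. f (F x)) has_derivative (\<lambda>v. f' (F x) (D x v))) (at x)"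
      using has_derivative_compose[OF DF[OF that] f'(1)[OF FT[OF that]]] .
    moreover have "f' (F x) (D x v) = (\<Sum>b\<in>Basis. f' (F x) b * G b x v)" for v
      unfolding D_def using lin by (simp add: linear_sum linear_cmul mult.commute)
    ultimately show ?thesis by simp
  qed
  have comp: "Ck_on k S (\<lambda>x. F x \<bullet> b)" if "b \<in> Basis" for b using Suc.prems(2) that Ck_on_Suc_imp[OF S] by blast
  show ?case by (rule Ck_on_SucI[OF S DfF]) (auto intro!: Ck_on_sum S Ck_on_mult G Suc.IH f' comp)
qed

lemma smooth_on_compose_real:
  fixes g :: "'a::euclidean_space \<Rightarrow> real"
  assumes "open S" "open T" "\<And>x. x \<in> S \<Longrightarrow> g x \<in> T" "smooth_on T f" "smooth_on S g"
  shows "smooth_on S (\<lambda>x. f (g x))" unfolding smooth_on_def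
proof
  fix k
  show "Ck_on k S (\<lambda>x. f (g x))" by (rule Ck_on_compose[OF assms(1-3)]) (use assms(4,5) in \<open>auto simp: smooth_on_def\<close>)
qed

lemma smooth_on_mult: "open S \<Longrightarrow> smooth_on S f \<Longrightarrow> smooth_on S g \<Longrightarrow> smooth_on S (\<lambda>x. f x * g x)" by (simp add: smooth_on_def Ck_on_mult)

lemma smooth_on_add: "open S \<Longrightarrow> smooth_on S f \<Longrightarrow> smooth_on S g \<Longrightarrow> smooth_on S (\<lambda>x. f x + g x)" by (simp add: smooth_on_def Ck_on_add)

lemma smooth_on_const: "open S \<Longrightarrow> smooth_on S (\<lambda>x. c)" by (simp add: smooth_on_def Ck_on_const)

lemma smooth_on_subset: "smooth_on S f \<Longrightarrow> T \<subseteq> S \<Longrightarrow> smooth_on T f" using Ck_on_subset unfolding smooth_on_def by blast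

lemma smooth_on_cong: "open S \<Longrightarrow> smooth_on S f \<Longrightarrow> (\<And>x. x \<in> S \<Longrightarrow> f x = g x) \<Longrightarrow> smooth_on S g" unfolding smooth_on_def by (metis Ck_on_cong)

lemma smooth_on_Un: "open S \<Longrightarrow> open T \<Longrightarrow> smooth_on S f \<Longrightarrow> smooth_on T f \<Longrightarrow> smooth_on (S \<union> T) f" by (simp add: smooth_on_def Ck_on_Un)

lemma smooth_on_linear: "bounded_linear f \<Longrightarrow> open S \<Longrightarrow> smooth_on S f" by (simp add: smooth_on_def Ck_on_linear)

lemma smooth_on_powr: "smooth_on {0<..} (\<lambda>t::real. t powr r)"
proof -
  have "Ck_on k {0<..} (\<lambda>t::real. t powr r)" for k
  proof (induction k arbitrary: r)
    case (Suc k)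
    have "((\<lambda>t::real. t powr r) has_derivative (\<lambda>h. (r * t powr (r - 1)) * h)) (at t)" if "t > 0" for t
      using that by (auto intro!: derivative_eq_intros simp: powr_diff field_simps)
    thus ?case by (rule Ck_on_SucI[rotated, where f' = "\<lambda>t h. (r * t powr (r - 1)) * h"])
         (auto intro!: Ck_on_mult Ck_on_const Suc)
  qed (auto intro!: continuous_intros)
  thus ?thesis by (simp add: smooth_on_def)
qed

lemma smooth_on_ln: "smooth_on {0<..} (ln :: real \<Rightarrow> real)"
proof -
  have "Ck_on k {0<..} (ln :: real \<Rightarrow> real)" for k
  proof (cases k)
    case (Suc k)
    have "Ck_on (Suc k) {0<..} (ln :: real \<Rightarrow> real)"
    proof (rule Ck_on_SucI[where f' = "\<lambda>t h. t powr (-1) * h"])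
      show "(ln has_derivative (\<lambda>h. t powr - 1 * h)) (at t)" if "t \<in> {0<..}" for t :: real
        using that by (auto intro!: derivative_eq_intros simp: powr_minus field_simps)
      show "Ck_on k {0<..} (\<lambda>t::real. t powr - 1 * v)" for v
        by (intro Ck_on_mult Ck_on_const smooth_on_powr[unfolded smooth_on_def, rule_format]) simp_all
    qed auto
    thus ?thesis by (simp add: Suc)
  qed (auto intro!: continuous_intros)
  thus ?thesis by (simp add: smooth_on_def)
qed

lemma smooth_on_exp: "smooth_on UNIV (exp :: real \<Rightarrow> real)"
proof -
  have "Ck_on k UNIV (exp :: real \<Rightarrow> real)" for k
  proof (induction k)
    case (Suc k)
    show ?case by (rule Ck_on_SucI[where f' = "\<lambda>t h. exp t * h"])
         (auto intro!: derivative_eq_intros Ck_on_mult Ck_on_const Suc)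
  qed (auto intro!: continuous_intros)
  thus ?thesis by (simp add: smooth_on_def)
qed

text \<open>The flat function behind every smooth cutoff. The family over \<open>j\<close> is closed under
  differentiation, which makes the induction on the order of differentiability go through.\<close>

definition flat :: "nat \<Rightarrow> real \<Rightarrow> real" where
  "flat j t = (if t > 0 then exp (- (1 / t)) / t ^ j else 0)"

lemma flat_has_derivative:
  "(flat j has_real_derivative flat (j + 2) t - real j * flat (j + 1) t) (at t)"
proof (cases t "0::real" rule: linorder_cases)
  case less
  have "((\<lambda>_. 0) has_real_derivative 0) (at t)" by simp
  hence "(flat j has_real_derivative 0) (at t)" by (rule has_field_derivative_transform_within_open[where S = "{..<0}"])
       (use less in \<open>auto simp: flat_def\<close>)
  thus ?thesis using less by (simp add: flat_def)
next
  case equal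
  have "((\<lambda>h. flat j h / h) \<longlongrightarrow> 0) (at_left 0)" by (rule tendsto_eventually, rule eventually_at_leftI[of "-1"]) (auto simp: flat_def)
  moreover have "((\<lambda>h::real. exp (- (1 / h)) / h ^ j / h) \<longlongrightarrow> 0) (at_right 0)" by real_asymp
  hence "((\<lambda>h. flat j h / h) \<longlongrightarrow> 0) (at_right 0)" by (rule Lim_transform_eventually)
       (auto simp: flat_def eventually_at_right_less intro!: eventually_at_rightI[of 0 1])
  ultimately have "((\<lambda>h. flat j h / h) \<longlongrightarrow> 0) (at 0)" by (simp add: filterlim_split_at)
  thus ?thesis using equal by (simp add: DERIV_def flat_def)
next
  case greater
  have "((\<lambda>t. exp (- (1 / t)) / t ^ j) has_real_derivative flat (j + 2) t - real j * flat (j + 1) t) (at t)"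
  proof -
    have e: "((\<lambda>t. exp (- (1 / t))) has_real_derivative exp (- (1 / t)) / t\<^sup>2) (at t)"
      using greater by (auto intro!: derivative_eq_intros simp: power2_eq_square)
    have p: "((\<lambda>t. t ^ j) has_real_derivative real j * t ^ (j - 1)) (at t)" using DERIV_pow[of j t] by simp
    have "((\<lambda>t. exp (- (1 / t)) / t ^ j) has_real_derivative
        (exp (- (1 / t)) / t\<^sup>2 * t ^ j - exp (- (1 / t)) * (real j * t ^ (j - 1))) / (t ^ j * t ^ j)) (at t)"
      by (rule DERIV_divide[OF e p]) (use greater in simp)
    also have "(exp (- (1 / t)) / t\<^sup>2 * t ^ j - exp (- (1 / t)) * (real j * t ^ (j - 1))) / (t ^ j * t ^ j)
      = exp (- (1 / t)) / t ^ (j + 2) - real j * (exp (- (1 / t)) / t ^ (j + 1))"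
      using greater by (cases j) (simp_all add: divide_simps power2_eq_square, simp add: algebra_simps)
    finally show ?thesis using greater by (simp add: flat_def)
  qed
  thus ?thesis by (rule has_field_derivative_transform_within_open[where S = "{0<..}"])
       (use greater in \<open>auto simp: flat_def\<close>)
qed

lemma smooth_on_flat: "smooth_on UNIV (flat j)"
proof -
  have "Ck_on k UNIV (flat j)" for k
  proof (induction k arbitrary: j)
    case 0
    have "isCont (flat j) x" for x using DERIV_isCont[OF flat_has_derivative] .
    thus ?case by (simp add: continuous_on_eq_continuous_at)
  next
    case (Suc k)
    have "Ck_on k UNIV (\<lambda>x. (flat (j + 2) x + (- real j) * flat (j + 1) x) * v)" for v
      by (intro Ck_on_mult Ck_on_add Ck_on_const Suc) auto
    thus ?case using flat_has_derivative[of j, unfolded has_field_derivative_def]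
      by (intro Ck_on_SucI[OF open_UNIV, where f' = "\<lambda>t h. (flat (j + 2) t - real j * flat (j + 1) t) * h"])
         simp_all
  qed
  thus ?thesis by (simp add: smooth_on_def)
qed

definition bump :: "real \<Rightarrow> real" where
  "bump t = flat 0 (4 - t\<^sup>2) / (flat 0 (4 - t\<^sup>2) + flat 0 (t\<^sup>2 - 1))"

lemma flat_nonneg: "0 \<le> flat j t" by (simp add: flat_def)

lemma flat_pos: "t > 0 \<Longrightarrow> 0 < flat j t" by (simp add: flat_def)

lemma bump_denominator_pos: "0 < flat 0 (4 - t\<^sup>2) + flat 0 (t\<^sup>2 - 1)"
proof (cases "t\<^sup>2 < 4")
  case True
  thus ?thesis using flat_pos[of "4 - t\<^sup>2" 0] flat_nonneg[of 0 "t\<^sup>2 - 1"] by simp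
next
  case False
  thus ?thesis using flat_pos[of "t\<^sup>2 - 1" 0] flat_nonneg[of 0 "4 - t\<^sup>2"] by simp
qed

lemma bump_range: "0 \<le> bump t" "bump t \<le> 1" using bump_denominator_pos[of t] flat_nonneg[of 0 "4 - t\<^sup>2"] flat_nonneg[of 0 "t\<^sup>2 - 1"]
  by (auto simp: bump_def)

lemma bump_eq_1: "\<bar>t\<bar> \<le> 1 \<Longrightarrow> bump t = 1"
proof -
  assume "\<bar>t\<bar> \<le> 1"
  hence "t\<^sup>2 \<le> 1" by (simp add: abs_square_le_1)
  thus ?thesis using flat_pos[of "4 - t\<^sup>2" 0] by (simp add: bump_def flat_def[of 0 "t\<^sup>2 - 1"])
qed

lemma bump_eq_0: "\<bar>t\<bar> \<ge> 2 \<Longrightarrow> bump t = 0"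
proof -
  assume "\<bar>t\<bar> \<ge> 2"
  hence "\<bar>2\<bar> \<le> \<bar>t\<bar>" by simp
  hence "t\<^sup>2 \<ge> 4" by (metis abs_le_square_iff four_x_squared mult_2_right numeral_Bit0 power2_eq_square)
  thus ?thesis by (simp add: bump_def flat_def)
qed

lemma smooth_on_bump: "smooth_on UNIV bump"
proof -
  have sq: "smooth_on UNIV (\<lambda>t::real. t\<^sup>2)"
    unfolding power2_eq_square by (intro smooth_on_mult smooth_on_linear) (auto intro: bounded_linear_ident)
  have a: "smooth_on UNIV (\<lambda>t::real. 4 + (-1) * t\<^sup>2)" "smooth_on UNIV (\<lambda>t::real. t\<^sup>2 + (-1))"
    by (intro smooth_on_add smooth_on_mult smooth_on_const sq open_UNIV)+
  have f: "smooth_on UNIV (\<lambda>t::real. flat 0 (4 - t\<^sup>2))" "smooth_on UNIV (\<lambda>t::real. flat 0 (t\<^sup>2 - 1))"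
    using smooth_on_compose_real[OF _ _ _ smooth_on_flat a(1), of 0]
      smooth_on_compose_real[OF _ _ _ smooth_on_flat a(2), of 0] by simp_all
  have "smooth_on UNIV (\<lambda>t. (flat 0 (4 - t\<^sup>2) + flat 0 (t\<^sup>2 - 1)) powr (-1))" by (rule smooth_on_compose_real[OF _ _ _ smooth_on_powr])
       (use bump_denominator_pos in \<open>auto intro: smooth_on_add f\<close>)
  hence "smooth_on UNIV (\<lambda>t. flat 0 (4 - t\<^sup>2) * (flat 0 (4 - t\<^sup>2) + flat 0 (t\<^sup>2 - 1)) powr (-1))" by (intro smooth_on_mult f) auto
  thus ?thesis by (rule smooth_on_cong[rotated])
       (auto simp: bump_def powr_minus divide_inverse less_imp_le[OF bump_denominator_pos])
qed

section \<open>Polar coordinates\<close>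

text \<open>Binders in the style of \<open>LBINT\<close> for the integrals that occur throughout.\<close>

abbreviation nn_integral_lborel :: "('a::euclidean_space \<Rightarrow> ennreal) \<Rightarrow> ennreal" (binder "LBNN " 10) where
  "nn_integral_lborel f \<equiv> integral\<^sup>N lborel f"

abbreviation ball_vol :: "'a::euclidean_space itself \<Rightarrow> real" where
  "ball_vol T \<equiv> unit_ball_vol (real DIM('a))"

definition sphere_area :: "'a::euclidean_space itself \<Rightarrow> real" where
  "sphere_area T = real DIM('a) * ball_vol TYPE('a)"

text \<open>The rotation invariant probability measure on the unit sphere, obtained by projecting the
  unit ball radially.\<close>

definition usphere :: "'a::euclidean_space measure" where
  "usphere = distr (uniform_measure lborel (cball 0 1)) borel sgn"

lemma borel_measurable_sgn [measurable]: "(sgn :: 'a::euclidean_space \<Rightarrow> 'a) \<in> borel_measurable borel"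
  unfolding sgn_div_norm by measurable

lemma emeasure_unit_cball: "emeasure lborel (cball (0::'a::euclidean_space) 1) = ennreal (ball_vol TYPE('a))"
  by (simp add: emeasure_cball)

lemma ball_vol_pos: "ball_vol TYPE('a::euclidean_space) > 0" by simp

lemma sphere_area_pos: "sphere_area TYPE('a::euclidean_space) > 0" by (simp add: sphere_area_def ball_vol_pos)

lemma prob_space_ball: "prob_space (uniform_measure lborel (cball (0::'a::euclidean_space) 1))"
  by (rule prob_space_uniform_measure) (use ball_vol_pos[where 'a = 'a] in \<open>auto simp: emeasure_unit_cball simp del: unit_ball_vol_pos\<close>)

lemma prob_space_usphere: "prob_space (usphere :: 'a::euclidean_space measure)"
  unfolding usphere_def by (rule prob_space.prob_space_distr[OF prob_space_ball]) simp

interpretation usphere: prob_space usphere by (rule prob_space_usphere)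

abbreviation nn_integral_usphere_binder :: "('a::euclidean_space \<Rightarrow> ennreal) \<Rightarrow> ennreal" (binder "SPNN " 10) where
  "nn_integral_usphere_binder f \<equiv> integral\<^sup>N usphere f"

abbreviation integral_usphere :: "('a::euclidean_space \<Rightarrow> real) \<Rightarrow> real" (binder "SPINT " 10) where
  "integral_usphere f \<equiv> integral\<^sup>L usphere f"

lemma sets_usphere [simp, measurable_cong]: "sets usphere = sets borel" by (simp add: usphere_def)

lemma space_usphere [simp]: "space usphere = UNIV" by (simp add: usphere_def)

lemma pred_mem_cball [measurable]:
  fixes f :: "'b \<Rightarrow> 'a::euclidean_space"
  assumes "f \<in> borel_measurable M" shows "Measurable.pred M (\<lambda>x. f x \<in> cball c r)"
  using measurable_compose[OF assms, of "\<lambda>x. x \<in> cball c r" "count_space UNIV"] by simp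

lemma prob_usphere_UNIV [simp]: "measure (usphere :: 'a::euclidean_space measure) UNIV = 1"
  using usphere.prob_space[where 'a = 'a] by simp

lemma nn_integral_usphere:
  assumes [measurable]: "F \<in> borel_measurable borel"
  shows "(SPNN w. F w) =
    (LBNN x. F (sgn x) * indicator (cball (0::'a::euclidean_space) 1) x) / ball_vol TYPE('a)" unfolding usphere_def
  by (simp add: nn_integral_distr nn_integral_uniform_measure emeasure_unit_cball)

lemma AE_usphere_norm: "AE w in (usphere :: 'a::euclidean_space measure). norm w = 1"
proof -
  have "AE x in lborel. x \<noteq> (0::'a)" by (rule AE_lborel_singleton)
  hence "AE x in uniform_measure lborel (cball 0 1). norm (sgn x :: 'a) = 1" by (intro AE_uniform_measureI) (auto simp: norm_sgn)
  thus ?thesis unfolding usphere_def by (subst AE_distr_iff) auto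
qed

lemma nn_integral_lborel_cong_nonzero:
  fixes f g :: "'a::euclidean_space \<Rightarrow> ennreal"
  assumes "\<And>x. x \<noteq> 0 \<Longrightarrow> f x = g x"
  shows "(LBNN x. f x) = (LBNN x. g x)" by (rule nn_integral_cong_AE) (use AE_lborel_singleton[of 0] assms in auto)

lemma nn_integral_lborel_scale:
  fixes F :: "'a::euclidean_space \<Rightarrow> ennreal"
  assumes [measurable]: "F \<in> borel_measurable borel" and c: "c > 0"
  shows "(LBNN x. F x) = ennreal (c ^ DIM('a)) * (LBNN x. F (t + c *\<^sub>R x))"
proof -
  have "(LBNN x. F x) = (\<integral>\<^sup>+x. F x \<partial>(density (distr lborel borel (\<lambda>x. t + c *\<^sub>R x)) (\<lambda>_. \<bar>c\<bar> ^ DIM('a))))"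
    using lborel_affine[of c t] c by simp
  also have "\<dots> = ennreal (c ^ DIM('a)) * (LBNN x. F (t + c *\<^sub>R x))"
    using c by (simp add: nn_integral_density nn_integral_distr nn_integral_cmult)
  finally show ?thesis .
qed

lemma nn_integral_exp_tail:
  assumes "d > 0"
  shows "(LBNN s. ennreal (exp (- d * s)) * indicator {a..} s) = ennreal (exp (- d * a) / d)"
proof -
  have "((\<lambda>s. - exp (- d * s) / d) \<longlongrightarrow> - 0 / d) at_top"
    by (intro tendsto_intros filterlim_compose[OF exp_at_bot] filterlim_tendsto_neg_mult_at_bot[of _ "-d"] filterlim_ident)
       (use assms in auto)
  hence "(LBNN s. ennreal (exp (- d * s)) * indicator {a..} s) = ennreal (0 - (- exp (- d * a) / d))" using assms
    by (intro nn_integral_FTC_atLeast) (auto intro!: derivative_eq_intros)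
  thus ?thesis by simp
qed

text \<open>The cylinder \<open>\<real> \<times> S\<^sup>d\<^sup>-\<^sup>1\<close> with coordinates \<open>s = ln |x|\<close> and \<open>w = x/|x|\<close>.
  Writing the sphere average as a ball average, the factor \<open>|x|\<close> is absorbed by a translation in
  \<open>s\<close>; a dilation of \<open>x\<close> then leaves an elementary integral in \<open>s\<close>.\<close>

lemma nn_integral_polar_aux:
  fixes F :: "'a::euclidean_space \<Rightarrow> ennreal"
  assumes [measurable]: "F \<in> borel_measurable borel"
  shows "(LBNN x. F x) = ennreal (sphere_area TYPE('a)) *
    (SPNN w. (LBNN s. ennreal (exp (real DIM('a) * s)) * F (exp s *\<^sub>R w)))"
proof -
  define d where "d = real DIM('a)"
  have d: "d > 0" by (simp add: d_def)
  define B where "B = ball_vol TYPE('a)"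
  have B: "B > 0" by (simp add: B_def ball_vol_pos)
  have shift: "(LBNN s. ennreal (exp (d * s)) * F (exp s *\<^sub>R sgn x)) =
      (LBNN s. ennreal (norm x ^ DIM('a)) * ennreal (exp (d * s)) * F (exp s *\<^sub>R x))" if "x \<noteq> 0" for x :: 'a
  proof -
    have n: "exp (d * ln (norm x)) = norm x ^ DIM('a)" using that exp_of_nat_mult[of "DIM('a)" "ln (norm x)"] by (simp add: d_def)
    have "(LBNN s. ennreal (exp (d * s)) * F (exp s *\<^sub>R sgn x)) =
       (LBNN s. ennreal (exp (d * (ln (norm x) + s))) * F (exp (ln (norm x) + s) *\<^sub>R sgn x))"
      using nn_integral_real_affine[of "\<lambda>s. ennreal (exp (d * s)) * F (exp s *\<^sub>R sgn x)" 1 "ln (norm x)"] by simp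
    also have "\<dots> = (LBNN s. ennreal (norm x ^ DIM('a)) * ennreal (exp (d * s)) * F (exp s *\<^sub>R x))"
    proof (intro nn_integral_cong)
      fix s
      have "exp (ln (norm x) + s) *\<^sub>R sgn x = exp s *\<^sub>R x" using that by (simp add: exp_add sgn_div_norm)
      moreover have "exp (d * (ln (norm x) + s)) = norm x ^ DIM('a) * exp (d * s)" by (simp add: distrib_left exp_add n)
      ultimately show "ennreal (exp (d * (ln (norm x) + s))) * F (exp (ln (norm x) + s) *\<^sub>R sgn x) =
          ennreal (norm x ^ DIM('a)) * ennreal (exp (d * s)) * F (exp s *\<^sub>R x)" by (simp add: ennreal_mult)
    qed
    finally show ?thesis .
  qed
  have scale: "(LBNN x. ennreal (norm x ^ DIM('a)) * ennreal (exp (d * s)) * F (exp s *\<^sub>R x) * indicator (cball 0 1) x)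
     = (LBNN y. ennreal (norm y ^ DIM('a)) * F y * (ennreal (exp (- d * s)) * indicator {ln (norm y)..} s))" for s
  proof -
    have "(LBNN y. ennreal (norm y ^ DIM('a)) * F y * (ennreal (exp (- d * s)) * indicator {ln (norm y)..} s))
      = (LBNN y. ennreal (norm y ^ DIM('a)) * F y * (ennreal (exp (- d * s)) * indicator (cball 0 (exp s)) y))"
    proof (rule nn_integral_lborel_cong_nonzero)
      fix y :: 'a assume "y \<noteq> 0"
      hence "ln (norm y) \<le> s \<longleftrightarrow> norm y \<le> exp s" by (metis exp_le_cancel_iff exp_ln zero_less_norm_iff)
      thus "ennreal (norm y ^ DIM('a)) * F y * (ennreal (exp (- d * s)) * indicator {ln (norm y)..} s) =
        ennreal (norm y ^ DIM('a)) * F y * (ennreal (exp (- d * s)) * indicator (cball 0 (exp s)) y)" by (simp add: indicator_def)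
    qed
    also have "\<dots> = ennreal (exp s ^ DIM('a)) * (\<integral>\<^sup>+x. ennreal (norm (exp s *\<^sub>R x) ^ DIM('a)) * F (exp s *\<^sub>R x) *
        (ennreal (exp (- d * s)) * indicator (cball 0 (exp s)) (exp s *\<^sub>R x)) \<partial>lborel)"
      using nn_integral_lborel_scale[of "\<lambda>y. ennreal (norm y ^ DIM('a)) * F y *
        (ennreal (exp (- d * s)) * indicator (cball 0 (exp s)) y)" "exp s" 0] by simp
    also have "\<dots> = (\<integral>\<^sup>+x. ennreal (exp s ^ DIM('a)) * (ennreal (norm (exp s *\<^sub>R x) ^ DIM('a)) * F (exp s *\<^sub>R x) *
        (ennreal (exp (- d * s)) * indicator (cball 0 (exp s)) (exp s *\<^sub>R x))) \<partial>lborel)"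
      by (rule nn_integral_cmult[symmetric]) measurable
    also have "\<dots> = (LBNN x. ennreal (norm x ^ DIM('a)) * ennreal (exp (d * s)) * F (exp s *\<^sub>R x) * indicator (cball 0 1) x)"
    proof (intro nn_integral_cong)
      fix x :: 'a
      have e: "exp s ^ DIM('a) = exp (d * s)" using exp_of_nat_mult[of "DIM('a)" s] by (simp add: d_def)
      have "exp s ^ DIM('a) * (norm (exp s *\<^sub>R x) ^ DIM('a)) * exp (- d * s) = norm x ^ DIM('a) * exp (d * s)"
        by (simp add: power_mult_distrib e exp_minus)
      hence "ennreal (exp s ^ DIM('a)) * ennreal (norm (exp s *\<^sub>R x) ^ DIM('a)) * ennreal (exp (- d * s)) =
          ennreal (norm x ^ DIM('a)) * ennreal (exp (d * s))" by (simp flip: ennreal_mult')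
      moreover have "(indicator (cball 0 (exp s)) (exp s *\<^sub>R x) :: ennreal) = indicator (cball 0 1) x" by (simp add: indicator_def)
      ultimately show "ennreal (exp s ^ DIM('a)) * (ennreal (norm (exp s *\<^sub>R x) ^ DIM('a)) * F (exp s *\<^sub>R x) *
        (ennreal (exp (- d * s)) * indicator (cball 0 (exp s)) (exp s *\<^sub>R x))) =
        ennreal (norm x ^ DIM('a)) * ennreal (exp (d * s)) * F (exp s *\<^sub>R x) * indicator (cball 0 1) x" by (simp only: mult_ac)
    qed
    finally show ?thesis ..
  qed
  have "ennreal B * (SPNN w. (LBNN s. ennreal (exp (d * s)) * F (exp s *\<^sub>R w))) =
     (LBNN x. (LBNN s. ennreal (exp (d * s)) * F (exp s *\<^sub>R sgn x)) * indicator (cball 0 1) x)" unfolding B_def[symmetric]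
    using B by (subst nn_integral_usphere)
      (auto simp: B_def[symmetric] ennreal_times_divide mult.commute[of "ennreal B"] ennreal_mult_divide_eq)
  also have "\<dots> = (LBNN x. (LBNN s. ennreal (norm x ^ DIM('a)) * ennreal (exp (d * s)) * F (exp s *\<^sub>R x) * indicator (cball 0 1) x))"
    by (rule nn_integral_lborel_cong_nonzero)
       (simp add: shift nn_integral_multc)
  also have "\<dots> = (LBNN s. (LBNN x. ennreal (norm x ^ DIM('a)) * ennreal (exp (d * s)) * F (exp s *\<^sub>R x) * indicator (cball 0 1) x))"
    by (rule lborel_pair.Fubini') measurable
  also have "\<dots> = (LBNN s. (LBNN y. ennreal (norm y ^ DIM('a)) * F y * (ennreal (exp (- d * s)) * indicator {ln (norm y)..} s)))"
    by (intro nn_integral_cong scale)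
  also have "\<dots> = (LBNN y. (LBNN s. ennreal (norm y ^ DIM('a)) * F y * (ennreal (exp (- d * s)) * indicator {ln (norm y)..} s)))"
  proof (rule lborel_pair.Fubini')
    have "(\<lambda>(y, s). ennreal (norm y ^ DIM('a)) * F y * (ennreal (exp (- d * s)) * indicator {(s::real, y::'a). ln (norm y) \<le> s} (s, y)))
       \<in> borel_measurable (lborel \<Otimes>\<^sub>M lborel)" by measurable
    thus "(\<lambda>(y, s). ennreal (norm y ^ DIM('a)) * F y * (ennreal (exp (- d * s)) * indicator {ln (norm y)..} s))
       \<in> borel_measurable (lborel \<Otimes>\<^sub>M lborel)" by (simp add: indicator_def)
  qed
  also have "\<dots> = (LBNN y. F y * ennreal (1 / d))"
  proof (rule nn_integral_lborel_cong_nonzero)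
    fix y :: 'a assume y: "y \<noteq> 0"
    have e: "exp (- d * ln (norm y)) = inverse (norm y ^ DIM('a))"
      using y exp_of_nat_mult[of "DIM('a)" "ln (norm y)"] by (simp add: d_def exp_minus del: unit_ball_vol_pos)
    have "(LBNN s. ennreal (norm y ^ DIM('a)) * F y * (ennreal (exp (- d * s)) * indicator {ln (norm y)..} s))
      = ennreal (norm y ^ DIM('a)) * F y * ennreal (exp (- d * ln (norm y)) / d)"
      by (subst nn_integral_cmult) (use nn_integral_exp_tail[OF d] in simp_all)
    also have "\<dots> = F y * (ennreal (norm y ^ DIM('a)) * ennreal (inverse (norm y ^ DIM('a)) / d))" unfolding e by (simp only: mult_ac)
    also have "ennreal (norm y ^ DIM('a)) * ennreal (inverse (norm y ^ DIM('a)) / d) = ennreal (1 / d)"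
      using y d by (simp flip: ennreal_mult' add: divide_simps)
    finally show "(LBNN s. ennreal (norm y ^ DIM('a)) * F y * (ennreal (exp (- d * s)) * indicator {ln (norm y)..} s))
      = F y * ennreal (1 / d)" .
  qed
  also have "\<dots> = (LBNN y. F y) * ennreal (1 / d)" by (rule nn_integral_multc) simp
  finally have "ennreal B * (SPNN w. (LBNN s. ennreal (exp (d * s)) * F (exp s *\<^sub>R w))) =
    (LBNN y. F y) * ennreal (1 / d)" .
  hence "ennreal d * (ennreal B * (SPNN w. (LBNN s. ennreal (exp (d * s)) * F (exp s *\<^sub>R w)))) =
    (LBNN y. F y) * (ennreal d * ennreal (1 / d))" by (simp only: mult_ac)
  also have "ennreal d * ennreal (1 / d) = 1" using d by (simp flip: ennreal_mult')
  finally show ?thesis using d B by (simp add: sphere_area_def d_def B_def ennreal_mult mult.assoc)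
qed

abbreviation cyl :: "(real \<times> 'a::euclidean_space) measure" where
  "cyl \<equiv> lborel \<Otimes>\<^sub>M usphere"

abbreviation nn_integral_cyl :: "(real \<times> 'a::euclidean_space \<Rightarrow> ennreal) \<Rightarrow> ennreal" (binder "CYNN " 10) where
  "nn_integral_cyl f \<equiv> integral\<^sup>N cyl f"

abbreviation integral_cyl :: "(real \<times> 'a::euclidean_space \<Rightarrow> real) \<Rightarrow> real" (binder "CYINT " 10) where
  "integral_cyl f \<equiv> integral\<^sup>L cyl f"

lemma sigma_finite_usphere: "sigma_finite_measure usphere" by unfold_locales

interpretation cyl: pair_sigma_finite "lborel :: real measure" "usphere :: 'a::euclidean_space measure"
  by (intro pair_sigma_finite.intro lborel.sigma_finite_measure_axioms sigma_finite_usphere)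

lemma lborel_eq_polar:
  "(lborel :: 'a::euclidean_space measure) =
    distr (density cyl (\<lambda>z. ennreal (sphere_area TYPE('a) * exp (real DIM('a) * fst z)))) borel
      (\<lambda>z. exp (fst z) *\<^sub>R snd z)"
proof (rule measure_eqI)
  fix A :: "'a set" assume "A \<in> sets lborel"
  hence [measurable]: "A \<in> sets borel" by simp
  have "emeasure lborel A = (\<integral>\<^sup>+x. indicator A x \<partial>(lborel :: 'a measure))" by simp
  also have "\<dots> = ennreal (sphere_area TYPE('a)) *
    (SPNN w. (LBNN s. ennreal (exp (real DIM('a) * s)) * indicator A (exp s *\<^sub>R w)))" by (rule nn_integral_polar_aux) simp
  also have "\<dots> = (SPNN w. (LBNN s. ennreal (sphere_area TYPE('a) * exp (real DIM('a) * s)) * indicator A (exp s *\<^sub>R w)))"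
    using sphere_area_pos[where 'a = 'a] by (simp add: nn_integral_cmult ennreal_mult mult.assoc)
  also have "\<dots> = (CYNN z. ennreal (sphere_area TYPE('a) * exp (real DIM('a) * fst z)) * indicator A (exp (fst z) *\<^sub>R snd z))"
    using cyl.nn_integral_snd[of "\<lambda>z. ennreal (sphere_area TYPE('a) * exp (real DIM('a) * fst z)) * indicator A (exp (fst z) *\<^sub>R snd z)"]
    by simp
  also have "\<dots> = (\<integral>\<^sup>+z. indicator A (exp (fst z) *\<^sub>R snd z) \<partial>density cyl (\<lambda>z. ennreal (sphere_area TYPE('a) * exp (real DIM('a) * fst z))))"
    by (rule nn_integral_density[symmetric]) measurable
  also have "\<dots> = emeasure (distr (density cyl (\<lambda>z. ennreal (sphere_area TYPE('a) * exp (real DIM('a) * fst z)))) borel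
      (\<lambda>z. exp (fst z) *\<^sub>R snd z)) A" by (subst nn_integral_indicator[symmetric], simp, subst nn_integral_distr) auto
  finally show "emeasure lborel A = emeasure (distr (density cyl (\<lambda>z. ennreal (sphere_area TYPE('a) * exp (real DIM('a) * fst z)))) borel
      (\<lambda>z. exp (fst z) *\<^sub>R snd z)) A" .
qed simp

lemma
  fixes F :: "'a::euclidean_space \<Rightarrow> ennreal"
  assumes [measurable]: "F \<in> borel_measurable borel"
  shows nn_integral_polar: "(LBNN x. F x) =
    (CYNN z. ennreal (sphere_area TYPE('a) * exp (real DIM('a) * fst z)) * F (exp (fst z) *\<^sub>R snd z))"
proof -
  have "(LBNN x. F x) = (\<integral>\<^sup>+z. F (exp (fst z) *\<^sub>R snd z)
      \<partial>density cyl (\<lambda>z. ennreal (sphere_area TYPE('a) * exp (real DIM('a) * fst z))))"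
    by (subst lborel_eq_polar, rule nn_integral_distr) measurable
  also have "\<dots> = (CYNN z. ennreal (sphere_area TYPE('a) * exp (real DIM('a) * fst z)) * F (exp (fst z) *\<^sub>R snd z))"
    by (rule nn_integral_density) measurable
  finally show ?thesis .
qed

lemma
  fixes F :: "'a::euclidean_space \<Rightarrow> real"
  assumes [measurable]: "F \<in> borel_measurable borel"
  shows integrable_polar: "integrable lborel F \<longleftrightarrow>
      integrable cyl (\<lambda>z. sphere_area TYPE('a) * exp (real DIM('a) * fst z) * F (exp (fst z) *\<^sub>R snd z))" (is ?A)
    and integral_polar: "(LBINT x. F x) =
      (CYINT z. sphere_area TYPE('a) * exp (real DIM('a) * fst z) * F (exp (fst z) *\<^sub>R snd z))" (is ?B)
proof -
  let ?c = "\<lambda>z::real \<times> 'a. sphere_area TYPE('a) * exp (real DIM('a) * fst z)"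
  have c: "AE z in cyl. 0 \<le> ?c z" using sphere_area_pos[where 'a = 'a] by simp
  have "integrable lborel F \<longleftrightarrow> integrable (density cyl (\<lambda>z. ennreal (?c z))) (\<lambda>z. F (exp (fst z) *\<^sub>R snd z))"
    by (subst lborel_eq_polar, rule integrable_distr_eq) measurable
  also have "\<dots> \<longleftrightarrow> integrable cyl (\<lambda>z. ?c z *\<^sub>R F (exp (fst z) *\<^sub>R snd z))" by (rule integrable_density[OF _ _ c]) measurable
  finally show ?A by simp
  have "(LBINT x. F x) = (\<integral>z. F (exp (fst z) *\<^sub>R snd z) \<partial>density cyl (\<lambda>z. ennreal (?c z)))"
    by (subst lborel_eq_polar, rule integral_distr) measurable
  also have "\<dots> = (CYINT z. ?c z *\<^sub>R F (exp (fst z) *\<^sub>R snd z))" by (rule integral_density[OF _ _ c]) measurable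
  finally show ?B by simp
qed

section \<open>A one-dimensional logarithmic Sobolev inequality\<close>

lemma integrable_compact_support:
  fixes f :: "real \<Rightarrow> real"
  assumes "continuous_on UNIV f" "\<And>x. \<bar>x\<bar> > L \<Longrightarrow> f x = 0"
  shows "integrable lborel f"
proof -
  have "integrable lborel (\<lambda>x. indicator {-L..L} x *\<^sub>R f x)"
    by (rule borel_integrable_compact[OF _ continuous_on_subset[OF assms(1)]]) auto
  moreover have "(\<lambda>x. indicator {-L..L} x *\<^sub>R f x) = f"
  proof
    fix x show "indicator {-L..L} x *\<^sub>R f x = f x" using assms(2)[of x] by (cases "\<bar>x\<bar> > L") (auto simp: indicator_def)
  qed
  ultimately show ?thesis by simp
qed

lemma continuous_on_x_ln_x: "continuous_on {0..} (\<lambda>x::real. x * ln x)"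
proof -
  have "continuous (at x within {0..}) (\<lambda>x::real. x * ln x)" if "x \<ge> 0" for x
  proof (cases "x = 0")
    case True
    have "((\<lambda>x::real. x * ln x) \<longlongrightarrow> 0) (at_right 0)" by real_asymp
    thus ?thesis using True by (simp add: continuous_within at_within_Ici_at_right)
  next
    case False
    thus ?thesis using that by (intro continuous_intros) auto
  qed
  thus ?thesis by (simp add: continuous_on_eq_continuous_within)
qed

lemma continuous_on_entropy [continuous_intros]:
  assumes "continuous_on S f" "\<And>x. x \<in> S \<Longrightarrow> f x \<ge> (0::real)"
  shows "continuous_on S (\<lambda>x. f x * ln (f x))" by (rule continuous_on_compose2[OF continuous_on_x_ln_x assms(1)]) (use assms(2) in auto)

lemma x_ln_x_lower: "x \<ge> 0 \<Longrightarrow> x * ln x \<ge> x - (1::real)"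
proof (cases "x = 0")
  case False
  assume "x \<ge> 0"
  with False have x: "x > 0" by simp
  have "ln (1 / x) \<le> 1 / x - 1" using x by (intro ln_le_minus_one) simp
  hence "x * (- ln x) \<le> x * (1 / x - 1)" using x by (intro mult_left_mono) (simp_all add: ln_div)
  thus ?thesis using x by (simp add: algebra_simps)
qed simp

lemma cdf_density:
  fixes f :: "real \<Rightarrow> real"
  assumes f: "continuous_on UNIV f" "\<And>x. 0 \<le> f x" "integrable lborel f" "(LBINT x. f x) = 1"
  shows "((cdf (density lborel f)) has_real_derivative f x) (at x)"
    and "(cdf (density lborel f) \<longlongrightarrow> 1) at_top" "(cdf (density lborel f) \<longlongrightarrow> 0) at_bot"
    and "0 \<le> cdf (density lborel f) x" "cdf (density lborel f) x \<le> 1"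
proof -
  let ?M = "density lborel (\<lambda>x. ennreal (f x))"
  have [measurable]: "f \<in> borel_measurable borel" using f(1) by (rule borel_measurable_continuous_onI)
  have "emeasure ?M (space ?M) = 1" using f by (simp add: emeasure_density nn_integral_eq_integral)
  then interpret real_distribution ?M by (simp add: real_distribution_def real_distribution_axioms_def prob_spaceI)
  show "(cdf ?M \<longlongrightarrow> 1) at_top" "(cdf ?M \<longlongrightarrow> 0) at_bot" by (rule cdf_lim_at_top_prob cdf_lim_at_bot)+
  show "0 \<le> cdf ?M x" "cdf ?M x \<le> 1" by (simp_all add: cdf_nonneg cdf_bounded_prob)
  define a where "a = x - 1"
  have cdf_eq: "cdf ?M y = cdf ?M a + integral {a..y} f" if "a < y" for y
  proof -
    have i: "f integrable_on {a..y}" by (rule integrable_continuous_interval) (use f(1) continuous_on_subset in auto)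
    have m: "cdf ?M y - cdf ?M a = measure ?M {a<..y}" using cdf_diff_eq[OF that] by simp
    have "emeasure ?M {a<..y} = (LBNN x. ennreal (f x) * indicator {a<..y} x)" by (simp add: emeasure_density)
    also have "\<dots> = (LBNN x. ennreal (f x) * indicator {a..y} x)"
      by (rule nn_integral_cong_AE) (use AE_lborel_singleton[of a] in \<open>auto simp: indicator_def\<close>)
    also have "\<dots> = ennreal (integral {a..y} f)" using f(2) i by (intro nn_integral_has_integral_lebesgue') auto
    finally have e: "emeasure ?M {a<..y} = ennreal (integral {a..y} f)" .
    have "measure ?M {a<..y} = integral {a..y} f" unfolding measure_def e using f(2) by (simp add: integral_nonneg i)
    thus ?thesis using m by simp
  qed
  have "((\<lambda>y. integral {a..y} f) has_real_derivative f x) (at x within {a..x+1})"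
    by (rule integral_has_real_derivative) (use f(1) continuous_on_subset in \<open>auto simp: a_def\<close>)
  hence "((\<lambda>y. integral {a..y} f) has_real_derivative f x) (at x)" using at_within_Icc_at[of a x "x + 1"] by (simp add: a_def)
  hence "((\<lambda>y. cdf ?M a + integral {a..y} f) has_real_derivative f x) (at x)" by (auto intro!: derivative_eq_intros)
  thus "(cdf ?M has_real_derivative f x) (at x)" by (rule has_field_derivative_transform_within_open[where S = "{a<..}"])
       (auto simp: cdf_eq a_def)
qed

lemma positive_density_quantile:
  fixes g :: "real \<Rightarrow> real"
  assumes g: "continuous_on UNIV g" "\<And>x. 0 < g x" "integrable lborel g" "(LBINT x. g x) = 1"
  obtains Q where "\<And>p. 0 < p \<Longrightarrow> p < 1 \<Longrightarrow> (Q has_real_derivative 1 / g (Q p)) (at p)"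
proof -
  define G where "G = cdf (density lborel g)"
  note c = cdf_density[OF g(1) less_imp_le[OF g(2)] g(3,4), folded G_def]
  have cont: "isCont G x" for x using c(1) DERIV_isCont by blast
  have mono: "G x < G y" if "x < y" for x y using that by (rule DERIV_pos_imp_increasing) (use c(1) g(2) in blast)
  hence inj: "inj G" by (metis injI linorder_less_linear order_less_irrefl)
  define Q where "Q = inv G"
  have QG: "Q (G x) = x" for x by (simp add: Q_def inj)
  have surj: "\<exists>x. G x = p" if p: "0 < p" "p < 1" for p
  proof -
    have "eventually (\<lambda>x. G x > p) at_top" using order_tendstoD(1)[OF c(2)] p by blast
    then obtain b where b: "G b > p" using eventually_happens'[OF trivial_limit_at_top_linorder] by blast
    have "eventually (\<lambda>x. G x < p) at_bot" using order_tendstoD(2)[OF c(3)] p by blast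
    then obtain a where a: "G a < p" using eventually_happens'[OF trivial_limit_at_bot_linorder] by blast
    have "a \<le> b" using mono a b by (metis less_trans linorder_not_less order_less_asym)
    thus ?thesis using IVT'[of G a p b] a b cont by (force intro: continuous_at_imp_continuous_on)
  qed
  have GQ: "G (Q p) = p" if "0 < p" "p < 1" for p using surj[OF that] QG by auto
  have "(Q has_real_derivative 1 / g (Q p)) (at p)" if p: "0 < p" "p < 1" for p
  proof -
    have "isCont Q (G (Q p))" by (rule isCont_inverse_function2[of "Q p - 1" _ "Q p + 1"]) (auto simp: QG cont)
    hence "isCont Q p" by (simp add: GQ p)
    hence "(Q has_real_derivative inverse (g (Q p))) (at p)" by (intro DERIV_inverse_function[where a = 0 and b = 1, OF c(1)])
         (use p GQ g(2) in \<open>auto simp: less_imp_neq[symmetric]\<close>)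
    thus ?thesis by (simp add: inverse_eq_divide)
  qed
  thus ?thesis by (rule that)
qed

text \<open>Monotone transport of the density \<open>R\<close> to the Gaussian of variance \<open>\<tau>\<close>. The map \<open>T\<close> satisfies
  \<open>R = g(T) T'\<close>, so \<open>ln R = ln g(T) + ln T'\<close> with \<open>ln T' \<le> T' - 1\<close>. The hypothesis stands for an
  integration by parts in \<open>\<integral> R T'\<close>, whose quadratic term cancels the one in \<open>ln g(T)\<close>. Equality
  holds for Gaussians, hence the sharp constant. Compressing the distribution function of \<open>R\<close> into
  \<open>[\<epsilon>, 1 - \<epsilon>]\<close> keeps \<open>T\<close> finite where \<open>R\<close> vanishes.\<close>

lemma entropy_le_by_gaussian_transport:
  fixes R :: "real \<Rightarrow> real"
  assumes R: "continuous_on UNIV R" "\<And>x. 0 \<le> R x" "\<And>x. \<bar>x\<bar> > L \<Longrightarrow> R x = 0" "(LBINT x. R x) = 1"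
    and \<tau>: "\<tau> > 0"
    and parts: "\<And>T T'. (\<And>s. (T has_real_derivative T' s) (at s)) \<Longrightarrow> continuous_on UNIV T' \<Longrightarrow>
        (LBINT s. R s * T' s) \<le> c + (LBINT s. R s * ((T s)\<^sup>2 / (2 * \<tau>)))"
  shows "(LBINT s. R s * ln (R s)) \<le> c - ln (2 * pi * \<tau>) / 2 - 1"
proof -
  define g where "g = normal_density 0 (sqrt \<tau>)"
  have g: "continuous_on UNIV g" "\<And>x. 0 < g x" "integrable lborel g" "(LBINT x. g x) = 1"
    using \<tau> by (auto simp: g_def normal_density_pos intro!: continuous_intros)
      (auto simp: normal_density_def intro!: continuous_intros)
  have lng: "ln (g y) = - (y\<^sup>2 / (2 * \<tau>)) - ln (2 * pi * \<tau>) / 2" for y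
    using \<tau> by (simp add: g_def normal_density_def ln_mult ln_div ln_sqrt)
  obtain Q where Q: "\<And>p. 0 < p \<Longrightarrow> p < 1 \<Longrightarrow> (Q has_real_derivative 1 / g (Q p)) (at p)" using positive_density_quantile[OF g] by blast
  have Ri: "integrable lborel R" by (rule integrable_compact_support[OF R(1,3)])
  have supp: "integrable lborel (\<lambda>s. R s * h s)" if "continuous_on UNIV h" for h
    by (rule integrable_compact_support[where L = L]) (use R that in \<open>auto intro!: continuous_intros\<close>)
  have RlnR: "integrable lborel (\<lambda>s. R s * ln (R s))"
    by (rule integrable_compact_support[where L = L]) (use R in \<open>auto intro!: continuous_intros\<close>)
  define F where "F = cdf (density lborel R)"
  note F = cdf_density[OF R(1,2) Ri R(4), folded F_def]
  have bound: "(LBINT s. R s * ln (R s)) \<le> (c - ln (2 * pi * \<tau>) / 2 - 1) - ln (1 - 2 * \<epsilon>)"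
    if \<epsilon>: "0 < \<epsilon>" "\<epsilon> < 1/2" for \<epsilon>
  proof -
    define T where "T s = Q (\<epsilon> + (1 - 2 * \<epsilon>) * F s)" for s
    define T' where "T' s = (1 - 2 * \<epsilon>) * R s / g (T s)" for s
    have range: "0 < \<epsilon> + (1 - 2 * \<epsilon>) * F s" "\<epsilon> + (1 - 2 * \<epsilon>) * F s < 1" for s
    proof -
      have "(1 - 2 * \<epsilon>) * F s \<le> 1 - 2 * \<epsilon>" using \<epsilon> F(5)[of s] by (intro mult_left_le) auto
      moreover have "0 \<le> (1 - 2 * \<epsilon>) * F s" using \<epsilon> F(4)[of s] by (intro mult_nonneg_nonneg) auto
      ultimately show "0 < \<epsilon> + (1 - 2 * \<epsilon>) * F s" "\<epsilon> + (1 - 2 * \<epsilon>) * F s < 1" using \<epsilon>(1) by linarith+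
    qed
    have T: "(T has_real_derivative T' s) (at s)" for s
    proof -
      have "((\<lambda>s. \<epsilon> + (1 - 2 * \<epsilon>) * F s) has_real_derivative (1 - 2 * \<epsilon>) * R s) (at s)"
        using F(1)[of s] by (auto intro!: derivative_eq_intros)
      from DERIV_chain2[OF Q[OF range] this] show ?thesis by (simp add: T_def[abs_def] T'_def)
    qed
    hence contT: "continuous_on UNIV T" using DERIV_isCont by (blast intro: continuous_at_imp_continuous_on)
    have contgT: "continuous_on UNIV (\<lambda>s. g (T s))" by (rule continuous_on_compose2[OF g(1) contT]) simp
    have contT': "continuous_on UNIV T'"
      unfolding T'_def using g(2) by (intro continuous_intros R(1) contgT) (auto simp: less_imp_neq[symmetric])
    have pointwise: "R s * ln (R s) \<le> R s * T' s - R s * ((T s)\<^sup>2 / (2 * \<tau>))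
        + (- ln (2 * pi * \<tau>) / 2 - 1 - ln (1 - 2 * \<epsilon>)) * R s" for s
    proof (cases "R s = 0")
      case False
      hence Rs: "R s > 0" using R(2)[of s] by simp
      hence T'p: "T' s > 0" using \<epsilon> g(2) by (simp add: T'_def)
      have "R s = g (T s) * T' s / (1 - 2 * \<epsilon>)" using \<epsilon> g(2)[of "T s"] by (simp add: T'_def)
      hence "ln (R s) = ln (g (T s)) + ln (T' s) - ln (1 - 2 * \<epsilon>)" using g(2)[of "T s"] T'p \<epsilon> by (simp add: ln_mult ln_div)
      also have "ln (T' s) \<le> T' s - 1" using T'p by (rule ln_le_minus_one)
      finally have "ln (R s) \<le> T' s - (T s)\<^sup>2 / (2 * \<tau>) + (- ln (2 * pi * \<tau>) / 2 - 1 - ln (1 - 2 * \<epsilon>))" by (simp add: lng)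
      hence "R s * ln (R s) \<le> R s * (T' s - (T s)\<^sup>2 / (2 * \<tau>) + (- ln (2 * pi * \<tau>) / 2 - 1 - ln (1 - 2 * \<epsilon>)))"
        using Rs by (intro mult_left_mono) auto
      thus ?thesis by (simp add: algebra_simps)
    qed simp
    have i1: "integrable lborel (\<lambda>s. R s * T' s)" by (rule supp[OF contT'])
    have i2: "integrable lborel (\<lambda>s. R s * ((T s)\<^sup>2 / (2 * \<tau>)))" by (intro supp continuous_intros contT) (use \<tau> in auto)
    have "(LBINT s. R s * ln (R s)) \<le> (\<integral>s. R s * T' s - R s * ((T s)\<^sup>2 / (2 * \<tau>))
        + (- ln (2 * pi * \<tau>) / 2 - 1 - ln (1 - 2 * \<epsilon>)) * R s \<partial>lborel)"
      by (intro integral_mono RlnR Bochner_Integration.integrable_add Bochner_Integration.integrable_diff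
          i1 i2 integrable_mult_right Ri pointwise)
    also have "\<dots> = (LBINT s. R s * T' s) - (LBINT s. R s * ((T s)\<^sup>2 / (2 * \<tau>)))
        + (- ln (2 * pi * \<tau>) / 2 - 1 - ln (1 - 2 * \<epsilon>))" using i1 i2 Ri R(4) by simp
    also have "\<dots> \<le> c + (- ln (2 * pi * \<tau>) / 2 - 1 - ln (1 - 2 * \<epsilon>))" using parts[OF T contT'] by simp
    finally show ?thesis by simp
  qed
  have "((\<lambda>\<epsilon>. (c - ln (2 * pi * \<tau>) / 2 - 1) - ln (1 - 2 * \<epsilon>)) \<longlongrightarrow> (c - ln (2 * pi * \<tau>) / 2 - 1) - ln (1 - 2 * 0)) (at_right 0)"
    by (intro tendsto_intros) auto
  hence "((\<lambda>\<epsilon>. (c - ln (2 * pi * \<tau>) / 2 - 1) - ln (1 - 2 * \<epsilon>)) \<longlongrightarrow> c - ln (2 * pi * \<tau>) / 2 - 1) (at_right 0)" by simp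
  moreover have "eventually (\<lambda>\<epsilon>. (LBINT s. R s * ln (R s)) \<le> (c - ln (2 * pi * \<tau>) / 2 - 1) - ln (1 - 2 * \<epsilon>)) (at_right 0)"
    by (rule eventually_at_rightI[of 0 "1/2"]) (use bound in auto)
  ultimately show ?thesis by (rule tendsto_lowerbound) simp
qed

section \<open>Integration on the sphere and on the cylinder\<close>

lemma gradient_unique:
  assumes "(f has_derivative (\<lambda>h. h \<bullet> D)) (at x)" shows "gradient f x = D"
proof -
  have "E = D" if "GDERIV f x :> E" for E
  proof -
    have "(\<lambda>h. h \<bullet> E) = (\<lambda>h. h \<bullet> D)" using has_derivative_unique[OF _ assms] that by (simp add: gderiv_def)
    from fun_cong[OF this, of "E - D"] have "(E - D) \<bullet> E = (E - D) \<bullet> D" .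
    hence "(E - D) \<bullet> (E - D) = 0" by (metis inner_diff_right diff_self)
    thus ?thesis by simp
  qed
  moreover have "GDERIV f x :> D" using assms by (simp add: gderiv_def)
  ultimately show ?thesis unfolding gradient_def by (rule the_equality[rotated])
qed

lemma smooth_on_gradient:
  assumes "open S" "smooth_on S f" "x \<in> S"
  shows "(f has_derivative (\<lambda>h. h \<bullet> gradient f x)) (at x)"
proof -
  have "Ck_on (Suc 0) S f" using assms(2) by (simp add: smooth_on_def)
  then obtain f' where f': "(f has_derivative f') (at x)" using assms(3) by (auto simp: differentiable_def)
  hence lin: "linear f'" by (rule has_derivative_linear)
  define D where "D = (\<Sum>b\<in>Basis. f' b *\<^sub>R b)"
  have "f' h = h \<bullet> D" for h
  proof -
    have "f' h = f' (\<Sum>b\<in>Basis. (h \<bullet> b) *\<^sub>R b)" by (simp add: euclidean_representation)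
    also have "\<dots> = (\<Sum>b\<in>Basis. (h \<bullet> b) * f' b)" using lin by (simp add: linear_sum linear_cmul)
    also have "\<dots> = h \<bullet> D" by (simp add: D_def inner_sum_right mult.commute)
    finally show ?thesis .
  qed
  hence "f' = (\<lambda>h. h \<bullet> D)" by (rule ext)
  with f' have "(f has_derivative (\<lambda>h. h \<bullet> D)) (at x)" by simp
  thus ?thesis using gradient_unique by metis
qed

lemma continuous_on_gradient:
  assumes "open S" "smooth_on S f" shows "continuous_on S (gradient f)"
proof -
  have "continuous_on S (\<lambda>x. gradient f x \<bullet> b)" for b
  proof -
    have "Ck_on (Suc 0) S f" using assms(2) by (simp add: smooth_on_def)
    hence "continuous_on S (\<lambda>x. frechet_derivative f (at x) b)" by simp
    moreover have "frechet_derivative f (at x) b = gradient f x \<bullet> b" if "x \<in> S" for x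
      using frechet_derivative_at[OF smooth_on_gradient[OF assms that]] by (metis inner_commute)
    ultimately show ?thesis by (simp cong: continuous_on_cong)
  qed
  thus ?thesis by (intro continuous_on_componentwise[THEN iffD2]) auto
qed

lemma continuous_on_smooth: "open S \<Longrightarrow> smooth_on S f \<Longrightarrow> continuous_on S f" using Ck_on.simps(1) unfolding smooth_on_def by blast

lemma borel_measurable_continuous_nonzero:
  fixes f :: "'a::euclidean_space \<Rightarrow> 'b::euclidean_space"
  assumes "continuous_on (- {0}) f" shows "f \<in> borel_measurable borel"
proof -
  have "(\<lambda>x. indicator (- {0}) x *\<^sub>R f x) \<in> borel_measurable borel" by (rule borel_measurable_continuous_on_indicator[OF _ assms]) simp
  thus ?thesis by (rule measurable_discrete_difference[where X = "{0}"]) auto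
qed

lemma integrable_usphere:
  fixes f :: "'a::euclidean_space \<Rightarrow> real"
  assumes "f \<in> borel_measurable borel" "continuous_on (sphere 0 1) f"
  shows "integrable usphere f"
proof -
  have "compact (f ` sphere 0 1)" by (rule compact_continuous_image[OF assms(2)]) simp
  then obtain C where C: "\<And>x. x \<in> sphere 0 1 \<Longrightarrow> norm (f x) \<le> C" using compact_imp_bounded bounded_iff by (metis imageI)
  show ?thesis by (rule usphere.integrable_const_bound[where B = C])
       (use assms(1) C in \<open>auto intro!: eventually_mono[OF AE_usphere_norm]\<close>)
qed

lemma AE_cyl_norm: "AE z in (cyl :: (real \<times> 'a::euclidean_space) measure). norm (snd z) = 1"
proof -
  have "{z \<in> space (cyl :: (real \<times> 'a) measure). norm (snd z) = 1} \<in> sets cyl" by measurable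
  from cyl.AE_pair_iff[OF this] show ?thesis using AE_usphere_norm[where 'a = 'a] by simp
qed

lemma integrable_cyl_strip: "integrable (cyl :: (real \<times> 'a::euclidean_space) measure) (\<lambda>z. indicator {-L..L} (fst z) :: real)"
proof -
  have "integrable (cyl :: (real \<times> 'a) measure) (\<lambda>z. indicator ({-L..L} \<times> UNIV) z :: real)" by (rule integrable_real_indicator)
       (auto simp: usphere.emeasure_pair_measure_Times usphere.emeasure_space_1[simplified] emeasure_lborel_Icc_eq)
  moreover have "(indicator ({-L..L} \<times> UNIV) z :: real) = indicator {-L..L} (fst z)" for z :: "real \<times> 'a"
    by (cases z) (simp add: indicator_def)
  ultimately show ?thesis by simp
qed

lemma integrable_cyl:
  fixes F :: "real \<times> 'a::euclidean_space \<Rightarrow> real"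
  assumes F: "continuous_on UNIV F" "\<And>s w. norm w = 1 \<Longrightarrow> \<bar>s\<bar> > L \<Longrightarrow> F (s, w) = 0"
  shows "integrable cyl F"
proof -
  have "compact (F ` ({-L..L} \<times> sphere 0 1))" by (intro compact_continuous_image continuous_on_subset[OF F(1)] compact_Times) auto
  then obtain C where C: "\<And>x. x \<in> {-L..L} \<times> sphere 0 1 \<Longrightarrow> norm (F x) \<le> C" using compact_imp_bounded bounded_iff by (metis imageI)
  show ?thesis
  proof (rule Bochner_Integration.integrable_bound[OF integrable_mult_right[OF integrable_cyl_strip[of L], of C]])
    show "F \<in> borel_measurable cyl"
      using borel_measurable_continuous_onI[OF F(1)] by (simp add: borel_prod[symmetric] cong: measurable_cong_sets)
    show "AE z in cyl. norm (F z) \<le> norm (C * indicator {-L..L} (fst z))" using AE_cyl_norm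
    proof eventually_elim
      case (elim z)
      thus ?case using F(2)[of "snd z" "fst z"] C[of z] by (cases "\<bar>fst z\<bar> > L") (auto simp: indicator_def mem_Times_iff)
    qed
  qed
qed

section \<open>The entropy inequality on the cylinder\<close>

text \<open>The spherical inequality that decides symmetry. Here \<open>tgrad\<close> is the gradient along the unit
  sphere.\<close>

definition tgrad :: "('a::euclidean_space \<Rightarrow> real) \<Rightarrow> 'a \<Rightarrow> 'a" where
  "tgrad \<psi> w = gradient \<psi> w - (w \<bullet> gradient \<psi> w) *\<^sub>R w"

definition tangential_energy :: "('a::euclidean_space \<Rightarrow> real) \<Rightarrow> real" where
  "tangential_energy \<psi> = (SPINT w. (norm (tgrad \<psi> w))\<^sup>2)"

definition sphere_entropy :: "('a::euclidean_space \<Rightarrow> real) \<Rightarrow> real" where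
  "sphere_entropy \<psi> = (SPINT w. (\<psi> w)\<^sup>2 * ln ((\<psi> w)\<^sup>2))"

definition sphere_log_ineq :: "'a::euclidean_space itself \<Rightarrow> real \<Rightarrow> real \<Rightarrow> bool" where
  "sphere_log_ineq T \<alpha> \<Lambda> \<longleftrightarrow> (\<forall>\<psi> :: 'a \<Rightarrow> real. smooth_on (- {0}) \<psi> \<and> (SPINT w. (\<psi> w)\<^sup>2) = 1 \<longrightarrow>
     sphere_entropy \<psi> \<le> \<alpha> * ln (1 + tangential_energy \<psi> / \<Lambda>))"

lemma tangential_energy_nonneg: "tangential_energy \<psi> \<ge> 0" unfolding tangential_energy_def by (rule integral_nonneg_AE) simp

lemma ln_le_tangent: "0 < x \<Longrightarrow> 0 < (c::real) \<Longrightarrow> ln x \<le> ln c + x / c - 1" using ln_le_minus_one[of "x / c"] by (simp add: ln_div)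

lemma
  fixes \<psi> :: "'a::euclidean_space \<Rightarrow> real"
  assumes "smooth_on (- {0}) \<psi>"
  shows borel_measurable_smooth: "\<psi> \<in> borel_measurable borel"
    and borel_measurable_gradient: "gradient \<psi> \<in> borel_measurable borel"
    and borel_measurable_tgrad: "tgrad \<psi> \<in> borel_measurable borel"
    and continuous_on_sphere: "continuous_on (sphere 0 1) \<psi>"
    and continuous_on_sphere_tgrad: "continuous_on (sphere 0 1) (tgrad \<psi>)"
proof -
  have \<psi>: "continuous_on (- {0}) \<psi>" and g: "continuous_on (- {0}) (gradient \<psi>)"
    using assms by (auto intro: continuous_on_smooth continuous_on_gradient)
  have t: "continuous_on (- {0}) (tgrad \<psi>)" unfolding tgrad_def by (intro continuous_intros g)
  show "\<psi> \<in> borel_measurable borel" "gradient \<psi> \<in> borel_measurable borel" "tgrad \<psi> \<in> borel_measurable borel"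
    by (rule borel_measurable_continuous_nonzero, fact)+
  show "continuous_on (sphere 0 1) \<psi>" "continuous_on (sphere 0 1) (tgrad \<psi>)" by (rule continuous_on_subset, fact, force)+
qed

lemma integrable_sphere_square: "smooth_on (- {0}) \<psi> \<Longrightarrow> integrable usphere (\<lambda>w. (\<psi> w)\<^sup>2)"
  using borel_measurable_smooth continuous_on_sphere by (intro integrable_usphere) (auto intro!: continuous_intros)

lemma integrable_sphere_tgrad: "smooth_on (- {0}) \<psi> \<Longrightarrow> integrable usphere (\<lambda>w. (norm (tgrad \<psi> w))\<^sup>2)" by (intro integrable_usphere)
     (use borel_measurable_tgrad[of \<psi>] continuous_on_sphere_tgrad[of \<psi>] in \<open>auto intro!: continuous_intros borel_measurable_power borel_measurable_norm\<close>)

lemma integrable_sphere_entropy: "smooth_on (- {0}) \<psi> \<Longrightarrow> integrable usphere (\<lambda>w. (\<psi> w)\<^sup>2 * ln ((\<psi> w)\<^sup>2))"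
  using borel_measurable_smooth continuous_on_sphere by (intro integrable_usphere) (auto intro!: continuous_intros)

lemma tgrad_cmult:
  fixes \<psi> :: "'a::euclidean_space \<Rightarrow> real"
  assumes "smooth_on (- {0}) \<psi>" "w \<noteq> 0"
  shows "gradient (\<lambda>w. c * \<psi> w) w = c *\<^sub>R gradient \<psi> w" "tgrad (\<lambda>w. c * \<psi> w) w = c *\<^sub>R tgrad \<psi> w"
proof -
  have "(\<psi> has_derivative (\<lambda>h. h \<bullet> gradient \<psi> w)) (at w)" by (rule smooth_on_gradient[of "- {0}"]) (use assms in auto)
  from has_derivative_mult_right[OF this, of c]
  show g: "gradient (\<lambda>w. c * \<psi> w) w = c *\<^sub>R gradient \<psi> w" by (intro gradient_unique) simp
  show "tgrad (\<lambda>w. c * \<psi> w) w = c *\<^sub>R tgrad \<psi> w" unfolding tgrad_def g by (simp add: scaleR_diff_right)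
qed

lemma tangential_energy_cmult:
  fixes \<psi> :: "'a::euclidean_space \<Rightarrow> real"
  assumes "smooth_on (- {0}) \<psi>"
  shows "tangential_energy (\<lambda>w. c * \<psi> w) = c\<^sup>2 * tangential_energy \<psi>"
proof -
  have "tangential_energy (\<lambda>w. c * \<psi> w) = (SPINT w. c\<^sup>2 * (norm (tgrad \<psi> w))\<^sup>2)" unfolding tangential_energy_def
  proof (rule integral_cong_AE)
    have [measurable]: "tgrad \<psi> \<in> borel_measurable borel" "tgrad (\<lambda>w. c * \<psi> w) \<in> borel_measurable borel"
      using assms by (auto intro!: borel_measurable_tgrad smooth_on_mult smooth_on_const)
    show "(\<lambda>w. (norm (tgrad (\<lambda>w. c * \<psi> w) w))\<^sup>2) \<in> borel_measurable usphere"
      "(\<lambda>w. c\<^sup>2 * (norm (tgrad \<psi> w))\<^sup>2) \<in> borel_measurable usphere" by measurable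
    show "AE w in usphere. (norm (tgrad (\<lambda>w. c * \<psi> w) w))\<^sup>2 = c\<^sup>2 * (norm (tgrad \<psi> w))\<^sup>2" using AE_usphere_norm
    proof eventually_elim
      case (elim w)
      hence "w \<noteq> 0" by auto
      from tgrad_cmult(2)[OF assms this, of c] show ?case by (simp add: power_mult_distrib)
    qed
  qed
  thus ?thesis by (simp add: tangential_energy_def)
qed

text \<open>Replacing the concave logarithm by its tangents and removing the normalization makes the
  spherical inequality linear in the mass and in the energy, so that it can be integrated over
  the slices of the cylinder.\<close>

lemma sphere_log_ineq_linear:
  fixes \<psi> :: "'a::euclidean_space \<Rightarrow> real"
  assumes ineq: "sphere_log_ineq TYPE('a) \<alpha> \<Lambda>" and \<alpha>: "\<alpha> > 0" and \<Lambda>: "\<Lambda> > 0" and l: "l > 0"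
    and \<psi>: "smooth_on (- {0}) \<psi>" and m_def: "m = (SPINT w. (\<psi> w)\<^sup>2)"
  shows "sphere_entropy \<psi> \<le> m * ln m + \<alpha> * (m * (ln (l / \<Lambda>) + \<Lambda> / l - 1) + tangential_energy \<psi> / l)"
proof (cases "m = 0")
  case True
  have [measurable]: "\<psi> \<in> borel_measurable borel" by (rule borel_measurable_smooth[OF \<psi>])
  have "AE w in usphere. (\<psi> w)\<^sup>2 = 0" using True integral_nonneg_eq_0_iff_AE[OF integrable_sphere_square[OF \<psi>]] by (simp add: m_def)
  hence "sphere_entropy \<psi> = (\<integral>w. 0 \<partial>(usphere :: 'a measure))" unfolding sphere_entropy_def by (intro integral_cong_AE) auto
  thus ?thesis using True \<alpha> l tangential_energy_nonneg[of \<psi>] by simp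
next
  case False
  have "m \<ge> 0" unfolding m_def by (rule integral_nonneg_AE) simp
  with False have m: "m > 0" by simp
  define c where "c = 1 / sqrt m"
  have c2: "c\<^sup>2 = 1 / m" using m by (simp add: c_def power_divide)
  define v where "v w = c * \<psi> w" for w
  have v: "smooth_on (- {0}) v" unfolding v_def by (intro smooth_on_mult smooth_on_const \<psi>) auto
  have vm: "(SPINT w. (v w)\<^sup>2) = 1" using m by (simp add: v_def power_mult_distrib c2 m_def[symmetric])
  have b: "tangential_energy v = tangential_energy \<psi> / m" using tangential_energy_cmult[OF \<psi>, of c] by (simp add: v_def[abs_def] c2)
  have e: "(\<psi> w)\<^sup>2 * ln ((\<psi> w)\<^sup>2) = m * ((v w)\<^sup>2 * ln ((v w)\<^sup>2)) + ln m * (\<psi> w)\<^sup>2" for w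
  proof (cases "\<psi> w = 0")
    case False
    thus ?thesis using m by (simp add: v_def power_mult_distrib c2 ln_div algebra_simps)
  qed (simp add: v_def)
  have "sphere_entropy \<psi> = m * sphere_entropy v + ln m * m" unfolding sphere_entropy_def e
    using integrable_sphere_entropy[OF v] integrable_sphere_square[OF \<psi>] by (simp add: m_def)
  also have "sphere_entropy v \<le> \<alpha> * ln (1 + tangential_energy v / \<Lambda>)" using ineq v vm unfolding sphere_log_ineq_def by blast
  also have "ln (1 + tangential_energy v / \<Lambda>) = ln ((\<Lambda> + tangential_energy v) / \<Lambda>)" using \<Lambda> by (simp add: add_divide_distrib)
  also have "\<dots> \<le> ln (l / \<Lambda>) + ((\<Lambda> + tangential_energy v) / \<Lambda>) / (l / \<Lambda>) - 1"
    using \<Lambda> l tangential_energy_nonneg[of v] by (intro ln_le_tangent) (auto simp: add_pos_nonneg)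
  also have "((\<Lambda> + tangential_energy v) / \<Lambda>) / (l / \<Lambda>) = \<Lambda> / l + tangential_energy \<psi> / (m * l)" using \<Lambda> l m by (simp add: b field_simps)
  finally have "sphere_entropy \<psi> \<le> m * (\<alpha> * (ln (l / \<Lambda>) + (\<Lambda> / l + tangential_energy \<psi> / (m * l)) - 1)) + ln m * m"
    using m \<alpha> by (simp add: mult_left_mono)
  also have "\<dots> = m * ln m + \<alpha> * (m * (ln (l / \<Lambda>) + \<Lambda> / l - 1) + tangential_energy \<psi> / l)" using m l by (simp add: field_simps)
  finally show ?thesis .
qed

text \<open>Constant functions satisfy the same estimate for every \<open>\<Lambda>\<close>, because
  \<open>ln x + 1 / x \<ge> 1\<close>. Radial functions, whose slices are constant, therefore obey the inequality on
  the cylinder with the best conceivable constant.\<close>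

lemma sphere_entropy_linear:
  fixes \<psi> :: "'a::euclidean_space \<Rightarrow> real"
  assumes ineq: "sphere_log_ineq TYPE('a) \<alpha> \<Lambda> \<or> (\<exists>c. \<forall>w. norm w = 1 \<longrightarrow> \<psi> w = c)"
    and \<alpha>: "\<alpha> > 0" and \<Lambda>: "\<Lambda> > 0" and l: "l > 0"
    and \<psi>: "smooth_on (- {0}) \<psi>" and m_def: "m = (SPINT w. (\<psi> w)\<^sup>2)"
  shows "sphere_entropy \<psi> \<le> m * ln m + \<alpha> * (m * (ln (l / \<Lambda>) + \<Lambda> / l - 1) + tangential_energy \<psi> / l)" using ineq
proof
  assume "sphere_log_ineq TYPE('a) \<alpha> \<Lambda>"
  thus ?thesis by (rule sphere_log_ineq_linear[OF _ \<alpha> \<Lambda> l \<psi> m_def])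
next
  assume "\<exists>c. \<forall>w. norm w = 1 \<longrightarrow> \<psi> w = c"
  then obtain c where c: "\<And>w. norm w = 1 \<Longrightarrow> \<psi> w = c" by blast
  have [measurable]: "\<psi> \<in> borel_measurable borel" by (rule borel_measurable_smooth[OF \<psi>])
  have "m = (\<integral>w. c\<^sup>2 \<partial>(usphere :: 'a measure))"
    unfolding m_def by (rule integral_cong_AE) (auto intro!: eventually_mono[OF AE_usphere_norm] simp: c)
  hence m: "m = c\<^sup>2" by simp
  have "sphere_entropy \<psi> = (\<integral>w. c\<^sup>2 * ln (c\<^sup>2) \<partial>(usphere :: 'a measure))"
    unfolding sphere_entropy_def by (rule integral_cong_AE) (auto intro!: eventually_mono[OF AE_usphere_norm] simp: c)
  hence "sphere_entropy \<psi> = m * ln m" by (simp add: m)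
  moreover have "0 \<le> ln (l / \<Lambda>) + \<Lambda> / l - 1" using ln_le_tangent[of "\<Lambda> / l" 1] \<Lambda> l by (simp add: ln_div)
  hence "0 \<le> \<alpha> * (m * (ln (l / \<Lambda>) + \<Lambda> / l - 1) + tangential_energy \<psi> / l)"
    using \<alpha> l m tangential_energy_nonneg[of \<psi>] by (intro mult_nonneg_nonneg add_nonneg_nonneg) auto
  ultimately show ?thesis by simp
qed

text \<open>The positive part of the entropy of a density exceeds its entropy by a controlled amount,
  because \<open>t ln t\<close> is bounded from below.\<close>

lemma sphere_entropy_pos_part:
  fixes \<psi> :: "'a::euclidean_space \<Rightarrow> real"
  assumes \<psi>: "smooth_on (- {0}) \<psi>" and m_def: "m = (SPINT w. (\<psi> w)\<^sup>2)"
    and K: "m \<le> K"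
  shows "(SPINT w. max 0 ((\<psi> w)\<^sup>2 * ln ((\<psi> w)\<^sup>2))) \<le> sphere_entropy \<psi> - m * ln m + m + m * K"
proof (cases "m = 0")
  have [measurable]: "\<psi> \<in> borel_measurable borel" by (rule borel_measurable_smooth[OF \<psi>])
  {
    case True
    have z: "AE w in usphere. (\<psi> w)\<^sup>2 = 0"
      using True integral_nonneg_eq_0_iff_AE[OF integrable_sphere_square[OF \<psi>]] by (simp add: m_def)
    hence "sphere_entropy \<psi> = (\<integral>w. 0 \<partial>(usphere :: 'a measure))" unfolding sphere_entropy_def by (intro integral_cong_AE) auto
    moreover have "(SPINT w. max 0 ((\<psi> w)\<^sup>2 * ln ((\<psi> w)\<^sup>2))) = (\<integral>w. 0 \<partial>(usphere :: 'a measure))"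
      using z by (intro integral_cong_AE) auto
    ultimately show ?thesis using True by simp
  next
    case False
    have "m \<ge> 0" unfolding m_def by (rule integral_nonneg_AE) simp
    with False have m: "m > 0" by simp
    have ie: "integrable usphere (\<lambda>w. (\<psi> w)\<^sup>2 * ln ((\<psi> w)\<^sup>2))" by (rule integrable_sphere_entropy[OF \<psi>])
    have i2: "integrable usphere (\<lambda>w. (\<psi> w)\<^sup>2)" by (rule integrable_sphere_square[OF \<psi>])
    have p: "max 0 ((\<psi> w)\<^sup>2 * ln ((\<psi> w)\<^sup>2)) \<le> (\<psi> w)\<^sup>2 * ln ((\<psi> w)\<^sup>2) - ln m * (\<psi> w)\<^sup>2 + m + K * (\<psi> w)\<^sup>2" for w
    proof (cases "\<psi> w = 0")
      case True thus ?thesis using m by simp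
    next
      case False
      define f where "f = (\<psi> w)\<^sup>2"
      have f: "f > 0" using False by (simp add: f_def)
      have "f / m * ln (f / m) \<ge> f / m - 1" using f m by (intro x_ln_x_lower) simp
      hence "m * (f / m * ln (f / m)) \<ge> m * (f / m - 1)" using m by (intro mult_left_mono) auto
      hence a: "f * ln f - ln m * f \<ge> f - m" using f m by (simp add: ln_div algebra_simps)
      have "ln m \<le> K" using K ln_le_minus_one[OF m] by simp
      hence b: "ln m * f \<le> K * f" using f by (intro mult_right_mono) auto
      have c: "K * f \<ge> 0" using f m K by simp
      have "0 \<le> f * ln f - ln m * f + m + K * f" "f * ln f \<le> f * ln f - ln m * f + m + K * f" using a b c f m by linarith+
      thus ?thesis unfolding f_def[symmetric] by (rule max.boundedI)
    qed
    have "(SPINT w. max 0 ((\<psi> w)\<^sup>2 * ln ((\<psi> w)\<^sup>2))) \<le>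
       (SPINT w. (\<psi> w)\<^sup>2 * ln ((\<psi> w)\<^sup>2) - ln m * (\<psi> w)\<^sup>2 + m + K * (\<psi> w)\<^sup>2)"
      by (intro integral_mono p integrable_max ie i2 Bochner_Integration.integrable_add
          Bochner_Integration.integrable_diff integrable_mult_right) auto
    also have "\<dots> = sphere_entropy \<psi> - m * ln m + m + m * K"
      using ie i2 by (simp add: sphere_entropy_def m_def usphere.prob_space[simplified])
    finally show ?thesis .
  }
qed

lemma integral_derivative_compact_support:
  fixes f f' :: "real \<Rightarrow> real"
  assumes "\<And>s. (f has_real_derivative f' s) (at s)" "continuous_on UNIV f'"
    and "\<And>s. \<bar>s\<bar> > L \<Longrightarrow> f s = 0" "\<And>s. \<bar>s\<bar> > L \<Longrightarrow> f' s = 0"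
  shows "(LBINT s. f' s) = 0"
proof -
  define M where "M = \<bar>L\<bar> + 1"
  have "(LBINT s. f' s) = (LBINT s. f' s * indicator {-M..M} s)"
  proof (rule Bochner_Integration.integral_cong[OF refl])
    fix s show "f' s = f' s * indicator {-M..M} s" using assms(4)[of s] by (cases "\<bar>s\<bar> > L") (auto simp: indicator_def M_def)
  qed
  also have "\<dots> = f M - f (- M)" using assms(1,2) by (intro integral_FTC_Icc_real) (auto simp: M_def continuous_on_eq_continuous_at)
  also have "\<dots> = 0" using assms(3)[of M] assms(3)[of "- M"] by (simp add: M_def)
  finally show ?thesis .
qed

text \<open>A function \<open>W\<close> on the cylinder is analysed through its slice masses \<open>R\<close>. The entropy splits into
  the entropy of the density \<open>R\<close> on the line, controlled by transport, and the entropies of the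
  slices, controlled by the spherical inequality.\<close>

context
  fixes W Ws :: "real \<Rightarrow> 'a::euclidean_space \<Rightarrow> real" and L :: real
  assumes W: "continuous_on UNIV (\<lambda>z. W (fst z) (snd z))"
    and Ws: "continuous_on UNIV (\<lambda>z. Ws (fst z) (snd z))"
    and der: "\<And>s w. norm w = 1 \<Longrightarrow> ((\<lambda>s. W s w) has_real_derivative Ws s w) (at s)"
    and W0: "\<And>s w. norm w = 1 \<Longrightarrow> \<bar>s\<bar> > L \<Longrightarrow> W s w = 0"
    and Ws0: "\<And>s w. norm w = 1 \<Longrightarrow> \<bar>s\<bar> > L \<Longrightarrow> Ws s w = 0"
begin

lemma continuous_W_slices:
  "continuous_on UNIV (W s)" "continuous_on UNIV (\<lambda>s. W s w)" "continuous_on UNIV (\<lambda>s. Ws s w)"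
proof -
  have "continuous_on UNIV (\<lambda>w. W (fst (s, w)) (snd (s, w)))" by (rule continuous_on_compose2[OF W]) (auto intro!: continuous_intros)
  thus "continuous_on UNIV (W s)" by simp
  have "continuous_on UNIV (\<lambda>s. W (fst (s, w)) (snd (s, w)))" by (rule continuous_on_compose2[OF W]) (auto intro!: continuous_intros)
  thus "continuous_on UNIV (\<lambda>s. W s w)" by simp
  have "continuous_on UNIV (\<lambda>s. Ws (fst (s, w)) (snd (s, w)))" by (rule continuous_on_compose2[OF Ws]) (auto intro!: continuous_intros)
  thus "continuous_on UNIV (\<lambda>s. Ws s w)" by simp
qed

lemma borel_measurable_W: "W s \<in> borel_measurable borel" by (rule borel_measurable_continuous_onI[OF continuous_W_slices(1)])

lemma integrable_W:
  assumes "continuous_on UNIV h"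
  shows "integrable cyl (\<lambda>z. (W (fst z) (snd z))\<^sup>2 * h (fst z))"
    "integrable cyl (\<lambda>z. (Ws (fst z) (snd z))\<^sup>2)"
    "integrable cyl (\<lambda>z. W (fst z) (snd z) * Ws (fst z) (snd z) * h (fst z))"
    "integrable cyl (\<lambda>z. (W (fst z) (snd z))\<^sup>2 * ln ((W (fst z) (snd z))\<^sup>2))" using assms
  by (auto intro!: integrable_cyl[where L = L] continuous_intros W Ws
        continuous_on_compose2[OF assms, of UNIV fst] simp: W0 Ws0)

lemma integrable_W_squares:
  "integrable cyl (\<lambda>z. (W (fst z) (snd z))\<^sup>2)" "integrable cyl (\<lambda>z. W (fst z) (snd z) * Ws (fst z) (snd z))"
  using integrable_W[of "\<lambda>_. 1"] by auto

definition "R s = (SPINT w. (W s w)\<^sup>2)"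

lemma R_nonneg: "R s \<ge> 0" unfolding R_def by (rule integral_nonneg_AE) simp

lemma R_zero: "\<bar>s\<bar> > L \<Longrightarrow> R s = 0"
proof -
  note [measurable] = borel_measurable_W
  assume "\<bar>s\<bar> > L"
  hence "AE w in usphere. (W s w)\<^sup>2 = 0" by (auto intro!: eventually_mono[OF AE_usphere_norm] simp: W0)
  hence "R s = (\<integral>w. 0 \<partial>(usphere :: 'a measure))" unfolding R_def by (intro integral_cong_AE) auto
  thus ?thesis by simp
qed

lemma continuous_R: "continuous_on UNIV R"
proof -
  note [measurable] = borel_measurable_W
  have "compact ((\<lambda>z. (W (fst z) (snd z))\<^sup>2) ` ({-L..L} \<times> sphere 0 1))"
    by (intro compact_continuous_image compact_Times) (auto intro!: continuous_intros continuous_on_subset[OF W])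
  then obtain C where C: "\<And>z. z \<in> {-L..L} \<times> sphere 0 1 \<Longrightarrow> norm ((W (fst z) (snd z))\<^sup>2) \<le> C"
    using compact_imp_bounded bounded_iff by (metis (no_types, lifting) imageI)
  have bd: "norm ((W s w)\<^sup>2) \<le> max C 0" if "norm w = 1" for s w
  proof (cases "\<bar>s\<bar> > L")
    case False
    hence "(s, w) \<in> {-L..L} \<times> sphere 0 1" using that by auto
    from C[OF this] show ?thesis by simp
  qed (simp add: W0 that)
  show ?thesis
  proof (rule continuous_on_sequentiallyI)
    fix u a assume u: "u \<longlonglongrightarrow> (a :: real)"
    show "(\<lambda>n. R (u n)) \<longlonglongrightarrow> R a" unfolding R_def
    proof (rule integral_dominated_convergence[where w = "\<lambda>_. max C 0"])
      show "(\<lambda>w. (W a w)\<^sup>2) \<in> borel_measurable usphere" "\<And>i. (\<lambda>w. (W (u i) w)\<^sup>2) \<in> borel_measurable usphere" by measurable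
      have "(\<lambda>n. (W (u n) w)\<^sup>2) \<longlonglongrightarrow> (W a w)\<^sup>2" for w
      proof -
        have "isCont (\<lambda>s. W s w) a" using continuous_W_slices(2)[of w] by (simp add: continuous_on_eq_continuous_at)
        from isCont_tendsto_compose[OF this u] show ?thesis by (intro tendsto_power)
      qed
      thus "AE w in usphere. (\<lambda>i. (W (u i) w)\<^sup>2) \<longlonglongrightarrow> (W a w)\<^sup>2" by simp
      show "\<And>i. AE w in usphere. norm ((W (u i) w)\<^sup>2) \<le> max C 0" by (auto intro!: eventually_mono[OF AE_usphere_norm] bd[simplified])
    qed simp
  qed
qed

lemma integral_R_mult:
  assumes "continuous_on UNIV h"
  shows "(LBINT s. R s * h s) = (CYINT z. (W (fst z) (snd z))\<^sup>2 * h (fst z))"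
  using cyl.integral_fst'[OF integrable_W(1)[OF assms]] by (simp add: R_def)

text \<open>This replaces \<open>R T'\<close> by an expression without a derivative of \<open>T\<close>, as the transport lemma
  requires. The slice masses \<open>R\<close> themselves are never differentiated.\<close>

lemma cylinder_parts:
  assumes T: "\<And>s. (T has_real_derivative T' s) (at s)" "continuous_on UNIV T'"
  shows "(CYINT z. (W (fst z) (snd z))\<^sup>2 * T' (fst z)) = - (CYINT z. 2 * (W (fst z) (snd z) * Ws (fst z) (snd z) * T (fst z)))"
proof -
  have cT: "continuous_on UNIV T" using T(1) DERIV_isCont by (blast intro: continuous_at_imp_continuous_on)
  let ?f = "\<lambda>z. 2 * (W (fst z) (snd z) * Ws (fst z) (snd z) * T (fst z)) + (W (fst z) (snd z))\<^sup>2 * T' (fst z)"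
  have i: "integrable cyl (\<lambda>z. 2 * (W (fst z) (snd z) * Ws (fst z) (snd z) * T (fst z)))" using integrable_W(3)[OF cT] by simp
  have i': "integrable cyl (\<lambda>z. (W (fst z) (snd z))\<^sup>2 * T' (fst z))" by (rule integrable_W(1)[OF T(2)])
  have "integrable cyl ?f" using i i' by (rule Bochner_Integration.integrable_add)
  hence "(CYINT z. ?f z) = (SPINT w. (LBINT s. ?f (s, w)))" using cyl.integral_snd[of "\<lambda>s w. ?f (s, w)"] by (simp add: case_prod_beta')
  also have "\<dots> = (\<integral>w. 0 \<partial>(usphere :: 'a measure))"
  proof (rule integral_cong_AE)
    show "(\<lambda>w. \<integral>s. ?f (s, w) \<partial>lborel) \<in> borel_measurable usphere" using cyl.integrable_snd[of "\<lambda>s w. ?f (s, w)"] \<open>integrable cyl ?f\<close>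
      by (auto simp: case_prod_beta' intro: borel_measurable_integrable)
    show "AE w in usphere. (LBINT s. ?f (s, w)) = 0" using AE_usphere_norm
    proof eventually_elim
      case (elim w)
      have "(LBINT s. 2 * (W s w * Ws s w * T s) + (W s w)\<^sup>2 * T' s) = 0"
      proof (rule integral_derivative_compact_support[where f = "\<lambda>s. (W s w)\<^sup>2 * T s" and L = L])
        show "((\<lambda>s. (W s w)\<^sup>2 * T s) has_real_derivative 2 * (W s w * Ws s w * T s) + (W s w)\<^sup>2 * T' s) (at s)" for s
          using der[OF elim, of s] T(1)[of s] by (auto intro!: derivative_eq_intros simp: algebra_simps)
        show "continuous_on UNIV (\<lambda>s. 2 * (W s w * Ws s w * T s) + (W s w)\<^sup>2 * T' s)"
          by (intro continuous_intros continuous_W_slices cT T(2))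
      qed (simp_all add: W0 Ws0 elim)
      thus ?case by simp
    qed
  qed simp
  finally have "(CYINT z. ?f z) = 0" by simp
  thus ?thesis using i i' by simp
qed

lemma integral_W_Ws: "(CYINT z. W (fst z) (snd z) * Ws (fst z) (snd z)) = 0" using cylinder_parts[of "\<lambda>_. 1" "\<lambda>_. 0"] by simp

context
  assumes N: "(CYINT z. (W (fst z) (snd z))\<^sup>2) = 1"
begin

lemma integral_R: "(LBINT s. R s) = 1" using integral_R_mult[of "\<lambda>_. 1"] N by simp

lemma integrable_R: "integrable lborel R" by (rule integrable_compact_support[OF continuous_R R_zero])

lemma entropy_R:
  assumes \<tau>: "\<tau> > 0"
  shows "(LBINT s. R s * ln (R s)) \<le> 2 * \<tau> * (CYINT z. (Ws (fst z) (snd z))\<^sup>2) - ln (2 * pi * \<tau>) / 2 - 1"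
proof (rule entropy_le_by_gaussian_transport[OF continuous_R R_nonneg R_zero integral_R \<tau>])
  fix T T' assume T: "\<And>s. (T has_real_derivative T' s) (at s)" "continuous_on UNIV T'"
  have cT: "continuous_on UNIV T" using T(1) DERIV_isCont by (blast intro: continuous_at_imp_continuous_on)
  have cT2: "continuous_on UNIV (\<lambda>s. (T s)\<^sup>2 / (2 * \<tau>))" using \<tau> by (auto intro!: continuous_intros cT)
  have young: "- (2 * (a * b * t)) \<le> 2 * \<tau> * b\<^sup>2 + a\<^sup>2 * (t\<^sup>2 / (2 * \<tau>))" for a b t
  proof -
    have "0 \<le> (2 * \<tau> * b + a * t)\<^sup>2 / (2 * \<tau>)" using \<tau> by simp
    also have "\<dots> = 2 * \<tau> * b\<^sup>2 + a\<^sup>2 * (t\<^sup>2 / (2 * \<tau>)) + 2 * (a * b * t)" using \<tau> by (simp add: power2_eq_square field_simps)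
    finally show ?thesis by simp
  qed
  have "(LBINT s. R s * T' s) = (CYINT z. - (2 * (W (fst z) (snd z) * Ws (fst z) (snd z) * T (fst z))))"
    using integral_R_mult[OF T(2)] cylinder_parts[OF T] by simp
  also have "\<dots> \<le> (CYINT z. 2 * \<tau> * (Ws (fst z) (snd z))\<^sup>2 + (W (fst z) (snd z))\<^sup>2 * ((T (fst z))\<^sup>2 / (2 * \<tau>)))"
    using integrable_W(3)[OF cT] integrable_W(2)[OF cT] integrable_W(1)[OF cT2]
    by (intro integral_mono young Bochner_Integration.integrable_add integrable_mult_right
        Bochner_Integration.integrable_minus) auto
  also have "\<dots> = 2 * \<tau> * (CYINT z. (Ws (fst z) (snd z))\<^sup>2) + (LBINT s. R s * ((T s)\<^sup>2 / (2 * \<tau>)))"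
    using integrable_W(2)[OF cT] integrable_W(1)[OF cT2] integral_R_mult[OF cT2] by auto
  finally show "(LBINT s. R s * T' s) \<le> 2 * \<tau> * (CYINT z. (Ws (fst z) (snd z))\<^sup>2) + (LBINT s. R s * ((T s)\<^sup>2 / (2 * \<tau>)))" .
qed

text \<open>Integrating \<open>\<bar>(W\<^sup>2)\<^sub>s\<bar> \<le> W\<^sup>2 + W\<^sub>s\<^sup>2\<close> from \<open>-\<infinity>\<close>. The bound serves to control the positive part of
  the entropy.\<close>

lemma R_bound: "R s \<le> 1 + (CYINT z. (Ws (fst z) (snd z))\<^sup>2)"
proof -
  have c1: "continuous_on UNIV (\<lambda>_. 1)" by simp
  let ?f = "\<lambda>z. (W (fst z) (snd z))\<^sup>2 + (Ws (fst z) (snd z))\<^sup>2"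
  have i: "integrable cyl ?f" using integrable_W_squares(1) integrable_W(2)[OF c1] by simp
  have "R s \<le> (SPINT w. (LBINT s. ?f (s, w)))" unfolding R_def
  proof (rule integral_mono_AE)
    show "integrable usphere (\<lambda>w. (W s w)\<^sup>2)" by (rule integrable_usphere)
         (auto intro!: borel_measurable_continuous_onI continuous_intros continuous_W_slices continuous_on_subset[OF continuous_W_slices(1)])
    show "integrable usphere (\<lambda>w. \<integral>s. ?f (s, w) \<partial>lborel)"
      using cyl.integrable_snd[of "\<lambda>s w. ?f (s, w)"] i by (simp add: case_prod_beta')
    show "AE w in usphere. (W s w)\<^sup>2 \<le> (LBINT s. ?f (s, w))" using AE_usphere_norm
    proof eventually_elim
      case (elim w)
      define M where "M = \<bar>L\<bar> + 1 + \<bar>s\<bar>"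
      have iw: "integrable lborel (\<lambda>s. (W s w)\<^sup>2 + (Ws s w)\<^sup>2)"
        by (rule integrable_compact_support[where L = L]) (auto intro!: continuous_intros continuous_W_slices simp: W0 Ws0 elim)
      have c: "continuous_on UNIV (\<lambda>x. 2 * (W x w * Ws x w))" by (intro continuous_intros continuous_W_slices)
      have "(LBINT x. 2 * (W x w * Ws x w) * indicator {-M..s} x) = (W s w)\<^sup>2 - (W (-M) w)\<^sup>2"
      proof (rule integral_FTC_Icc_real)
        show "((\<lambda>x. (W x w)\<^sup>2) has_real_derivative 2 * (W x w * Ws x w)) (at x)" for x
          using der[OF elim, of x] by (auto intro!: derivative_eq_intros)
        show "isCont (\<lambda>x. 2 * (W x w * Ws x w)) x" for x using c by (simp add: continuous_on_eq_continuous_at)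
      qed (simp add: M_def)
      moreover have "W (-M) w = 0" by (rule W0[OF elim]) (simp add: M_def)
      ultimately have "(W s w)\<^sup>2 = (LBINT x. 2 * (W x w * Ws x w) * indicator {-M..s} x)" by simp
      also have "\<dots> \<le> (LBINT x. (W x w)\<^sup>2 + (Ws x w)\<^sup>2)"
      proof (rule integral_mono[OF _ iw])
        have "integrable lborel (\<lambda>x. 2 * (W x w * Ws x w))" by (rule integrable_compact_support[OF c, of L]) (simp add: W0 elim)
        thus "integrable lborel (\<lambda>x. 2 * (W x w * Ws x w) * indicator {-M..s} x)" by (intro integrable_real_mult_indicator) simp_all
        show "2 * (W x w * Ws x w) * indicator {-M..s} x \<le> (W x w)\<^sup>2 + (Ws x w)\<^sup>2" for x
          using sum_squares_bound[of "W x w" "Ws x w"] by (auto simp: indicator_def)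
      qed
      finally show ?case by simp
    qed
  qed
  also have "\<dots> = (CYINT z. ?f z)" using cyl.integral_snd[of "\<lambda>s w. ?f (s, w)"] i by (simp add: case_prod_beta')
  also have "\<dots> = 1 + (CYINT z. (Ws (fst z) (snd z))\<^sup>2)" using N integrable_W_squares(1) integrable_W(2)[OF c1] by simp
  finally show ?thesis .
qed

context
  fixes \<alpha> \<Lambda> l :: real
  assumes slices: "\<And>s. smooth_on (- {0}) (W s)"
    and \<beta>: "integrable lborel (\<lambda>s. tangential_energy (W s))"
    and ineq: "\<And>s. sphere_log_ineq TYPE('a) \<alpha> \<Lambda> \<or> (\<exists>c. \<forall>w. norm w = 1 \<longrightarrow> W s w = c)" and \<alpha>: "\<alpha> > 0" and \<Lambda>: "\<Lambda> > 0" and l: "l > 0"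
begin

lemma integral_slice_entropy:
  "integrable lborel (\<lambda>s. sphere_entropy (W s))"
  "(LBINT s. sphere_entropy (W s)) = (CYINT z. (W (fst z) (snd z))\<^sup>2 * ln ((W (fst z) (snd z))\<^sup>2))"
proof -
  have i: "integrable cyl (\<lambda>z. (W (fst z) (snd z))\<^sup>2 * ln ((W (fst z) (snd z))\<^sup>2))" by (rule integrable_W(4)[of "\<lambda>_. 1"]) simp
  show "integrable lborel (\<lambda>s. sphere_entropy (W s))" using cyl.integrable_fst'[OF i] by (simp add: sphere_entropy_def)
  show "(LBINT s. sphere_entropy (W s)) = (CYINT z. (W (fst z) (snd z))\<^sup>2 * ln ((W (fst z) (snd z))\<^sup>2))"
    using cyl.integral_fst'[OF i] by (simp add: sphere_entropy_def)
qed

lemma integrable_R_entropy: "integrable lborel (\<lambda>s. R s * ln (R s))"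
  by (rule integrable_compact_support[where L = L]) (auto intro!: continuous_intros continuous_R R_nonneg simp: R_zero)

lemma slice_entropy_excess:
  "(LBINT s. sphere_entropy (W s) - R s * ln (R s)) \<le>
     \<alpha> * (ln (l / \<Lambda>) + \<Lambda> / l - 1 + (LBINT s. tangential_energy (W s)) / l)"
proof -
  have "(LBINT s. sphere_entropy (W s) - R s * ln (R s)) \<le>
     (LBINT s. \<alpha> * (R s * (ln (l / \<Lambda>) + \<Lambda> / l - 1) + tangential_energy (W s) / l))"
  proof (rule integral_mono)
    show "integrable lborel (\<lambda>s. sphere_entropy (W s) - R s * ln (R s))"
      by (intro Bochner_Integration.integrable_diff integral_slice_entropy integrable_R_entropy)
    show "integrable lborel (\<lambda>s. \<alpha> * (R s * (ln (l / \<Lambda>) + \<Lambda> / l - 1) + tangential_energy (W s) / l))" using \<beta> integrable_R by auto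
    show "sphere_entropy (W s) - R s * ln (R s) \<le> \<alpha> * (R s * (ln (l / \<Lambda>) + \<Lambda> / l - 1) + tangential_energy (W s) / l)" for s
      using sphere_entropy_linear[OF ineq \<alpha> \<Lambda> l slices R_def, of s] by simp
  qed
  also have "\<dots> = \<alpha> * (ln (l / \<Lambda>) + \<Lambda> / l - 1 + (LBINT s. tangential_energy (W s)) / l)" using \<beta> integrable_R integral_R by simp
  finally show ?thesis .
qed

lemma cylinder_entropy_le:
  assumes "\<tau> > 0"
  shows "(CYINT z. (W (fst z) (snd z))\<^sup>2 * ln ((W (fst z) (snd z))\<^sup>2)) \<le>
    2 * \<tau> * (CYINT z. (Ws (fst z) (snd z))\<^sup>2) - ln (2 * pi * \<tau>) / 2 - 1
    + \<alpha> * (ln (l / \<Lambda>) + \<Lambda> / l - 1 + (LBINT s. tangential_energy (W s)) / l)"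
  using slice_entropy_excess entropy_R[OF assms] integral_slice_entropy integrable_R_entropy by simp

lemma cylinder_entropy_pos_part_le:
  "(CYINT z. max 0 ((W (fst z) (snd z))\<^sup>2 * ln ((W (fst z) (snd z))\<^sup>2))) \<le>
    \<alpha> * (ln (l / \<Lambda>) + \<Lambda> / l - 1 + (LBINT s. tangential_energy (W s)) / l)
    + 2 + (CYINT z. (Ws (fst z) (snd z))\<^sup>2)"
proof -
  define K where "K = 1 + (CYINT z. (Ws (fst z) (snd z))\<^sup>2)"
  have i: "integrable cyl (\<lambda>z. max 0 ((W (fst z) (snd z))\<^sup>2 * ln ((W (fst z) (snd z))\<^sup>2)))"
    using integrable_W(4)[of "\<lambda>_. 1"] by (intro integrable_max) auto
  have "(CYINT z. max 0 ((W (fst z) (snd z))\<^sup>2 * ln ((W (fst z) (snd z))\<^sup>2))) =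
     (LBINT s. (SPINT w. max 0 ((W s w)\<^sup>2 * ln ((W s w)\<^sup>2))))" using cyl.integral_fst'[OF i] by simp
  also have "\<dots> \<le> (LBINT s. (sphere_entropy (W s) - R s * ln (R s)) + R s + R s * K)"
  proof (rule integral_mono)
    show "integrable lborel (\<lambda>s. SPINT w. max 0 ((W s w)\<^sup>2 * ln ((W s w)\<^sup>2)))" using cyl.integrable_fst'[OF i] by simp
    show "integrable lborel (\<lambda>s. (sphere_entropy (W s) - R s * ln (R s)) + R s + R s * K)"
      using integral_slice_entropy(1) integrable_R_entropy integrable_R by auto
    show "(SPINT w. max 0 ((W s w)\<^sup>2 * ln ((W s w)\<^sup>2))) \<le> (sphere_entropy (W s) - R s * ln (R s)) + R s + R s * K" for s
      using sphere_entropy_pos_part[OF slices R_def R_bound, of s] by (simp add: K_def)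
  qed
  also have "\<dots> = (LBINT s. sphere_entropy (W s) - R s * ln (R s)) + 1 + K"
    using integral_slice_entropy(1) integrable_R_entropy integrable_R integral_R by simp
  finally show ?thesis using slice_entropy_excess by (simp add: K_def)
qed

end
end
end

section \<open>Potential estimates on the sphere\<close>

lemma nn_integral_exp_interval:
  assumes "t > 0"
  shows "(LBNN s. ennreal (exp s) * indicator {s. 1 - t \<le> exp s \<and> exp s \<le> 1} s) \<le> ennreal t"
proof (cases "t < 1")
  case True
  have "1 - t \<le> exp s \<longleftrightarrow> ln (1 - t) \<le> s" for s using True exp_le_cancel_iff[of "ln (1 - t)" s] by simp
  hence "{s. 1 - t \<le> exp s \<and> exp s \<le> 1} = {ln (1 - t)..0}"
    by (simp only: set_eq_iff mem_Collect_eq atLeastAtMost_iff exp_le_one_iff simp_thms)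
  moreover have "(LBNN s. ennreal (exp s) * indicator {ln (1 - t)..0} s) = ennreal (exp 0 - exp (ln (1 - t)))"
    by (rule nn_integral_FTC_Icc) (use True assms in \<open>auto intro!: derivative_eq_intros\<close>)
  ultimately show ?thesis using True by simp
next
  case False
  have "(LBNN s. ennreal (exp s) * indicator {s. 1 - t \<le> exp s \<and> exp s \<le> 1} s) \<le>
    (LBNN s. ennreal (exp s) * indicator {..0} s)" by (intro nn_integral_mono) (auto simp: indicator_def)
  also have "\<dots> = (LBNN s. ennreal (exp (- s)) * indicator {..0} (- s))"
    using nn_integral_real_affine[of "\<lambda>s. ennreal (exp s) * indicator {..0} s" "-1" 0] by simp
  also have "\<dots> = (LBNN s. ennreal (exp (- 1 * s)) * indicator {0..} s)" by (intro nn_integral_cong) (simp add: indicator_def)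
  also have "\<dots> = ennreal (exp (- 1 * 0) / 1)" by (rule nn_integral_exp_tail) simp
  also have "\<dots> \<le> ennreal t" using False by (intro ennreal_leI) simp
  finally show ?thesis .
qed

text \<open>\<open>radial_ext E\<close> extends a function on the sphere to a function homogeneous of degree \<open>-1\<close>, as for
  the length of the gradient of a function that is constant along rays.\<close>

definition radial_ext :: "('a::euclidean_space \<Rightarrow> real) \<Rightarrow> 'a \<Rightarrow> ennreal" where
  "radial_ext E z = ennreal (E (sgn z) / norm z)"

definition segment_mean :: "('a::euclidean_space \<Rightarrow> real) \<Rightarrow> real \<Rightarrow> 'a \<Rightarrow> ennreal" where
  "segment_mean E t x = (LBNN y. radial_ext E ((1 - t) *\<^sub>R x + t *\<^sub>R y) * indicator (cball 0 1) y) / ball_vol TYPE('a)"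

lemma borel_measurable_radial_ext [measurable]:
  assumes [measurable]: "E \<in> borel_measurable borel"
  shows "radial_ext E \<in> borel_measurable borel" unfolding radial_ext_def[abs_def] by measurable

lemma borel_measurable_segment_mean:
  assumes [measurable]: "E \<in> borel_measurable borel"
  shows "(\<lambda>z. segment_mean E (fst z) (snd z)) \<in> borel_measurable (borel \<Otimes>\<^sub>M borel)" unfolding segment_mean_def by measurable

lemma segment_mean_eq:
  fixes E :: "'a::euclidean_space \<Rightarrow> real"
  assumes [measurable]: "E \<in> borel_measurable borel" and t: "t > 0"
  shows "segment_mean E t x = ennreal (1 / (ball_vol TYPE('a) * t ^ DIM('a))) *
     (LBNN z. radial_ext E z * indicator (cball ((1 - t) *\<^sub>R x) t) z)"
proof -
  define B where "B = ball_vol TYPE('a)"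
  have B: "B > 0" by (simp add: B_def)
  let ?I = "LBNN y. radial_ext E ((1 - t) *\<^sub>R x + t *\<^sub>R y) * indicator (cball 0 1) y"
  have "(LBNN z. radial_ext E z * indicator (cball ((1 - t) *\<^sub>R x) t) z) =
     ennreal (t ^ DIM('a)) * (\<integral>\<^sup>+y. radial_ext E ((1 - t) *\<^sub>R x + t *\<^sub>R y) *
        indicator (cball ((1 - t) *\<^sub>R x) t) ((1 - t) *\<^sub>R x + t *\<^sub>R y) \<partial>lborel)"
    by (rule nn_integral_lborel_scale[OF _ t, where t = "(1 - t) *\<^sub>R x"]) measurable
  also have "(\<lambda>y. indicator (cball ((1 - t) *\<^sub>R x) t) ((1 - t) *\<^sub>R x + t *\<^sub>R y) :: ennreal) = indicator (cball 0 1)"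
    using t by (auto simp: fun_eq_iff indicator_def dist_norm)
  finally have "(LBNN z. radial_ext E z * indicator (cball ((1 - t) *\<^sub>R x) t) z) = ennreal (t ^ DIM('a)) * ?I" by (simp add: fun_eq_iff)
  hence "ennreal (1 / (B * t ^ DIM('a))) * (LBNN z. radial_ext E z * indicator (cball ((1 - t) *\<^sub>R x) t) z)
     = (ennreal (1 / (B * t ^ DIM('a))) * ennreal (t ^ DIM('a))) * ?I" by (simp add: mult.assoc)
  also have "ennreal (1 / (B * t ^ DIM('a))) * ennreal (t ^ DIM('a)) = ennreal (1 / B)" using t B by (simp flip: ennreal_mult')
  also have "ennreal (1 / B) * ?I = ?I / B" using B by (simp add: divide_ennreal_def inverse_ennreal inverse_eq_divide mult.commute)
  finally show ?thesis by (simp add: segment_mean_def B_def)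
qed

lemma nn_integral_cyl_product:
  assumes [measurable]: "f \<in> borel_measurable borel" "g \<in> borel_measurable borel"
  shows "(\<integral>\<^sup>+z. f (fst z) * g (snd z) \<partial>(cyl :: (real \<times> 'a::euclidean_space) measure)) =
    (LBNN s. f s) * (SPNN w. g w)"
proof -
  have "(\<integral>\<^sup>+z. f (fst z) * g (snd z) \<partial>(cyl :: (real \<times> 'a) measure)) = (LBNN s. (SPNN w. f s * g w))"
    by (subst usphere.nn_integral_fst[symmetric]) auto
  also have "\<dots> = (LBNN s. f s) * (SPNN w. g w)" by (simp add: nn_integral_cmult nn_integral_multc)
  finally show ?thesis .
qed

lemma radial_ext_shell:
  fixes E :: "'a::euclidean_space \<Rightarrow> real"
  assumes [measurable]: "E \<in> borel_measurable borel" and E: "\<And>w. E w \<ge> 0" and t: "t > 0" and d: "DIM('a) \<ge> 2"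
  shows "(LBNN z. radial_ext E z * indicator {z. 1 - t \<le> norm z \<and> norm z \<le> 1} z)
    \<le> ennreal (sphere_area TYPE('a) * t) * (SPNN w. ennreal (E w))"
proof -
  define S where "S = sphere_area TYPE('a)"
  have S: "S > 0" by (simp add: S_def sphere_area_pos)
  define I where "I s = (indicator {s. 1 - t \<le> exp s \<and> exp s \<le> 1} s :: ennreal)" for s :: real
  have [measurable]: "I \<in> borel_measurable borel" unfolding I_def[abs_def] by measurable
  have "(LBNN z. radial_ext E z * indicator {z. 1 - t \<le> norm z \<and> norm z \<le> 1} z) =
    (\<integral>\<^sup>+z. ennreal (S * exp (real DIM('a) * fst z)) * (radial_ext E (exp (fst z) *\<^sub>R snd z) *
       indicator {z. 1 - t \<le> norm z \<and> norm z \<le> 1} (exp (fst z) *\<^sub>R snd z)) \<partial>cyl)" unfolding S_def by (rule nn_integral_polar) measurable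
  also have "\<dots> \<le> (CYNN z. (ennreal S * (ennreal (exp (fst z)) * I (fst z))) * ennreal (E (snd z)))"
  proof (rule nn_integral_mono_AE)
    show "AE z in cyl. ennreal (S * exp (real DIM('a) * fst z)) * (radial_ext E (exp (fst z) *\<^sub>R snd z) *
       indicator {z. 1 - t \<le> norm z \<and> norm z \<le> 1} (exp (fst z) *\<^sub>R snd z))
       \<le> (ennreal S * (ennreal (exp (fst z)) * I (fst z))) * ennreal (E (snd z))" using AE_cyl_norm
    proof eventually_elim
      case (elim z)
      obtain s w where z: "z = (s, w)" by (cases z)
      with elim have w: "norm w = 1" by simp
      have sg: "sgn (exp s *\<^sub>R w) = w" using w by (simp add: sgn_div_norm)
      show ?case
      proof (cases "1 - t \<le> exp s \<and> exp s \<le> 1")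
        case True
        hence "s \<le> 0" by simp
        hence "real DIM('a) * s \<le> 2 * s" using d by (intro mult_right_mono_neg) auto
        hence "exp (real DIM('a) * s) \<le> exp s * exp s" by (simp flip: exp_add)
        hence "exp (real DIM('a) * s) / exp s \<le> exp s" by (simp add: field_simps)
        hence "S * E w * (exp (real DIM('a) * s) / exp s) \<le> S * E w * exp s" using S E[of w] by (intro mult_left_mono) auto
        hence "ennreal (S * exp (real DIM('a) * s) * (E w / exp s)) \<le> ennreal (S * exp s * E w)"
          by (intro ennreal_leI) (simp add: mult_ac)
        moreover have "ennreal (S * exp (real DIM('a) * s)) * ennreal (E w / exp s) = ennreal (S * exp (real DIM('a) * s) * (E w / exp s))"
          using S by (intro ennreal_mult'[symmetric]) simp
        moreover have "ennreal S * ennreal (exp s) * ennreal (E w) = ennreal (S * exp s * E w)" using S by (simp add: ennreal_mult')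
        ultimately show ?thesis using True w by (simp add: z radial_ext_def sg I_def)
      qed (use w in \<open>auto simp: z I_def\<close>)
    qed
  qed
  also have "\<dots> = (LBNN s. ennreal S * (ennreal (exp s) * I s)) * (SPNN w. ennreal (E w))" by (rule nn_integral_cyl_product) measurable
  also have "(LBNN s. ennreal S * (ennreal (exp s) * I s)) = ennreal S * (LBNN s. ennreal (exp s) * I s)"
    by (rule nn_integral_cmult) measurable
  also have "\<dots> \<le> ennreal S * ennreal t" unfolding I_def by (intro mult_left_mono nn_integral_exp_interval t) simp
  finally show ?thesis using S t by (simp add: S_def ennreal_mult mult_right_mono)
qed

text \<open>The points \<open>(1 - t) x + t y\<close> fill the ball of radius \<open>t\<close> about \<open>(1 - t) x\<close>, which lies in a shell
  of width \<open>2t\<close>. The loss \<open>t\<^sup>1\<^sup>-\<^sup>d\<close> is the ratio of the volumes of shell and ball.\<close>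

lemma segment_mean_sup:
  fixes E :: "'a::euclidean_space \<Rightarrow> real"
  assumes [measurable]: "E \<in> borel_measurable borel" and E: "\<And>w. E w \<ge> 0" and t: "0 < t" "t \<le> 1"
    and d: "DIM('a) \<ge> 2" and x: "norm x = 1"
  shows "segment_mean E t x \<le> ennreal (2 * real DIM('a) / t ^ (DIM('a) - 1)) * (SPNN w. ennreal (E w))"
proof -
  define B where "B = ball_vol TYPE('a)"
  have B: "B > 0" by (simp add: B_def)
  have "(LBNN z. radial_ext E z * indicator (cball ((1 - t) *\<^sub>R x) t) z) \<le>
    (LBNN z. radial_ext E z * indicator {z. 1 - 2 * t \<le> norm z \<and> norm z \<le> 1} z)"
  proof (intro nn_integral_mono mult_left_mono)
    fix z
    have "1 - 2 * t \<le> norm z \<and> norm z \<le> 1" if "norm ((1 - t) *\<^sub>R x - z) \<le> t"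
    proof -
      have "norm ((1 - t) *\<^sub>R x) = 1 - t" using t x by simp
      thus ?thesis using that norm_triangle_ineq2[of "(1 - t) *\<^sub>R x" z] norm_triangle_ineq2[of z "(1 - t) *\<^sub>R x"]
        by (simp add: norm_minus_commute)
    qed
    thus "indicator (cball ((1 - t) *\<^sub>R x) t) z \<le> (indicator {z. 1 - 2 * t \<le> norm z \<and> norm z \<le> 1} z :: ennreal)"
      by (auto simp: indicator_def dist_norm)
  qed simp
  also have "\<dots> \<le> ennreal (sphere_area TYPE('a) * (2 * t)) * (SPNN w. ennreal (E w))" by (rule radial_ext_shell) (use assms in auto)
  finally have "segment_mean E t x \<le> ennreal (1 / (B * t ^ DIM('a))) *
      (ennreal (sphere_area TYPE('a) * (2 * t)) * (SPNN w. ennreal (E w)))"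
    unfolding segment_mean_eq[OF assms(1) t(1)] B_def by (intro mult_left_mono) simp_all
  also have "\<dots> = (ennreal (1 / (B * t ^ DIM('a))) * ennreal (sphere_area TYPE('a) * (2 * t))) * (SPNN w. ennreal (E w))"
    by (simp add: mult.assoc)
  also have "ennreal (1 / (B * t ^ DIM('a))) * ennreal (sphere_area TYPE('a) * (2 * t)) = ennreal (2 * real DIM('a) / t ^ (DIM('a) - 1))"
  proof -
    have "t ^ DIM('a) = t * t ^ (DIM('a) - 1)" using d by (cases "DIM('a)") simp_all
    hence "1 / (B * t ^ DIM('a)) * (sphere_area TYPE('a) * (2 * t)) = 2 * real DIM('a) / t ^ (DIM('a) - 1)"
      using t B by (simp add: sphere_area_def B_def[symmetric] field_simps)
    thus ?thesis using t B by (simp flip: ennreal_mult')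
  qed
  finally show ?thesis .
qed

text \<open>The cone over a spherical cap of radius \<open>\<rho>\<close>, truncated to a shell of width \<open>\<rho>\<close>, lies in a ball
  of radius \<open>2\<rho>\<close>.\<close>

lemma cap_measure:
  fixes p :: "'a::euclidean_space"
  assumes \<rho>: "\<rho> > 0" and d: "DIM('a) \<ge> 2"
  shows "emeasure usphere {x. norm (x - p) \<le> \<rho>} \<le> ennreal (2 ^ DIM('a) * \<rho> ^ (DIM('a) - 1))"
proof (cases "\<rho> < 1")
  case False
  hence "1 * 1 \<le> (2::real) ^ DIM('a) * \<rho> ^ (DIM('a) - 1)" by (intro mult_mono one_le_power) auto
  hence "1 \<le> ennreal (2 ^ DIM('a) * \<rho> ^ (DIM('a) - 1))" by (metis ennreal_1 ennreal_leI mult_1)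
  thus ?thesis using usphere.emeasure_le_1 order_trans by blast
next
  case True
  define S where "S = sphere_area TYPE('a)"
  define B where "B = ball_vol TYPE('a)"
  define n where "n = DIM('a)"
  have n: "n \<ge> 2" "n > 0" using d by (auto simp: n_def)
  have B: "B > 0" by (simp add: B_def)
  have S: "S = real n * B" by (simp add: S_def B_def n_def sphere_area_def)
  define A where "A = {z::'a. 1 - \<rho> \<le> norm z \<and> norm z \<le> 1 \<and> norm (sgn z - p) \<le> \<rho>}"
  have [measurable]: "A \<in> sets borel" unfolding A_def by measurable
  have "A \<subseteq> cball p (2 * \<rho>)"
  proof
    fix z assume z: "z \<in> A"
    hence "z \<noteq> 0" using True by (auto simp: A_def)
    hence "z = norm z *\<^sub>R sgn z" by (simp add: sgn_div_norm)
    hence "norm (sgn z - z) = norm ((1 - norm z) *\<^sub>R sgn z)" by (metis scaleR_left_diff_distrib scaleR_one)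
    also have "\<dots> = 1 - norm z" using z \<open>z \<noteq> 0\<close> by (simp add: A_def norm_sgn)
    finally have "norm (sgn z - z) \<le> \<rho>" using z by (simp add: A_def)
    moreover have "norm (p - z) \<le> norm (sgn z - p) + norm (sgn z - z)" using norm_triangle_ineq4[of "sgn z - z" "sgn z - p"] by simp
    ultimately show "z \<in> cball p (2 * \<rho>)" using z by (simp add: A_def dist_norm)
  qed
  hence "emeasure lborel A \<le> emeasure lborel (cball p (2 * \<rho>))" by (intro emeasure_mono) auto
  also have "\<dots> = ennreal (B * (2 * \<rho>) ^ n)" using \<rho> by (simp add: emeasure_cball B_def n_def)
  finally have upper: "emeasure lborel A \<le> ennreal (B * (2 * \<rho>) ^ n)" .
  have "emeasure lborel A = (LBNN z. indicator A z)" by simp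
  also have "\<dots> = (CYNN z. ennreal (S * exp (real DIM('a) * fst z)) * indicator A (exp (fst z) *\<^sub>R snd z))"
    unfolding S_def by (rule nn_integral_polar) measurable
  also have "\<dots> = (CYNN z. (ennreal S * (ennreal (exp (real n * fst z)) * indicator {ln (1 - \<rho>)..0} (fst z))) * indicator {x. norm (x - p) \<le> \<rho>} (snd z))"
  proof (rule nn_integral_cong_AE)
    show "AE z in cyl. ennreal (S * exp (real DIM('a) * fst z)) * indicator A (exp (fst z) *\<^sub>R snd z) =
      (ennreal S * (ennreal (exp (real n * fst z)) * indicator {ln (1 - \<rho>)..0} (fst z))) * indicator {x. norm (x - p) \<le> \<rho>} (snd z)"
      using AE_cyl_norm
    proof eventually_elim
      case (elim z)
      have sg: "sgn (exp (fst z) *\<^sub>R snd z) = snd z" using elim by (simp add: sgn_div_norm)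
      have "1 - \<rho> \<le> exp (fst z) \<longleftrightarrow> ln (1 - \<rho>) \<le> fst z" using True exp_le_cancel_iff[of "ln (1 - \<rho>)" "fst z"] by simp
      thus ?case using elim B n by (simp add: A_def indicator_def sg S n_def ennreal_mult)
    qed
  qed
  also have "\<dots> = (LBNN s. ennreal S * (ennreal (exp (real n * s)) * indicator {ln (1 - \<rho>)..0} s)) *
      (SPNN x. indicator {x. norm (x - p) \<le> \<rho>} x)" by (rule nn_integral_cyl_product) measurable
  also have "(SPNN x. indicator {x. norm (x - p) \<le> \<rho>} x) = emeasure usphere {x. norm (x - p) \<le> \<rho>}"
    by (rule nn_integral_indicator) measurable
  also have "(LBNN s. ennreal S * (ennreal (exp (real n * s)) * indicator {ln (1 - \<rho>)..0} s)) =
      ennreal S * (LBNN s. ennreal (exp (real n * s)) * indicator {ln (1 - \<rho>)..0} s)" by (rule nn_integral_cmult) measurable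
  also have "(LBNN s. ennreal (exp (real n * s)) * indicator {ln (1 - \<rho>)..0} s) =
      ennreal (exp (real n * 0) / real n - exp (real n * ln (1 - \<rho>)) / real n)"
    by (rule nn_integral_FTC_Icc) (use True \<rho> n in \<open>auto intro!: derivative_eq_intros\<close>)
  also have "ennreal S * \<dots> = ennreal (B * (1 - (1 - \<rho>) ^ n))"
  proof -
    have "exp (real n * ln (1 - \<rho>)) = (1 - \<rho>) ^ n" using True exp_of_nat_mult[of n "ln (1 - \<rho>)"] by simp
    hence "S * (exp (real n * 0) / real n - exp (real n * ln (1 - \<rho>)) / real n) = B * (1 - (1 - \<rho>) ^ n)"
      using n by (simp add: S diff_divide_distrib[symmetric])
    moreover have "S \<ge> 0" using B by (simp add: S)
    ultimately show ?thesis by (simp only: ennreal_mult'[symmetric])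
  qed
  finally have eq: "emeasure lborel A = ennreal (B * (1 - (1 - \<rho>) ^ n)) * emeasure usphere {x. norm (x - p) \<le> \<rho>}" .
  have "(1 - \<rho>) ^ n \<le> (1 - \<rho>) ^ 1" using True \<rho> n by (intro power_decreasing) auto
  hence "B * \<rho> \<le> B * (1 - (1 - \<rho>) ^ n)" using B by (intro mult_left_mono) auto
  hence "ennreal (B * \<rho>) * emeasure usphere {x. norm (x - p) \<le> \<rho>} \<le>
      ennreal (B * (1 - (1 - \<rho>) ^ n)) * emeasure usphere {x. norm (x - p) \<le> \<rho>}" by (intro mult_right_mono ennreal_leI) simp_all
  also have "\<dots> \<le> ennreal (B * (2 * \<rho>) ^ n)" using upper unfolding eq .
  also have "B * (2 * \<rho>) ^ n = (B * \<rho>) * (2 ^ n * \<rho> ^ (n - 1))" using n by (cases n) (simp_all add: power_mult_distrib)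
  also have "ennreal \<dots> = ennreal (B * \<rho>) * ennreal (2 ^ n * \<rho> ^ (n - 1))" using B \<rho> by (intro ennreal_mult') simp
  finally have "ennreal (B * \<rho>) * emeasure usphere {x. norm (x - p) \<le> \<rho>} \<le> ennreal (B * \<rho>) * ennreal (2 ^ n * \<rho> ^ (n - 1))" .
  moreover have "ennreal (B * \<rho>) \<noteq> 0" using B \<rho> by simp
  ultimately show ?thesis unfolding n_def by (metis ennreal_mult_le_mult_iff ennreal_neq_top)
qed

text \<open>After averaging over \<open>x\<close> as well there is no loss: for small \<open>t\<close> the directions from which a given
  point is reached form a cap of radius comparable to \<open>t\<close>.\<close>

lemma segment_mean_average:
  fixes E :: "'a::euclidean_space \<Rightarrow> real"
  assumes [measurable]: "E \<in> borel_measurable borel" and E: "\<And>w. E w \<ge> 0" and t: "0 < t" "t \<le> 1"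
    and d: "DIM('a) \<ge> 2"
  shows "(SPNN x. segment_mean E t x) \<le> ennreal (2 * real DIM('a) * 4 ^ DIM('a)) * (SPNN w. ennreal (E w))"
proof -
  define n where "n = DIM('a)"
  define B where "B = ball_vol TYPE('a)"
  have B: "B > 0" by (simp add: B_def)
  define m where "m = (SPNN w. ennreal (E w))"
  define sh where "sh = {z::'a. 1 - 2 * t \<le> norm z \<and> norm z \<le> 1}"
  define k where "k = 4 ^ n * t ^ (n - 1)"
  have k: "k \<ge> 0" using t by (simp add: k_def)
  have cap: "emeasure usphere {x. norm ((1 - t) *\<^sub>R x - z) \<le> t} \<le> ennreal k" for z :: 'a
  proof (cases "t \<le> 1/2")
    case True
    have "{x. norm ((1 - t) *\<^sub>R x - z) \<le> t} \<subseteq> {x. norm (x - z /\<^sub>R (1 - t)) \<le> 2 * t}"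
    proof
      fix x assume "x \<in> {x. norm ((1 - t) *\<^sub>R x - z) \<le> t}"
      moreover have "(1 - t) *\<^sub>R x - z = (1 - t) *\<^sub>R (x - z /\<^sub>R (1 - t))" using True by (simp add: scaleR_diff_right)
      ultimately have "(1 - t) * norm (x - z /\<^sub>R (1 - t)) \<le> t" using t by (simp del: scaleR_right_diff_distrib)
      moreover have "1/2 * norm (x - z /\<^sub>R (1 - t)) \<le> (1 - t) * norm (x - z /\<^sub>R (1 - t))" using True by (intro mult_right_mono) auto
      ultimately show "x \<in> {x. norm (x - z /\<^sub>R (1 - t)) \<le> 2 * t}" by simp
    qed
    hence "emeasure usphere {x. norm ((1 - t) *\<^sub>R x - z) \<le> t} \<le> emeasure usphere {x. norm (x - z /\<^sub>R (1 - t)) \<le> 2 * t}"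
      by (intro emeasure_mono) (auto simp: sets_usphere)
    also have "\<dots> \<le> ennreal (2 ^ DIM('a) * (2 * t) ^ (DIM('a) - 1))" by (rule cap_measure) (use t d in auto)
    also have "\<dots> \<le> ennreal k"
    proof (rule ennreal_leI)
      have "2 ^ n * (2 * t) ^ (n - 1) = (2 ^ n * 2 ^ (n - 1)) * t ^ (n - 1)" by (simp add: power_mult_distrib)
      also have "\<dots> \<le> (2 ^ n * 2 ^ n) * t ^ (n - 1)" using t by (intro mult_right_mono mult_left_mono power_increasing) auto
      also have "\<dots> = k" by (simp add: k_def power_mult_distrib[symmetric])
      finally show "2 ^ DIM('a) * (2 * t) ^ (DIM('a) - 1) \<le> k" by (simp add: n_def)
    qed
    finally show ?thesis .
  next
    case False
    have "1 \<le> (2 * t) ^ (n - 1)" using False by (intro one_le_power) simp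
    also have "\<dots> = 2 ^ (n - 1) * t ^ (n - 1)" by (simp add: power_mult_distrib)
    also have "\<dots> \<le> 4 ^ n * t ^ (n - 1)"
    proof (rule mult_right_mono)
      have "(2::real) ^ (n - 1) \<le> 2 ^ n" by (intro power_increasing) auto
      also have "\<dots> \<le> 4 ^ n" by (intro power_mono) auto
      finally show "(2::real) ^ (n - 1) \<le> 4 ^ n" .
    qed (use t in auto)
    finally have "1 \<le> ennreal k" unfolding k_def by (metis ennreal_1 ennreal_leI)
    thus ?thesis using usphere.emeasure_le_1 order_trans by blast
  qed
  have "(SPNN x. segment_mean E t x) = (\<integral>\<^sup>+x. ennreal (1 / (B * t ^ n)) *
     (LBNN z. radial_ext E z * indicator (cball ((1 - t) *\<^sub>R x) t) z) \<partial>usphere)"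
    unfolding B_def n_def by (simp only: segment_mean_eq[OF assms(1) t(1)])
  also have "\<dots> \<le> (\<integral>\<^sup>+x. ennreal (1 / (B * t ^ n)) *
     (LBNN z. radial_ext E z * indicator sh z * indicator {x. norm ((1 - t) *\<^sub>R x - z) \<le> t} x) \<partial>usphere)"
  proof (rule nn_integral_mono_AE)
    show "AE x in usphere. ennreal (1 / (B * t ^ n)) *
     (LBNN z. radial_ext E z * indicator (cball ((1 - t) *\<^sub>R x) t) z)
     \<le> ennreal (1 / (B * t ^ n)) *
     (LBNN z. radial_ext E z * indicator sh z * indicator {x. norm ((1 - t) *\<^sub>R x - z) \<le> t} x)" using AE_usphere_norm
    proof eventually_elim
      case (elim x)
      show ?case
      proof (intro mult_left_mono nn_integral_mono)
        fix z
        have "z \<in> sh" if "norm ((1 - t) *\<^sub>R x - z) \<le> t"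
        proof -
          have "norm ((1 - t) *\<^sub>R x) = 1 - t" using t elim by simp
          thus ?thesis using that norm_triangle_ineq2[of "(1 - t) *\<^sub>R x" z] norm_triangle_ineq2[of z "(1 - t) *\<^sub>R x"]
            by (simp add: norm_minus_commute sh_def)
        qed
        thus "radial_ext E z * indicator (cball ((1 - t) *\<^sub>R x) t) z \<le>
            radial_ext E z * indicator sh z * indicator {x. norm ((1 - t) *\<^sub>R x - z) \<le> t} x" by (simp add: indicator_def dist_norm)
      qed simp
    qed
  qed
  also have "\<dots> = ennreal (1 / (B * t ^ n)) *
     (SPNN x. (LBNN z. radial_ext E z * indicator sh z * indicator {x. norm ((1 - t) *\<^sub>R x - z) \<le> t} x))"
    unfolding sh_def by (rule nn_integral_cmult) (simp add: indicator_def)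
  also have "(SPNN x. (LBNN z. radial_ext E z * indicator sh z * indicator {x. norm ((1 - t) *\<^sub>R x - z) \<le> t} x))
     = (LBNN z. (SPNN x. radial_ext E z * indicator sh z * indicator {x. norm ((1 - t) *\<^sub>R x - z) \<le> t} x))"
  proof -
    interpret p: pair_sigma_finite "lborel :: 'a measure" "usphere :: 'a measure"
      by (intro pair_sigma_finite.intro lborel.sigma_finite_measure_axioms sigma_finite_usphere)
    show ?thesis unfolding sh_def by (rule p.Fubini') (simp add: indicator_def)
  qed
  also have "\<dots> \<le> (LBNN z. radial_ext E z * indicator sh z * ennreal k)"
  proof (rule nn_integral_mono)
    fix z :: 'a
    have "(SPNN x. radial_ext E z * indicator sh z * indicator {x. norm ((1 - t) *\<^sub>R x - z) \<le> t} x) =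
      radial_ext E z * indicator sh z * emeasure usphere {x. norm ((1 - t) *\<^sub>R x - z) \<le> t}" by (subst nn_integral_cmult) auto
    thus "(SPNN x. radial_ext E z * indicator sh z * indicator {x. norm ((1 - t) *\<^sub>R x - z) \<le> t} x) \<le>
      radial_ext E z * indicator sh z * ennreal k" using cap[of z] by (simp add: mult_left_mono)
  qed
  also have "\<dots> = (LBNN z. radial_ext E z * indicator sh z) * ennreal k" unfolding sh_def by (rule nn_integral_multc) measurable
  also have "(LBNN z. radial_ext E z * indicator sh z) \<le> ennreal (sphere_area TYPE('a) * (2 * t)) * m"
    unfolding sh_def m_def by (rule radial_ext_shell) (use assms in auto)
  finally have "(SPNN x. segment_mean E t x) \<le> ennreal (1 / (B * t ^ n)) *
      (ennreal (sphere_area TYPE('a) * (2 * t)) * m * ennreal k)" by (simp add: mult_left_mono mult_right_mono)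
  also have "\<dots> = (ennreal (1 / (B * t ^ n)) * ennreal (sphere_area TYPE('a) * (2 * t)) * ennreal k) * m" by (simp only: mult_ac)
  also have "ennreal (1 / (B * t ^ n)) * ennreal (sphere_area TYPE('a) * (2 * t)) * ennreal k = ennreal (2 * real n * 4 ^ n)"
  proof -
    have "t ^ n = t * t ^ (n - 1)" using d by (cases n) (auto simp: n_def)
    moreover have "sphere_area TYPE('a) = real n * B" by (simp add: sphere_area_def B_def n_def)
    ultimately have "1 / (B * t ^ n) * (sphere_area TYPE('a) * (2 * t)) * k = 2 * real n * 4 ^ n"
      using t B by (simp add: k_def field_simps)
    moreover have "1 / (B * t ^ n) \<ge> 0" "1 / (B * t ^ n) * (sphere_area TYPE('a) * (2 * t)) \<ge> 0"
      using B t sphere_area_pos[where 'a = 'a] by auto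
    ultimately show ?thesis by (simp only: ennreal_mult'[symmetric])
  qed
  finally show ?thesis by (simp add: n_def m_def)
qed

lemma segment_mean_one:
  fixes x :: "'a::euclidean_space"
  assumes t: "0 < t" "t \<le> 1" and d: "DIM('a) \<ge> 2" and x: "norm x = 1"
  shows "segment_mean (\<lambda>_. 1) t x \<le> ennreal (3 + 2 * real DIM('a) * 3 ^ DIM('a))"
proof (cases "t \<le> 1/3")
  case True
  have B: "ball_vol TYPE('a) > 0" by simp
  have "(LBNN y. radial_ext (\<lambda>_. 1) ((1 - t) *\<^sub>R x + t *\<^sub>R y) * indicator (cball 0 1) y) \<le>
     (LBNN y. 3 * indicator (cball (0::'a) 1) y)"
  proof (rule nn_integral_mono)
    fix y :: 'a
    show "radial_ext (\<lambda>_. 1) ((1 - t) *\<^sub>R x + t *\<^sub>R y) * indicator (cball 0 1) y \<le> 3 * indicator (cball (0::'a) 1) y"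
    proof (cases "norm y \<le> 1")
      case y: True
      have "norm (t *\<^sub>R y) \<le> 1/3" using mult_mono[OF True y] t by simp
      moreover have "norm ((1 - t) *\<^sub>R x) \<ge> 2/3" using x t True by simp
      ultimately have "norm ((1 - t) *\<^sub>R x + t *\<^sub>R y) \<ge> 1/3" using norm_diff_ineq[of "(1 - t) *\<^sub>R x" "t *\<^sub>R y"] by linarith
      hence "1 / norm ((1 - t) *\<^sub>R x + t *\<^sub>R y) \<le> 3" by (simp add: divide_le_eq)
      hence "radial_ext (\<lambda>_. 1) ((1 - t) *\<^sub>R x + t *\<^sub>R y) \<le> ennreal 3" unfolding radial_ext_def by (rule ennreal_leI)
      thus ?thesis using y by simp
    qed simp
  qed
  also have "\<dots> = 3 * ennreal (ball_vol TYPE('a))" by (simp add: nn_integral_cmult emeasure_unit_cball)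
  finally have "segment_mean (\<lambda>_. 1) t x \<le> 3 * ennreal (ball_vol TYPE('a)) / ball_vol TYPE('a)"
    unfolding segment_mean_def by (rule divide_right_mono_ennreal)
  also have "\<dots> = 3" using B by (intro ennreal_mult_divide_eq) (auto simp del: unit_ball_vol_pos)
  also have "3 \<le> ennreal (3 + 2 * real DIM('a) * 3 ^ DIM('a))" by (subst ennreal_numeral[symmetric], rule ennreal_leI) simp
  finally show ?thesis .
next
  case False
  have "segment_mean (\<lambda>_. 1) t x \<le> ennreal (2 * real DIM('a) / t ^ (DIM('a) - 1)) * (\<integral>\<^sup>+w. ennreal 1 \<partial>(usphere :: 'a measure))"
    by (rule segment_mean_sup) (use assms in auto)
  also have "\<dots> = ennreal (2 * real DIM('a) / t ^ (DIM('a) - 1))" using usphere.emeasure_space_1[where 'a = 'a] by simp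
  also have "\<dots> \<le> ennreal (3 + 2 * real DIM('a) * 3 ^ DIM('a))"
  proof (rule ennreal_leI)
    have "1 / t ^ (DIM('a) - 1) = (1 / t) ^ (DIM('a) - 1)" by (simp add: power_divide)
    also have "\<dots> \<le> 3 ^ (DIM('a) - 1)" using False t by (intro power_mono) (auto simp: field_simps)
    also have "\<dots> \<le> 3 ^ DIM('a)" by (intro power_increasing) auto
    finally have "2 * real DIM('a) * (1 / t ^ (DIM('a) - 1)) \<le> 2 * real DIM('a) * 3 ^ DIM('a)" by (intro mult_left_mono) auto
    thus "2 * real DIM('a) / t ^ (DIM('a) - 1) \<le> 3 + 2 * real DIM('a) * 3 ^ DIM('a)" by simp
  qed
  finally show ?thesis .
qed

lemma ray_constant_has_derivative:
  fixes f :: "'a::euclidean_space \<Rightarrow> real"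
  assumes f: "smooth_on (- {0}) f" and z: "z \<noteq> 0"
  shows "((\<lambda>z. f (sgn z)) has_derivative (\<lambda>h. h \<bullet> tgrad f (sgn z) / norm z)) (at z)"
proof -
  have w: "sgn z \<noteq> 0" "norm (sgn z) = 1" using z by (auto simp: sgn_zero_iff norm_sgn)
  have "((\<lambda>z. inverse (norm z) *\<^sub>R z) has_derivative
      (\<lambda>h. inverse (norm z) *\<^sub>R h + (- (inverse (norm z) * (h \<bullet> sgn z) * inverse (norm z))) *\<^sub>R z)) (at z)"
    using has_derivative_scaleR[OF Deriv.has_derivative_inverse[OF _ has_derivative_norm[OF z]] has_derivative_ident] z by simp
  moreover have "(\<lambda>z. inverse (norm z) *\<^sub>R z) = (sgn :: 'a \<Rightarrow> 'a)" by (simp add: fun_eq_iff sgn_div_norm)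
  ultimately have s: "(sgn has_derivative (\<lambda>h. inverse (norm z) *\<^sub>R h + (- (inverse (norm z) * (h \<bullet> sgn z) * inverse (norm z))) *\<^sub>R z)) (at z)"
    by simp
  have g: "(f has_derivative (\<lambda>h. h \<bullet> gradient f (sgn z))) (at (sgn z))" by (rule smooth_on_gradient[of "- {0}"]) (use f w in auto)
  have "(inverse (norm z) *\<^sub>R h + (- (inverse (norm z) * (h \<bullet> sgn z) * inverse (norm z))) *\<^sub>R z) \<bullet> gradient f (sgn z)
     = h \<bullet> tgrad f (sgn z) / norm z" for h
  proof -
    have "(inverse (norm z) * (h \<bullet> sgn z) * inverse (norm z)) *\<^sub>R z = (inverse (norm z) * (h \<bullet> sgn z)) *\<^sub>R sgn z"
      by (simp add: sgn_div_norm)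
    thus ?thesis unfolding tgrad_def using z
      by (simp add: inner_diff_right inner_diff_left inner_add_left divide_inverse algebra_simps inner_commute)
  qed
  with has_derivative_compose[OF s g] show ?thesis by simp
qed

text \<open>The points of a segment are traversed at speed \<open>M q\<^sup>M\<^sup>-\<^sup>1\<close>. The slow start for large \<open>M\<close> turns
  the singularity at the starting point into a bounded factor.\<close>

lemma segment_difference:
  fixes f :: "'a::euclidean_space \<Rightarrow> real" and M :: nat
  assumes f: "smooth_on (- {0}) f" and M: "M > 0"
    and nz: "\<And>q. 0 \<le> q \<Longrightarrow> q \<le> 1 \<Longrightarrow> (1 - q ^ M) *\<^sub>R x + q ^ M *\<^sub>R y \<noteq> 0"
  shows "ennreal \<bar>f (sgn x) - f (sgn y)\<bar> \<le> (\<integral>\<^sup>+q. ennreal (norm (y - x)) * (ennreal (real M * q ^ (M - 1)) *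
      radial_ext (\<lambda>w. norm (tgrad f w)) ((1 - q ^ M) *\<^sub>R x + q ^ M *\<^sub>R y)) * indicator {0..1} q \<partial>lborel)"
proof -
  define z where "z q = (1 - q ^ M) *\<^sub>R x + q ^ M *\<^sub>R y" for q :: real
  define z' where "z' q = (real M * q ^ (M - 1)) *\<^sub>R (y - x)" for q :: real
  define F' where "F' q = z' q \<bullet> tgrad f (sgn (z q)) / norm (z q)" for q
  have zd: "(z has_vector_derivative z' q) (at q)" for q
  proof -
    have z_eq: "z = (\<lambda>q. x + q ^ M *\<^sub>R (y - x))" by (simp add: z_def fun_eq_iff algebra_simps)
    have "((\<lambda>q::real. q ^ M) has_vector_derivative real M * q ^ (M - 1)) (at q)"
      using DERIV_pow[of M q] by (simp add: has_real_derivative_iff_has_vector_derivative)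
    from has_vector_derivative_scaleR[OF DERIV_pow[of M q] has_vector_derivative_const[of "y - x"]]
    show ?thesis unfolding z_eq z'_def by (auto intro!: derivative_eq_intros)
  qed
  have nz': "z q \<noteq> 0" if "0 \<le> q" "q \<le> 1" for q using nz[OF that] by (simp add: z_def)
  have ct: "continuous_on (- {0}) (\<lambda>z. tgrad f (sgn z))"
  proof (rule continuous_on_compose2[of "- {0}" "tgrad f" "- {0}" sgn])
    have g: "continuous_on (- {0}) (gradient f)" by (intro continuous_on_gradient f) auto
    show "continuous_on (- {0}) (tgrad f)" unfolding tgrad_def by (intro continuous_intros g)
    show "continuous_on (- {0::'a}) sgn" by (auto intro!: continuous_intros)
  qed (auto simp: sgn_zero_iff)
  have "has_bochner_integral lborel (\<lambda>q. F' q * indicator {0..1} q) (f (sgn (z 1)) - f (sgn (z 0)))"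
  proof (rule has_bochner_integral_FTC_Icc_real)
    fix q :: real assume q: "0 \<le> q" "q \<le> 1"
    have "((\<lambda>q. f (sgn (z q))) has_derivative (\<lambda>h. (h *\<^sub>R z' q) \<bullet> tgrad f (sgn (z q)) / norm (z q))) (at q)"
      using has_derivative_compose[OF zd[of q, unfolded has_vector_derivative_def],
          of "\<lambda>z. f (sgn z)", OF ray_constant_has_derivative[OF f nz'[OF q]]] .
    moreover have "(\<lambda>h. (h *\<^sub>R z' q) \<bullet> tgrad f (sgn (z q)) / norm (z q)) = (*) (F' q)" by (rule ext) (simp add: F'_def)
    ultimately show "((\<lambda>q. f (sgn (z q))) has_real_derivative F' q) (at q)" by (simp add: has_field_derivative_def)
    have cz: "isCont z q" using zd has_vector_derivative_continuous by blast
    have "isCont (\<lambda>z. tgrad f (sgn z)) (z q)"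
      using ct nz'[OF q] continuous_on_eq_continuous_at[of "- {0::'a}" "\<lambda>z. tgrad f (sgn z)"] by blast
    hence "isCont (\<lambda>q. tgrad f (sgn (z q))) q" by (rule isCont_o2[OF cz])
    thus "isCont F' q" unfolding F'_def z'_def using cz nz'[OF q] by (intro continuous_intros) auto
  qed simp
  moreover have "z 1 = y" "z 0 = x" using M by (auto simp: z_def power_0_left)
  ultimately have i: "integrable lborel (\<lambda>q. F' q * indicator {0..1} q)"
    "(LBINT q. F' q * indicator {0..1} q) = f (sgn y) - f (sgn x)" by (auto simp: has_bochner_integral_iff)
  have "ennreal \<bar>f (sgn x) - f (sgn y)\<bar> = ennreal (norm (LBINT q. F' q * indicator {0..1} q))"
    unfolding i by (simp add: abs_minus_commute)
  also have "\<dots> \<le> (LBNN q. ennreal (norm (F' q * indicator {0..1} q)))" by (rule integral_norm_bound_ennreal[OF i(1)])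
  also have "\<dots> \<le> (\<integral>\<^sup>+q. ennreal (norm (y - x)) * (ennreal (real M * q ^ (M - 1)) *
      radial_ext (\<lambda>w. norm (tgrad f w)) (z q)) * indicator {0..1} q \<partial>lborel)"
  proof (rule nn_integral_mono)
    fix q :: real
    show "ennreal (norm (F' q * indicator {0..1} q)) \<le> ennreal (norm (y - x)) * (ennreal (real M * q ^ (M - 1)) *
      radial_ext (\<lambda>w. norm (tgrad f w)) (z q)) * indicator {0..1} q"
    proof (cases "q \<in> {0..1}")
      case True
      have nn: "real M * q ^ (M - 1) \<ge> 0" using True by simp
      have "norm (F' q) \<le> norm (z' q) * norm (tgrad f (sgn (z q))) / norm (z q)"
        unfolding F'_def by (simp add: Cauchy_Schwarz_ineq2 divide_right_mono)
      also have "\<dots> = norm (y - x) * ((real M * q ^ (M - 1)) * (norm (tgrad f (sgn (z q))) / norm (z q)))" using nn by (simp add: z'_def)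
      finally have "ennreal (norm (F' q)) \<le> ennreal (norm (y - x) * ((real M * q ^ (M - 1)) * (norm (tgrad f (sgn (z q))) / norm (z q))))"
        by (rule ennreal_leI)
      also have "\<dots> = ennreal (norm (y - x)) * (ennreal (real M * q ^ (M - 1)) * ennreal (norm (tgrad f (sgn (z q))) / norm (z q)))"
        using nn by (simp only: ennreal_mult' norm_ge_zero)
      finally show ?thesis using True by (simp add: radial_ext_def)
    qed simp
  qed
  finally show ?thesis by (simp add: z_def)
qed

lemma AE_segment_avoids_zero:
  fixes x :: "'a::euclidean_space"
  assumes d: "DIM('a) \<ge> 2" and x: "x \<noteq> 0"
  shows "AE y in lborel. \<forall>t. (1 - t) *\<^sub>R x + t *\<^sub>R y \<noteq> 0"
proof -
  have "dim (span {x}) < DIM('a)" using d x by (simp add: dim_insert)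
  hence "negligible (span {x})" by (rule negligible_lowdim)
  hence "span {x} \<in> null_sets lebesgue" by (simp add: negligible_iff_null_sets)
  moreover have b: "span {x} \<in> sets borel" using closed_span by (rule borel_closed)
  ultimately have "emeasure lborel (span {x}) = 0" by (auto simp: null_sets_def)
  with b have "span {x} \<in> null_sets lborel" by auto
  moreover have "{y. \<not> (\<forall>t. (1 - t) *\<^sub>R x + t *\<^sub>R y \<noteq> 0)} \<subseteq> span {x}"
  proof
    fix y assume "y \<in> {y. \<not> (\<forall>t. (1 - t) *\<^sub>R x + t *\<^sub>R y \<noteq> 0)}"
    then obtain t where t: "(1 - t) *\<^sub>R x + t *\<^sub>R y = 0" by auto
    with x have "t \<noteq> 0" by auto
    moreover from t have "t *\<^sub>R y = (t - 1) *\<^sub>R x" by (simp add: algebra_simps add_eq_0_iff)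
    hence "y = ((t - 1) / t) *\<^sub>R x" using \<open>t \<noteq> 0\<close> by (metis divideR_right divide_inverse_commute scaleR_scaleR inverse_eq_divide mult.commute)
    thus "y \<in> span {x}" by (simp add: span_base span_scale)
  qed
  ultimately show ?thesis by (intro AE_I'[where N = "span {x}"]) auto
qed

text \<open>The deviation of \<open>f\<close> from its mean is bounded by averaging over all segments from \<open>x\<close> into the
  ball.\<close>

lemma sphere_deviation:
  fixes f :: "'a::euclidean_space \<Rightarrow> real" and M :: nat
  assumes f: "smooth_on (- {0}) f" and M: "M > 0" and d: "DIM('a) \<ge> 2" and x: "norm x = 1"
  shows "ennreal \<bar>f x - (SPINT w. f w)\<bar> \<le>
    2 * (LBNN q. ennreal (real M * q ^ (M - 1)) * segment_mean (\<lambda>w. norm (tgrad f w)) (q ^ M) x * indicator {0..1} q)"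
proof -
  define D where "D w = norm (tgrad f w)" for w
  have [measurable]: "f \<in> borel_measurable borel" "tgrad f \<in> borel_measurable borel"
    using f borel_measurable_smooth borel_measurable_tgrad by auto
  have Dm [measurable]: "D \<in> borel_measurable borel" unfolding D_def[abs_def] by measurable
  have fi: "integrable usphere f" by (rule integrable_usphere) (use continuous_on_sphere[OF f] in auto)
  define B where "B = ennreal (ball_vol TYPE('a))"
  have sx: "sgn x = x" using x by (simp add: sgn_div_norm)
  have "f x - (SPINT w. f w) = (SPINT w. f x - f w)" using fi by simp
  hence "ennreal \<bar>f x - (SPINT w. f w)\<bar> \<le> (SPNN w. ennreal (norm (f x - f w)))"
    using integral_norm_bound_ennreal[of usphere "\<lambda>w. f x - f w"] fi by simp
  also have "\<dots> = (LBNN y. ennreal (norm (f x - f (sgn y))) * indicator (cball 0 1) y) / B"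
    unfolding B_def by (rule nn_integral_usphere) measurable
  also have "(LBNN y. ennreal (norm (f x - f (sgn y))) * indicator (cball 0 1) y) \<le>
     (\<integral>\<^sup>+y. (\<integral>\<^sup>+q. 2 * (ennreal (real M * q ^ (M - 1)) *
      (radial_ext D ((1 - q ^ M) *\<^sub>R x + q ^ M *\<^sub>R y) * indicator (cball 0 1) y) * indicator {0..1} q) \<partial>lborel) \<partial>lborel)"
  proof (rule nn_integral_mono_AE)
    have "x \<noteq> 0" using x by auto
    from AE_segment_avoids_zero[OF d this]
    show "AE y in lborel. ennreal (norm (f x - f (sgn y))) * indicator (cball 0 1) y \<le>
       (\<integral>\<^sup>+q. 2 * (ennreal (real M * q ^ (M - 1)) *
      (radial_ext D ((1 - q ^ M) *\<^sub>R x + q ^ M *\<^sub>R y) * indicator (cball 0 1) y) * indicator {0..1} q) \<partial>lborel)"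
    proof eventually_elim
      case (elim y)
      show ?case
      proof (cases "norm y \<le> 1")
        case True
        have "norm (y - x) \<le> 2" using norm_triangle_ineq4[of y x] True x by simp
        hence n2: "ennreal (norm (y - x)) \<le> 2" by (metis ennreal_leI ennreal_numeral zero_le_numeral)
        have "ennreal \<bar>f x - f (sgn y)\<bar> \<le> (\<integral>\<^sup>+q. ennreal (norm (y - x)) * (ennreal (real M * q ^ (M - 1)) *
      radial_ext D ((1 - q ^ M) *\<^sub>R x + q ^ M *\<^sub>R y)) * indicator {0..1} q \<partial>lborel)"
          using segment_difference[OF f M, of x y] elim unfolding D_def sx by blast
        also have "\<dots> \<le> (\<integral>\<^sup>+q. 2 * (ennreal (real M * q ^ (M - 1)) *
      radial_ext D ((1 - q ^ M) *\<^sub>R x + q ^ M *\<^sub>R y)) * indicator {0..1} q \<partial>lborel)" by (intro nn_integral_mono mult_right_mono n2) auto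
        finally show ?thesis using True by (simp add: mult.assoc)
      qed simp
    qed
  qed
  also have "(\<integral>\<^sup>+y. (\<integral>\<^sup>+q. 2 * (ennreal (real M * q ^ (M - 1)) *
      (radial_ext D ((1 - q ^ M) *\<^sub>R x + q ^ M *\<^sub>R y) * indicator (cball 0 1) y) * indicator {0..1} q) \<partial>lborel) \<partial>lborel)
    = (\<integral>\<^sup>+q. (\<integral>\<^sup>+y. 2 * (ennreal (real M * q ^ (M - 1)) *
      (radial_ext D ((1 - q ^ M) *\<^sub>R x + q ^ M *\<^sub>R y) * indicator (cball 0 1) y) * indicator {0..1} q) \<partial>lborel) \<partial>lborel)"
    by (rule lborel_pair.Fubini') measurable
  also have "\<dots> = (\<integral>\<^sup>+q. 2 * (ennreal (real M * q ^ (M - 1)) * indicator {0..1} q *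
      (LBNN y. radial_ext D ((1 - q ^ M) *\<^sub>R x + q ^ M *\<^sub>R y) * indicator (cball 0 1) y)) \<partial>lborel)"
  proof (rule nn_integral_cong)
    fix q :: real
    have [measurable]: "(\<lambda>y. radial_ext D ((1 - q ^ M) *\<^sub>R x + q ^ M *\<^sub>R y) * indicator (cball 0 1) y) \<in> borel_measurable lborel"
      by measurable
    let ?c = "2 * (ennreal (real M * q ^ (M - 1)) * indicator {0..1} q)"
    have "(\<integral>\<^sup>+y. 2 * (ennreal (real M * q ^ (M - 1)) *
      (radial_ext D ((1 - q ^ M) *\<^sub>R x + q ^ M *\<^sub>R y) * indicator (cball 0 1) y) * indicator {0..1} q) \<partial>lborel) =
      (LBNN y. ?c * (radial_ext D ((1 - q ^ M) *\<^sub>R x + q ^ M *\<^sub>R y) * indicator (cball 0 1) y))" by (simp only: mult_ac)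
    also have "\<dots> = ?c * (LBNN y. radial_ext D ((1 - q ^ M) *\<^sub>R x + q ^ M *\<^sub>R y) * indicator (cball 0 1) y)"
      by (rule nn_integral_cmult) measurable
    finally show "(\<integral>\<^sup>+y. 2 * (ennreal (real M * q ^ (M - 1)) *
      (radial_ext D ((1 - q ^ M) *\<^sub>R x + q ^ M *\<^sub>R y) * indicator (cball 0 1) y) * indicator {0..1} q) \<partial>lborel) =
      2 * (ennreal (real M * q ^ (M - 1)) * indicator {0..1} q *
      (LBNN y. radial_ext D ((1 - q ^ M) *\<^sub>R x + q ^ M *\<^sub>R y) * indicator (cball 0 1) y))" by (simp only: mult_ac)
  qed
  finally have "ennreal \<bar>f x - (SPINT w. f w)\<bar> \<le> (\<integral>\<^sup>+q. 2 * (ennreal (real M * q ^ (M - 1)) * indicator {0..1} q *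
      (LBNN y. radial_ext D ((1 - q ^ M) *\<^sub>R x + q ^ M *\<^sub>R y) * indicator (cball 0 1) y)) \<partial>lborel) / B"
    by (simp add: divide_right_mono_ennreal)
  also have "\<dots> = (\<integral>\<^sup>+q. 2 * (ennreal (real M * q ^ (M - 1)) * indicator {0..1} q *
      (LBNN y. radial_ext D ((1 - q ^ M) *\<^sub>R x + q ^ M *\<^sub>R y) * indicator (cball 0 1) y)) / B \<partial>lborel)"
    by (rule nn_integral_divide[symmetric]) measurable
  also have "\<dots> = (LBNN q. 2 * (ennreal (real M * q ^ (M - 1)) * segment_mean D (q ^ M) x * indicator {0..1} q))"
    by (rule nn_integral_cong) (simp add: segment_mean_def B_def ennreal_times_divide mult_ac)
  also have "\<dots> = 2 * (LBNN q. ennreal (real M * q ^ (M - 1)) * segment_mean D (q ^ M) x * indicator {0..1} q)"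
  proof (rule nn_integral_cmult)
    have "(\<lambda>q. segment_mean D (fst (q ^ M, x)) (snd (q ^ M, x))) \<in> borel_measurable lborel"
      by (rule measurable_compose[OF _ borel_measurable_segment_mean[OF Dm]]) measurable
    hence [measurable]: "(\<lambda>q. segment_mean D (q ^ M) x) \<in> borel_measurable borel" by simp
    show "(\<lambda>q. ennreal (real M * q ^ (M - 1)) * segment_mean D (q ^ M) x * indicator {0..1} q) \<in> borel_measurable lborel" by measurable
  qed
  finally show ?thesis unfolding D_def[abs_def] .
qed

lemma borel_measurable_segment_mean2 [measurable (raw)]:
  assumes "E \<in> borel_measurable borel" "u \<in> borel_measurable M" "v \<in> borel_measurable M"
  shows "(\<lambda>z. segment_mean E (u z) (v z)) \<in> borel_measurable M"
  using measurable_compose[OF measurable_Pair[OF assms(2,3)] borel_measurable_segment_mean[OF assms(1)]] by simp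

lemma segment_mean_mono:
  assumes "\<And>w. E w \<le> E' w"
  shows "segment_mean E t x \<le> segment_mean E' t x" unfolding segment_mean_def radial_ext_def
  by (intro divide_right_mono_ennreal nn_integral_mono mult_right_mono ennreal_leI divide_right_mono assms) auto

lemma segment_mean_lincomb:
  assumes [measurable]: "E \<in> borel_measurable borel" and "\<And>w. E w \<ge> 0" "a \<ge> 0" "b \<ge> 0"
  shows "segment_mean (\<lambda>w. a + b * E w) t x = ennreal a * segment_mean (\<lambda>_. 1) t x + ennreal b * segment_mean E t x"
proof -
  let ?z = "\<lambda>y. (1 - t) *\<^sub>R x + t *\<^sub>R y"
  have "radial_ext (\<lambda>w. a + b * E w) z = ennreal a * radial_ext (\<lambda>_. 1) z + ennreal b * radial_ext E z" for z
    using assms(2-) by (simp add: radial_ext_def ennreal_mult'[symmetric] ennreal_plus[symmetric] add_divide_distrib del: ennreal_plus)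
  hence "(LBNN y. radial_ext (\<lambda>w. a + b * E w) (?z y) * indicator (cball 0 1) y) =
    (\<integral>\<^sup>+y. ennreal a * (radial_ext (\<lambda>_. 1) (?z y) * indicator (cball 0 1) y)
      + ennreal b * (radial_ext E (?z y) * indicator (cball 0 1) y) \<partial>lborel)"
    by (intro nn_integral_cong) (simp add: distrib_right mult.assoc)
  also have "\<dots> = ennreal a * (LBNN y. radial_ext (\<lambda>_. 1) (?z y) * indicator (cball 0 1) y)
      + ennreal b * (LBNN y. radial_ext E (?z y) * indicator (cball 0 1) y)" by (simp add: nn_integral_add nn_integral_cmult)
  finally show ?thesis by (simp add: segment_mean_def add_divide_distrib_ennreal ennreal_times_divide)
qed

lemma sq_le_of_all_scales:
  fixes a C h :: real
  assumes "a \<ge> 0" "C > 0" "h \<ge> 0" and le: "\<And>l. l > 0 \<Longrightarrow> a \<le> l * C + h / l"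
  shows "a\<^sup>2 \<le> 4 * C * h"
proof (cases "h = 0")
  case True
  have "a \<le> 0"
  proof (rule ccontr)
    assume "\<not> a \<le> 0"
    hence "a \<le> (a / (2 * C)) * C" using le[of "a / (2 * C)"] True \<open>C > 0\<close> by simp
    thus False using \<open>\<not> a \<le> 0\<close> \<open>C > 0\<close> by simp
  qed
  thus ?thesis using True assms(1) by simp
next
  case False
  define l where "l = sqrt (h / C)"
  have h: "h > 0" using False assms(3) by simp
  have l: "l > 0" using h assms(2) by (simp add: l_def)
  have l2: "l * l = h / C" using h assms(2) by (simp add: l_def)
  have "h / l = l * C" using l l2 assms(2) by (simp add: field_simps)
  hence "a \<le> 2 * (l * C)" using le[OF l] by linarith
  hence "a\<^sup>2 \<le> (2 * (l * C))\<^sup>2" using assms(1) by (intro power_mono) auto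
  also have "\<dots> = 4 * C * (C * (l * l))" by (simp add: power2_eq_square)
  also have "\<dots> = 4 * C * h" using assms(2) by (simp add: l2)
  finally show ?thesis .
qed

text \<open>A bounded density suffices for all integrals below to be finite.\<close>

lemma nn_integral_segment_mean_average:
  fixes E :: "'a::euclidean_space \<Rightarrow> real" and M :: nat
  assumes [measurable]: "E \<in> borel_measurable borel" and E: "\<And>w. E w \<ge> 0" and d: "DIM('a) \<ge> 2" and M: "M > 0"
  shows "(SPNN x. (LBNN q. segment_mean E (q ^ M) x * indicator {0..1} q))
    \<le> ennreal (2 * real DIM('a) * 4 ^ DIM('a)) * (SPNN w. ennreal (E w))"
proof -
  have "(SPNN x. (LBNN q. segment_mean E (q ^ M) x * indicator {0..1} q)) =
    (LBNN q. (SPNN x. segment_mean E (q ^ M) x * indicator {0..1} q))"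
  proof (rule cyl.Fubini')
    have "(\<lambda>z. segment_mean E (fst z ^ M) (snd z) * indicator {0..1} (fst z)) \<in> borel_measurable (lborel \<Otimes>\<^sub>M usphere)" by measurable
    thus "(\<lambda>(q, x). segment_mean E (q ^ M) x * indicator {0..1} q) \<in> borel_measurable (lborel \<Otimes>\<^sub>M usphere)"
      by (simp add: case_prod_beta')
  qed
  also have "\<dots> \<le> (LBNN q. (ennreal (2 * real DIM('a) * 4 ^ DIM('a)) * (SPNN w. ennreal (E w))) * indicator {0..1::real} q)"
  proof (rule nn_integral_mono_AE)
    show "AE q in lborel. (SPNN x. segment_mean E (q ^ M) x * indicator {0..1} q) \<le>
        (ennreal (2 * real DIM('a) * 4 ^ DIM('a)) * (SPNN w. ennreal (E w))) * indicator {0..1} q"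
      using AE_lborel_singleton[of "0::real"]
    proof eventually_elim
      case (elim q)
      show ?case
      proof (cases "q \<in> {0..1}")
        case True
        hence "0 < q ^ M" "q ^ M \<le> 1" using elim by (auto intro: power_le_one)
        from segment_mean_average[OF assms(1) E this d] show ?thesis using True by simp
      qed simp
    qed
  qed
  also have "\<dots> = ennreal (2 * real DIM('a) * 4 ^ DIM('a)) * (SPNN w. ennreal (E w))" by (simp add: nn_integral_cmult_indicator)
  finally show ?thesis .
qed

lemma nn_integral_segment_mean_le:
  fixes E :: "'a::euclidean_space \<Rightarrow> real" and M :: nat
  assumes [measurable]: "E \<in> borel_measurable borel" and E: "\<And>w. E w \<ge> 0" and d: "DIM('a) \<ge> 2"
    and x: "norm x = 1" and M: "M > 0" and c: "c \<ge> 0" "\<And>w. norm w = 1 \<Longrightarrow> E w \<le> c"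
    and g: "\<And>q. 0 \<le> q \<Longrightarrow> q \<le> 1 \<Longrightarrow> g q \<le> K"
  shows "(LBNN q. ennreal (g q) * segment_mean E (q ^ M) x * indicator {0..1} q)
    \<le> ennreal K * (ennreal c * ennreal (3 + 2 * real DIM('a) * 3 ^ DIM('a)))"
proof -
  have le: "segment_mean E t x \<le> ennreal c * ennreal (3 + 2 * real DIM('a) * 3 ^ DIM('a))" if "0 < t" "t \<le> 1" for t
  proof -
    have "radial_ext E z \<le> radial_ext (\<lambda>_. c) z" for z
      unfolding radial_ext_def using c by (cases "z = 0") (auto intro!: ennreal_leI divide_right_mono simp: norm_sgn)
    hence "segment_mean E t x \<le> segment_mean (\<lambda>_. c) t x"
      unfolding segment_mean_def by (intro divide_right_mono_ennreal nn_integral_mono mult_right_mono) auto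
    also have "\<dots> = ennreal c * segment_mean (\<lambda>_. 1) t x" using segment_mean_lincomb[of "\<lambda>_. 0" c 0 t x] c by simp
    also have "\<dots> \<le> ennreal c * ennreal (3 + 2 * real DIM('a) * 3 ^ DIM('a))" by (intro mult_left_mono segment_mean_one that d x) simp
    finally show ?thesis .
  qed
  have "(LBNN q. ennreal (g q) * segment_mean E (q ^ M) x * indicator {0..1} q) \<le>
    (LBNN q. (ennreal K * (ennreal c * ennreal (3 + 2 * real DIM('a) * 3 ^ DIM('a)))) * indicator {0..1::real} q)"
  proof (rule nn_integral_mono_AE)
    show "AE q in lborel. ennreal (g q) * segment_mean E (q ^ M) x * indicator {0..1} q \<le>
      (ennreal K * (ennreal c * ennreal (3 + 2 * real DIM('a) * 3 ^ DIM('a)))) * indicator {0..1} q"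
      using AE_lborel_singleton[of "0::real"]
    proof eventually_elim
      case (elim q)
      show ?case
      proof (cases "q \<in> {0..1}")
        case True
        hence "0 < q ^ M" "q ^ M \<le> 1" using elim by (auto intro: power_le_one)
        from mult_mono[OF ennreal_leI[OF g] le[OF this]] show ?thesis using True by simp
      qed simp
    qed
  qed
  also have "\<dots> = ennreal K * (ennreal c * ennreal (3 + 2 * real DIM('a) * 3 ^ DIM('a)))" by (simp add: nn_integral_cmult_indicator)
  finally show ?thesis .
qed

lemma bounded_tgrad:
  assumes "smooth_on (- {0}) (f :: 'a::euclidean_space \<Rightarrow> real)"
  obtains c where "c \<ge> 0" "\<And>w. norm w = 1 \<Longrightarrow> norm (tgrad f w) \<le> c"
proof -
  have "compact (tgrad f ` sphere 0 1)" by (rule compact_continuous_image[OF continuous_on_sphere_tgrad[OF assms]]) simp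
  then obtain c where "\<And>x. x \<in> sphere 0 1 \<Longrightarrow> norm (tgrad f x) \<le> c" using compact_imp_bounded bounded_iff by (metis imageI)
  thus ?thesis using that[of "max c 0"] by (force simp: le_max_iff_disj)
qed

text \<open>Square the bound of the deviation for \<open>M = 1\<close> by the Cauchy-Schwarz inequality and average over the
  starting point.\<close>

lemma sphere_poincare:
  assumes d: "DIM('a::euclidean_space) \<ge> 2"
  obtains C where "C > 0" "\<And>f :: 'a \<Rightarrow> real. smooth_on (- {0}) f \<Longrightarrow>
    (SPINT x. (f x - (SPINT w. f w))\<^sup>2) \<le> C * tangential_energy f"
proof -
  define C2 where "C2 = 3 + 2 * real DIM('a) * 3 ^ DIM('a)"
  define K1 where "K1 = 2 * real DIM('a) * 4 ^ DIM('a)"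
  have C2: "C2 > 0" and K1: "K1 > 0" by (auto simp: C2_def K1_def add_pos_nonneg)
  have "(SPINT x. (f x - (SPINT w. f w))\<^sup>2) \<le> (4 * C2 * K1) * tangential_energy f"
    if f: "smooth_on (- {0}) f" for f :: "'a \<Rightarrow> real"
  proof -
    define D where "D w = norm (tgrad f w)" for w
    define fb where "fb = (SPINT w. f w)"
    have [measurable]: "f \<in> borel_measurable borel" "tgrad f \<in> borel_measurable borel"
      using f borel_measurable_smooth borel_measurable_tgrad by auto
    have Dm [measurable]: "D \<in> borel_measurable borel" unfolding D_def[abs_def] by measurable
    obtain c where c: "c \<ge> 0" "\<And>w. norm w = 1 \<Longrightarrow> D w \<le> c" using bounded_tgrad[OF f] unfolding D_def by metis
    have c2: "(D w)\<^sup>2 \<le> c\<^sup>2" if "norm w = 1" for w using c(2)[OF that] by (intro power_mono) (auto simp: D_def)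
    define H where "H x = (LBNN q. segment_mean (\<lambda>w. (D w)\<^sup>2) (q ^ 1) x * indicator {0..1} q)" for x
    have pt: "ennreal ((f x - fb)\<^sup>2) \<le> ennreal (4 * C2) * H x" if x: "norm x = 1" for x
    proof -
      have "H x \<le> ennreal 1 * (ennreal (c\<^sup>2) * ennreal C2)"
        using nn_integral_segment_mean_le[of "\<lambda>w. (D w)\<^sup>2" x 1 "c\<^sup>2" "\<lambda>_. 1" 1] d x c2 by (simp add: H_def C2_def)
      hence "H x < \<top>" by (rule le_less_trans) (simp add: ennreal_mult_less_top)
      then obtain h where h: "H x = ennreal h" "h \<ge> 0" by (cases "H x") auto
      have "\<bar>f x - fb\<bar> \<le> l * C2 + h / l" if l: "l > 0" for l
      proof -
        have "ennreal \<bar>f x - fb\<bar> \<le> 2 * (LBNN q. ennreal (real 1 * q ^ (1 - 1)) * segment_mean D (q ^ 1) x * indicator {0..1} q)"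
          unfolding fb_def D_def[abs_def] by (rule sphere_deviation[OF f _ d x]) simp
        also have "\<dots> \<le> 2 * (\<integral>\<^sup>+q. (ennreal (l / 2) * segment_mean (\<lambda>_. 1) (q ^ 1) x * indicator {0..1} q +
            ennreal (1 / (2 * l)) * (segment_mean (\<lambda>w. (D w)\<^sup>2) (q ^ 1) x * indicator {0..1} q)) \<partial>lborel)"
        proof (intro mult_left_mono nn_integral_mono)
          fix q :: real
          have "D w \<le> l / 2 + 1 / (2 * l) * (D w)\<^sup>2" for w
          proof -
            have "0 \<le> (D w - l)\<^sup>2 / (2 * l)" using l by simp
            also have "\<dots> = l / 2 + 1 / (2 * l) * (D w)\<^sup>2 - D w" using l by (simp add: power2_eq_square field_simps)
            finally show ?thesis by simp
          qed
          hence "segment_mean D (q ^ 1) x \<le> segment_mean (\<lambda>w. l / 2 + 1 / (2 * l) * (D w)\<^sup>2) (q ^ 1) x" by (rule segment_mean_mono)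
          also have "\<dots> = ennreal (l / 2) * segment_mean (\<lambda>_. 1) (q ^ 1) x + ennreal (1 / (2 * l)) * segment_mean (\<lambda>w. (D w)\<^sup>2) (q ^ 1) x"
            by (rule segment_mean_lincomb) (use l in auto)
          finally show "ennreal (real 1 * q ^ (1 - 1)) * segment_mean D (q ^ 1) x * indicator {0..1} q \<le>
             ennreal (l / 2) * segment_mean (\<lambda>_. 1) (q ^ 1) x * indicator {0..1} q +
            ennreal (1 / (2 * l)) * (segment_mean (\<lambda>w. (D w)\<^sup>2) (q ^ 1) x * indicator {0..1} q)" by (auto simp: indicator_def)
        qed simp
        also have "\<dots> = 2 * ((LBNN q. ennreal (l / 2) * segment_mean (\<lambda>_. 1) (q ^ 1) x * indicator {0..1} q) +
            ennreal (1 / (2 * l)) * H x)"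
        proof -
          have "(LBNN q. ennreal (1 / (2 * l)) * (segment_mean (\<lambda>w. (D w)\<^sup>2) (q ^ 1) x * indicator {0..1} q))
              = ennreal (1 / (2 * l)) * H x" unfolding H_def by (rule nn_integral_cmult) measurable
          moreover have "(\<integral>\<^sup>+q. (ennreal (l / 2) * segment_mean (\<lambda>_. 1) (q ^ 1) x * indicator {0..1} q +
            ennreal (1 / (2 * l)) * (segment_mean (\<lambda>w. (D w)\<^sup>2) (q ^ 1) x * indicator {0..1} q)) \<partial>lborel)
            = (LBNN q. ennreal (l / 2) * segment_mean (\<lambda>_. 1) (q ^ 1) x * indicator {0..1} q) +
              (LBNN q. ennreal (1 / (2 * l)) * (segment_mean (\<lambda>w. (D w)\<^sup>2) (q ^ 1) x * indicator {0..1} q))"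
            by (rule nn_integral_add) measurable
          ultimately show ?thesis by simp
        qed
        also have "\<dots> \<le> 2 * (ennreal (l / 2) * (ennreal 1 * ennreal C2) + ennreal (1 / (2 * l)) * H x)" unfolding C2_def using l
          by (intro mult_left_mono add_right_mono nn_integral_segment_mean_le d x) auto
        also have "\<dots> = ennreal (l * C2 + h / l)"
        proof -
          have "ennreal (l / 2) * (ennreal 1 * ennreal C2) + ennreal (1 / (2 * l)) * H x = ennreal (l / 2 * C2 + 1 / (2 * l) * h)"
            using l C2 h by (simp add: ennreal_mult'[symmetric])
          hence "2 * (ennreal (l / 2) * (ennreal 1 * ennreal C2) + ennreal (1 / (2 * l)) * H x) = ennreal 2 * ennreal (l / 2 * C2 + 1 / (2 * l) * h)"
            by simp
          also have "\<dots> = ennreal (2 * (l / 2 * C2 + 1 / (2 * l) * h))" by (rule ennreal_mult'[symmetric]) simp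
          also have "2 * (l / 2 * C2 + 1 / (2 * l) * h) = l * C2 + h / l" using l by (simp add: field_simps)
          finally show ?thesis .
        qed
        finally show ?thesis using l C2 h by (subst (asm) ennreal_le_iff) auto
      qed
      from sq_le_of_all_scales[OF abs_ge_zero C2 h(2) this] have "(f x - fb)\<^sup>2 \<le> 4 * C2 * h" by simp
      hence "ennreal ((f x - fb)\<^sup>2) \<le> ennreal (4 * C2 * h)" by (rule ennreal_leI)
      also have "\<dots> = ennreal (4 * C2) * H x" using C2 unfolding h by (intro ennreal_mult') simp
      finally show ?thesis .
    qed
    have "(SPNN x. ennreal ((f x - fb)\<^sup>2)) \<le> (SPNN x. ennreal (4 * C2) * H x)"
      by (intro nn_integral_mono_AE) (auto intro!: eventually_mono[OF AE_usphere_norm] pt)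
    also have "\<dots> = ennreal (4 * C2) * (SPNN x. H x)"
    proof (rule nn_integral_cmult)
      have "(\<lambda>x. LBNN q. segment_mean (\<lambda>w. (D w)\<^sup>2) (snd (x, q) ^ 1) (fst (x, q)) * indicator {0..1} (snd (x, q))) \<in> borel_measurable usphere"
        by (rule lborel.borel_measurable_nn_integral_fst) measurable
      thus "H \<in> borel_measurable usphere" by (simp add: H_def[abs_def])
    qed
    also have "\<dots> \<le> ennreal (4 * C2) * (ennreal K1 * (SPNN w. ennreal ((D w)\<^sup>2)))"
      unfolding H_def K1_def by (intro mult_left_mono nn_integral_segment_mean_average d) auto
    also have "(SPNN w. ennreal ((D w)\<^sup>2)) = ennreal (tangential_energy f)"
      unfolding tangential_energy_def D_def by (rule nn_integral_eq_integral[OF integrable_sphere_tgrad[OF f]]) simp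
    also have "(SPNN x. ennreal ((f x - fb)\<^sup>2)) = ennreal (SPINT x. (f x - fb)\<^sup>2)" by (rule nn_integral_eq_integral)
         (auto intro!: integrable_usphere continuous_intros continuous_on_sphere[OF f])
    finally have "ennreal (SPINT x. (f x - fb)\<^sup>2) \<le> ennreal (4 * C2 * K1 * tangential_energy f)"
      using C2 K1 by (simp add: ennreal_mult' mult.assoc)
    thus ?thesis using C2 K1 tangential_energy_nonneg[of f] by (simp add: fb_def)
  qed
  thus ?thesis using C2 K1 by (intro that[of "4 * C2 * K1"]) auto
qed

text \<open>Young's inequality plays the role of Jensen's inequality for \<open>h = \<integral> X\<close>, where the power \<open>X\<^sup>p\<close>
  is already bounded by a multiple of \<open>g\<close>.\<close>

lemma powr_le_by_young:
  fixes h c :: real and X g :: "real \<Rightarrow> ennreal"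
  assumes [measurable]: "X \<in> borel_measurable lborel" "g \<in> borel_measurable lborel"
    and p: "p > 1" and h: "(LBNN \<tau>. X \<tau> * indicator {0..1::real} \<tau>) = ennreal h" "h \<ge> 0" and c: "c \<ge> 0"
    and X: "\<And>\<tau>. 0 < \<tau> \<Longrightarrow> \<tau> \<le> 1 \<Longrightarrow> \<exists>x y. X \<tau> = ennreal x \<and> g \<tau> = ennreal y \<and> 0 \<le> x \<and> 0 \<le> y \<and> x powr p \<le> c * y"
  shows "ennreal (h powr p) \<le> ennreal c * (LBNN \<tau>. g \<tau> * indicator {0..1} \<tau>)"
proof (cases "(LBNN \<tau>. g \<tau> * indicator {0..1} \<tau>) = \<top>")
  case True
  show ?thesis
  proof (cases "c = 0")
    case c0: True
    have "(LBNN \<tau>. X \<tau> * indicator {0..1::real} \<tau>) = (\<integral>\<^sup>+\<tau>. 0 \<partial>(lborel :: real measure))"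
    proof (rule nn_integral_cong_AE)
      show "AE \<tau> in lborel. X \<tau> * indicator {0..1::real} \<tau> = 0" using AE_lborel_singleton[of "0::real"]
      proof eventually_elim
        case (elim \<tau>)
        show ?case
        proof (cases "\<tau> \<in> {0..1}")
          case True
          with elim obtain x y where "X \<tau> = ennreal x" "0 \<le> x" "x powr p \<le> c * y" using X[of \<tau>] by auto
          hence "X \<tau> = 0" using c0 p by simp
          thus ?thesis by simp
        qed simp
      qed
    qed
    hence "h = 0" using h by simp
    thus ?thesis using p by simp
  next
    case False
    hence "ennreal c \<noteq> 0" using c by simp
    hence "ennreal c * (LBNN \<tau>. g \<tau> * indicator {0..1} \<tau>) = \<top>" by (simp add: True ennreal_mult_eq_top_iff)
    thus ?thesis by simp
  qed
next
  case False
  then obtain r where r: "(LBNN \<tau>. g \<tau> * indicator {0..1} \<tau>) = ennreal r" "r \<ge> 0" by (cases "LBNN \<tau>. g \<tau> * indicator {0..1} \<tau>") auto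
  define q where "q = p / (p - 1)"
  have q: "q > 1" "1 / p + 1 / q = 1" "(p - 1) * q = p" using p by (auto simp: q_def field_simps)
  define b where "b = h powr (p - 1)"
  have b: "b \<ge> 0" "b powr q = h powr p" by (auto simp: b_def powr_powr q)
  have hb: "b * h = h powr p" using h(2) p powr_mult_base[of h "p - 1"] by (simp add: b_def mult.commute)
  have "ennreal b * (LBNN \<tau>. X \<tau> * indicator {0..1::real} \<tau>) = (LBNN \<tau>. ennreal b * (X \<tau> * indicator {0..1::real} \<tau>))"
    by (rule nn_integral_cmult[symmetric]) measurable
  also have "\<dots> \<le> (LBNN \<tau>. ennreal (c / p) * (g \<tau> * indicator {0..1} \<tau>) + ennreal (h powr p / q) * indicator {0..1} \<tau>)"
  proof (rule nn_integral_mono_AE)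
    show "AE \<tau> in lborel. ennreal b * (X \<tau> * indicator {0..1::real} \<tau>) \<le>
        ennreal (c / p) * (g \<tau> * indicator {0..1} \<tau>) + ennreal (h powr p / q) * indicator {0..1} \<tau>"
      using AE_lborel_singleton[of "0::real"]
    proof eventually_elim
      case (elim \<tau>)
      show ?case
      proof (cases "\<tau> \<in> {0..1}")
        case True
        with elim obtain x y where xy: "X \<tau> = ennreal x" "g \<tau> = ennreal y" "0 \<le> x" "0 \<le> y" "x powr p \<le> c * y" using X[of \<tau>] by auto
        have "x * b \<le> x powr p / p + b powr q / q" by (rule Youngs_inequality) (use p q b xy in auto)
        also have "\<dots> \<le> (c / p) * y + h powr p / q" using xy p b by (simp add: divide_right_mono)
        finally have "ennreal (b * x) \<le> ennreal ((c / p) * y + h powr p / q)" by (intro ennreal_leI) (simp add: mult.commute)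
        also have "ennreal ((c / p) * y + h powr p / q) = ennreal (c / p) * ennreal y + ennreal (h powr p / q)"
          using ennreal_plus[of "c / p * y" "h powr p / q"] ennreal_mult'[of "c / p" y] xy p q c by simp
        finally show ?thesis using True xy b by (simp add: ennreal_mult')
      qed simp
    qed
  qed
  also have "\<dots> = (LBNN \<tau>. ennreal (c / p) * (g \<tau> * indicator {0..1} \<tau>)) + (LBNN \<tau>. ennreal (h powr p / q) * indicator {0..1::real} \<tau>)"
    by (rule nn_integral_add) measurable
  also have "(LBNN \<tau>. ennreal (c / p) * (g \<tau> * indicator {0..1} \<tau>)) = ennreal (c / p) * ennreal r"
    unfolding r(1)[symmetric] by (rule nn_integral_cmult) measurable
  also have "(LBNN \<tau>. ennreal (h powr p / q) * indicator {0..1::real} \<tau>) = ennreal (h powr p / q)"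
    by (simp add: nn_integral_cmult_indicator)
  also have "ennreal (c / p) * ennreal r + ennreal (h powr p / q) = ennreal (c / p * r + h powr p / q)"
    using ennreal_plus[of "c / p * r" "h powr p / q"] ennreal_mult'[of "c / p" r] c p r q by simp
  also have "ennreal b * (LBNN \<tau>. X \<tau> * indicator {0..1::real} \<tau>) = ennreal (h powr p)"
    unfolding h(1) using b(1) by (simp add: ennreal_mult'[symmetric] hb)
  finally have "h powr p \<le> c / p * r + h powr p / q" using c p r q by (subst (asm) ennreal_le_iff) auto
  moreover have "h powr p / q = h powr p - h powr p / p"
  proof -
    have "1 / q = 1 - 1 / p" using q(2) by simp
    hence "h powr p * (1 / q) = h powr p * (1 - 1 / p)" by simp
    thus ?thesis by (simp add: algebra_simps)
  qed
  ultimately have "h powr p \<le> c * r" using p by (simp add: field_simps)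
  thus ?thesis unfolding r(1) using c by (simp add: ennreal_leI flip: ennreal_mult')
qed

text \<open>A Sobolev inequality for all exponents below the critical one. For each \<open>\<tau>\<close> the averages over
  segments are bounded in \<open>L\<^sup>1\<close> and, with a factor blowing up as \<open>\<tau> \<rightarrow> 0\<close>, in \<open>L\<^sup>\<infinity>\<close>; below the
  critical exponent the interpolated factor is absorbed by the slow start of the segments.\<close>

lemma sphere_sobolev:
  fixes p :: real
  assumes d: "DIM('a::euclidean_space) \<ge> 2" and p: "p > 1" "(real DIM('a) - 2) * (p - 1) < 1"
  obtains C where "C > 0" "\<And>f :: 'a \<Rightarrow> real. smooth_on (- {0}) f \<Longrightarrow>
    (SPINT x. \<bar>f x - (SPINT w. f w)\<bar> powr p) \<le> C * (SPINT w. norm (tgrad f w)) powr p"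
proof -
  define n where "n = real DIM('a)"
  have n: "n \<ge> 2" using d by (simp add: n_def)
  define \<delta> where "\<delta> = 1 - (n - 2) * (p - 1)"
  have \<delta>: "\<delta> > 0" using p by (simp add: \<delta>_def n_def)
  define M where "M = Suc (nat \<lceil>p / \<delta>\<rceil>)"
  have M: "M > 0" by (simp add: M_def)
  have "p / \<delta> \<le> real M" unfolding M_def using real_nat_ceiling_ge[of "p / \<delta>"] by linarith
  hence "p \<le> real M * \<delta>" using \<delta> by (simp add: pos_divide_le_eq)
  hence e: "0 \<le> real (M - 1) * p - real M * (n - 1) * (p - 1)" using M by (simp add: \<delta>_def of_nat_diff algebra_simps)
  define K1 where "K1 = 2 * real DIM('a) * 4 ^ DIM('a)"
  have K1: "K1 > 0" by (simp add: K1_def)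
  define k where "k = real M powr p * (2 * n) powr (p - 1)"
  have k: "k > 0" using M n by (simp add: k_def)
  have "(SPINT x. \<bar>f x - (SPINT w. f w)\<bar> powr p) \<le> (2 powr p * k * K1) * (SPINT w. norm (tgrad f w)) powr p"
    if f: "smooth_on (- {0}) f" for f :: "'a \<Rightarrow> real"
  proof -
    define D where "D w = norm (tgrad f w)" for w
    define fb where "fb = (SPINT w. f w)"
    define m where "m = (SPINT w. D w)"
    have [measurable]: "f \<in> borel_measurable borel" "tgrad f \<in> borel_measurable borel"
      using f borel_measurable_smooth borel_measurable_tgrad by auto
    have Dm [measurable]: "D \<in> borel_measurable borel" unfolding D_def[abs_def] by measurable
    have D0: "D w \<ge> 0" for w by (simp add: D_def)
    have Di: "integrable usphere D"
      by (rule integrable_usphere) (auto simp: D_def intro!: continuous_intros continuous_on_sphere_tgrad[OF f])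
    have m: "m \<ge> 0" "(SPNN w. ennreal (D w)) = ennreal m" using nn_integral_eq_integral[OF Di] D0 by (auto simp: m_def)
    obtain b where b: "b \<ge> 0" "\<And>w. norm w = 1 \<Longrightarrow> D w \<le> b" using bounded_tgrad[OF f] unfolding D_def by metis
    define c where "c = k * m powr (p - 1)"
    have c: "c \<ge> 0" using k by (simp add: c_def)
    define G where "G x = (LBNN \<tau>. segment_mean D (\<tau> ^ M) x * indicator {0..1} \<tau>)" for x
    have pt: "ennreal (\<bar>f x - fb\<bar> powr p) \<le> ennreal (2 powr p * c) * G x" if x: "norm x = 1" for x
    proof -
      define X where "X \<tau> = ennreal (real M * \<tau> ^ (M - 1)) * segment_mean D (\<tau> ^ M) x" for \<tau> :: real
      have [measurable]: "X \<in> borel_measurable lborel" unfolding X_def[abs_def] by measurable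
      have "(LBNN \<tau>. X \<tau> * indicator {0..1::real} \<tau>) \<le> ennreal (real M) * (ennreal b * ennreal (3 + 2 * real DIM('a) * 3 ^ DIM('a)))"
        unfolding X_def using M by (intro nn_integral_segment_mean_le Dm D0 d x b) (auto intro!: mult_left_le power_le_one)
      hence "(LBNN \<tau>. X \<tau> * indicator {0..1::real} \<tau>) < \<top>" by (rule le_less_trans) (simp add: ennreal_mult_less_top)
      then obtain h where h: "(LBNN \<tau>. X \<tau> * indicator {0..1::real} \<tau>) = ennreal h" "h \<ge> 0"
        by (cases "LBNN \<tau>. X \<tau> * indicator {0..1::real} \<tau>") auto
      have hp: "ennreal (h powr p) \<le> ennreal c * (LBNN \<tau>. segment_mean D (\<tau> ^ M) x * indicator {0..1} \<tau>)"
      proof (rule powr_le_by_young[OF _ _ p(1) h c])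
        fix \<tau> :: real assume \<tau>: "0 < \<tau>" "\<tau> \<le> 1"
        hence t: "0 < \<tau> ^ M" "\<tau> ^ M \<le> 1" by (auto intro: power_le_one)
        have up: "segment_mean D (\<tau> ^ M) x \<le> ennreal (2 * n / (\<tau> ^ M) ^ (DIM('a) - 1) * m)"
          using segment_mean_sup[OF Dm D0 t d x] unfolding m(2) n_def ennreal_mult''[OF m(1)] .
        hence "segment_mean D (\<tau> ^ M) x < \<top>" by (rule le_less_trans) simp
        then obtain y where y: "segment_mean D (\<tau> ^ M) x = ennreal y" "y \<ge> 0" by (cases "segment_mean D (\<tau> ^ M) x") auto
        define P where "P = \<tau> powr (real M * (n - 1))"
        have P: "P > 0" "(\<tau> ^ M) ^ (DIM('a) - 1) = P"
          using \<tau> d by (auto simp: P_def n_def powr_realpow[symmetric] powr_powr of_nat_diff)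
        have yle: "y \<le> 2 * n * m / P" using up y n m P by (simp add: P(2))
        define x' where "x' = real M * \<tau> ^ (M - 1) * y"
        have x'0: "x' \<ge> 0" using \<tau> y by (simp add: x'_def)
        have "x' powr p = real M powr p * \<tau> powr (real (M - 1) * p) * (y powr (p - 1) * y)"
        proof -
          have "y powr p = y powr (p - 1) * y" using powr_mult_base[of y "p - 1"] y by (simp add: mult.commute)
          moreover have "(\<tau> ^ (M - 1)) powr p = \<tau> powr (real (M - 1) * p)" using \<tau> by (simp add: powr_realpow[symmetric] powr_powr)
          ultimately show ?thesis using \<tau> y by (simp add: x'_def powr_mult)
        qed
        also have "\<dots> \<le> real M powr p * \<tau> powr (real (M - 1) * p) * ((2 * n * m / P) powr (p - 1) * y)"
          using yle y p by (intro mult_left_mono mult_right_mono powr_mono2) auto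
        also have "(2 * n * m / P) powr (p - 1) = (2 * n) powr (p - 1) * m powr (p - 1) * \<tau> powr (- (real M * (n - 1) * (p - 1)))"
        proof -
          have "2 * n * m / P = 2 * n * m * \<tau> powr (- (real M * (n - 1)))" by (simp add: P_def powr_minus divide_inverse)
          thus ?thesis using n m by (simp add: powr_mult powr_powr)
        qed
        also have "real M powr p * \<tau> powr (real (M - 1) * p) * ((2 * n) powr (p - 1) * m powr (p - 1) * \<tau> powr (- (real M * (n - 1) * (p - 1))) * y)
          = c * y * \<tau> powr (real (M - 1) * p - real M * (n - 1) * (p - 1))"
          unfolding c_def k_def by (simp add: powr_diff powr_minus divide_inverse mult_ac)
        also have "\<dots> \<le> c * y * 1"
        proof (rule mult_left_mono)
          show "\<tau> powr (real (M - 1) * p - real M * (n - 1) * (p - 1)) \<le> 1" using powr_mono2[OF e, of \<tau> 1] \<tau> by simp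
        qed (use c y in simp)
        finally have "x' powr p \<le> c * y" by simp
        moreover have "X \<tau> = ennreal x'" using \<tau> y by (simp add: X_def x'_def ennreal_mult')
        ultimately show "\<exists>x' y. X \<tau> = ennreal x' \<and> segment_mean D (\<tau> ^ M) x = ennreal y \<and> 0 \<le> x' \<and> 0 \<le> y \<and> x' powr p \<le> c * y"
          using x'0 y by blast
      qed measurable
      have "ennreal \<bar>f x - fb\<bar> \<le> 2 * ennreal h"
        using sphere_deviation[OF f M d x] unfolding h(1)[symmetric] X_def fb_def D_def[abs_def] .
      also have "\<dots> = ennreal (2 * h)" using h by (simp add: ennreal_mult')
      finally have "\<bar>f x - fb\<bar> \<le> 2 * h" using h by (subst (asm) ennreal_le_iff) auto
      hence "\<bar>f x - fb\<bar> powr p \<le> (2 * h) powr p" using p by (intro powr_mono2) auto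
      also have "\<dots> = 2 powr p * h powr p" using h by (simp add: powr_mult)
      finally have "ennreal (\<bar>f x - fb\<bar> powr p) \<le> ennreal (2 powr p) * ennreal (h powr p)"
        by (simp add: ennreal_leI flip: ennreal_mult')
      also have "\<dots> \<le> ennreal (2 powr p) * (ennreal c * G x)" unfolding G_def by (intro mult_left_mono hp) simp
      also have "\<dots> = ennreal (2 powr p * c) * G x" by (simp add: ennreal_mult' mult.assoc)
      finally show ?thesis .
    qed
    have "(SPNN x. ennreal (\<bar>f x - fb\<bar> powr p)) \<le> (SPNN x. ennreal (2 powr p * c) * G x)"
      by (intro nn_integral_mono_AE) (auto intro!: eventually_mono[OF AE_usphere_norm] pt)
    also have "\<dots> = ennreal (2 powr p * c) * (SPNN x. G x)"
    proof (rule nn_integral_cmult)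
      have "(\<lambda>x. LBNN \<tau>. segment_mean D (snd (x, \<tau>) ^ M) (fst (x, \<tau>)) * indicator {0..1} (snd (x, \<tau>))) \<in> borel_measurable usphere"
        by (rule lborel.borel_measurable_nn_integral_fst) measurable
      thus "G \<in> borel_measurable usphere" by (simp add: G_def[abs_def])
    qed
    also have "\<dots> \<le> ennreal (2 powr p * c) * (ennreal K1 * ennreal m)"
      unfolding G_def K1_def m(2)[symmetric] by (intro mult_left_mono nn_integral_segment_mean_average d Dm D0 M) auto
    also have "\<dots> = ennreal (2 powr p * c * K1 * m)" using c K1 m by (simp add: ennreal_mult' mult.assoc)
    also have "2 powr p * c * K1 * m = (2 powr p * k * K1) * m powr p"
      using powr_mult_base[OF m(1), of "p - 1"] by (simp add: c_def mult_ac)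
    also have "(SPNN x. ennreal (\<bar>f x - fb\<bar> powr p)) = ennreal (SPINT x. \<bar>f x - fb\<bar> powr p)" by (rule nn_integral_eq_integral)
         (use p in \<open>auto intro!: integrable_usphere continuous_intros continuous_on_powr' continuous_on_sphere[OF f]\<close>)
    finally show ?thesis using k K1 by (simp add: fb_def m_def D_def)
  qed
  thus ?thesis using k K1 by (intro that[of "2 powr p * k * K1"]) auto
qed

section \<open>The spherical inequality holds with some constant\<close>

lemma tgrad_square:
  fixes v :: "'a::euclidean_space \<Rightarrow> real"
  assumes v: "smooth_on (- {0}) v" and w: "w \<noteq> 0"
  shows "tgrad (\<lambda>w. (v w)\<^sup>2) w = (2 * v w) *\<^sub>R tgrad v w"
proof -
  have "(v has_derivative (\<lambda>h. h \<bullet> gradient v w)) (at w)" by (rule smooth_on_gradient[of "- {0}"]) (use v w in auto)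
  from has_derivative_mult[OF this this]
  have "((\<lambda>w. (v w)\<^sup>2) has_derivative (\<lambda>h. h \<bullet> ((2 * v w) *\<^sub>R gradient v w))) (at w)" by (simp add: power2_eq_square algebra_simps)
  hence "gradient (\<lambda>w. (v w)\<^sup>2) w = (2 * v w) *\<^sub>R gradient v w" by (rule gradient_unique)
  thus ?thesis by (simp add: tgrad_def scaleR_diff_right)
qed

lemma tgrad_add_const:
  fixes v :: "'a::euclidean_space \<Rightarrow> real"
  assumes v: "smooth_on (- {0}) v" and w: "w \<noteq> 0"
  shows "tgrad (\<lambda>w. v w + c) w = tgrad v w"
proof -
  have "(v has_derivative (\<lambda>h. h \<bullet> gradient v w)) (at w)" by (rule smooth_on_gradient[of "- {0}"]) (use v w in auto)
  hence "((\<lambda>w. v w + c) has_derivative (\<lambda>h. h \<bullet> gradient v w)) (at w)" by (auto intro!: derivative_eq_intros)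
  hence "gradient (\<lambda>w. v w + c) w = gradient v w" by (rule gradient_unique)
  thus ?thesis by (simp add: tgrad_def)
qed

lemma smooth_on_square: "smooth_on (- {0}) v \<Longrightarrow> smooth_on (- {0}) (\<lambda>w::'a::euclidean_space. (v w)\<^sup>2)"
  unfolding power2_eq_square by (intro smooth_on_mult) auto

lemma integral_tgrad_square_le:
  fixes v :: "'a::euclidean_space \<Rightarrow> real"
  assumes v: "smooth_on (- {0}) v" and l: "l > 0"
  shows "(SPINT w. norm (tgrad (\<lambda>w. (v w)\<^sup>2) w)) \<le> l * (SPINT w. (v w)\<^sup>2) + tangential_energy v / l"
proof -
  have v2: "smooth_on (- {0}) (\<lambda>w. (v w)\<^sup>2)" by (rule smooth_on_square[OF v])
  have "(SPINT w. norm (tgrad (\<lambda>w. (v w)\<^sup>2) w)) \<le> (SPINT w. l * (v w)\<^sup>2 + (norm (tgrad v w))\<^sup>2 / l)"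
  proof (rule integral_mono_AE)
    show "integrable usphere (\<lambda>w. norm (tgrad (\<lambda>w. (v w)\<^sup>2) w))" using borel_measurable_tgrad[OF v2] continuous_on_sphere_tgrad[OF v2]
      by (intro integrable_usphere) (auto intro!: continuous_intros)
    show "integrable usphere (\<lambda>w. l * (v w)\<^sup>2 + (norm (tgrad v w))\<^sup>2 / l)"
      using integrable_sphere_square[OF v] integrable_sphere_tgrad[OF v] by auto
    show "AE w in usphere. norm (tgrad (\<lambda>w. (v w)\<^sup>2) w) \<le> l * (v w)\<^sup>2 + (norm (tgrad v w))\<^sup>2 / l" using AE_usphere_norm
    proof eventually_elim
      case (elim w)
      hence "w \<noteq> 0" by auto
      have "0 \<le> (l * \<bar>v w\<bar> - norm (tgrad v w))\<^sup>2 / l" using l by simp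
      also have "\<dots> = l * (v w)\<^sup>2 + (norm (tgrad v w))\<^sup>2 / l - 2 * \<bar>v w\<bar> * norm (tgrad v w)"
        using l by (simp add: power2_diff power_mult_distrib add_divide_distrib diff_divide_distrib) (simp add: power2_eq_square)
      finally show ?case using tgrad_square[OF v \<open>w \<noteq> 0\<close>] by (simp add: abs_mult)
    qed
  qed
  also have "\<dots> = l * (SPINT w. (v w)\<^sup>2) + tangential_energy v / l"
    using integrable_sphere_square[OF v] integrable_sphere_tgrad[OF v] by (simp add: tangential_energy_def)
  finally show ?thesis .
qed

lemma powr_add_le:
  fixes x y p :: real
  assumes "x \<ge> 0" "y \<ge> 0" "p > 0"
  shows "(x + y) powr p \<le> 2 powr p * (x powr p + y powr p)"
proof -
  have "(x + y) powr p \<le> (2 * max x y) powr p" using assms by (intro powr_mono2) auto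
  also have "\<dots> = 2 powr p * (max x y) powr p" using assms by (simp add: powr_mult)
  also have "(max x y) powr p \<le> x powr p + y powr p" by (simp add: max_def)
  finally show ?thesis by (simp add: mult_left_mono)
qed

lemma integrable_sphere_powr:
  fixes v :: "'a::euclidean_space \<Rightarrow> real"
  assumes "smooth_on (- {0}) v" "p > 0"
  shows "integrable usphere (\<lambda>w. \<bar>v w\<bar> powr p)" using borel_measurable_smooth[OF assms(1)] continuous_on_sphere[OF assms(1)] assms(2)
  by (intro integrable_usphere) (auto intro!: continuous_intros continuous_on_powr')

lemma integral_powr_shift_le:
  fixes f :: "'a::euclidean_space \<Rightarrow> real"
  assumes f: "smooth_on (- {0}) f" and f0: "\<And>w. f w \<ge> 0" and p: "p > 0" and \<mu>: "\<mu> \<ge> 0"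
  shows "(SPINT w. f w powr p) \<le> 2 powr p * (\<mu> powr p + (SPINT w. \<bar>f w - \<mu>\<bar> powr p))"
proof -
  have fm: "smooth_on (- {0}) (\<lambda>w. f w - \<mu>)" using smooth_on_add[OF _ f smooth_on_const[of _ "- \<mu>"]] by auto
  have i: "integrable usphere (\<lambda>w. \<bar>f w - \<mu>\<bar> powr p)" by (rule integrable_sphere_powr[OF fm p])
  have "(SPINT w. f w powr p) \<le> (SPINT w. 2 powr p * (\<mu> powr p + \<bar>f w - \<mu>\<bar> powr p))"
  proof (rule integral_mono)
    show "integrable usphere (\<lambda>w. f w powr p)" using integrable_sphere_powr[OF f p] f0 by simp
    show "integrable usphere (\<lambda>w. 2 powr p * (\<mu> powr p + \<bar>f w - \<mu>\<bar> powr p))" using i by simp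
    show "f w powr p \<le> 2 powr p * (\<mu> powr p + \<bar>f w - \<mu>\<bar> powr p)" for w
    proof -
      have "f w powr p \<le> (\<mu> + \<bar>f w - \<mu>\<bar>) powr p" using f0[of w] p by (intro powr_mono2) auto
      also have "\<dots> \<le> 2 powr p * (\<mu> powr p + \<bar>f w - \<mu>\<bar> powr p)" by (rule powr_add_le) (use \<mu> p in auto)
      finally show ?thesis .
    qed
  qed
  also have "\<dots> = 2 powr p * (\<mu> powr p + (SPINT w. \<bar>f w - \<mu>\<bar> powr p))" using i by simp
  finally show ?thesis .
qed

text \<open>The convex function \<open>t ln t - t + 1\<close> at \<open>t = (1 + y)\<^sup>2\<close>: quadratic near \<open>y = 0\<close>, and of growth
  below any power larger than \<open>2\<close>.\<close>

lemma entropy_function_bound: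
  fixes y p :: real
  assumes p: "p > 1"
  shows "(1 + y)\<^sup>2 * ln ((1 + y)\<^sup>2) - (1 + y)\<^sup>2 + 1 \<le> 9 * y\<^sup>2 + (4 powr p / (p - 1) + 1) * (y\<^sup>2) powr p"
proof (cases "\<bar>y\<bar> \<le> 1")
  case True
  define t where "t = (1 + y)\<^sup>2"
  have t: "t \<ge> 0" by (simp add: t_def)
  have "t * ln t - t + 1 \<le> (t - 1)\<^sup>2"
  proof (cases "t = 0")
    case False
    hence "t * ln t \<le> t * (t - 1)" using t by (intro mult_left_mono ln_le_minus_one) auto
    thus ?thesis by (simp add: power2_eq_square algebra_simps)
  qed simp
  also have "(t - 1)\<^sup>2 = y\<^sup>2 * (2 + y)\<^sup>2" by (simp add: t_def power2_eq_square algebra_simps)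
  also have "\<dots> \<le> y\<^sup>2 * 3\<^sup>2" using True by (intro mult_left_mono power_mono) auto
  finally have "t * ln t - t + 1 \<le> 9 * y\<^sup>2" by simp
  moreover have "0 \<le> (4 powr p / (p - 1) + 1) * (y\<^sup>2) powr p" using p by simp
  ultimately show ?thesis by (simp add: t_def)
next
  case False
  define t where "t = (1 + y)\<^sup>2"
  have t: "t \<ge> 0" by (simp add: t_def)
  have y1: "1 \<le> (y\<^sup>2) powr p"
  proof -
    have "1 \<le> y\<^sup>2" using False abs_square_le_1[of y] by (simp add: not_le)
    thus ?thesis using p by (simp add: ge_one_powr_ge_zero)
  qed
  have "\<bar>1 + y\<bar> \<le> 2 * \<bar>y\<bar>" using False by linarith
  hence "\<bar>1 + y\<bar>\<^sup>2 \<le> (2 * \<bar>y\<bar>)\<^sup>2" by (intro power_mono) auto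
  hence "t \<le> 4 * y\<^sup>2" by (simp add: t_def power_mult_distrib)
  hence "t powr p \<le> (4 * y\<^sup>2) powr p" using t p by (intro powr_mono2) auto
  hence tp: "t powr p \<le> 4 powr p * (y\<^sup>2) powr p" by (simp add: powr_mult)
  have "t * ln t \<le> t powr p / (p - 1)"
  proof (cases "t = 0")
    case False
    with t have t: "t > 0" by simp
    have "(p - 1) * ln t = ln (t powr (p - 1))" using t by (simp add: ln_powr)
    also have "\<dots> \<le> t powr (p - 1)" using ln_le_minus_one[of "t powr (p - 1)"] t by simp
    finally have "ln t \<le> t powr (p - 1) / (p - 1)" using p by (simp add: field_simps)
    hence "t * ln t \<le> t * (t powr (p - 1) / (p - 1))" using t by (intro mult_left_mono) auto
    also have "\<dots> = t powr p / (p - 1)" using powr_mult_base[of t "p - 1"] t by simp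
    finally show ?thesis .
  qed simp
  also have "\<dots> \<le> 4 powr p * (y\<^sup>2) powr p / (p - 1)" using tp p by (intro divide_right_mono) auto
  finally have "t * ln t - t + 1 \<le> (4 powr p / (p - 1) + 1) * (y\<^sup>2) powr p" using t y1 by (simp add: algebra_simps)
  thus ?thesis unfolding t_def[symmetric] by (simp add: add_increasing)
qed

text \<open>For large energies the entropy is estimated through the \<open>L\<^sup>p\<close> norm of the density \<open>v\<^sup>2\<close>, whose
  gradient is controlled in \<open>L\<^sup>1\<close>. The relation between \<open>p\<close> and \<open>\<alpha>\<close> is what produces the coefficient
  \<open>\<alpha>\<close> of the logarithm.\<close>

lemma sphere_entropy_le_log:
  fixes \<alpha> :: real
  assumes d: "DIM('a::euclidean_space) \<ge> 2" and \<alpha>: "\<alpha> > (real DIM('a) - 1) / 2"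
  obtains C where "C \<ge> 1" "\<And>v :: 'a \<Rightarrow> real. smooth_on (- {0}) v \<Longrightarrow> (SPINT w. (v w)\<^sup>2) = 1 \<Longrightarrow>
    sphere_entropy v \<le> \<alpha> * ln (C * (1 + tangential_energy v))"
proof -
  \<comment> \<open>the exponent with \<open>p / (2 (p - 1)) = \<alpha>\<close>; it is subcritical exactly when \<open>\<alpha> > (d - 1) / 2\<close>\<close>
  define p where "p = 2 * \<alpha> / (2 * \<alpha> - 1)"
  have \<alpha>1: "2 * \<alpha> > 1" using \<alpha> d by auto
  hence p1: "p > 1" by (simp add: p_def)
  have pm: "p - 1 = 1 / (2 * \<alpha> - 1)" using \<alpha>1 by (simp add: p_def field_simps)
  have "(real DIM('a) - 2) * (p - 1) < 1" using \<alpha>1 \<alpha> by (simp add: pm)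
  then obtain C where C: "C > 0" "\<And>f :: 'a \<Rightarrow> real. smooth_on (- {0}) f \<Longrightarrow>
    (SPINT x. \<bar>f x - (SPINT w. f w)\<bar> powr p) \<le> C * (SPINT w. norm (tgrad f w)) powr p" using sphere_sobolev[OF d p1] by blast
  define C3 where "C3 = 2 powr p * (1 + C * 2 powr p)"
  have "1 \<le> (2::real) powr p" using p1 by (simp add: ge_one_powr_ge_zero)
  hence "1 * 1 \<le> C3" unfolding C3_def using C by (intro mult_mono) auto
  hence C3: "C3 \<ge> 1" by simp
  define L where "L = ln C3 / (p - 1)"
  have L: "L \<ge> 0" using C3 p1 by (simp add: L_def)
  have "sphere_entropy v \<le> \<alpha> * ln (exp (L / \<alpha>) * (1 + tangential_energy v))"
    if v: "smooth_on (- {0}) v" "(SPINT w. (v w)\<^sup>2) = 1" for v :: "'a \<Rightarrow> real"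
  proof -
    define f where "f w = (v w)\<^sup>2" for w
    define b where "b = tangential_energy v"
    define m where "m = (SPINT w. norm (tgrad f w))"
    have b: "b \<ge> 0" by (simp add: b_def tangential_energy_nonneg)
    have f: "smooth_on (- {0}) f" "\<And>w. f w \<ge> 0" using smooth_on_square[OF v(1)] by (auto simp: f_def[abs_def])
    have m0: "m \<ge> 0" unfolding m_def by (rule integral_nonneg_AE) simp
    have "m\<^sup>2 \<le> 4 * 1 * b"
    proof (rule sq_le_of_all_scales[OF m0 _ b])
      show "m \<le> l * 1 + b / l" if "l > 0" for l
        using integral_tgrad_square_le[OF v(1) that] v(2) by (simp add: m_def f_def[abs_def] b_def)
    qed simp
    hence "m\<^sup>2 \<le> (2 * sqrt b)\<^sup>2" using b by (simp add: power_mult_distrib)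
    hence "m \<le> 2 * sqrt b" by (rule power2_le_imp_le) (use b in simp)
    hence "m powr p \<le> (2 * sqrt b) powr p" using m0 p1 by (intro powr_mono2) auto
    also have "\<dots> = 2 powr p * b powr (p / 2)" using b by (simp only: powr_mult powr_half_sqrt[symmetric] powr_powr) simp
    also have "b powr (p / 2) \<le> (1 + b) powr (p / 2)" using b p1 by (intro powr_mono2) auto
    finally have mp: "m powr p \<le> 2 powr p * (1 + b) powr (p / 2)" by simp
    have b1: "1 \<le> (1 + b) powr (p / 2)" using b p1 by (simp add: ge_one_powr_ge_zero)
    define c where "c = C3 * (1 + b) powr (p / 2)"
    have c: "c > 0" using C3 b by (simp add: c_def)
    have fmean: "(SPINT w. f w) = 1" using v(2) by (simp add: f_def)
    have "(SPINT w. f w powr p) \<le> 2 powr p * (1 powr p + (SPINT w. \<bar>f w - 1\<bar> powr p))"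
      by (rule integral_powr_shift_le) (use f p1 in auto)
    also have "\<dots> \<le> 2 powr p * ((1 + b) powr (p / 2) + C * (2 powr p * (1 + b) powr (p / 2)))"
    proof (intro mult_left_mono add_mono)
      have "(SPINT w. \<bar>f w - 1\<bar> powr p) \<le> C * m powr p" using C(2)[OF f(1)] by (simp add: fmean m_def)
      also have "\<dots> \<le> C * (2 powr p * (1 + b) powr (p / 2))" using mp C by (intro mult_left_mono) auto
      finally show "(SPINT w. \<bar>f w - 1\<bar> powr p) \<le> C * (2 powr p * (1 + b) powr (p / 2))" .
    qed (use b1 in auto)
    also have "\<dots> = c" by (simp add: c_def C3_def algebra_simps)
    finally have fp: "(SPINT w. f w powr p) \<le> c" .
    have ifp: "integrable usphere (\<lambda>w. f w powr p)" using integrable_sphere_powr[OF f(1), of p] p1 f(2) by simp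
    have fi: "integrable usphere f" using integrable_sphere_square[OF v(1)] by (simp add: f_def[abs_def])
    have "(p - 1) * sphere_entropy v = (SPINT w. (p - 1) * (f w * ln (f w)))" by (simp add: sphere_entropy_def f_def)
    also have "\<dots> \<le> (SPINT w. (ln c - 1) * f w + f w powr p / c)"
    proof (rule integral_mono)
      show "integrable usphere (\<lambda>w. (p - 1) * (f w * ln (f w)))" using integrable_sphere_entropy[OF v(1)] by (simp add: f_def[abs_def])
      show "integrable usphere (\<lambda>w. (ln c - 1) * f w + f w powr p / c)" using fi ifp by auto
      show "(p - 1) * (f w * ln (f w)) \<le> (ln c - 1) * f w + f w powr p / c" for w
      proof (cases "f w = 0")
        case False
        with f(2)[of w] have fw: "f w > 0" by simp
        have "(p - 1) * ln (f w) = ln (f w powr (p - 1))" using fw by (simp add: ln_powr)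
        also have "\<dots> \<le> ln c + f w powr (p - 1) / c - 1" using fw c by (intro ln_le_tangent) auto
        finally have "f w * ((p - 1) * ln (f w)) \<le> f w * (ln c + f w powr (p - 1) / c - 1)" using fw by (intro mult_left_mono) auto
        also have "\<dots> = (ln c - 1) * f w + f w powr p / c" using powr_mult_base[of "f w" "p - 1"] fw by (simp add: algebra_simps)
        finally show ?thesis by (simp add: mult_ac)
      qed (use c in simp)
    qed
    also have "\<dots> = (ln c - 1) + (SPINT w. f w powr p) / c" using fi ifp fmean by simp
    also have "\<dots> \<le> (ln c - 1) + 1" using fp c by (simp add: divide_le_eq)
    also have "\<dots> = ln C3 + p / 2 * ln (1 + b)" using C3 b by (simp add: c_def ln_mult ln_powr)
    finally have "sphere_entropy v \<le> (ln C3 + p / 2 * ln (1 + b)) / (p - 1)" using p1 by (simp add: pos_le_divide_eq mult.commute)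
    also have "\<dots> = L + p / (2 * (p - 1)) * ln (1 + b)" by (simp add: L_def add_divide_distrib)
    also have "p / (2 * (p - 1)) = \<alpha>" using \<alpha>1 by (simp add: pm) (simp add: p_def)
    also have "L + \<alpha> * ln (1 + b) = \<alpha> * ln (exp (L / \<alpha>) * (1 + b))"
    proof -
      have "ln (exp (L / \<alpha>) * (1 + b)) = L / \<alpha> + ln (1 + b)" using b by (simp add: ln_mult)
      thus ?thesis using \<alpha>1 by (simp only: distrib_left) simp
    qed
    finally show ?thesis by (simp add: b_def)
  qed
  thus ?thesis using L \<alpha>1 by (intro that[of "exp (L / \<alpha>)"]) auto
qed

text \<open>For small energies \<open>v\<close> is close to its mean, and the entropy is estimated by the second order
  behaviour of \<open>t ln t\<close> with the Poincare inequality, the remainder by the Sobolev inequality for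
  the square of the deviation from the mean.\<close>

lemma sphere_entropy_le_linear:
  assumes d: "DIM('a::euclidean_space) \<ge> 2"
  obtains K b1 where "K > 0" "b1 > 0" "\<And>v :: 'a \<Rightarrow> real. smooth_on (- {0}) v \<Longrightarrow> (SPINT w. (v w)\<^sup>2) = 1 \<Longrightarrow>
    tangential_energy v \<le> b1 \<Longrightarrow> sphere_entropy v \<le> K * tangential_energy v"
proof -
  obtain Cp where Cp: "Cp > 0" "\<And>f :: 'a \<Rightarrow> real. smooth_on (- {0}) f \<Longrightarrow>
    (SPINT x. (f x - (SPINT w. f w))\<^sup>2) \<le> Cp * tangential_energy f" using sphere_poincare[OF d] by blast
  define p where "p = 1 + 1 / (real DIM('a))"
  have p1: "p > 1" by (simp add: p_def)
  have "(real DIM('a) - 2) * (p - 1) < 1" by (simp add: p_def)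
  then obtain C where C: "C > 0" "\<And>f :: 'a \<Rightarrow> real. smooth_on (- {0}) f \<Longrightarrow>
    (SPINT x. \<bar>f x - (SPINT w. f w)\<bar> powr p) \<le> C * (SPINT w. norm (tgrad f w)) powr p" using sphere_sobolev[OF d p1] by blast
  define b1 where "b1 = min 1 (1 / (2 * Cp))"
  have b1: "b1 > 0" "b1 \<le> 1" "Cp * b1 \<le> 1 / 2"
  proof -
    show "b1 > 0" "b1 \<le> 1" using Cp by (auto simp: b1_def)
    have "Cp * b1 \<le> Cp * (1 / (2 * Cp))" using Cp by (intro mult_left_mono) (auto simp: b1_def)
    thus "Cp * b1 \<le> 1 / 2" using Cp by simp
  qed
  define C4 where "C4 = 2 powr p * (Cp powr p + C * (Cp + 1) powr p)"
  have C4: "C4 > 0" using C Cp by (simp add: C4_def add_pos_pos)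
  define C5 where "C5 = 4 powr p / (p - 1) + 1"
  have C5: "C5 > 0" using p1 by (simp add: C5_def add_pos_pos)
  define K where "K = 9 * Cp + C5 * 2 powr (p - 1) * C4"
  have K: "K > 0" using Cp C4 C5 by (simp add: K_def add_pos_pos)
  have "sphere_entropy v \<le> K * tangential_energy v"
    if v: "smooth_on (- {0}) v" "(SPINT w. (v w)\<^sup>2) = 1" and bb: "tangential_energy v \<le> b1" for v :: "'a \<Rightarrow> real"
  proof -
    define b where "b = tangential_energy v"
    have b: "b \<ge> 0" "b \<le> b1" using bb by (auto simp: b_def tangential_energy_nonneg)
    define vb where "vb = (SPINT w. v w)"
    define z where "z w = v w + (- vb)" for w
    have z: "smooth_on (- {0}) z" unfolding z_def[abs_def] by (intro smooth_on_add v smooth_on_const) auto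
    have vi: "integrable usphere v"
      by (rule integrable_usphere) (use borel_measurable_smooth[OF v(1)] continuous_on_sphere[OF v(1)] in auto)
    have v2i: "integrable usphere (\<lambda>w. (v w)\<^sup>2)" by (rule integrable_sphere_square[OF v(1)])
    define \<mu> where "\<mu> = (SPINT w. (z w)\<^sup>2)"
    have \<mu>0: "\<mu> \<ge> 0" unfolding \<mu>_def by (rule integral_nonneg_AE) simp
    have \<mu>b: "\<mu> \<le> Cp * b" using Cp(2)[OF v(1)] by (simp add: \<mu>_def z_def vb_def b_def)
    have "(z w)\<^sup>2 = (v w)\<^sup>2 - 2 * vb * v w + vb\<^sup>2" for w by (simp add: z_def power2_eq_square algebra_simps)
    hence "\<mu> = 1 - vb\<^sup>2" using vi v2i v(2) by (simp add: \<mu>_def vb_def[symmetric] power2_eq_square)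
    moreover have "Cp * b \<le> Cp * b1" using b Cp by (intro mult_left_mono) auto
    ultimately have vb: "1 / 2 \<le> vb\<^sup>2" using \<mu>b b1 by linarith
    have tz: "tangential_energy z = b" unfolding b_def tangential_energy_def
    proof (rule integral_cong_AE)
      show "(\<lambda>w. (norm (tgrad z w))\<^sup>2) \<in> borel_measurable usphere" "(\<lambda>w. (norm (tgrad v w))\<^sup>2) \<in> borel_measurable usphere"
        using borel_measurable_tgrad[OF z] borel_measurable_tgrad[OF v(1)] by measurable
      show "AE w in usphere. (norm (tgrad z w))\<^sup>2 = (norm (tgrad v w))\<^sup>2" using AE_usphere_norm
      proof eventually_elim
        case (elim w)
        hence "w \<noteq> 0" by auto
        from tgrad_add_const[OF v(1) this, of "- vb"] show ?case by (simp add: z_def[abs_def])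
      qed
    qed
    have zf: "smooth_on (- {0}) (\<lambda>w. (z w)\<^sup>2)" by (rule smooth_on_square[OF z])
    define m where "m = (SPINT w. norm (tgrad (\<lambda>w. (z w)\<^sup>2) w))"
    have m0: "m \<ge> 0" unfolding m_def by (rule integral_nonneg_AE) simp
    have "m \<le> 1 * \<mu> + b / 1" using integral_tgrad_square_le[OF z, of 1] by (simp add: m_def \<mu>_def tz)
    hence mb: "m \<le> (Cp + 1) * b" using \<mu>b by (simp add: algebra_simps)
    have "(SPINT w. ((z w)\<^sup>2) powr p) \<le> 2 powr p * (\<mu> powr p + (SPINT w. \<bar>(z w)\<^sup>2 - \<mu>\<bar> powr p))"
      by (rule integral_powr_shift_le) (use zf p1 \<mu>0 in auto)
    also have "\<dots> \<le> 2 powr p * ((Cp * b) powr p + C * ((Cp + 1) * b) powr p)"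
    proof (intro mult_left_mono add_mono)
      show "\<mu> powr p \<le> (Cp * b) powr p" using \<mu>b \<mu>0 p1 by (intro powr_mono2) auto
      have "(SPINT w. \<bar>(z w)\<^sup>2 - \<mu>\<bar> powr p) \<le> C * m powr p" using C(2)[OF zf] by (simp add: m_def \<mu>_def)
      also have "\<dots> \<le> C * ((Cp + 1) * b) powr p" using mb m0 p1 C by (intro mult_left_mono powr_mono2) auto
      finally show "(SPINT w. \<bar>(z w)\<^sup>2 - \<mu>\<bar> powr p) \<le> C * ((Cp + 1) * b) powr p" .
    qed simp
    also have "\<dots> = C4 * b powr p" 
    proof -
      have "(Cp * b) powr p = Cp powr p * b powr p" "((Cp + 1) * b) powr p = (Cp + 1) powr p * b powr p"
        using Cp(1) b by (auto intro!: powr_mult)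
      thus ?thesis by (simp only: C4_def) (simp add: algebra_simps)
    qed
    also have "\<dots> \<le> C4 * b"
    proof (intro mult_left_mono)
      have "b powr (p - 1) \<le> 1" using b b1 p1 powr_mono2[of "p - 1" b 1] by simp
      hence "b * b powr (p - 1) \<le> b * 1" using b by (intro mult_left_mono) auto
      thus "b powr p \<le> b" using powr_mult_base[OF b(1), of "p - 1"] by simp
    qed (use C4 in simp)
    finally have zp: "(SPINT w. ((z w)\<^sup>2) powr p) \<le> C4 * b" .
    have izp: "integrable usphere (\<lambda>w. ((z w)\<^sup>2) powr p)" using integrable_sphere_powr[OF zf, of p] p1 by simp
    have iz: "integrable usphere (\<lambda>w. (z w)\<^sup>2)" by (rule integrable_sphere_square[OF z])
    define c where "c = vb\<^sup>2"
    have c: "c > 0" "1 / 2 \<le> c" using vb by (auto simp: c_def)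
    have vb0: "vb \<noteq> 0" using c by (auto simp: c_def)
    have ie: "integrable usphere (\<lambda>w. (v w)\<^sup>2 * ln ((v w)\<^sup>2))" by (rule integrable_sphere_entropy[OF v(1)])
    have "sphere_entropy v \<le> sphere_entropy v - ln c - 1 + c" using ln_le_minus_one[OF c(1)] by simp
    also have "\<dots> = (SPINT w. (v w)\<^sup>2 * ln ((v w)\<^sup>2) - ln c * (v w)\<^sup>2 - (v w)\<^sup>2 + c)" using ie v2i v(2) by (simp add: sphere_entropy_def)
    also have "\<dots> \<le> (SPINT w. 9 * (z w)\<^sup>2 + C5 * 2 powr (p - 1) * ((z w)\<^sup>2) powr p)"
    proof (rule integral_mono)
      show "integrable usphere (\<lambda>w. (v w)\<^sup>2 * ln ((v w)\<^sup>2) - ln c * (v w)\<^sup>2 - (v w)\<^sup>2 + c)" using ie v2i by auto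
      show "integrable usphere (\<lambda>w. 9 * (z w)\<^sup>2 + C5 * 2 powr (p - 1) * ((z w)\<^sup>2) powr p)" using iz izp by auto
      fix w
      define y where "y = z w / vb"
      have vy: "(v w)\<^sup>2 = c * (1 + y)\<^sup>2"
      proof -
        have "v w = vb * (1 + y)" using vb0 by (simp add: y_def z_def field_simps)
        thus ?thesis by (simp add: c_def power_mult_distrib)
      qed
      have zy: "(z w)\<^sup>2 = c * y\<^sup>2" using vb0 by (simp add: y_def c_def power_divide)
      have "(v w)\<^sup>2 * ln ((v w)\<^sup>2) - ln c * (v w)\<^sup>2 - (v w)\<^sup>2 + c = c * ((1 + y)\<^sup>2 * ln ((1 + y)\<^sup>2) - (1 + y)\<^sup>2 + 1)"
      proof (cases "1 + y = 0")
        case False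
        hence "(1 + y)\<^sup>2 > 0" by simp
        thus ?thesis unfolding vy using c by (simp add: ln_mult algebra_simps)
      qed (simp add: vy)
      also have "\<dots> \<le> c * (9 * y\<^sup>2 + C5 * (y\<^sup>2) powr p)"
        unfolding C5_def using c by (intro mult_left_mono entropy_function_bound p1) auto
      also have "\<dots> = 9 * (z w)\<^sup>2 + C5 * (c * (y\<^sup>2) powr p)" by (simp add: zy algebra_simps)
      also have "c * (y\<^sup>2) powr p \<le> 2 powr (p - 1) * ((z w)\<^sup>2) powr p"
      proof -
        have "(1 / c) powr (p - 1) * c powr p = c" using c by (simp add: powr_diff powr_divide)
        hence "c * (y\<^sup>2) powr p = (1 / c) powr (p - 1) * (c powr p * (y\<^sup>2) powr p)" by (simp only: mult.assoc[symmetric])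
        also have "\<dots> = (1 / c) powr (p - 1) * ((z w)\<^sup>2) powr p" using c by (simp add: zy powr_mult)
        also have "\<dots> \<le> 2 powr (p - 1) * ((z w)\<^sup>2) powr p" using c p1 by (intro mult_right_mono powr_mono2) (auto simp: field_simps)
        finally show ?thesis .
      qed
      finally show "(v w)\<^sup>2 * ln ((v w)\<^sup>2) - ln c * (v w)\<^sup>2 - (v w)\<^sup>2 + c \<le> 9 * (z w)\<^sup>2 + C5 * 2 powr (p - 1) * ((z w)\<^sup>2) powr p"
        using C5 by (simp add: mult.assoc)
    qed
    also have "\<dots> = 9 * \<mu> + C5 * 2 powr (p - 1) * (SPINT w. ((z w)\<^sup>2) powr p)" using iz izp by (simp add: \<mu>_def)
    also have "\<dots> \<le> 9 * (Cp * b) + C5 * 2 powr (p - 1) * (C4 * b)" using \<mu>b zp C5 by (intro add_mono mult_left_mono) auto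
    also have "\<dots> = K * b" by (simp add: K_def algebra_simps)
    finally show ?thesis by (simp add: b_def)
  qed
  thus ?thesis using K b1 by (intro that[of K b1]) auto
qed

lemma one_minus_inverse_le_ln: "y > 0 \<Longrightarrow> 1 - 1 / y \<le> ln (y::real)" using ln_le_minus_one[of "1 / y"] by (simp add: ln_div)

text \<open>Up to the energy \<open>b0\<close> the linear bound lies below the logarithm for small \<open>\<Lambda>\<close>; beyond it, a small
  \<open>\<Lambda>\<close> absorbs the constant \<open>C\<close> inside the logarithm.\<close>

theorem sphere_log_ineq_exists:
  assumes d: "DIM('a::euclidean_space) \<ge> 2" and \<alpha>: "\<alpha> > (real DIM('a) - 1) / 2"
  obtains \<Lambda> where "\<Lambda> > 0" "sphere_log_ineq TYPE('a) \<alpha> \<Lambda>"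
proof -
  obtain C where C: "C \<ge> 1" "\<And>v :: 'a \<Rightarrow> real. smooth_on (- {0}) v \<Longrightarrow> (SPINT w. (v w)\<^sup>2) = 1 \<Longrightarrow>
    sphere_entropy v \<le> \<alpha> * ln (C * (1 + tangential_energy v))" using sphere_entropy_le_log[OF d \<alpha>] by blast
  obtain K b1 where K: "K > 0" "b1 > 0" "\<And>v :: 'a \<Rightarrow> real. smooth_on (- {0}) v \<Longrightarrow> (SPINT w. (v w)\<^sup>2) = 1 \<Longrightarrow>
    tangential_energy v \<le> b1 \<Longrightarrow> sphere_entropy v \<le> K * tangential_energy v" using sphere_entropy_le_linear[OF d] by blast
  have \<alpha>0: "\<alpha> > 0" using \<alpha> d by simp
  define b0 where "b0 = min b1 (\<alpha> / (2 * K))"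
  have b0: "b0 > 0" "b0 \<le> b1" "b0 \<le> \<alpha> / (2 * K)" using K \<alpha>0 by (auto simp: b0_def)
  define \<Lambda> where "\<Lambda> = min b0 (b0 / (C * (1 + b0)))"
  have \<Lambda>: "\<Lambda> > 0" "\<Lambda> \<le> b0" "\<Lambda> \<le> b0 / (C * (1 + b0))" using b0 C by (auto simp: \<Lambda>_def)
  have "sphere_entropy v \<le> \<alpha> * ln (1 + tangential_energy v / \<Lambda>)"
    if v: "smooth_on (- {0}) v" "(SPINT w. (v w)\<^sup>2) = 1" for v :: "'a \<Rightarrow> real"
  proof -
    define b where "b = tangential_energy v"
    have b: "b \<ge> 0" by (simp add: b_def tangential_energy_nonneg)
    show ?thesis
    proof (cases "b \<le> b0")
      case True
      have "K * b \<le> \<alpha> * (b / (2 * b0))"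
      proof -
        have "b0 * (2 * K) \<le> \<alpha>" using b0(3) K by (simp add: pos_le_divide_eq)
        hence "b0 * (2 * K) * b \<le> \<alpha> * b" using b by (rule mult_right_mono)
        thus ?thesis using b0 by (simp add: field_simps)
      qed
      also have "\<dots> \<le> \<alpha> * ln (1 + b / \<Lambda>)"
      proof (intro mult_left_mono)
        have y: "1 + b / \<Lambda> > 0" using b \<Lambda> by (simp add: add_pos_nonneg)
        have "1 - 1 / (1 + b / \<Lambda>) \<le> ln (1 + b / \<Lambda>)" by (rule one_minus_inverse_le_ln[OF y])
        moreover have "1 - 1 / (1 + b / \<Lambda>) = b / (\<Lambda> + b)" using b \<Lambda>(1) by (simp add: field_simps add_pos_nonneg)
        moreover have "b / (2 * b0) \<le> b / (\<Lambda> + b)" using b \<Lambda> True b0 by (intro divide_left_mono) auto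
        ultimately show "b / (2 * b0) \<le> ln (1 + b / \<Lambda>)" by simp
      qed (use \<alpha>0 in simp)
      finally show ?thesis using K(3)[OF v] True b0 by (simp add: b_def)
    next
      case False
      hence bp: "b > 0" using b0 by simp
      have "C * (1 + b) \<le> b / \<Lambda>"
      proof -
        have "\<Lambda> * (C * (1 + b0)) \<le> b0" using \<Lambda>(3) C b0 by (simp add: pos_le_divide_eq)
        hence "\<Lambda> * (C * (1 + b0)) * b \<le> b0 * b" using b by (rule mult_right_mono)
        moreover have "\<Lambda> * C * (b0 * (1 + b)) \<le> \<Lambda> * C * ((1 + b0) * b)"
          using \<Lambda> C False by (intro mult_left_mono) (auto simp: algebra_simps)
        ultimately have "b0 * (\<Lambda> * (C * (1 + b))) \<le> b0 * b" by (simp add: algebra_simps)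
        hence "\<Lambda> * (C * (1 + b)) \<le> b" using b0 by simp
        thus ?thesis using \<Lambda> by (simp add: pos_le_divide_eq mult.commute)
      qed
      hence "ln (C * (1 + b)) \<le> ln (1 + b / \<Lambda>)" using C bp by (intro ln_mono) auto
      hence "\<alpha> * ln (C * (1 + b)) \<le> \<alpha> * ln (1 + b / \<Lambda>)" using \<alpha>0 by (intro mult_left_mono) auto
      with C(2)[OF v] show ?thesis unfolding b_def by (rule order_trans)
    qed
  qed
  thus ?thesis using \<Lambda>(1) by (intro that[of \<Lambda>]) (auto simp: sphere_log_ineq_def)
qed

section \<open>The inequality for test functions\<close>

lemma test_function_smooth:
  assumes "test_function \<phi>"
  shows "smooth_on UNIV \<phi>" "smooth_on (- {0}) \<phi>" "continuous_on UNIV \<phi>" "continuous_on UNIV (gradient \<phi>)"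
    "\<phi> \<in> borel_measurable borel" "gradient \<phi> \<in> borel_measurable borel"
proof -
  show s: "smooth_on UNIV \<phi>" using assms by (simp add: test_function_def smooth_on_UNIV)
  thus "smooth_on (- {0}) \<phi>" by (rule smooth_on_subset) simp
  show "continuous_on UNIV \<phi>" "continuous_on UNIV (gradient \<phi>)" using s by (auto intro: continuous_on_smooth continuous_on_gradient)
  thus "\<phi> \<in> borel_measurable borel" "gradient \<phi> \<in> borel_measurable borel" by (auto intro: borel_measurable_continuous_onI)
qed

lemma gradient_zero_outside_support:
  assumes "x \<notin> support \<phi>"
  shows "\<phi> x = 0" "gradient \<phi> x = 0"
proof -
  have z: "\<phi> y = 0" if "y \<notin> support \<phi>" for y using that closure_subset[of "{x. \<phi> x \<noteq> 0}"] by (auto simp: support_def)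
  show "\<phi> x = 0" by (rule z[OF assms])
  have "((\<lambda>_. 0) has_derivative (\<lambda>h. h \<bullet> 0)) (at x)" by simp
  moreover have "open (- support \<phi>)" by (simp add: support_def open_Compl)
  ultimately have "(\<phi> has_derivative (\<lambda>h. h \<bullet> 0)) (at x)" by (rule has_derivative_transform_within_open) (use assms z in auto)
  thus "gradient \<phi> x = 0" by (rule gradient_unique)
qed

lemma test_function_annulus:
  fixes \<phi> :: "'a::euclidean_space \<Rightarrow> real"
  assumes "test_function \<phi>"
  obtains L where "\<And>s w. norm w = 1 \<Longrightarrow> \<bar>s\<bar> > L \<Longrightarrow> exp s *\<^sub>R w \<notin> support \<phi>"
proof -
  have K: "compact (support \<phi>)" "0 \<notin> support \<phi>" using assms by (auto simp: test_function_def)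
  have "open (- support \<phi>)" using K(1) compact_imp_closed by auto
  then obtain e where e: "e > 0" "ball 0 e \<subseteq> - support \<phi>" using K(2) open_contains_ball[of "- support \<phi>"] by auto
  obtain B where B: "B > 0" "\<And>x. x \<in> support \<phi> \<Longrightarrow> norm x \<le> B" using compact_imp_bounded[OF K(1)] bounded_pos by blast
  have "exp s *\<^sub>R w \<notin> support \<phi>" if "norm w = 1" "\<bar>s\<bar> > max \<bar>ln e\<bar> \<bar>ln B\<bar>" for s w
  proof
    assume "exp s *\<^sub>R w \<in> support \<phi>"
    hence "exp s *\<^sub>R w \<notin> ball 0 e" "norm (exp s *\<^sub>R w) \<le> B" using e(2) B(2) by blast+
    hence "e \<le> exp s" "exp s \<le> B" using that(1) by (auto simp: not_less)
    hence "ln e \<le> s" "s \<le> ln B" using ln_le_cancel_iff[of e "exp s"] ln_le_cancel_iff[of "exp s" B] e(1) B(1) by simp_all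
    thus False using that(2) by auto
  qed
  thus ?thesis by (rule that)
qed

lemma entropy_ln_div:
  fixes t S :: real
  assumes "t \<ge> 0" "S > 0" shows "t * ln (t / S) = t * ln t - ln S * t" using assms by (cases "t = 0") (auto simp: ln_div algebra_simps)

definition hardy_weight :: "real \<Rightarrow> ('a::euclidean_space \<Rightarrow> real) \<Rightarrow> 'a \<Rightarrow> real" where
  "hardy_weight a u x = \<bar>u x\<bar>\<^sup>2 / norm x powr (2 * (a + 1))"

definition entropy_density :: "real \<Rightarrow> ('a::euclidean_space \<Rightarrow> real) \<Rightarrow> 'a \<Rightarrow> real" where
  "entropy_density a u x = hardy_weight a u x * ln (norm x powr (real DIM('a) - 2 - 2 * a) * \<bar>u x\<bar>\<^sup>2)"

definition energy_density :: "real \<Rightarrow> ('a::euclidean_space \<Rightarrow> 'a) \<Rightarrow> 'a \<Rightarrow> real" where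
  "energy_density a g x = (norm (g x))\<^sup>2 / norm x powr (2 * a)"

text \<open>The Emden-Fowler transformation \<open>W = sqrt |S\<^sup>d\<^sup>-\<^sup>1| e\<^sup>k\<^sup>s u\<close> with \<open>k = a\<^sub>c - a\<close>.\<close>

lemma emden_fowler:
  fixes u :: "'a::euclidean_space \<Rightarrow> real" and g :: "'a \<Rightarrow> 'a" and a s :: real
  assumes w: "norm w = 1"
  defines "S \<equiv> sphere_area TYPE('a)" and "k \<equiv> a_c DIM('a) - a"
  defines "W \<equiv> sqrt S * exp (k * s) * u (exp s *\<^sub>R w)"
  defines "Ws \<equiv> k * W + sqrt S * exp (k * s) * (exp s * (w \<bullet> g (exp s *\<^sub>R w)))"
  shows "S * exp (real DIM('a) * s) * hardy_weight a u (exp s *\<^sub>R w) = W\<^sup>2"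
    and "S * exp (real DIM('a) * s) * entropy_density a u (exp s *\<^sub>R w) = W\<^sup>2 * ln (W\<^sup>2) - ln S * W\<^sup>2"
    and "S * exp (real DIM('a) * s) * energy_density a g (exp s *\<^sub>R w) =
      (Ws - k * W)\<^sup>2 + S * exp (2 * k * s) * (exp s)\<^sup>2 * ((norm (g (exp s *\<^sub>R w)))\<^sup>2 - (w \<bullet> g (exp s *\<^sub>R w))\<^sup>2)"
proof -
  let ?x = "exp s *\<^sub>R w"
  have S: "S > 0" by (simp add: S_def sphere_area_pos)
  have n: "norm ?x powr r = exp (r * s)" for r using w by (simp add: powr_def)
  have W2: "W\<^sup>2 = S * exp (2 * k * s) * (u ?x)\<^sup>2" using S by (simp add: W_def power_mult_distrib exp_double[symmetric] mult.assoc)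
  have e1: "exp (real DIM('a) * s) / exp (2 * (a + 1) * s) = exp (2 * k * s)"
    by (simp add: exp_diff[symmetric] k_def a_c_def field_simps)
  have "S * exp (real DIM('a) * s) * hardy_weight a u ?x = S * (exp (real DIM('a) * s) / exp (2 * (a + 1) * s)) * (u ?x)\<^sup>2"
    unfolding hardy_weight_def n by simp
  thus hw: "S * exp (real DIM('a) * s) * hardy_weight a u ?x = W\<^sup>2" unfolding e1 W2 .
  have "(real DIM('a) - 2 - 2 * a) * s = 2 * k * s" by (simp add: k_def a_c_def field_simps)
  hence p: "norm ?x powr (real DIM('a) - 2 - 2 * a) = exp (2 * k * s)" by (simp only: n)
  have "norm ?x powr (real DIM('a) - 2 - 2 * a) * \<bar>u ?x\<bar>\<^sup>2 = W\<^sup>2 / S" unfolding p W2 using S by simp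
  hence "S * exp (real DIM('a) * s) * entropy_density a u ?x = W\<^sup>2 * ln (W\<^sup>2 / S)" unfolding entropy_density_def hw[symmetric] by simp
  thus "S * exp (real DIM('a) * s) * entropy_density a u ?x = W\<^sup>2 * ln (W\<^sup>2) - ln S * W\<^sup>2"
    using entropy_ln_div[OF zero_le_power2 S] by simp
  have e2: "exp (real DIM('a) * s) / exp (2 * a * s) = exp (2 * k * s) * (exp s)\<^sup>2"
    by (simp add: exp_diff[symmetric] exp_double[symmetric] exp_add[symmetric] k_def a_c_def field_simps)
  have "S * exp (real DIM('a) * s) * energy_density a g ?x = S * (exp (real DIM('a) * s) / exp (2 * a * s)) * (norm (g ?x))\<^sup>2"
    unfolding energy_density_def n by simp
  also have "\<dots> = (Ws - k * W)\<^sup>2 + S * exp (2 * k * s) * (exp s)\<^sup>2 * ((norm (g ?x))\<^sup>2 - (w \<bullet> g ?x)\<^sup>2)"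
    unfolding e2 using S by (simp add: Ws_def power_mult_distrib exp_double[symmetric] algebra_simps)
  finally show "S * exp (real DIM('a) * s) * energy_density a g ?x =
      (Ws - k * W)\<^sup>2 + S * exp (2 * k * s) * (exp s)\<^sup>2 * ((norm (g ?x))\<^sup>2 - (w \<bullet> g ?x)\<^sup>2)" .
qed

lemma norm_tgrad_sq: "norm w = 1 \<Longrightarrow> (norm (tgrad f w))\<^sup>2 = (norm (gradient f w))\<^sup>2 - (w \<bullet> gradient f w)\<^sup>2"
  unfolding tgrad_def power2_norm_eq_inner by (simp add: inner_diff_left inner_diff_right inner_commute power2_eq_square norm_eq_1)

lemma gradient_slice:
  fixes u :: "'a::euclidean_space \<Rightarrow> real"
  assumes u: "smooth_on (- {0}) u" and w: "w \<noteq> 0"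
  shows "smooth_on (- {0}) (\<lambda>w. c * u (exp s *\<^sub>R w))"
    and "gradient (\<lambda>w. c * u (exp s *\<^sub>R w)) w = (c * exp s) *\<^sub>R gradient u (exp s *\<^sub>R w)"
proof -
  have "smooth_on (- {0}) (\<lambda>w. u (exp s *\<^sub>R w))" unfolding smooth_on_def
  proof
    fix k
    show "Ck_on k (- {0}) (\<lambda>w. u (exp s *\<^sub>R w))" by (rule Ck_on_compose[where T = "- {0}"])
         (use u in \<open>auto simp: smooth_on_def intro!: Ck_on_linear bounded_linear_intros\<close>)
  qed
  thus "smooth_on (- {0}) (\<lambda>w. c * u (exp s *\<^sub>R w))" by (intro smooth_on_mult smooth_on_const) auto
  have d: "(u has_derivative (\<lambda>h. h \<bullet> gradient u (exp s *\<^sub>R w))) (at (exp s *\<^sub>R w))"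
    by (rule smooth_on_gradient[of "- {0}"]) (use u w in auto)
  have "((\<lambda>w. exp s *\<^sub>R w) has_derivative (\<lambda>h. exp s *\<^sub>R h)) (at w)" by (auto intro!: derivative_eq_intros)
  from has_derivative_mult_right[OF has_derivative_compose[OF this d], of c]
  show "gradient (\<lambda>w. c * u (exp s *\<^sub>R w)) w = (c * exp s) *\<^sub>R gradient u (exp s *\<^sub>R w)"
    by (intro gradient_unique) (simp add: mult.assoc)
qed

text \<open>The constant of the inequality with parameter \<open>\<Lambda>\<close> in logarithmic form,
  \<open>2 \<gamma> ln C\<close>. It comes from optimizing the two parameters \<open>\<tau>\<close> and \<open>l\<close> of the inequality on
  the cylinder for given total energy.\<close>

definition log_const :: "'a::euclidean_space itself \<Rightarrow> real \<Rightarrow> real \<Rightarrow> real" where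
  "log_const T \<gamma> \<Lambda> = - 1 / 2 - ln (2 * pi * \<gamma>) / 2 +
     (2 * \<gamma> - 1 / 2) * ln ((2 * \<gamma> - 1 / 2) / (2 * \<gamma> * \<Lambda>)) - ln (sphere_area TYPE('a))"

definition radial_function :: "('a::real_normed_vector \<Rightarrow> real) \<Rightarrow> bool" where
  "radial_function \<phi> \<longleftrightarrow> (\<exists>f. \<forall>x. \<phi> x = f (norm x))"

text \<open>The terms of the inequality on the cylinder are a multiple of \<open>A = \<integral>W\<^sub>s\<^sup>2\<close>, coming from the line, and a
  multiple of \<open>B\<close>, the tangential energy, coming from the sphere. The choice of \<open>\<tau>\<close> and \<open>l\<close> gives
  both the coefficient \<open>2\<gamma> / E\<close>, where \<open>E = A + B + k\<^sup>2\<close>, so that only the total energy remains.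
  The bound of the positive part, crude as it is, makes that part survive the passage to limits.\<close>

lemma test_function_WLH:
  fixes \<phi> :: "'a::euclidean_space \<Rightarrow> real" and a \<gamma> \<Lambda> :: real
  assumes \<phi>: "test_function \<phi>" and N: "(LBINT x. hardy_weight a \<phi> x) = 1"
    and \<gamma>: "\<gamma> > 1 / 4" and \<Lambda>: "\<Lambda> > 0" "\<Lambda> \<le> (a_c DIM('a) - a)\<^sup>2" and ineq: "sphere_log_ineq TYPE('a) (2 * \<gamma> - 1 / 2) \<Lambda> \<or> radial_function \<phi>"
  defines "E \<equiv> \<integral>x. energy_density a (gradient \<phi>) x \<partial>lborel"
  shows "E \<ge> \<Lambda>"
    and "integrable lborel (entropy_density a \<phi>)"
    and "(LBINT x. entropy_density a \<phi> x) \<le> 2 * \<gamma> * ln E + log_const TYPE('a) \<gamma> \<Lambda>"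
    and "(LBINT x. max 0 (entropy_density a \<phi> x)) \<le>
      ((2 * \<gamma> - 1 / 2) / \<Lambda> + 1) * E + 2 + \<bar>ln (sphere_area TYPE('a))\<bar>"
proof -
  note sm = test_function_smooth[OF \<phi>]
  have [measurable]: "\<phi> \<in> borel_measurable borel" "gradient \<phi> \<in> borel_measurable borel" using sm by auto
  define S where "S = sphere_area TYPE('a)"
  have S: "S > 0" by (simp add: S_def sphere_area_pos)
  define k where "k = a_c DIM('a) - a"
  define \<alpha> where "\<alpha> = 2 * \<gamma> - 1 / 2"
  have \<alpha>: "\<alpha> > 0" using \<gamma> by (simp add: \<alpha>_def)
  obtain L where L: "\<And>s w. norm w = 1 \<Longrightarrow> \<bar>s\<bar> > L \<Longrightarrow> exp s *\<^sub>R w \<notin> support \<phi>" using test_function_annulus[OF \<phi>] by metis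
  define W where "W s w = sqrt S * exp (k * s) * \<phi> (exp s *\<^sub>R w)" for s and w :: 'a
  define Ws where "Ws s w = k * W s w + sqrt S * exp (k * s) * (exp s * (w \<bullet> gradient \<phi> (exp s *\<^sub>R w)))" for s and w :: 'a
  define \<beta> where "\<beta> z = S * exp (2 * k * fst z) * (exp (fst z))\<^sup>2 *
     ((norm (gradient \<phi> (exp (fst z) *\<^sub>R snd z)))\<^sup>2 - (snd z \<bullet> gradient \<phi> (exp (fst z) *\<^sub>R snd z))\<^sup>2)" for z :: "real \<times> 'a"
  have cp: "continuous_on UNIV (\<lambda>z::real \<times> 'a. exp (fst z) *\<^sub>R snd z)" by (intro continuous_intros)
  have c\<phi>: "continuous_on UNIV (\<lambda>z::real \<times> 'a. \<phi> (exp (fst z) *\<^sub>R snd z))" by (rule continuous_on_compose2[OF sm(3) cp]) simp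
  have cg: "continuous_on UNIV (\<lambda>z::real \<times> 'a. gradient \<phi> (exp (fst z) *\<^sub>R snd z))" by (rule continuous_on_compose2[OF sm(4) cp]) simp
  have cW: "continuous_on UNIV (\<lambda>z. W (fst z) (snd z))" unfolding W_def by (intro continuous_intros c\<phi>)
  have cWs: "continuous_on UNIV (\<lambda>z. Ws (fst z) (snd z))" unfolding Ws_def by (intro continuous_intros cW cg)
  have c\<beta>: "continuous_on UNIV \<beta>" unfolding \<beta>_def by (intro continuous_intros cg)
  have W0: "W s w = 0" and Ws0: "Ws s w = 0" and \<beta>0: "\<beta> (s, w) = 0" if "norm w = 1" "\<bar>s\<bar> > L" for s w
    using gradient_zero_outside_support[OF L[OF that]] by (auto simp: W_def Ws_def \<beta>_def)
  have der: "((\<lambda>s. W s w) has_real_derivative Ws s w) (at s)" if "norm w = 1" for s w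
  proof -
    have "(\<phi> has_derivative (\<lambda>h. h \<bullet> gradient \<phi> (exp s *\<^sub>R w))) (at (exp s *\<^sub>R w))"
      by (rule smooth_on_gradient[OF open_UNIV sm(1)]) simp
    moreover have "((\<lambda>s. exp s *\<^sub>R w) has_derivative (\<lambda>h. (exp s * h) *\<^sub>R w)) (at s)"
      by (auto intro!: derivative_eq_intros simp: mult.commute)
    ultimately have "((\<lambda>s. \<phi> (exp s *\<^sub>R w)) has_derivative (\<lambda>h. ((exp s * h) *\<^sub>R w) \<bullet> gradient \<phi> (exp s *\<^sub>R w))) (at s)"
      by (rule has_derivative_compose[rotated])
    moreover have "(\<lambda>h. ((exp s * h) *\<^sub>R w) \<bullet> gradient \<phi> (exp s *\<^sub>R w)) = (*) (exp s * (w \<bullet> gradient \<phi> (exp s *\<^sub>R w)))"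
      by (rule ext) simp
    ultimately have "((\<lambda>s. \<phi> (exp s *\<^sub>R w)) has_real_derivative exp s * (w \<bullet> gradient \<phi> (exp s *\<^sub>R w))) (at s)"
      by (simp add: has_field_derivative_def)
    thus ?thesis unfolding W_def Ws_def by (auto intro!: derivative_eq_intros simp: algebra_simps)
  qed
  note cyl = cW cWs der W0 Ws0
  have slices: "smooth_on (- {0}) (W s)" for s using gradient_slice(1)[OF sm(2), of _ "sqrt S * exp (k * s)" s] S
    by (cases "\<exists>w::'a. w \<noteq> 0") (auto simp: W_def[abs_def] intro: smooth_on_cong[OF _ smooth_on_const])
  have sl: "sphere_log_ineq TYPE('a) \<alpha> \<Lambda> \<or> (\<exists>c. \<forall>w. norm w = 1 \<longrightarrow> W s w = c)" for s
    using ineq by (auto simp: W_def \<alpha>_def radial_function_def)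
  have tE: "tangential_energy (W s) = (SPINT w. \<beta> (s, w))" for s unfolding tangential_energy_def
  proof (rule integral_cong_AE)
    show "(\<lambda>w. (norm (tgrad (W s) w))\<^sup>2) \<in> borel_measurable usphere" using borel_measurable_tgrad[OF slices] by measurable
    have "continuous_on UNIV (\<lambda>w. \<beta> (s, w))" by (rule continuous_on_compose2[OF c\<beta>]) (auto intro!: continuous_intros)
    from borel_measurable_continuous_onI[OF this]
    show "(\<lambda>w. \<beta> (s, w)) \<in> borel_measurable usphere" by simp
    show "AE w in usphere. (norm (tgrad (W s) w))\<^sup>2 = \<beta> (s, w)" using AE_usphere_norm
    proof eventually_elim
      case (elim w)
      hence "w \<noteq> 0" by auto
      have g: "gradient (W s) w = (sqrt S * exp (k * s) * exp s) *\<^sub>R gradient \<phi> (exp s *\<^sub>R w)"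
        using gradient_slice(2)[OF sm(2) \<open>w \<noteq> 0\<close>, of "sqrt S * exp (k * s)" s] by (simp add: W_def[abs_def])
      show ?case unfolding norm_tgrad_sq[OF elim] g \<beta>_def using S by (simp add: power_mult_distrib exp_double[symmetric] algebra_simps)
    qed
  qed
  have i\<beta>: "integrable cyl \<beta>" by (rule integrable_cyl[OF c\<beta> \<beta>0])
  have itE: "integrable lborel (\<lambda>s. tangential_energy (W s))" using cyl.integrable_fst'[OF i\<beta>] by (simp add: tE)
  have B: "(LBINT s. tangential_energy (W s)) = (CYINT z. \<beta> z)" using cyl.integral_fst'[OF i\<beta>] by (simp add: tE)
  have ef: "S * exp (real DIM('a) * s) * hardy_weight a \<phi> (exp s *\<^sub>R w) = (W s w)\<^sup>2"
    "S * exp (real DIM('a) * s) * entropy_density a \<phi> (exp s *\<^sub>R w) = (W s w)\<^sup>2 * ln ((W s w)\<^sup>2) - ln S * (W s w)\<^sup>2"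
    "S * exp (real DIM('a) * s) * energy_density a (gradient \<phi>) (exp s *\<^sub>R w) = (Ws s w - k * W s w)\<^sup>2 + \<beta> (s, w)"
    if "norm w = 1" for s w using emden_fowler(1)[OF that, where a = a and u = \<phi> and s = s]
      emden_fowler(2)[OF that, where a = a and u = \<phi> and s = s]
      emden_fowler(3)[OF that, where a = a and u = \<phi> and s = s and g = "gradient \<phi>"]
    by (auto simp: S_def[symmetric] k_def[symmetric] W_def[symmetric] Ws_def[symmetric] \<beta>_def)
  have hm [measurable]: "hardy_weight a \<phi> \<in> borel_measurable borel" unfolding hardy_weight_def[abs_def] by measurable
  have em [measurable]: "entropy_density a \<phi> \<in> borel_measurable borel" unfolding entropy_density_def[abs_def] by measurable
  have dm [measurable]: "energy_density a (gradient \<phi>) \<in> borel_measurable borel" unfolding energy_density_def[abs_def] by measurable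
  have cylm [measurable]: "(\<lambda>z. W (fst z) (snd z)) \<in> borel_measurable cyl" "(\<lambda>z. Ws (fst z) (snd z)) \<in> borel_measurable cyl"
    "\<beta> \<in> borel_measurable cyl" unfolding W_def Ws_def \<beta>_def by measurable
  have NW: "(CYINT z. (W (fst z) (snd z))\<^sup>2) = 1"
  proof -
    have "(CYINT z. (W (fst z) (snd z))\<^sup>2) = (CYINT z. S * exp (real DIM('a) * fst z) * hardy_weight a \<phi> (exp (fst z) *\<^sub>R snd z))"
      by (rule integral_cong_AE) (auto intro!: eventually_mono[OF AE_cyl_norm] simp: ef)
    thus ?thesis using N integral_polar[OF hm] by (simp add: S_def)
  qed
  define A where "A = (CYINT z. (Ws (fst z) (snd z))\<^sup>2)"
  define Bt where "Bt = (LBINT s. tangential_energy (W s))"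
  have A0: "A \<ge> 0" unfolding A_def by (rule integral_nonneg_AE) simp
  have B0: "Bt \<ge> 0" unfolding Bt_def by (rule integral_nonneg_AE) (simp add: tangential_energy_nonneg)
  have c1: "continuous_on UNIV (\<lambda>_::real. 1::real)" by simp
  have iW2: "integrable cyl (\<lambda>z. (W (fst z) (snd z))\<^sup>2)" "integrable cyl (\<lambda>z. W (fst z) (snd z) * Ws (fst z) (snd z))"
    using integrable_W_squares[where W = W and Ws = Ws, OF cyl] by auto
  have iWs: "integrable cyl (\<lambda>z. (Ws (fst z) (snd z))\<^sup>2)" by (rule integrable_W(2)[OF cyl c1])
  have iWl: "integrable cyl (\<lambda>z. (W (fst z) (snd z))\<^sup>2 * ln ((W (fst z) (snd z))\<^sup>2))" by (rule integrable_W(4)[OF cyl c1])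
  have E: "E = A + k\<^sup>2 + Bt"
  proof -
    have "E = (CYINT z. S * exp (real DIM('a) * fst z) * energy_density a (gradient \<phi>) (exp (fst z) *\<^sub>R snd z))"
      unfolding E_def S_def by (rule integral_polar[OF dm])
    also have "\<dots> = (CYINT z. (Ws (fst z) (snd z))\<^sup>2 - 2 * k * (W (fst z) (snd z) * Ws (fst z) (snd z)) + k\<^sup>2 * (W (fst z) (snd z))\<^sup>2 + \<beta> z)"
    proof (rule integral_cong_AE)
      show "AE z in cyl. S * exp (real DIM('a) * fst z) * energy_density a (gradient \<phi>) (exp (fst z) *\<^sub>R snd z) =
         (Ws (fst z) (snd z))\<^sup>2 - 2 * k * (W (fst z) (snd z) * Ws (fst z) (snd z)) + k\<^sup>2 * (W (fst z) (snd z))\<^sup>2 + \<beta> z"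
        using AE_cyl_norm by eventually_elim (simp add: ef, simp add: power2_eq_square algebra_simps)
    qed measurable
    also have "\<dots> = A + k\<^sup>2 + Bt" using iW2 iWs i\<beta> NW integral_W_Ws[OF cyl] by (simp add: A_def Bt_def B)
    finally show ?thesis .
  qed
  have k2: "k\<^sup>2 \<ge> \<Lambda>" using \<Lambda> by (simp add: k_def)
  show "E \<ge> \<Lambda>" using E A0 B0 k2 by linarith
  hence Epos: "E > 0" using \<Lambda> by simp
  have ie: "integrable cyl (\<lambda>z. (W (fst z) (snd z))\<^sup>2 * ln ((W (fst z) (snd z))\<^sup>2) - ln S * (W (fst z) (snd z))\<^sup>2)"
    using iWl iW2 by auto
  have eq: "AE z in cyl. S * exp (real DIM('a) * fst z) * entropy_density a \<phi> (exp (fst z) *\<^sub>R snd z) =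
     (W (fst z) (snd z))\<^sup>2 * ln ((W (fst z) (snd z))\<^sup>2) - ln S * (W (fst z) (snd z))\<^sup>2"
    using AE_cyl_norm by eventually_elim (simp add: ef)
  show "integrable lborel (entropy_density a \<phi>)" unfolding integrable_polar[OF em]
    by (rule integrable_cong_AE_imp[OF ie]) (use eq in \<open>auto simp: S_def[symmetric]\<close>)
  have "(LBINT x. entropy_density a \<phi> x) = (CYINT z. (W (fst z) (snd z))\<^sup>2 * ln ((W (fst z) (snd z))\<^sup>2) - ln S * (W (fst z) (snd z))\<^sup>2)"
    unfolding integral_polar[OF em] by (rule integral_cong_AE) (use eq in \<open>auto simp: S_def[symmetric]\<close>)
  also have "\<dots> = (CYINT z. (W (fst z) (snd z))\<^sup>2 * ln ((W (fst z) (snd z))\<^sup>2)) - ln S" using iWl iW2 NW by simp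
  finally have ent: "(LBINT x. entropy_density a \<phi> x) = (CYINT z. (W (fst z) (snd z))\<^sup>2 * ln ((W (fst z) (snd z))\<^sup>2)) - ln S" .
  define \<tau> where "\<tau> = \<gamma> / E"
  define l where "l = E * \<alpha> / (2 * \<gamma>)"
  have \<tau>l: "\<tau> > 0" "l > 0" using Epos \<alpha> \<gamma> by (auto simp: \<tau>_def l_def)
  have "(CYINT z. (W (fst z) (snd z))\<^sup>2 * ln ((W (fst z) (snd z))\<^sup>2)) \<le>
      2 * \<tau> * A - ln (2 * pi * \<tau>) / 2 - 1 + \<alpha> * (ln (l / \<Lambda>) + \<Lambda> / l - 1 + Bt / l)" unfolding A_def Bt_def
    by (rule cylinder_entropy_le[OF cyl NW slices itE sl \<alpha> \<Lambda>(1) \<tau>l(2,1)])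
  also have "\<dots> = (2 * \<tau> * A + \<alpha> * ((\<Lambda> + Bt) / l)) - ln (2 * pi * \<tau>) / 2 - 1 + \<alpha> * (ln (l / \<Lambda>) - 1)"
    by (simp add: algebra_simps add_divide_distrib)
  also have "2 * \<tau> * A + \<alpha> * ((\<Lambda> + Bt) / l) = 2 * \<gamma> * ((A + \<Lambda> + Bt) / E)" using Epos \<alpha> \<gamma> by (simp add: \<tau>_def l_def field_simps)
  also have "\<dots> \<le> 2 * \<gamma> * 1" using Epos \<gamma> k2 E by (intro mult_left_mono) (auto simp: divide_le_eq)
  also have "2 * \<gamma> * 1 - ln (2 * pi * \<tau>) / 2 - 1 + \<alpha> * (ln (l / \<Lambda>) - 1) - ln S = 2 * \<gamma> * ln E + log_const TYPE('a) \<gamma> \<Lambda>"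
  proof -
    have e1: "ln (2 * pi * \<tau>) = ln (2 * pi * \<gamma>) - ln E" using Epos \<gamma> by (simp add: \<tau>_def ln_div)
    have "l / \<Lambda> = E * (\<alpha> / (2 * \<gamma> * \<Lambda>))" by (simp add: l_def)
    moreover have "\<alpha> / (2 * \<gamma> * \<Lambda>) > 0" using \<alpha> \<gamma> \<Lambda> by simp
    ultimately have e2: "ln (l / \<Lambda>) = ln E + ln (\<alpha> / (2 * \<gamma> * \<Lambda>))" using Epos by (simp only: ln_mult_pos)
    have g2: "2 * \<gamma> * ln E = \<alpha> * ln E + ln E / 2" "2 * \<gamma> = \<alpha> + 1 / 2" by (auto simp: \<alpha>_def algebra_simps)
    show ?thesis unfolding log_const_def S_def[symmetric] \<alpha>_def[symmetric] e1 e2 g2(1) using g2(2)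
      by (simp add: right_diff_distrib distrib_left diff_divide_distrib)
  qed
  finally show "(LBINT x. entropy_density a \<phi> x) \<le> 2 * \<gamma> * ln E + log_const TYPE('a) \<gamma> \<Lambda>" unfolding ent by simp
  have "(LBINT x. max 0 (entropy_density a \<phi> x)) =
    (CYINT z. S * exp (real DIM('a) * fst z) * max 0 (entropy_density a \<phi> (exp (fst z) *\<^sub>R snd z)))"
    unfolding S_def by (rule integral_polar) measurable
  also have "\<dots> \<le> (CYINT z. max 0 ((W (fst z) (snd z))\<^sup>2 * ln ((W (fst z) (snd z))\<^sup>2)) + \<bar>ln S\<bar> * (W (fst z) (snd z))\<^sup>2)"
  proof (rule integral_mono_AE)
    show i: "integrable cyl (\<lambda>z. max 0 ((W (fst z) (snd z))\<^sup>2 * ln ((W (fst z) (snd z))\<^sup>2)) + \<bar>ln S\<bar> * (W (fst z) (snd z))\<^sup>2)"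
      using iWl iW2 by (intro Bochner_Integration.integrable_add integrable_max integrable_mult_right) auto
    show le: "AE z in cyl. S * exp (real DIM('a) * fst z) * max 0 (entropy_density a \<phi> (exp (fst z) *\<^sub>R snd z)) \<le>
       max 0 ((W (fst z) (snd z))\<^sup>2 * ln ((W (fst z) (snd z))\<^sup>2)) + \<bar>ln S\<bar> * (W (fst z) (snd z))\<^sup>2" using eq
    proof eventually_elim
      case (elim z)
      have "S * exp (real DIM('a) * fst z) * max 0 (entropy_density a \<phi> (exp (fst z) *\<^sub>R snd z)) =
        max 0 (S * exp (real DIM('a) * fst z) * entropy_density a \<phi> (exp (fst z) *\<^sub>R snd z))"
        using S by (auto simp: max_def zero_le_mult_iff mult_le_0_iff)
      moreover have "- (ln S * (W (fst z) (snd z))\<^sup>2) \<le> \<bar>ln S\<bar> * (W (fst z) (snd z))\<^sup>2" by (metis abs_ge_minus_self abs_mult abs_power2)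
      moreover have "0 \<le> \<bar>ln S\<bar> * (W (fst z) (snd z))\<^sup>2" by simp
      ultimately show ?case unfolding elim by (simp add: max_def)
    qed
    show "integrable cyl (\<lambda>z. S * exp (real DIM('a) * fst z) * max 0 (entropy_density a \<phi> (exp (fst z) *\<^sub>R snd z)))"
      by (rule Bochner_Integration.integrable_bound[OF i]) (use le S in \<open>auto elim!: eventually_mono simp: abs_of_nonneg\<close>)
  qed
  also have "\<dots> = (CYINT z. max 0 ((W (fst z) (snd z))\<^sup>2 * ln ((W (fst z) (snd z))\<^sup>2))) + \<bar>ln S\<bar>"
    using iWl iW2 NW by (subst Bochner_Integration.integral_add) (auto intro!: integrable_max)
  also have "(CYINT z. max 0 ((W (fst z) (snd z))\<^sup>2 * ln ((W (fst z) (snd z))\<^sup>2))) \<le>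
      \<alpha> * (ln (\<Lambda> / \<Lambda>) + \<Lambda> / \<Lambda> - 1 + Bt / \<Lambda>) + 2 + A" unfolding A_def Bt_def
    by (rule cylinder_entropy_pos_part_le[OF cyl NW slices itE sl \<alpha> \<Lambda>(1) \<Lambda>(1)])
  also have "\<dots> = \<alpha> / \<Lambda> * Bt + A + 2" using \<Lambda> by simp
  also have "\<dots> \<le> \<alpha> / \<Lambda> * E + E + 2" using E A0 B0 \<alpha> \<Lambda> by (intro add_mono mult_left_mono) auto
  finally show "(LBINT x. max 0 (entropy_density a \<phi> x)) \<le>
      ((2 * \<gamma> - 1 / 2) / \<Lambda> + 1) * E + 2 + \<bar>ln (sphere_area TYPE('a))\<bar>" by (simp add: S_def \<alpha>_def algebra_simps)
qed

section \<open>Logarithmic cutoffs and the completion\<close>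

abbreviation "energy_int a g \<equiv> (LBINT x. energy_density a g x)"
abbreviation "hardy_int a u \<equiv> (LBINT x. hardy_weight a u x)"
abbreviation "entropy_int a u \<equiv> (LBINT x. entropy_density a u x)"
abbreviation "hardy_dist a v u \<equiv> (LBNN x. ennreal ((norm x powr (- (a + 1)) * \<bar>v x - u x\<bar>)\<^sup>2))"
abbreviation "energy_dist a h g \<equiv> (LBNN x. ennreal ((norm x powr (- a) * norm (h x - g x))\<^sup>2))"

definition cutoff :: "real \<Rightarrow> 'a::euclidean_space \<Rightarrow> real" where
  "cutoff m x = (if x = 0 then 0 else bump (ln (norm x) / m))"

lemma cutoff_range: "0 \<le> cutoff m x" "cutoff m x \<le> 1" by (auto simp: cutoff_def bump_range)

lemma cutoff_eq_1: "m > 0 \<Longrightarrow> x \<noteq> 0 \<Longrightarrow> \<bar>ln (norm x)\<bar> \<le> m \<Longrightarrow> cutoff m x = 1" by (auto simp: cutoff_def intro!: bump_eq_1)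

lemma cutoff_eq_0: "m > 0 \<Longrightarrow> \<bar>ln (norm x)\<bar> \<ge> 2 * m \<Longrightarrow> cutoff m x = 0" by (auto simp: cutoff_def field_simps intro!: bump_eq_0)

lemma smooth_on_ln_norm: "smooth_on (- {0}) (\<lambda>x::'a::euclidean_space. ln (norm x))"
proof -
  have "smooth_on (- {0}) (\<lambda>x::'a. \<Sum>b\<in>Basis. (x \<bullet> b) * (x \<bullet> b))" unfolding smooth_on_def
    by (intro allI Ck_on_sum Ck_on_mult Ck_on_linear[OF bounded_linear_inner_left]) auto
  hence "smooth_on (- {0}) (\<lambda>x::'a. x \<bullet> x)" by (simp add: euclidean_inner[symmetric])
  hence "smooth_on (- {0}) (\<lambda>x::'a. ln (x \<bullet> x))" by (intro smooth_on_compose_real[OF _ _ _ smooth_on_ln]) auto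
  hence "smooth_on (- {0}) (\<lambda>x::'a. (1 / 2) * ln (x \<bullet> x))" by (intro smooth_on_mult smooth_on_const) auto
  thus ?thesis by (rule smooth_on_cong[rotated]) (auto simp: norm_eq_sqrt_inner ln_sqrt)
qed

lemma smooth_on_cutoff: "smooth_on (- {0}) (cutoff m :: 'a::euclidean_space \<Rightarrow> real)"
proof -
  have "smooth_on (- {0}) (\<lambda>x::'a. (1 / m) * ln (norm x))" by (intro smooth_on_mult smooth_on_const smooth_on_ln_norm) auto
  hence "smooth_on (- {0}) (\<lambda>x::'a. bump ((1 / m) * ln (norm x)))" by (intro smooth_on_compose_real[OF _ _ _ smooth_on_bump]) auto
  thus ?thesis by (rule smooth_on_cong[rotated]) (auto simp: cutoff_def)
qed

lemma bump_derivative_bound: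
  obtains C where "C > 0" "\<And>t. \<exists>D. (bump has_real_derivative D) (at t) \<and> \<bar>D\<bar> \<le> C"
proof -
  define B where "B t = gradient bump t" for t
  have d: "(bump has_real_derivative B t) (at t)" for t using smooth_on_gradient[OF open_UNIV smooth_on_bump, of t]
    by (simp add: has_field_derivative_def B_def inner_real_def mult.commute[of "gradient bump t"] mult_commute_abs)
  have cB: "continuous_on UNIV B" unfolding B_def using continuous_on_gradient[OF open_UNIV smooth_on_bump] by simp
  have "compact (B ` {-3..3})" by (rule compact_continuous_image[OF continuous_on_subset[OF cB]]) auto
  then obtain C where C: "\<And>t. t \<in> {-3..3} \<Longrightarrow> norm (B t) \<le> C" using compact_imp_bounded bounded_iff by (metis imageI)
  have "\<bar>B t\<bar> \<le> max C 1" for t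
  proof (cases "\<bar>t\<bar> \<le> 3")
    case True thus ?thesis using C[of t] by (auto simp: abs_le_iff le_max_iff_disj)
  next
    case False
    have "((\<lambda>_. 0) has_real_derivative 0) (at t)" by simp
    moreover have "open {s::real. \<bar>s\<bar> > 2}" by (intro open_Collect_less continuous_intros)
    ultimately have "(bump has_real_derivative 0) (at t)"
      by (rule has_field_derivative_transform_within_open) (use False in \<open>auto simp: bump_eq_0\<close>)
    hence "B t = 0" using d DERIV_unique by blast
    thus ?thesis by simp
  qed
  thus ?thesis using d by (intro that[of "max C 1"]) auto
qed

lemma gradient_cutoff:
  obtains C where "C > 0" "\<And>m x. m > 0 \<Longrightarrow> x \<noteq> 0 \<Longrightarrow> norm (gradient (cutoff m) (x::'a::euclidean_space)) \<le> C / (m * norm x)"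
proof -
  obtain C where C: "C > 0" "\<And>t. \<exists>D. (bump has_real_derivative D) (at t) \<and> \<bar>D\<bar> \<le> C" using bump_derivative_bound by blast
  have "norm (gradient (cutoff m) x) \<le> C / (m * norm x)" if m: "m > 0" and x: "x \<noteq> 0" for m and x :: 'a
  proof -
    obtain D where D: "(bump has_real_derivative D) (at (ln (norm x) / m))" "\<bar>D\<bar> \<le> C" using C(2) by blast
    have "(norm has_derivative (\<lambda>h. h \<bullet> sgn x)) (at x)" by (rule has_derivative_norm[OF x])
    moreover have "((\<lambda>r. bump (ln r / m)) has_derivative (\<lambda>h. h * (D * (1 / norm x / m)))) (at (norm x))"
    proof -
      have "((\<lambda>r. ln r / m) has_real_derivative 1 / norm x / m) (at (norm x))" using x m by (auto intro!: derivative_eq_intros)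
      from DERIV_chain2[OF D(1) this]
      have "((\<lambda>r. bump (ln r / m)) has_derivative (*) (D * (1 / norm x / m))) (at (norm x))" by (simp only: has_field_derivative_def)
      moreover have "(*) (D * (1 / norm x / m)) = (\<lambda>h. h * (D * (1 / norm x / m)))" by (rule ext) (rule mult.commute)
      ultimately show ?thesis by (simp only:)
    qed
    ultimately have "((\<lambda>y. bump (ln (norm y) / m)) has_derivative (\<lambda>h. (h \<bullet> sgn x) * (D * (1 / norm x / m)))) (at x)"
      by (rule has_derivative_compose)
    hence "((\<lambda>y. bump (ln (norm y) / m)) has_derivative (\<lambda>h. h \<bullet> ((D * (1 / norm x / m)) *\<^sub>R sgn x))) (at x)"
      by (simp add: mult.commute)
    moreover have "open (- {0::'a})" by auto
    ultimately have "(cutoff m has_derivative (\<lambda>h. h \<bullet> ((D * (1 / norm x / m)) *\<^sub>R sgn x))) (at x)"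
      by (rule has_derivative_transform_within_open) (use x in \<open>auto simp: cutoff_def\<close>)
    hence "gradient (cutoff m) x = (D * (1 / norm x / m)) *\<^sub>R sgn x" by (rule gradient_unique)
    hence "norm (gradient (cutoff m) x) = \<bar>D\<bar> / (m * norm x)" using m x by (simp add: norm_sgn abs_mult)
    also have "\<dots> \<le> C / (m * norm x)" using D m by (intro divide_right_mono) auto
    finally show ?thesis .
  qed
  thus ?thesis using C(1) by (rule that[rotated])
qed

lemma gradient_mult:
  fixes u v :: "'a::euclidean_space \<Rightarrow> real"
  assumes "smooth_on (- {0}) u" "smooth_on (- {0}) v" "x \<noteq> 0"
  shows "gradient (\<lambda>x. u x * v x) x = v x *\<^sub>R gradient u x + u x *\<^sub>R gradient v x"
proof -
  have d: "(u has_derivative (\<lambda>h. h \<bullet> gradient u x)) (at x)" "(v has_derivative (\<lambda>h. h \<bullet> gradient v x)) (at x)"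
    using assms by (auto intro!: smooth_on_gradient[of "- {0}"])
  have "((\<lambda>x. u x * v x) has_derivative (\<lambda>h. h \<bullet> (v x *\<^sub>R gradient u x + u x *\<^sub>R gradient v x))) (at x)"
    using has_derivative_mult[OF d] by (simp add: inner_add_right algebra_simps)
  thus ?thesis by (rule gradient_unique)
qed

lemma test_function_cutoff:
  fixes u :: "'a::euclidean_space \<Rightarrow> real"
  assumes u: "smooth_on (- {0}) u" and m: "m > 0"
  shows "test_function (\<lambda>x. u x * cutoff m x)"
proof -
  let ?f = "\<lambda>x. u x * cutoff m x"
  have z: "?f x = 0" if "norm x < exp (- 2 * m)" for x
  proof (cases "x = 0")
    case False
    hence "ln (norm x) < - 2 * m" using that ln_less_cancel_iff[of "norm x" "exp (- 2 * m)"] by simp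
    thus ?thesis using m by (simp add: cutoff_eq_0)
  qed (simp add: cutoff_def)
  have "smooth_on (- {0}) ?f" by (intro smooth_on_mult u smooth_on_cutoff) auto
  moreover have "smooth_on (ball 0 (exp (- 2 * m))) ?f" by (rule smooth_on_cong[OF _ smooth_on_const[of _ 0]]) (use z in auto)
  ultimately have "smooth_on (- {0} \<union> ball 0 (exp (- 2 * m))) ?f" by (intro smooth_on_Un) auto
  moreover have "- {0} \<union> ball 0 (exp (- 2 * m)) = (UNIV :: 'a set)" by auto
  ultimately have s: "smooth ?f" by (simp add: smooth_on_UNIV[symmetric])
  define K where "K = {x::'a. exp (- 2 * m) \<le> norm x \<and> norm x \<le> exp (2 * m)}"
  have "closed K" unfolding K_def by (intro closed_Collect_conj closed_Collect_le continuous_intros)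
  moreover have "{x. ?f x \<noteq> 0} \<subseteq> K"
  proof
    fix x assume x: "x \<in> {x. ?f x \<noteq> 0}"
    have "exp (- 2 * m) \<le> norm x"
    proof (rule ccontr)
      assume "\<not> exp (- 2 * m) \<le> norm x"
      hence "?f x = 0" by (intro z) simp
      thus False using x by simp
    qed
    moreover have "norm x \<le> exp (2 * m)"
    proof (rule ccontr)
      assume n: "\<not> norm x \<le> exp (2 * m)"
      hence "ln (exp (2 * m)) < ln (norm x)" by (subst ln_less_cancel_iff) (auto intro: less_trans[OF exp_gt_zero])
      hence "cutoff m x = 0" using m by (intro cutoff_eq_0) auto
      thus False using x by simp
    qed
    ultimately show "x \<in> K" by (simp add: K_def)
  qed
  ultimately have sK: "support ?f \<subseteq> K" unfolding support_def by (rule closure_minimal[rotated])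
  have "bounded K" unfolding K_def by (rule boundedI[of _ "exp (2 * m)"]) auto
  hence "compact (support ?f)" using sK by (metis bounded_subset closed_closure compact_eq_bounded_closed support_def)
  moreover have "0 \<notin> support ?f" using sK by (auto simp: K_def)
  ultimately show ?thesis using s by (simp add: test_function_def)
qed

lemma weight_sq: "(norm x powr (- a) * t)\<^sup>2 = t\<^sup>2 / norm x powr (2 * a)"
proof -
  have "norm x powr (2 * a) = (norm x powr a)\<^sup>2" by (simp add: power2_eq_square flip: powr_add)
  thus ?thesis by (simp add: power_mult_distrib powr_minus divide_inverse power_inverse mult.commute)
qed

lemma hardy_weight_eq: "hardy_weight a u x = (norm x powr (- (a + 1)) * u x)\<^sup>2" unfolding weight_sq hardy_weight_def by simp

lemma energy_density_eq: "energy_density a g x = (norm (norm x powr (- a) *\<^sub>R g x))\<^sup>2"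
  unfolding energy_density_def using weight_sq[of x a "norm (g x)"] by simp

lemma hardy_weight_nonneg: "hardy_weight a u x \<ge> 0" by (simp add: hardy_weight_eq)

lemma energy_density_nonneg: "energy_density a g x \<ge> 0" by (simp add: energy_density_eq)

lemma borel_measurable_densities [measurable]:
  assumes [measurable]: "u \<in> borel_measurable borel"
  shows "hardy_weight a u \<in> borel_measurable borel" "entropy_density a u \<in> borel_measurable borel"
proof -
  show [measurable]: "hardy_weight a u \<in> borel_measurable borel" unfolding hardy_weight_def[abs_def] by measurable
  show "entropy_density a u \<in> borel_measurable borel" unfolding entropy_density_def[abs_def] by measurable
qed

lemma borel_measurable_energy_density [measurable]:
  assumes [measurable]: "g \<in> borel_measurable borel"
  shows "energy_density a g \<in> borel_measurable borel" unfolding energy_density_def[abs_def] by measurable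

text \<open>On an annulus where the cutoff varies, its gradient is of size \<open>1/(m |x|)\<close>, so that its
  contribution to the energy is controlled by the Hardy weight.\<close>

lemma energy_gradient_cutoff:
  fixes u :: "'a::euclidean_space \<Rightarrow> real"
  assumes C: "\<And>m x. m > 0 \<Longrightarrow> x \<noteq> 0 \<Longrightarrow> norm (gradient (cutoff m) (x::'a)) \<le> C / (m * norm x)"
    and m: "m > 0" and x: "x \<noteq> 0" and \<delta>: "\<delta> > 0" and g: "norm v \<le> norm (g x)"
  shows "(norm (v + u x *\<^sub>R gradient (cutoff m) x))\<^sup>2 / norm x powr (2 * a) \<le>
    (1 + \<delta>) * energy_density a g x + (1 + 1 / \<delta>) * (C / m)\<^sup>2 * hardy_weight a u x"
proof -
  let ?q = "norm (u x *\<^sub>R gradient (cutoff m) x)"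
  have "norm (v + u x *\<^sub>R gradient (cutoff m) x) \<le> norm (g x) + ?q"
    using norm_triangle_ineq[of v "u x *\<^sub>R gradient (cutoff m) x"] g by linarith
  hence "(norm (v + u x *\<^sub>R gradient (cutoff m) x))\<^sup>2 \<le> (norm (g x) + ?q)\<^sup>2" by (intro power_mono) auto
  also have "\<dots> \<le> (1 + \<delta>) * (norm (g x))\<^sup>2 + (1 + 1 / \<delta>) * ?q\<^sup>2"
  proof -
    have "0 \<le> (\<delta> * norm (g x) - ?q)\<^sup>2 / \<delta>" using \<delta> by simp
    also have "\<dots> = \<delta> * (norm (g x))\<^sup>2 + ?q\<^sup>2 / \<delta> - 2 * norm (g x) * ?q"
      using \<delta> by (simp add: power2_diff power_mult_distrib add_divide_distrib diff_divide_distrib) (simp add: power2_eq_square)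
    finally show ?thesis by (simp add: power2_sum algebra_simps)
  qed
  also have "\<dots> \<le> (1 + \<delta>) * (norm (g x))\<^sup>2 + (1 + 1 / \<delta>) * ((C / m)\<^sup>2 * ((u x)\<^sup>2 / (norm x)\<^sup>2))"
  proof (intro add_left_mono mult_left_mono)
    have "?q\<^sup>2 \<le> (\<bar>u x\<bar> * (C / (m * norm x)))\<^sup>2" using mult_left_mono[OF C[OF m x] abs_ge_zero[of "u x"]] by (intro power_mono) simp_all
    also have "(\<bar>u x\<bar> * (C / (m * norm x)))\<^sup>2 = (C / m)\<^sup>2 * ((u x)\<^sup>2 / (norm x)\<^sup>2)" by (simp add: power_mult_distrib power_divide)
    finally show "?q\<^sup>2 \<le> (C / m)\<^sup>2 * ((u x)\<^sup>2 / (norm x)\<^sup>2)" .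
  qed (use \<delta> in simp)
  finally have "(norm (v + u x *\<^sub>R gradient (cutoff m) x))\<^sup>2 \<le>
      (1 + \<delta>) * (norm (g x))\<^sup>2 + (1 + 1 / \<delta>) * ((C / m)\<^sup>2 * ((u x)\<^sup>2 / (norm x)\<^sup>2))"
    .
  hence "(norm (v + u x *\<^sub>R gradient (cutoff m) x))\<^sup>2 / norm x powr (2 * a) \<le>
      ((1 + \<delta>) * (norm (g x))\<^sup>2 + (1 + 1 / \<delta>) * ((C / m)\<^sup>2 * ((u x)\<^sup>2 / (norm x)\<^sup>2))) / norm x powr (2 * a)"
    by (rule divide_right_mono) simp
  also have "\<dots> = (1 + \<delta>) * energy_density a g x + (1 + 1 / \<delta>) * (C / m)\<^sup>2 * hardy_weight a u x"
  proof -
    have "norm x powr (2 * (a + 1)) = norm x powr (2 * a) * (norm x)\<^sup>2" using x by (simp add: distrib_left powr_add)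
    thus ?thesis by (simp add: energy_density_def hardy_weight_def add_divide_distrib mult_ac)
  qed
  finally show ?thesis .
qed

lemma cutoff_tendsto_1:
  assumes "x \<noteq> 0" shows "(\<lambda>n. cutoff (real (Suc n)) x) \<longlonglongrightarrow> 1"
proof (rule tendsto_eventually)
  have "eventually (\<lambda>n. \<bar>ln (norm x)\<bar> \<le> real (Suc n)) sequentially" using filterlim_Suc filterlim_real_sequentially by real_asymp
  thus "eventually (\<lambda>n. cutoff (real (Suc n)) x = 1) sequentially" by eventually_elim (use assms in \<open>auto intro: cutoff_eq_1\<close>)
qed

text \<open>The truncations \<open>u \<chi>\<close> converge by domination, because the gradient of the cutoff is bounded by
  \<open>C / |x|\<close> for all \<open>m \<ge> 1\<close>.\<close>

lemma D12_intro:
  fixes u :: "'a::euclidean_space \<Rightarrow> real"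
  assumes u: "smooth_on (- {0}) u" and hi: "integrable lborel (hardy_weight a u)"
    and ei: "integrable lborel (energy_density a (gradient u))"
  shows "D12 a u (gradient u)"
proof -
  obtain C where C: "C > 0" "\<And>m x. m > 0 \<Longrightarrow> x \<noteq> 0 \<Longrightarrow> norm (gradient (cutoff m) (x::'a)) \<le> C / (m * norm x)" using gradient_cutoff by metis
  have [measurable]: "u \<in> borel_measurable borel" "gradient u \<in> borel_measurable borel"
    using u borel_measurable_smooth borel_measurable_gradient by auto
  define \<phi> where "\<phi> n x = u x * cutoff (real (Suc n)) x" for n x
  have t: "test_function (\<phi> n)" for n unfolding \<phi>_def[abs_def] by (rule test_function_cutoff[OF u]) simp
  have [measurable]: "\<phi> n \<in> borel_measurable borel" "gradient (\<phi> n) \<in> borel_measurable borel" for n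
    using test_function_smooth[OF t] by auto
  have g: "gradient (\<phi> n) x - gradient u x = - (1 - cutoff (real (Suc n)) x) *\<^sub>R gradient u x + u x *\<^sub>R gradient (cutoff (real (Suc n))) x"
    if "x \<noteq> 0" for n x unfolding \<phi>_def gradient_mult[OF u smooth_on_cutoff that] by (simp add: algebra_simps)
  have a1: "(\<lambda>n. LBNN x. ennreal ((norm x powr (- a) * norm (gradient (\<phi> n) x - gradient u x))\<^sup>2)) \<longlonglongrightarrow> (\<integral>\<^sup>+x. 0 \<partial>(lborel :: 'a measure))"
  proof (rule nn_integral_dominated_convergence[where w = "\<lambda>x. ennreal ((1 + 1) * energy_density a (gradient u) x + (1 + 1 / 1) * C\<^sup>2 * hardy_weight a u x)"])
    show "(LBNN x. ennreal ((1 + 1) * energy_density a (gradient u) x + (1 + 1 / 1) * C\<^sup>2 * hardy_weight a u x)) < \<infinity>"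
    proof -
      have "integrable lborel (\<lambda>x. (1 + 1) * energy_density a (gradient u) x + (1 + 1 / 1) * C\<^sup>2 * hardy_weight a u x)"
        using hi ei by auto
      from nn_integral_eq_integral[OF this] show ?thesis
        using hardy_weight_nonneg[of a u] energy_density_nonneg[of a "gradient u"] by simp
    qed
    show "AE x in lborel. ennreal ((norm x powr (- a) * norm (gradient (\<phi> n) x - gradient u x))\<^sup>2) \<le>
       ennreal ((1 + 1) * energy_density a (gradient u) x + (1 + 1 / 1) * C\<^sup>2 * hardy_weight a u x)" for n
      using AE_lborel_singleton[of "0::'a"]
    proof eventually_elim
      case (elim x)
      have c: "norm (- (1 - cutoff (real (Suc n)) x) *\<^sub>R gradient u x) \<le> norm (gradient u x)"
        using cutoff_range[of "real (Suc n)" x] by (simp add: mult_left_le_one_le)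
      have "(norm x powr (- a) * norm (gradient (\<phi> n) x - gradient u x))\<^sup>2 \<le>
          (1 + 1) * energy_density a (gradient u) x + (1 + 1 / 1) * (C / real (Suc n))\<^sup>2 * hardy_weight a u x"
        unfolding weight_sq g[OF elim] by (rule energy_gradient_cutoff[OF C(2)]) (use elim c in auto)
      also have "\<dots> \<le> (1 + 1) * energy_density a (gradient u) x + (1 + 1 / 1) * C\<^sup>2 * hardy_weight a u x"
        using C(1) hardy_weight_nonneg[of a u x]
        by (intro add_left_mono mult_right_mono mult_left_mono power_mono) (auto simp: divide_le_eq)
      finally show ?case by (rule ennreal_leI)
    qed
    show "AE x in lborel. (\<lambda>n. ennreal ((norm x powr (- a) * norm (gradient (\<phi> n) x - gradient u x))\<^sup>2)) \<longlonglongrightarrow> 0"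
      using AE_lborel_singleton[of "0::'a"]
    proof eventually_elim
      case (elim x)
      have "(\<lambda>n. C / (real (Suc n) * norm x)) \<longlonglongrightarrow> 0" using elim by real_asymp
      hence "(\<lambda>n. gradient (cutoff (real (Suc n))) x) \<longlonglongrightarrow> 0" by (rule Lim_null_comparison[rotated]) (use C(2) elim in auto)
      hence "(\<lambda>n. gradient (\<phi> n) x - gradient u x) \<longlonglongrightarrow> - (1 - 1) *\<^sub>R gradient u x + u x *\<^sub>R 0"
        unfolding g[OF elim] by (intro tendsto_intros cutoff_tendsto_1 elim)
      hence "(\<lambda>n. (norm x powr (- a) * norm (gradient (\<phi> n) x - gradient u x))\<^sup>2) \<longlonglongrightarrow> (norm x powr (- a) * norm (- (1 - 1) *\<^sub>R gradient u x + u x *\<^sub>R 0))\<^sup>2"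
        by (intro tendsto_intros)
      from tendsto_ennrealI[OF this] show ?case by simp
    qed
  qed measurable
  have a2: "(\<lambda>n. LBNN x. ennreal ((norm x powr (- (a + 1)) * \<bar>\<phi> n x - u x\<bar>)\<^sup>2)) \<longlonglongrightarrow> (\<integral>\<^sup>+x. 0 \<partial>(lborel :: 'a measure))"
  proof (rule nn_integral_dominated_convergence[where w = "\<lambda>x. ennreal (hardy_weight a u x)"])
    show "(LBNN x. ennreal (hardy_weight a u x)) < \<infinity>" using nn_integral_eq_integral[OF hi] hardy_weight_nonneg[of a u] by simp
    have d: "\<phi> n x - u x = - (1 - cutoff (real (Suc n)) x) * u x" for n x by (simp add: \<phi>_def algebra_simps)
    show "AE x in lborel. ennreal ((norm x powr (- (a + 1)) * \<bar>\<phi> n x - u x\<bar>)\<^sup>2) \<le> ennreal (hardy_weight a u x)" for n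
    proof (intro AE_I2 ennreal_leI)
      fix x :: 'a
      have "\<bar>\<phi> n x - u x\<bar> \<le> \<bar>u x\<bar>" unfolding d using cutoff_range[of "real (Suc n)" x] by (simp add: abs_mult mult_left_le_one_le)
      hence "(norm x powr (- (a + 1)) * \<bar>\<phi> n x - u x\<bar>)\<^sup>2 \<le> (norm x powr (- (a + 1)) * \<bar>u x\<bar>)\<^sup>2"
        by (intro power_mono mult_left_mono) auto
      thus "(norm x powr (- (a + 1)) * \<bar>\<phi> n x - u x\<bar>)\<^sup>2 \<le> hardy_weight a u x" by (simp add: hardy_weight_eq power_mult_distrib)
    qed
    show "AE x in lborel. (\<lambda>n. ennreal ((norm x powr (- (a + 1)) * \<bar>\<phi> n x - u x\<bar>)\<^sup>2)) \<longlonglongrightarrow> 0" using AE_lborel_singleton[of "0::'a"]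
    proof eventually_elim
      case (elim x)
      have "(\<lambda>n. (norm x powr (- (a + 1)) * \<bar>\<phi> n x - u x\<bar>)\<^sup>2) \<longlonglongrightarrow> (norm x powr (- (a + 1)) * \<bar>- (1 - 1) * u x\<bar>)\<^sup>2"
        unfolding d by (intro tendsto_intros cutoff_tendsto_1 elim)
      from tendsto_ennrealI[OF this] show ?case by simp
    qed
  qed measurable
  show ?thesis unfolding D12_def using t a1 a2 by (auto intro!: exI[of _ \<phi>])
qed

section \<open>From test functions to the completion\<close>

text \<open>Convergence in \<open>L\<^sup>2\<close> in the form in which the completion is given, with extended integrals that
  may be infinite for finitely many \<open>n\<close>.\<close>

lemma integral_square_convergence:
  fixes F :: "nat \<Rightarrow> 'a::euclidean_space \<Rightarrow> 'b::euclidean_space" and G :: "'a \<Rightarrow> 'b"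
  assumes [measurable]: "\<And>n. F n \<in> borel_measurable borel" "G \<in> borel_measurable borel"
    and Fi: "\<And>n. integrable lborel (\<lambda>x. (norm (F n x))\<^sup>2)"
    and conv: "(\<lambda>n. LBNN x. ennreal ((norm (F n x - G x))\<^sup>2)) \<longlonglongrightarrow> 0"
  shows "integrable lborel (\<lambda>x. (norm (G x))\<^sup>2)"
    and "(\<lambda>n. \<integral>x. \<bar>(norm (F n x))\<^sup>2 - (norm (G x))\<^sup>2\<bar> \<partial>lborel) \<longlonglongrightarrow> 0"
    and "\<exists>r. strict_mono r \<and> (AE x in lborel. (\<lambda>n. F (r n) x) \<longlonglongrightarrow> G x)"
proof -
  define d where "d n x = (norm (F n x - G x))\<^sup>2" for n x
  have [measurable]: "d n \<in> borel_measurable borel" for n unfolding d_def[abs_def] by measurable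
  have "eventually (\<lambda>n. (LBNN x. ennreal (d n x)) < \<top>) sequentially" using order_tendstoD(2)[OF conv, of \<top>] by (simp add: d_def)
  then obtain N where N: "\<And>n. n \<ge> N \<Longrightarrow> (LBNN x. ennreal (d n x)) < \<top>" by (auto simp: eventually_sequentially)
  have di: "integrable lborel (d n)" if "n \<ge> N" for n using N[OF that] by (intro integrableI_nonneg) (auto simp: d_def)
  have young: "\<bar>(norm a)\<^sup>2 - (norm b)\<^sup>2\<bar> \<le> (1 + 1 / \<delta>) * (norm (a - b))\<^sup>2 + \<delta> * (norm b)\<^sup>2" if \<delta>: "\<delta> > 0" for \<delta> and a b :: 'b
  proof -
    define r where "r = norm (a - b)"
    have r: "\<bar>norm a - norm b\<bar> \<le> r" unfolding r_def by (rule norm_triangle_ineq3)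
    have "\<bar>(norm a)\<^sup>2 - (norm b)\<^sup>2\<bar> = \<bar>norm a - norm b\<bar> * (norm a + norm b)"
      by (simp add: power2_eq_square square_diff_square_factored abs_mult mult.commute)
    also have "\<dots> \<le> r * (r + 2 * norm b)" using r by (intro mult_mono) auto
    also have "\<dots> \<le> (1 + 1 / \<delta>) * r\<^sup>2 + \<delta> * (norm b)\<^sup>2"
    proof -
      have "0 \<le> (\<delta> * norm b - r)\<^sup>2 / \<delta>" using \<delta> by simp
      also have "\<dots> = \<delta> * (norm b)\<^sup>2 + r\<^sup>2 / \<delta> - 2 * r * norm b"
        using \<delta> by (simp add: power2_diff power_mult_distrib add_divide_distrib diff_divide_distrib) (simp add: power2_eq_square)
      finally show ?thesis by (simp add: power2_eq_square algebra_simps)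
    qed
    finally show ?thesis by (simp add: r_def)
  qed
  show Gi: "integrable lborel (\<lambda>x. (norm (G x))\<^sup>2)"
  proof (rule Bochner_Integration.integrable_bound)
    show "integrable lborel (\<lambda>x. 2 * (norm (F N x))\<^sup>2 + 2 * d N x)" using Fi di[of N] by auto
    have "(norm (G x))\<^sup>2 \<le> 2 * (norm (F N x))\<^sup>2 + 2 * d N x" for x
    proof -
      have "norm (G x) \<le> norm (F N x) + norm (F N x - G x)" using norm_triangle_ineq4[of "F N x" "F N x - G x"] by simp
      hence "(norm (G x))\<^sup>2 \<le> (norm (F N x) + norm (F N x - G x))\<^sup>2" by (intro power_mono) auto
      also have "\<dots> \<le> 2 * (norm (F N x))\<^sup>2 + 2 * d N x"
        using sum_squares_bound[of "norm (F N x)" "norm (F N x - G x)"] by (simp add: power2_sum d_def)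
      finally show ?thesis .
    qed
    thus "AE x in lborel. norm ((norm (G x))\<^sup>2) \<le> norm (2 * (norm (F N x))\<^sup>2 + 2 * d N x)" by (auto simp: d_def)
  qed measurable
  define I where "I = (LBINT x. (norm (G x))\<^sup>2)"
  have I: "I \<ge> 0" unfolding I_def by (rule integral_nonneg_AE) simp
  have dconv: "(\<lambda>n. \<integral>x. d (n + N) x \<partial>lborel) \<longlonglongrightarrow> 0"
  proof -
    have "(\<lambda>n. LBNN x. ennreal (d (n + N) x)) \<longlonglongrightarrow> 0" using LIMSEQ_ignore_initial_segment[OF conv, of N] by (simp add: d_def)
    moreover have "(LBNN x. ennreal (d (n + N) x)) = ennreal (LBINT x. d (n + N) x)" for n
      by (rule nn_integral_eq_integral[OF di]) (auto simp: d_def)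
    ultimately have "(\<lambda>n. ennreal (LBINT x. d (n + N) x)) \<longlonglongrightarrow> ennreal 0" by simp
    thus ?thesis by (rule tendsto_ennrealD) (auto intro!: always_eventually integral_nonneg_AE simp: d_def)
  qed
  have "(\<lambda>n. \<integral>x. \<bar>(norm (F (n + N) x))\<^sup>2 - (norm (G x))\<^sup>2\<bar> \<partial>lborel) \<longlonglongrightarrow> 0"
  proof (rule LIMSEQ_I)
    fix e :: real assume e: "e > 0"
    define \<delta> where "\<delta> = e / (2 * (I + 1))"
    have \<delta>: "\<delta> > 0" using e I by (simp add: \<delta>_def)
    have "\<delta> * I < e / 2"
    proof -
      have "\<delta> * I < \<delta> * (I + 1)" using \<delta> by simp
      also have "\<dots> = e / 2" using I by (simp add: \<delta>_def field_simps)
      finally show ?thesis .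
    qed
    moreover have "(\<lambda>n. (1 + 1 / \<delta>) * (LBINT x. d (n + N) x) + \<delta> * I) \<longlonglongrightarrow> (1 + 1 / \<delta>) * 0 + \<delta> * I" by (intro tendsto_intros dconv)
    ultimately have "eventually (\<lambda>n. (1 + 1 / \<delta>) * (LBINT x. d (n + N) x) + \<delta> * I < e) sequentially"
      by (intro order_tendstoD(2)[where y = "(1 + 1 / \<delta>) * 0 + \<delta> * I"]) (use e in auto)
    then obtain n0 where n0: "\<And>n. n \<ge> n0 \<Longrightarrow> (1 + 1 / \<delta>) * (LBINT x. d (n + N) x) + \<delta> * I < e" by (auto simp: eventually_sequentially)
    have "norm ((LBINT x. \<bar>(norm (F (n + N) x))\<^sup>2 - (norm (G x))\<^sup>2\<bar>) - 0) < e" if "n \<ge> n0" for n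
    proof -
      have "(LBINT x. \<bar>(norm (F (n + N) x))\<^sup>2 - (norm (G x))\<^sup>2\<bar>) \<le> (LBINT x. (1 + 1 / \<delta>) * d (n + N) x + \<delta> * (norm (G x))\<^sup>2)"
        by (rule integral_mono) (use di[of "n + N"] Gi Fi[of "n + N"] young[OF \<delta>] in \<open>auto simp: d_def[abs_def]\<close>)
      also have "\<dots> = (1 + 1 / \<delta>) * (LBINT x. d (n + N) x) + \<delta> * I" using di[of "n + N"] Gi by (simp add: I_def)
      finally show ?thesis using n0[OF that] by (simp add: abs_of_nonneg integral_nonneg_AE)
    qed
    thus "\<exists>n0. \<forall>n\<ge>n0. norm ((LBINT x. \<bar>(norm (F (n + N) x))\<^sup>2 - (norm (G x))\<^sup>2\<bar>) - 0) < e" by blast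
  qed
  thus "(\<lambda>n. \<integral>x. \<bar>(norm (F n x))\<^sup>2 - (norm (G x))\<^sup>2\<bar> \<partial>lborel) \<longlonglongrightarrow> 0" by (rule LIMSEQ_offset)
  have "\<exists>r. strict_mono r \<and> (AE x in lborel. (\<lambda>n. d (r n + N) x) \<longlonglongrightarrow> 0)"
    by (rule tendsto_L1_AE_subseq[of lborel "\<lambda>n. d (n + N)"]) (use dconv di[of "_ + N"] in \<open>auto simp: d_def\<close>)
  then obtain r where r: "strict_mono r" "AE x in lborel. (\<lambda>n. d (r n + N) x) \<longlonglongrightarrow> 0" by blast
  have "AE x in lborel. (\<lambda>n. F (r n + N) x) \<longlonglongrightarrow> G x" using r(2)
  proof eventually_elim
    case (elim x)
    from tendsto_real_sqrt[OF elim] have "(\<lambda>n. norm (F (r n + N) x - G x)) \<longlonglongrightarrow> 0" by (simp add: d_def)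
    hence "(\<lambda>n. F (r n + N) x - G x) \<longlonglongrightarrow> 0" by (rule tendsto_norm_zero_cancel)
    thus ?case by (rule Lim_null[THEN iffD2])
  qed
  moreover have "strict_mono (\<lambda>n. r n + N)" using r(1) by (auto simp: strict_mono_def)
  ultimately show "\<exists>r. strict_mono r \<and> (AE x in lborel. (\<lambda>n. F (r n) x) \<longlonglongrightarrow> G x)" by blast
qed

lemma integrable_test_function:
  fixes \<phi> :: "'a::euclidean_space \<Rightarrow> real"
  assumes \<phi>: "test_function \<phi>"
  shows "integrable lborel (hardy_weight a \<phi>)" "integrable lborel (energy_density a (gradient \<phi>))"
proof -
  note sm = test_function_smooth[OF \<phi>]
  define K where "K = support \<phi>"
  have K: "compact K" "0 \<notin> K" using \<phi> by (auto simp: test_function_def K_def)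
  hence sub: "K \<subseteq> - {0}" by auto
  have cn: "continuous_on K (\<lambda>x. norm x powr r)" for r using sub by (intro continuous_intros) auto
  have "integrable lborel (\<lambda>x. indicator K x *\<^sub>R hardy_weight a \<phi> x)" unfolding hardy_weight_eq
    by (rule borel_integrable_compact[OF K(1)]) (intro continuous_intros cn continuous_on_subset[OF sm(3)], simp)
  moreover have "(\<lambda>x. indicator K x *\<^sub>R hardy_weight a \<phi> x) = hardy_weight a \<phi>"
    using gradient_zero_outside_support(1)[of _ \<phi>] by (auto simp: fun_eq_iff indicator_def hardy_weight_def K_def)
  ultimately show "integrable lborel (hardy_weight a \<phi>)" by simp
  have "integrable lborel (\<lambda>x. indicator K x *\<^sub>R energy_density a (gradient \<phi>) x)" unfolding energy_density_eq
    by (rule borel_integrable_compact[OF K(1)]) (intro continuous_intros cn continuous_on_subset[OF sm(4)], simp)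
  moreover have "(\<lambda>x. indicator K x *\<^sub>R energy_density a (gradient \<phi>) x) = energy_density a (gradient \<phi>)"
    using gradient_zero_outside_support(2)[of _ \<phi>] by (auto simp: fun_eq_iff indicator_def energy_density_def K_def)
  ultimately show "integrable lborel (energy_density a (gradient \<phi>))" by simp
qed

lemma hardy_weight_convergence:
  fixes u :: "'a::euclidean_space \<Rightarrow> real"
  assumes t: "\<And>n. test_function (\<phi> n)" and [measurable]: "u \<in> borel_measurable borel"
    and c: "(\<lambda>n. LBNN x. ennreal ((norm x powr (- (a + 1)) * \<bar>\<phi> n x - u x\<bar>)\<^sup>2)) \<longlonglongrightarrow> 0"
  shows "integrable lborel (hardy_weight a u)"
    and "(\<lambda>n. \<integral>x. \<bar>hardy_weight a (\<phi> n) x - hardy_weight a u x\<bar> \<partial>lborel) \<longlonglongrightarrow> 0"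
    and "\<exists>r. strict_mono r \<and> (AE x in lborel. (\<lambda>n. \<phi> (r n) x) \<longlonglongrightarrow> u x)"
proof -
  have [measurable]: "\<phi> n \<in> borel_measurable borel" for n using test_function_smooth[OF t] by auto
  define F where "F n x = norm x powr (- (a + 1)) * \<phi> n x" for n x
  define F0 where "F0 x = norm x powr (- (a + 1)) * u x" for x
  have [measurable]: "F n \<in> borel_measurable borel" "F0 \<in> borel_measurable borel" for n
    unfolding F_def[abs_def] F0_def[abs_def] by measurable
  have hw: "hardy_weight a (\<phi> n) x = (norm (F n x))\<^sup>2" "hardy_weight a u x = (norm (F0 x))\<^sup>2" for n x
    by (simp_all add: hardy_weight_eq F_def F0_def)
  have "(\<lambda>n. LBNN x. ennreal ((norm (F n x - F0 x))\<^sup>2)) \<longlonglongrightarrow> 0"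
  proof -
    have "norm x powr (- (a + 1)) * \<bar>\<phi> n x - u x\<bar> = norm (F n x - F0 x)" for n x
      by (simp add: F_def F0_def right_diff_distrib[symmetric] abs_mult)
    thus ?thesis using c by (simp only:)
  qed
  note A = integral_square_convergence[of F F0, OF _ _ _ this]
  have Fi: "integrable lborel (\<lambda>x. (norm (F n x))\<^sup>2)" for n using integrable_test_function(1)[OF t, of a n] unfolding hw .
  show "integrable lborel (hardy_weight a u)" using A(1)[OF _ _ Fi] unfolding hw by simp
  show "(\<lambda>n. \<integral>x. \<bar>hardy_weight a (\<phi> n) x - hardy_weight a u x\<bar> \<partial>lborel) \<longlonglongrightarrow> 0" using A(2)[OF _ _ Fi] unfolding hw by simp
  obtain r where r: "strict_mono r" "AE x in lborel. (\<lambda>n. F (r n) x) \<longlonglongrightarrow> F0 x" using A(3)[OF _ _ Fi] by auto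
  have "AE x in lborel. (\<lambda>n. \<phi> (r n) x) \<longlonglongrightarrow> u x" using r(2) AE_lborel_singleton[of "0::'a"]
  proof eventually_elim
    case (elim x)
    have w: "norm x powr (- (a + 1)) \<noteq> 0" using elim(2) by simp
    have "(\<lambda>n. F (r n) x / norm x powr (- (a + 1))) \<longlonglongrightarrow> F0 x / norm x powr (- (a + 1))" by (intro tendsto_divide elim(1) tendsto_const w)
    thus ?case using w by (simp add: F_def F0_def)
  qed
  with r(1) show "\<exists>r. strict_mono r \<and> (AE x in lborel. (\<lambda>n. \<phi> (r n) x) \<longlonglongrightarrow> u x)" by blast
qed

lemma energy_density_convergence:
  fixes g :: "'a::euclidean_space \<Rightarrow> 'a"
  assumes t: "\<And>n. test_function (\<phi> n)" and [measurable]: "g \<in> borel_measurable borel"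
    and c: "(\<lambda>n. LBNN x. ennreal ((norm x powr (- a) * norm (gradient (\<phi> n) x - g x))\<^sup>2)) \<longlonglongrightarrow> 0"
  shows "(\<lambda>n. \<integral>x. energy_density a (gradient (\<phi> n)) x \<partial>lborel) \<longlonglongrightarrow> (energy_int a g)"
proof -
  have [measurable]: "gradient (\<phi> n) \<in> borel_measurable borel" for n using test_function_smooth[OF t] by auto
  define H where "H n x = norm x powr (- a) *\<^sub>R gradient (\<phi> n) x" for n x
  define H0 where "H0 x = norm x powr (- a) *\<^sub>R g x" for x
  have [measurable]: "H n \<in> borel_measurable borel" "H0 \<in> borel_measurable borel" for n
    unfolding H_def[abs_def] H0_def[abs_def] by measurable
  have ew: "energy_density a (gradient (\<phi> n)) x = (norm (H n x))\<^sup>2" "energy_density a g x = (norm (H0 x))\<^sup>2" for n x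
    by (simp_all add: energy_density_eq H_def H0_def)
  have "(\<lambda>n. LBNN x. ennreal ((norm (H n x - H0 x))\<^sup>2)) \<longlonglongrightarrow> 0"
  proof -
    have "norm x powr (- a) * norm (gradient (\<phi> n) x - g x) = norm (H n x - H0 x)" for n x
      by (simp add: H_def H0_def scaleR_diff_right[symmetric])
    thus ?thesis using c by (simp only:)
  qed
  note B = integral_square_convergence[of H H0, OF _ _ _ this]
  have Hi: "integrable lborel (\<lambda>x. (norm (H n x))\<^sup>2)" for n using integrable_test_function(2)[OF t, of a n] unfolding ew .
  have ig: "integrable lborel (energy_density a g)" using B(1)[OF _ _ Hi] unfolding ew by simp
  have "(\<lambda>n. \<integral>x. \<bar>energy_density a (gradient (\<phi> n)) x - energy_density a g x\<bar> \<partial>lborel) \<longlonglongrightarrow> 0" using B(2)[OF _ _ Hi] unfolding ew by simp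
  hence "(\<lambda>n. (energy_int a (gradient (\<phi> n))) - (energy_int a g)) \<longlonglongrightarrow> 0"
  proof (rule Lim_null_comparison[rotated])
    show "eventually (\<lambda>n. norm ((energy_int a (gradient (\<phi> n))) - (energy_int a g)) \<le>
       (LBINT x. \<bar>energy_density a (gradient (\<phi> n)) x - energy_density a g x\<bar>)) sequentially"
    proof (intro always_eventually allI)
      fix n
      have "(energy_int a (gradient (\<phi> n))) - (energy_int a g) =
        (LBINT x. energy_density a (gradient (\<phi> n)) x - energy_density a g x)" using integrable_test_function(2)[OF t] ig by simp
      thus "norm ((energy_int a (gradient (\<phi> n))) - (energy_int a g)) \<le>
       (LBINT x. \<bar>energy_density a (gradient (\<phi> n)) x - energy_density a g x\<bar>)"
        using integral_norm_bound[of lborel "\<lambda>x. energy_density a (gradient (\<phi> n)) x - energy_density a g x"] by simp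
    qed
  qed
  thus "(\<lambda>n. \<integral>x. energy_density a (gradient (\<phi> n)) x \<partial>lborel) \<longlonglongrightarrow> (energy_int a g)" by (rule Lim_null[THEN iffD2])
qed

lemma D12_sequence:
  fixes u :: "'a::euclidean_space \<Rightarrow> real"
  assumes D: "D12 a u g"
  obtains \<phi> where "\<And>n. test_function (\<phi> n)" "integrable lborel (hardy_weight a u)"
    "(\<lambda>n. \<integral>x. \<bar>hardy_weight a (\<phi> n) x - hardy_weight a u x\<bar> \<partial>lborel) \<longlonglongrightarrow> 0"
    "(\<lambda>n. \<integral>x. energy_density a (gradient (\<phi> n)) x \<partial>lborel) \<longlonglongrightarrow> (energy_int a g)"
    "AE x in lborel. (\<lambda>n. \<phi> n x) \<longlonglongrightarrow> u x"
proof -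
  have [measurable]: "u \<in> borel_measurable borel" "g \<in> borel_measurable borel" using D by (auto simp: D12_def)
  obtain \<phi> where t: "\<And>n. test_function (\<phi> n)" and
    c1: "(\<lambda>n. LBNN x. ennreal ((norm x powr (- a) * norm (gradient (\<phi> n) x - g x))\<^sup>2)) \<longlonglongrightarrow> 0" and
    c2: "(\<lambda>n. LBNN x. ennreal ((norm x powr (- (a + 1)) * \<bar>\<phi> n x - u x\<bar>)\<^sup>2)) \<longlonglongrightarrow> 0" using D unfolding D12_def by blast
  have [measurable]: "\<phi> n \<in> borel_measurable borel" "gradient (\<phi> n) \<in> borel_measurable borel" for n
    using test_function_smooth[OF t] by auto
  note A = hardy_weight_convergence[OF t _ c2]
  obtain r where r: "strict_mono r" "AE x in lborel. (\<lambda>n. \<phi> (r n) x) \<longlonglongrightarrow> u x" using A(3) by auto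
  have iu: "integrable lborel (hardy_weight a u)" using A(1) by simp
  have cu: "(\<lambda>n. \<integral>x. \<bar>hardy_weight a (\<phi> n) x - hardy_weight a u x\<bar> \<partial>lborel) \<longlonglongrightarrow> 0" using A(2) by simp
  have cg: "(\<lambda>n. \<integral>x. energy_density a (gradient (\<phi> n)) x \<partial>lborel) \<longlonglongrightarrow> (energy_int a g)"
    by (rule energy_density_convergence[OF t _ c1]) measurable
  show ?thesis
  proof (rule that[of "\<lambda>n. \<phi> (r n)"])
    show "(\<lambda>n. \<integral>x. \<bar>hardy_weight a (\<phi> (r n)) x - hardy_weight a u x\<bar> \<partial>lborel) \<longlonglongrightarrow> 0"
      using LIMSEQ_subseq_LIMSEQ[OF cu r(1)] by (simp add: o_def)
    show "(\<lambda>n. \<integral>x. energy_density a (gradient (\<phi> (r n))) x \<partial>lborel) \<longlonglongrightarrow> (energy_int a g)"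
      using LIMSEQ_subseq_LIMSEQ[OF cg r(1)] by (simp add: o_def)
  qed (use t iu r in auto)
qed

lemma entropy_density_eq:
  fixes u :: "'a::euclidean_space \<Rightarrow> real" and a :: real
  assumes "x \<noteq> 0"
  defines "t \<equiv> norm x powr (real DIM('a) - 2 - 2 * a) * \<bar>u x\<bar>\<^sup>2"
  shows "entropy_density a u x = t * ln t / norm x powr real DIM('a)"
proof -
  have "norm x powr (real DIM('a) - 2 - 2 * a) = norm x powr real DIM('a) / norm x powr (2 * (a + 1))"
    by (simp add: powr_diff[symmetric] algebra_simps)
  hence "hardy_weight a u x = t / norm x powr real DIM('a)" using assms(1) by (simp add: t_def hardy_weight_def)
  thus ?thesis by (simp add: entropy_density_def t_def)
qed

lemma entropy_density_tendsto:
  assumes "x \<noteq> 0" "(\<lambda>n. v n x) \<longlonglongrightarrow> u x"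
  shows "(\<lambda>n. entropy_density a (v n) x) \<longlonglongrightarrow> entropy_density a u x" unfolding entropy_density_eq[OF assms(1)]
  by (intro tendsto_divide tendsto_const continuous_on_tendsto_compose[OF continuous_on_x_ln_x] tendsto_intros assms)
     (use assms(1) in auto)

lemma entropy_density_lower: "x \<noteq> 0 \<Longrightarrow> entropy_density a u (x::'a::euclidean_space) \<ge> - 1 / norm x powr real DIM('a)"
proof -
  assume x: "x \<noteq> 0"
  let ?t = "norm x powr (real DIM('a) - 2 - 2 * a) * \<bar>u x\<bar>\<^sup>2"
  have t: "?t \<ge> 0" by simp
  have "?t * ln ?t \<ge> ?t - 1" by (rule x_ln_x_lower) simp
  hence "?t * ln ?t \<ge> - 1" using t by linarith
  thus ?thesis unfolding entropy_density_eq[OF x] by (intro divide_right_mono) auto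
qed

lemma test_function_cmult:
  fixes \<phi> :: "'a::euclidean_space \<Rightarrow> real"
  assumes \<phi>: "test_function \<phi>"
  shows "test_function (\<lambda>x. c * \<phi> x)" "gradient (\<lambda>x. c * \<phi> x) x = c *\<^sub>R gradient \<phi> x"
proof -
  note sm = test_function_smooth[OF \<phi>]
  have "smooth_on UNIV (\<lambda>x. c * \<phi> x)" by (intro smooth_on_mult smooth_on_const sm) auto
  moreover have s: "support (\<lambda>x. c * \<phi> x) \<subseteq> support \<phi>" unfolding support_def by (intro closure_mono) auto
  moreover have "compact (support (\<lambda>x. c * \<phi> x))"
    using \<phi> s by (metis closed_closure compact_Int_closed inf.absorb2 support_def test_function_def)
  ultimately show "test_function (\<lambda>x. c * \<phi> x)" using \<phi> by (auto simp: test_function_def smooth_on_UNIV)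
  have "(\<phi> has_derivative (\<lambda>h. h \<bullet> gradient \<phi> x)) (at x)" by (rule smooth_on_gradient[OF open_UNIV sm(1)]) simp
  from has_derivative_mult_right[OF this, of c] show "gradient (\<lambda>x. c * \<phi> x) x = c *\<^sub>R gradient \<phi> x" by (intro gradient_unique) simp
qed

lemma density_cmult:
  "hardy_weight a (\<lambda>x. c * u x) x = c\<^sup>2 * hardy_weight a u x"
  "energy_density a (\<lambda>x. c *\<^sub>R g x) x = c\<^sup>2 * energy_density a g x"
  by (simp_all add: hardy_weight_def energy_density_def power_mult_distrib)

lemma entropy_density_cmult:
  fixes u :: "'a::euclidean_space \<Rightarrow> real"
  assumes "c \<noteq> 0" "x \<noteq> 0"
  shows "entropy_density a (\<lambda>x. c * u x) x = c\<^sup>2 * entropy_density a u x + c\<^sup>2 * ln (c\<^sup>2) * hardy_weight a u x"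
proof (cases "u x = 0")
  case False
  have "ln (norm x powr (real DIM('a) - 2 - 2 * a) * \<bar>c * u x\<bar>\<^sup>2) = ln (c\<^sup>2) + ln (norm x powr (real DIM('a) - 2 - 2 * a) * \<bar>u x\<bar>\<^sup>2)"
  proof -
    have "norm x powr (real DIM('a) - 2 - 2 * a) * \<bar>c * u x\<bar>\<^sup>2 = c\<^sup>2 * (norm x powr (real DIM('a) - 2 - 2 * a) * \<bar>u x\<bar>\<^sup>2)"
      by (simp add: power_mult_distrib)
    moreover have "0 < c\<^sup>2" "0 < norm x powr (real DIM('a) - 2 - 2 * a) * \<bar>u x\<bar>\<^sup>2" using assms False by auto
    ultimately show ?thesis by (simp only: ln_mult_pos)
  qed
  thus ?thesis unfolding entropy_density_def density_cmult by (simp add: algebra_simps)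
qed (simp add: entropy_density_def hardy_weight_def)

lemma test_function_WLH_scaled:
  fixes \<phi> :: "'a::euclidean_space \<Rightarrow> real" and a \<gamma> \<Lambda> :: real
  assumes \<phi>: "test_function \<phi>" and N: "N > 0" "(hardy_int a \<phi>) = N"
    and \<gamma>: "\<gamma> > 1 / 4" and \<Lambda>: "\<Lambda> > 0" "\<Lambda> \<le> (a_c DIM('a) - a)\<^sup>2" and ineq: "sphere_log_ineq TYPE('a) (2 * \<gamma> - 1 / 2) \<Lambda> \<or> radial_function \<phi>"
  defines "E \<equiv> \<integral>x. energy_density a (gradient \<phi>) x \<partial>lborel"
  shows "E \<ge> \<Lambda> * N"
    and "integrable lborel (entropy_density a \<phi>)"
    and "(entropy_int a \<phi>) \<le> N * (ln N + 2 * \<gamma> * ln (E / N) + log_const TYPE('a) \<gamma> \<Lambda>)"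
    and "test_function (\<lambda>x. 1 / sqrt N * \<phi> x)"
    and "integrable lborel (entropy_density a (\<lambda>x. 1 / sqrt N * \<phi> x))"
    and "(LBINT x. max 0 (entropy_density a (\<lambda>x. 1 / sqrt N * \<phi> x) x)) \<le>
      ((2 * \<gamma> - 1 / 2) / \<Lambda> + 1) * (E / N) + 2 + \<bar>ln (sphere_area TYPE('a))\<bar>"
proof -
  define c where "c = 1 / sqrt N"
  have c: "c \<noteq> 0" "c\<^sup>2 = 1 / N" using N by (auto simp: c_def power_divide)
  define \<psi> where "\<psi> = (\<lambda>x. c * \<phi> x)"
  have [measurable]: "\<phi> \<in> borel_measurable borel" using test_function_smooth[OF \<phi>] by auto
  have \<psi>: "test_function \<psi>" unfolding \<psi>_def by (rule test_function_cmult(1)[OF \<phi>])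
  have N\<psi>: "(hardy_int a \<psi>) = 1" using N c by (simp add: \<psi>_def density_cmult)
  have E\<psi>: "(energy_int a (gradient \<psi>)) = E / N"
  proof -
    have "gradient \<psi> = (\<lambda>x. c *\<^sub>R gradient \<phi> x)" unfolding \<psi>_def by (rule ext) (rule test_function_cmult(2)[OF \<phi>])
    thus ?thesis using c by (simp add: density_cmult E_def)
  qed
  have "sphere_log_ineq TYPE('a) (2 * \<gamma> - 1 / 2) \<Lambda> \<or> radial_function \<psi>" using ineq by (auto simp: \<psi>_def radial_function_def)
  note W = test_function_WLH[OF \<psi> N\<psi> \<gamma> \<Lambda> this, unfolded E\<psi>]
  show "E \<ge> \<Lambda> * N" using W(1) N by (simp add: pos_le_divide_eq)
  have ae: "AE x in lborel. entropy_density a \<psi> x = c\<^sup>2 * entropy_density a \<phi> x + c\<^sup>2 * ln (c\<^sup>2) * hardy_weight a \<phi> x"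
    using AE_lborel_singleton[of "0::'a"] by eventually_elim (simp add: \<psi>_def entropy_density_cmult[OF c(1)])
  have hi: "integrable lborel (hardy_weight a \<phi>)" by (rule integrable_test_function(1)[OF \<phi>])
  have "integrable lborel (\<lambda>x. N * (entropy_density a \<psi> x - c\<^sup>2 * ln (c\<^sup>2) * hardy_weight a \<phi> x))" using W(2) hi by auto
  thus ei: "integrable lborel (entropy_density a \<phi>)" by (rule integrable_cong_AE_imp) (use ae N c in \<open>auto elim!: eventually_mono\<close>)
  have "(entropy_int a \<psi>) = (LBINT x. c\<^sup>2 * entropy_density a \<phi> x + c\<^sup>2 * ln (c\<^sup>2) * hardy_weight a \<phi> x)"
    using ae test_function_smooth[OF \<psi>] by (intro integral_cong_AE) auto
  also have "\<dots> = (entropy_int a \<phi>) / N - ln N" using ei hi N c by (simp add: ln_div)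
  finally have "(entropy_int a \<phi>) / N - ln N \<le> 2 * \<gamma> * ln (E / N) + log_const TYPE('a) \<gamma> \<Lambda>" using W(3) by simp
  hence "(entropy_int a \<phi>) / N \<le> ln N + 2 * \<gamma> * ln (E / N) + log_const TYPE('a) \<gamma> \<Lambda>" by simp
  thus "(entropy_int a \<phi>) \<le> N * (ln N + 2 * \<gamma> * ln (E / N) + log_const TYPE('a) \<gamma> \<Lambda>)"
    using N by (simp add: pos_divide_le_eq mult.commute)
  show "test_function (\<lambda>x. 1 / sqrt N * \<phi> x)" "integrable lborel (entropy_density a (\<lambda>x. 1 / sqrt N * \<phi> x))"
    "(LBINT x. max 0 (entropy_density a (\<lambda>x. 1 / sqrt N * \<phi> x) x)) \<le>
      ((2 * \<gamma> - 1 / 2) / \<Lambda> + 1) * (E / N) + 2 + \<bar>ln (sphere_area TYPE('a))\<bar>" using \<psi> W(2,4) by (simp_all only: \<psi>_def c_def)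
qed

lemma integrable_fatou_bound:
  fixes f :: "nat \<Rightarrow> 'a \<Rightarrow> real"
  assumes [measurable]: "\<And>n. f n \<in> borel_measurable M" "h \<in> borel_measurable M"
    and ae: "AE x in M. (\<lambda>n. f n x) \<longlonglongrightarrow> h x"
    and n0: "\<And>n. n \<ge> n0 \<Longrightarrow> integrable M (f n)" "\<And>n. n \<ge> n0 \<Longrightarrow> AE x in M. 0 \<le> f n x"
      "\<And>n. n \<ge> n0 \<Longrightarrow> (\<integral>x. f n x \<partial>M) \<le> b n"
    and b: "b \<longlonglongrightarrow> B"
  shows "integrable M h" "(\<integral>x. h x \<partial>M) \<le> B"
proof -
  have nonneg: "AE x in M. \<forall>n. 0 \<le> f (n + n0) x" unfolding AE_all_countable using n0(2) by simp
  have h0: "AE x in M. 0 \<le> h x" using ae nonneg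
  proof eventually_elim
    case (elim x)
    show ?case by (rule LIMSEQ_le_const[OF LIMSEQ_ignore_initial_segment[OF elim(1), of n0]]) (use elim(2) in auto)
  qed
  have nn: "(\<integral>\<^sup>+x. ennreal (f (n + n0) x) \<partial>M) \<le> ennreal (b (n + n0))" for n
    using nn_integral_eq_integral[OF n0(1)[of "n + n0"] n0(2)[of "n + n0"]] n0(3)[of "n + n0"] by (simp add: ennreal_leI)
  have "(\<integral>\<^sup>+x. ennreal (h x) \<partial>M) = (\<integral>\<^sup>+x. liminf (\<lambda>n. ennreal (f (n + n0) x)) \<partial>M)"
  proof (rule nn_integral_cong_AE)
    show "AE x in M. ennreal (h x) = liminf (\<lambda>n. ennreal (f (n + n0) x))" using ae
    proof eventually_elim
      case (elim x)
      have "(\<lambda>n. ennreal (f (n + n0) x)) \<longlonglongrightarrow> ennreal (h x)" by (rule tendsto_ennrealI[OF LIMSEQ_ignore_initial_segment[OF elim]])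
      thus ?case by (rule lim_imp_Liminf[symmetric, rotated]) simp
    qed
  qed
  also have "\<dots> \<le> liminf (\<lambda>n. \<integral>\<^sup>+x. ennreal (f (n + n0) x) \<partial>M)" by (rule nn_integral_liminf) measurable
  also have "\<dots> \<le> liminf (\<lambda>n. ennreal (b (n + n0)))" by (rule Liminf_mono) (use nn in \<open>auto intro: always_eventually\<close>)
  also have "\<dots> = ennreal B" by (rule lim_imp_Liminf) (auto intro: tendsto_ennrealI LIMSEQ_ignore_initial_segment[OF b])
  finally have le: "(\<integral>\<^sup>+x. ennreal (h x) \<partial>M) \<le> ennreal B" .
  show i: "integrable M h" by (rule integrableI_nonneg) (use h0 le le_less_trans[OF le ennreal_less_top] in auto)
  have B0: "B \<ge> 0"
  proof (rule LIMSEQ_le_const[OF LIMSEQ_ignore_initial_segment[OF b, of n0]])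
    have "0 \<le> b (n + n0)" for n using n0(3)[of "n + n0"] integral_nonneg_AE[OF n0(2)[of "n + n0"]] by simp
    thus "\<exists>N. \<forall>n\<ge>N. 0 \<le> b (n + n0)" by blast
  qed
  show "(\<integral>x. h x \<partial>M) \<le> B" using le nn_integral_eq_integral[OF i h0] B0 by simp
qed

lemma extended_integral_eq:
  fixes f :: "'a::euclidean_space \<Rightarrow> real"
  assumes f: "integrable lborel f"
  shows "extended_integral f = ereal (LBINT x. f x)"
proof -
  define P where "P = (LBNN x. ennreal (f x))"
  define Q where "Q = (LBNN x. ennreal (- f x))"
  have "P < \<top>" "Q < \<top>" using f by (auto simp: real_integrable_def P_def Q_def less_top)
  moreover have "enn2ereal r = ereal (enn2real r)" if "r < \<top>" for r
    using that by (cases r rule: ennreal_cases) (simp_all add: enn2ereal_ennreal)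
  moreover have "(LBINT x. f x) = enn2real P - enn2real Q" unfolding P_def Q_def by (rule real_lebesgue_integral_def[OF f])
  ultimately show ?thesis by (simp add: extended_integral_def P_def[symmetric] Q_def[symmetric])
qed

lemma entropy_eq: "integrable lborel (entropy_density a u) \<Longrightarrow> entropy a u = ereal (entropy_int a u)"
  by (simp only: entropy_def entropy_density_def[symmetric] hardy_weight_def[symmetric] extended_integral_eq)

lemma abs_x_ln_x_le_1: "0 \<le> t \<Longrightarrow> t \<le> 1 \<Longrightarrow> \<bar>t * ln t\<bar> \<le> (1::real)"
proof -
  assume t: "0 \<le> t" "t \<le> 1"
  have "t * ln t \<le> 0" using t by (cases "t = 0") (auto intro: mult_nonneg_nonpos)
  moreover have "t * ln t \<ge> t - 1" by (rule x_ln_x_lower[OF t(1)])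
  ultimately show ?thesis using t by linarith
qed

lemma hardy_weight_mult: "hardy_weight a (\<lambda>x. u x * c x) x = (c x)\<^sup>2 * hardy_weight a u x"
  by (simp add: hardy_weight_def power_mult_distrib)

lemma entropy_density_mult:
  fixes u :: "'a::euclidean_space \<Rightarrow> real"
  assumes "x \<noteq> 0"
  shows "entropy_density a (\<lambda>x. u x * c x) x = (c x)\<^sup>2 * entropy_density a u x + (c x)\<^sup>2 * ln ((c x)\<^sup>2) * hardy_weight a u x"
proof (cases "c x = 0")
  case False
  have "entropy_density a (\<lambda>x. u x * c x) x = entropy_density a (\<lambda>y. c x * u y) x"
    by (simp add: entropy_density_def hardy_weight_def mult.commute)
  thus ?thesis using entropy_density_cmult[OF False assms] by simp
qed (simp add: entropy_density_def hardy_weight_def)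

lemma integrable_annulus_weight:
  "integrable lborel (\<lambda>x::'a::euclidean_space. indicator (cball 0 r - ball 0 \<epsilon>) x / norm x powr real DIM('a))" if "\<epsilon> > 0"
proof -
  let ?K = "cball 0 r - ball 0 \<epsilon> :: 'a set"
  have K: "compact ?K" by (intro compact_diff) auto
  have "continuous_on ?K (\<lambda>x. 1 / norm x powr real DIM('a))" by (intro continuous_intros) (use that in auto)
  from borel_integrable_compact[OF K this] show ?thesis by (simp add: indicator_def if_distrib cong: if_cong)
qed

lemma energy_cutoff_le:
  fixes \<phi> :: "'a::euclidean_space \<Rightarrow> real"
  assumes C: "\<And>m x. m > 0 \<Longrightarrow> x \<noteq> 0 \<Longrightarrow> norm (gradient (cutoff m) (x::'a)) \<le> C / (m * norm x)"
    and \<phi>: "test_function \<phi>" and m: "m > 0" and \<delta>: "\<delta> > 0"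
  shows "(energy_int a (gradient (\<lambda>x. \<phi> x * cutoff m x))) \<le>
    (1 + \<delta>) * (energy_int a (gradient \<phi>)) + (1 + 1 / \<delta>) * (C / m)\<^sup>2 * (hardy_int a \<phi>)"
proof -
  note sm = test_function_smooth(2)[OF \<phi>]
  have t: "test_function (\<lambda>x. \<phi> x * cutoff m x)" by (rule test_function_cutoff[OF sm m])
  note i = integrable_test_function[OF \<phi>, of a] integrable_test_function(2)[OF t, of a]
  have "(energy_int a (gradient (\<lambda>x. \<phi> x * cutoff m x))) \<le>
    (LBINT x. (1 + \<delta>) * energy_density a (gradient \<phi>) x + (1 + 1 / \<delta>) * (C / m)\<^sup>2 * hardy_weight a \<phi> x)"
  proof (rule integral_mono_AE[OF i(3)])
    show "integrable lborel (\<lambda>x. (1 + \<delta>) * energy_density a (gradient \<phi>) x + (1 + 1 / \<delta>) * (C / m)\<^sup>2 * hardy_weight a \<phi> x)"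
      using i by auto
    show "AE x in lborel. energy_density a (gradient (\<lambda>x. \<phi> x * cutoff m x)) x \<le>
       (1 + \<delta>) * energy_density a (gradient \<phi>) x + (1 + 1 / \<delta>) * (C / m)\<^sup>2 * hardy_weight a \<phi> x" using AE_lborel_singleton[of "0::'a"]
    proof eventually_elim
      case (elim x)
      have n: "norm (cutoff m x *\<^sub>R gradient \<phi> x) \<le> norm (gradient \<phi> x)" using cutoff_range[of m x] by (simp add: mult_left_le_one_le)
      show ?case
        using energy_gradient_cutoff[OF C m elim \<delta>, where v = "cutoff m x *\<^sub>R gradient \<phi> x" and g = "gradient \<phi>" and u = \<phi>, OF _ _ n]
        unfolding energy_density_def[of a "gradient (\<lambda>x. \<phi> x * cutoff m x)"] gradient_mult[OF sm smooth_on_cutoff elim] by blast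
    qed
  qed
  also have "\<dots> = (1 + \<delta>) * (energy_int a (gradient \<phi>)) + (1 + 1 / \<delta>) * (C / m)\<^sup>2 * (hardy_int a \<phi>)" using i by simp
  finally show ?thesis .
qed

text \<open>The integrand of the entropy has no integrable lower bound on the whole space, so Fatou's lemma
  does not apply directly. On an annulus it is bounded from below by \<open>-|x|\<^sup>-\<^sup>d\<close>, so the lemma applies after a cutoff, and the cutoff costs an arbitrarily
  small part of the energy since its gradient is of relative size \<open>1/m\<close>. In the limit \<open>m \<rightarrow> \<infinity>\<close> the
  entropies of the truncated functions converge by domination unless the entropy is \<open>-\<infinity>\<close>.\<close>

lemma WLH_limit:
  fixes u :: "'a::euclidean_space \<Rightarrow> real" and v :: "nat \<Rightarrow> 'a \<Rightarrow> real" and a \<gamma> \<Lambda> E :: real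
  assumes tf: "\<And>n. test_function (v n)"
    and ineq: "\<And>n. sphere_log_ineq TYPE('a) (2 * \<gamma> - 1 / 2) \<Lambda> \<or> radial_function (v n)"
    and u [measurable]: "u \<in> borel_measurable borel"
    and iu: "integrable lborel (hardy_weight a u)" and nu: "(hardy_int a u) = 1"
    and conv: "(\<lambda>n. \<integral>x. \<bar>hardy_weight a (v n) x - hardy_weight a u x\<bar> \<partial>lborel) \<longlonglongrightarrow> 0"
    and ae: "AE x in lborel. (\<lambda>n. v n x) \<longlonglongrightarrow> u x"
    and en: "\<And>n. (energy_int a (gradient (v n))) \<le> e n" and eE: "e \<longlonglongrightarrow> E"
    and \<gamma>: "\<gamma> > 1 / 4" and \<Lambda>: "\<Lambda> > 0" "\<Lambda> \<le> (a_c DIM('a) - a)\<^sup>2"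
  shows "E \<ge> \<Lambda>" "entropy a u \<le> ereal (2 * \<gamma> * ln E + log_const TYPE('a) \<gamma> \<Lambda>)"
proof -
  define K where "K = log_const TYPE('a) \<gamma> \<Lambda>"
  obtain C where C: "C > 0" "\<And>m x. m > 0 \<Longrightarrow> x \<noteq> 0 \<Longrightarrow> norm (gradient (cutoff m) (x::'a)) \<le> C / (m * norm x)" using gradient_cutoff by metis
  have [measurable]: "v n \<in> borel_measurable borel" for n using test_function_smooth[OF tf] by auto
  have [measurable]: "(cutoff m :: 'a \<Rightarrow> real) \<in> borel_measurable borel" for m by (rule borel_measurable_smooth[OF smooth_on_cutoff])
  note iv = integrable_test_function[OF tf, of a]
  define Nn where "Nn n = (hardy_int a (v n))" for n
  have cut_i: "integrable lborel (\<lambda>x. (cutoff m x)\<^sup>2 * hardy_weight a w x)"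
    if "integrable lborel (hardy_weight a w)" "w \<in> borel_measurable borel" for m and w :: "'a \<Rightarrow> real"
  proof (rule Bochner_Integration.integrable_bound[OF that(1)])
    have [measurable]: "w \<in> borel_measurable borel" by (rule that(2))
    show "(\<lambda>x. (cutoff m x)\<^sup>2 * hardy_weight a w x) \<in> borel_measurable lborel" by measurable
    have "norm ((cutoff m x)\<^sup>2 * hardy_weight a w x) \<le> norm (hardy_weight a w x)" for x
      using cutoff_range[of m x] hardy_weight_nonneg[of a w x] by (simp add: abs_mult mult_left_le_one_le power_le_one)
    thus "AE x in lborel. norm ((cutoff m x)\<^sup>2 * hardy_weight a w x) \<le> norm (hardy_weight a w x)" by simp
  qed
  define Nm where "Nm m = (LBINT x. (cutoff m x)\<^sup>2 * hardy_weight a u x)" for m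
  define Nnm where "Nnm n m = (LBINT x. (cutoff m x)\<^sup>2 * hardy_weight a (v n) x)" for n m
  have idiff: "integrable lborel (\<lambda>x. \<bar>hardy_weight a (v n) x - hardy_weight a u x\<bar>)" for n using iv(1)[of n] iu by auto
  have Nconv: "(\<lambda>n. Nn n) \<longlonglongrightarrow> 1"
  proof (rule Lim_null[THEN iffD2], rule Lim_null_comparison[OF _ conv], intro always_eventually allI)
    fix n
    have "Nn n - 1 = (LBINT x. hardy_weight a (v n) x - hardy_weight a u x)" using iv(1)[of n] iu nu by (simp add: Nn_def)
    thus "norm (Nn n - 1) \<le> (LBINT x. \<bar>hardy_weight a (v n) x - hardy_weight a u x\<bar>)"
      using integral_norm_bound[of lborel "\<lambda>x. hardy_weight a (v n) x - hardy_weight a u x"] by simp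
  qed
  have Nmconv: "(\<lambda>n. Nnm n m) \<longlonglongrightarrow> Nm m" for m
  proof (rule Lim_null[THEN iffD2], rule Lim_null_comparison[OF _ conv], intro always_eventually allI)
    fix n
    have "Nnm n m - Nm m = (LBINT x. (cutoff m x)\<^sup>2 * hardy_weight a (v n) x - (cutoff m x)\<^sup>2 * hardy_weight a u x)"
      using cut_i[OF iv(1)[of n]] cut_i[OF iu u] by (simp add: Nnm_def Nm_def)
    also have "norm \<dots> \<le> (LBINT x. \<bar>hardy_weight a (v n) x - hardy_weight a u x\<bar>)"
    proof (rule Bochner_Integration.integral_norm_bound_integral)
      show "integrable lborel (\<lambda>x. (cutoff m x)\<^sup>2 * hardy_weight a (v n) x - (cutoff m x)\<^sup>2 * hardy_weight a u x)"
        using cut_i[OF iv(1)[of n]] cut_i[OF iu u] by auto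
      show "norm ((cutoff m x)\<^sup>2 * hardy_weight a (v n) x - (cutoff m x)\<^sup>2 * hardy_weight a u x) \<le> \<bar>hardy_weight a (v n) x - hardy_weight a u x\<bar>" for x
        using cutoff_range[of m x] by (simp add: right_diff_distrib[symmetric] abs_mult mult_left_le_one_le power_le_one)
    qed (rule idiff)
    finally show "norm (Nnm n m - Nm m) \<le> (LBINT x. \<bar>hardy_weight a (v n) x - hardy_weight a u x\<bar>)" .
  qed
  obtain n0 where n0: "\<And>n. n \<ge> n0 \<Longrightarrow> Nn n > 0" using order_tendstoD(1)[OF Nconv, of 0] by (auto simp: eventually_sequentially)
  have "\<Lambda> * Nn n \<le> e n" if "n \<ge> n0" for n
    using test_function_WLH_scaled(1)[OF tf n0[OF that] Nn_def[symmetric] \<gamma> \<Lambda> ineq] en[of n] by linarith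
  hence "\<Lambda> * 1 \<le> E" by (intro LIMSEQ_le[OF tendsto_mult_left[OF Nconv] eE]) auto
  thus E: "E \<ge> \<Lambda>" by simp
  hence Epos: "E > 0" using \<Lambda> by simp
  have pos: "integrable lborel (\<lambda>x. max 0 (entropy_density a u x))"
  proof -
    define f where "f n x = max 0 (entropy_density a (\<lambda>x. 1 / sqrt (Nn n) * v n x) x)" for n x
    define b where "b n = ((2 * \<gamma> - 1 / 2) / \<Lambda> + 1) * (e n / Nn n) + 2 + \<bar>ln (sphere_area TYPE('a))\<bar>" for n
    have m1: "f n \<in> borel_measurable lborel" for n unfolding f_def[abs_def] by measurable
    have m2: "(\<lambda>x. max 0 (entropy_density a u x)) \<in> borel_measurable lborel" by measurable
    have b: "b \<longlonglongrightarrow> ((2 * \<gamma> - 1 / 2) / \<Lambda> + 1) * (E / 1) + 2 + \<bar>ln (sphere_area TYPE('a))\<bar>"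
      unfolding b_def by (intro tendsto_intros eE Nconv) simp
    have i: "integrable lborel (f n)" and le: "(LBINT x. f n x) \<le> b n" if n: "n \<ge> n0" for n
    proof -
      note Wn = test_function_WLH_scaled(5,6)[OF tf n0[OF n] Nn_def[symmetric] \<gamma> \<Lambda> ineq]
      show "integrable lborel (f n)" unfolding f_def[abs_def] by (intro integrable_max Wn(1)) simp
      have "(energy_int a (gradient (v n))) / Nn n \<le> e n / Nn n" using n0[OF n] en[of n] by (simp add: divide_right_mono)
      hence "((2 * \<gamma> - 1 / 2) / \<Lambda> + 1) * ((energy_int a (gradient (v n))) / Nn n) \<le>
         ((2 * \<gamma> - 1 / 2) / \<Lambda> + 1) * (e n / Nn n)" using \<gamma> \<Lambda> by (intro mult_left_mono) auto
      thus "(LBINT x. f n x) \<le> b n" using Wn(2) unfolding f_def b_def by linarith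
    qed
    have c: "AE x in lborel. (\<lambda>n. f n x) \<longlonglongrightarrow> max 0 (entropy_density a u x)" using ae AE_lborel_singleton[of "0::'a"]
    proof eventually_elim
      case (elim x)
      have "(\<lambda>n. 1 / sqrt (Nn n) * v n x) \<longlonglongrightarrow> 1 / sqrt 1 * u x" by (intro tendsto_intros Nconv elim(1)) simp
      hence "(\<lambda>n. 1 / sqrt (Nn n) * v n x) \<longlonglongrightarrow> u x" by simp
      from entropy_density_tendsto[OF elim(2), where v = "\<lambda>n x. 1 / sqrt (Nn n) * v n x" and u = u, OF this, of a]
      show ?case unfolding f_def by (intro tendsto_max tendsto_const)
    qed
    show ?thesis by (rule integrable_fatou_bound(1)[OF m1 m2 c i _ le b]) (auto simp: f_def)
  qed
  have cut: "integrable lborel (entropy_density a (\<lambda>x. u x * cutoff m x))"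
    "(entropy_int a (\<lambda>x. u x * cutoff m x)) \<le>
       Nm m * (ln (Nm m) + 2 * \<gamma> * ln (((1 + \<delta>) * E + (1 + 1 / \<delta>) * (C / m)\<^sup>2) / Nm m) + K)"
    if m: "m > 0" and Nm: "Nm m > 0" and \<delta>: "\<delta> > 0" for m \<delta>
  proof -
    define X where "X n x = v n x * cutoff m x" for n x
    define eb where "eb n = (1 + \<delta>) * e n + (1 + 1 / \<delta>) * (C / m)\<^sup>2 * Nn n" for n
    define E' where "E' = (1 + \<delta>) * E + (1 + 1 / \<delta>) * (C / m)\<^sup>2"
    have E': "E' > 0" unfolding E'_def using \<delta> Epos by (intro add_pos_nonneg) auto
    have "(\<lambda>n. eb n) \<longlonglongrightarrow> (1 + \<delta>) * E + (1 + 1 / \<delta>) * (C / m)\<^sup>2 * 1" unfolding eb_def by (intro tendsto_intros eE Nconv)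
    hence ebE: "eb \<longlonglongrightarrow> E'" by (simp add: E'_def)
    obtain n1 where n1: "\<And>n. n \<ge> n1 \<Longrightarrow> Nnm n m > 0" using order_tendstoD(1)[OF Nmconv Nm] by (auto simp: eventually_sequentially)
    have X: "test_function (X n)" for n unfolding X_def by (rule test_function_cutoff[OF test_function_smooth(2)[OF tf] m])
    have Xi: "sphere_log_ineq TYPE('a) (2 * \<gamma> - 1 / 2) \<Lambda> \<or> radial_function (X n)" for n
    proof -
      have "radial_function (X n)" if "radial_function (v n)"
      proof -
        obtain f where "\<And>x. v n x = f (norm x)" using \<open>radial_function (v n)\<close> by (auto simp: radial_function_def)
        hence "X n x = f (norm x) * (if norm x = 0 then 0 else bump (ln (norm x) / m))" for x by (simp add: X_def cutoff_def)
        thus ?thesis unfolding radial_function_def by (intro exI[of _ "\<lambda>r. f r * (if r = 0 then 0 else bump (ln r / m))"]) simp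
      qed
      thus ?thesis using ineq[of n] by blast
    qed
    have NX: "(hardy_int a (X n)) = Nnm n m" for n by (simp add: X_def[abs_def] hardy_weight_mult Nnm_def)
    define h where "h x = indicator (cball 0 (exp (2 * m)) - ball 0 (exp (- (2 * m)))) x / norm x powr real DIM('a)" for x :: 'a
    have hi: "integrable lborel h" unfolding h_def[abs_def] by (rule integrable_annulus_weight) simp
    have [measurable]: "h \<in> borel_measurable borel" using borel_measurable_integrable[OF hi] by simp
    have [measurable]: "X n \<in> borel_measurable borel" for n unfolding X_def[abs_def] by measurable
    have lower: "0 \<le> entropy_density a (\<lambda>x. w x * cutoff m x) x + h x" if x: "x \<noteq> 0" for w x
    proof (cases "x \<in> cball 0 (exp (2 * m)) - ball 0 (exp (- (2 * m)))")
      case True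
      hence "h x = 1 / norm x powr real DIM('a)" by (simp add: h_def)
      thus ?thesis using entropy_density_lower[OF x, of a "\<lambda>x. w x * cutoff m x"] by simp
    next
      case False
      have "\<bar>ln (norm x)\<bar> \<ge> 2 * m"
      proof (cases "norm x > exp (2 * m)")
        case True
        hence "ln (norm x) > ln (exp (2 * m))" by (subst ln_less_cancel_iff) auto
        thus ?thesis by simp
      next
        case F: False
        hence "norm x < exp (- (2 * m))" using False by auto
        hence "ln (norm x) < ln (exp (- (2 * m)))" using x by (subst ln_less_cancel_iff) auto
        thus ?thesis by simp
      qed
      hence "cutoff m x = 0" by (rule cutoff_eq_0[OF m])
      thus ?thesis by (simp add: entropy_density_def hardy_weight_def h_def)
    qed
    have ei: "integrable lborel (entropy_density a (X n))"
      and eb: "(entropy_int a (X n)) \<le> Nnm n m * (ln (Nnm n m) + 2 * \<gamma> * ln (eb n / Nnm n m) + K)"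
      if n: "n \<ge> n1" for n
    proof -
      note WX = test_function_WLH_scaled(1-3)[OF X n1[OF n] NX \<gamma> \<Lambda> Xi, folded K_def]
      let ?EX = "\<integral>x. energy_density a (gradient (X n)) x \<partial>lborel"
      show "integrable lborel (entropy_density a (X n))" by (rule WX(2))
      have "?EX \<le> eb n"
      proof -
        have "?EX \<le> (1 + \<delta>) * (energy_int a (gradient (v n))) + (1 + 1 / \<delta>) * (C / m)\<^sup>2 * Nn n"
          using energy_cutoff_le[OF C(2) tf[of n] m \<delta>, of a] by (simp add: X_def[abs_def] Nn_def)
        also have "\<dots> \<le> eb n" unfolding eb_def using \<delta> en[of n] by (intro add_right_mono mult_left_mono) auto
        finally show ?thesis .
      qed
      moreover have "0 < ?EX" using WX(1) n1[OF n] \<Lambda>(1) by (meson less_le_trans mult_pos_pos)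
      ultimately have "ln (?EX / Nnm n m) \<le> ln (eb n / Nnm n m)" using n1[OF n] by (intro ln_mono divide_right_mono divide_pos_pos) auto
      hence "Nnm n m * (ln (Nnm n m) + 2 * \<gamma> * ln (?EX / Nnm n m) + K) \<le> Nnm n m * (ln (Nnm n m) + 2 * \<gamma> * ln (eb n / Nnm n m) + K)"
        using n1[OF n] \<gamma> by (intro mult_left_mono add_right_mono add_left_mono) auto
      thus "(entropy_int a (X n)) \<le> Nnm n m * (ln (Nnm n m) + 2 * \<gamma> * ln (eb n / Nnm n m) + K)" using WX(3) by linarith
    qed
    have lim: "(\<lambda>n. Nnm n m * (ln (Nnm n m) + 2 * \<gamma> * ln (eb n / Nnm n m) + K) + (LBINT x. h x)) \<longlonglongrightarrow>
      Nm m * (ln (Nm m) + 2 * \<gamma> * ln (E' / Nm m) + K) + (LBINT x. h x)" using Nm E' by (intro tendsto_intros Nmconv ebE) auto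
    have F: "integrable lborel (\<lambda>x. entropy_density a (\<lambda>x. u x * cutoff m x) x + h x)"
      "(LBINT x. entropy_density a (\<lambda>x. u x * cutoff m x) x + h x) \<le> Nm m * (ln (Nm m) + 2 * \<gamma> * ln (E' / Nm m) + K) + (LBINT x. h x)"
    proof -
      have m1: "(\<lambda>x. entropy_density a (X n) x + h x) \<in> borel_measurable lborel" for n by measurable
      have m2: "(\<lambda>x. entropy_density a (\<lambda>x. u x * cutoff m x) x + h x) \<in> borel_measurable lborel" by measurable
      have c: "AE x in lborel. (\<lambda>n. entropy_density a (X n) x + h x) \<longlonglongrightarrow> entropy_density a (\<lambda>x. u x * cutoff m x) x + h x"
        using ae AE_lborel_singleton[of "0::'a"]
      proof eventually_elim
        case (elim x)
        have "(\<lambda>n. X n x) \<longlonglongrightarrow> u x * cutoff m x" unfolding X_def by (intro tendsto_intros elim(1))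
        from entropy_density_tendsto[OF elim(2), where v = X and u = "\<lambda>x. u x * cutoff m x", OF this, of a]
        show ?case by (intro tendsto_add tendsto_const)
      qed
      have i: "integrable lborel (\<lambda>x. entropy_density a (X n) x + h x)" if "n \<ge> n1" for n
        using ei[OF that] hi by (rule Bochner_Integration.integrable_add)
      have nn: "AE x in lborel. 0 \<le> entropy_density a (X n) x + h x" for n using AE_lborel_singleton[of "0::'a"]
        by eventually_elim (use lower[of _ "v n"] in \<open>simp add: X_def[abs_def]\<close>)
      have b: "(LBINT x. entropy_density a (X n) x + h x) \<le> Nnm n m * (ln (Nnm n m) + 2 * \<gamma> * ln (eb n / Nnm n m) + K) + (LBINT x. h x)"
        if "n \<ge> n1" for n using ei[OF that] eb[OF that] hi by simp
      note R = integrable_fatou_bound[OF m1 m2 c i nn b lim]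
      show "integrable lborel (\<lambda>x. entropy_density a (\<lambda>x. u x * cutoff m x) x + h x)"
        "(LBINT x. entropy_density a (\<lambda>x. u x * cutoff m x) x + h x) \<le> Nm m * (ln (Nm m) + 2 * \<gamma> * ln (E' / Nm m) + K) + (LBINT x. h x)"
        by (rule R; assumption)+
    qed
    show i: "integrable lborel (entropy_density a (\<lambda>x. u x * cutoff m x))" using Bochner_Integration.integrable_diff[OF F(1) hi] by simp
    show "(entropy_int a (\<lambda>x. u x * cutoff m x)) \<le>
       Nm m * (ln (Nm m) + 2 * \<gamma> * ln (((1 + \<delta>) * E + (1 + 1 / \<delta>) * (C / m)\<^sup>2) / Nm m) + K)" using F(2) i hi by (simp add: E'_def)
  qed
  define P where "P = (LBNN x. ennreal (entropy_density a u x))"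
  define Q where "Q = (LBNN x. ennreal (- entropy_density a u x))"
  have Pe: "P = (LBNN x. ennreal (max 0 (entropy_density a u x)))" unfolding P_def by (intro nn_integral_cong) (simp add: max_def ennreal_neg)
  have Pfin: "P < \<top>" unfolding Pe using nn_integral_eq_integral[OF pos] by simp
  have ent: "entropy a u = enn2ereal P - enn2ereal Q"
    by (simp add: entropy_def extended_integral_def P_def Q_def entropy_density_def hardy_weight_def)
  show "entropy a u \<le> ereal (2 * \<gamma> * ln E + log_const TYPE('a) \<gamma> \<Lambda>)"
  proof (cases "Q = \<top>")
    case True
    have "enn2ereal P \<noteq> \<infinity>" using Pfin by (simp add: enn2ereal_eq_top_iff less_top[symmetric])
    hence "entropy a u = - \<infinity>" unfolding ent True by (cases "enn2ereal P") (auto simp: enn2ereal_top)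
    thus ?thesis by simp
  next
    case False
    hence Qfin: "Q < \<top>" by (simp add: less_top)
    have ui: "integrable lborel (entropy_density a u)"
    proof (rule integrableI_bounded)
      have "(LBNN x. ennreal (norm (entropy_density a u x))) = (LBNN x. ennreal (entropy_density a u x) + ennreal (- entropy_density a u x))"
        by (intro nn_integral_cong) (auto simp: abs_if ennreal_neg)
      also have "\<dots> = P + Q" unfolding P_def Q_def by (rule nn_integral_add) auto
      finally show "(LBNN x. ennreal (norm (entropy_density a u x))) < \<infinity>" using Pfin Qfin by simp
    qed simp
    have "entropy a u = ereal (entropy_int a u)" by (rule entropy_eq[OF ui])
    also have "(entropy_int a u) \<le> 2 * \<gamma> * ln E + K"
    proof -
      have dom: "(\<lambda>m. \<integral>x. entropy_density a (\<lambda>x. u x * cutoff (real (Suc m)) x) x \<partial>lborel) \<longlonglongrightarrow> (entropy_int a u)"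
      proof (rule integral_dominated_convergence[where w = "\<lambda>x. \<bar>entropy_density a u x\<bar> + hardy_weight a u x"])
        show "integrable lborel (\<lambda>x. \<bar>entropy_density a u x\<bar> + hardy_weight a u x)" using ui iu by auto
        show "AE x in lborel. (\<lambda>m. entropy_density a (\<lambda>x. u x * cutoff (real (Suc m)) x) x) \<longlonglongrightarrow> entropy_density a u x"
          using AE_lborel_singleton[of "0::'a"]
        proof eventually_elim
          case (elim x)
          have "(\<lambda>m. u x * cutoff (real (Suc m)) x) \<longlonglongrightarrow> u x * 1" by (intro tendsto_mult tendsto_const cutoff_tendsto_1[OF elim])
          thus ?case by (intro entropy_density_tendsto[OF elim, where v = "\<lambda>m x. u x * cutoff (real (Suc m)) x"]) simp
        qed
        fix m
        show "AE x in lborel. norm (entropy_density a (\<lambda>x. u x * cutoff (real (Suc m)) x) x) \<le> \<bar>entropy_density a u x\<bar> + hardy_weight a u x"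
          using AE_lborel_singleton[of "0::'a"]
        proof eventually_elim
          case (elim x)
          let ?c = "(cutoff (real (Suc m)) x)\<^sup>2"
          have c: "0 \<le> ?c" "?c \<le> 1" using cutoff_range[of "real (Suc m)" x] by (auto simp: power_le_one)
          have "\<bar>?c * entropy_density a u x\<bar> \<le> \<bar>entropy_density a u x\<bar>" using c by (simp add: abs_mult mult_left_le_one_le)
          moreover have "\<bar>?c * ln ?c * hardy_weight a u x\<bar> \<le> hardy_weight a u x"
            using abs_x_ln_x_le_1[OF c] hardy_weight_nonneg[of a u x] by (simp add: abs_mult mult_left_le_one_le)
          ultimately show ?case unfolding entropy_density_mult[OF elim] real_norm_def by linarith
        qed
      qed measurable
      have Nm1: "(\<lambda>m. Nm (real (Suc m))) \<longlonglongrightarrow> 1"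
      proof -
        have "(\<lambda>m. Nm (real (Suc m))) \<longlonglongrightarrow> (hardy_int a u)" unfolding Nm_def
        proof (rule integral_dominated_convergence[where w = "\<lambda>x. hardy_weight a u x"])
          show "AE x in lborel. (\<lambda>m. (cutoff (real (Suc m)) x)\<^sup>2 * hardy_weight a u x) \<longlonglongrightarrow> hardy_weight a u x"
            using AE_lborel_singleton[of "0::'a"]
          proof eventually_elim
            case (elim x)
            have "(\<lambda>m. (cutoff (real (Suc m)) x)\<^sup>2 * hardy_weight a u x) \<longlonglongrightarrow> 1\<^sup>2 * hardy_weight a u x"
              by (intro tendsto_intros cutoff_tendsto_1[OF elim])
            thus ?case by simp
          qed
          show "AE x in lborel. norm ((cutoff (real (Suc m)) x)\<^sup>2 * hardy_weight a u x) \<le> hardy_weight a u x" for m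
          proof (intro always_eventually allI)
            fix x :: 'a
            show "norm ((cutoff (real (Suc m)) x)\<^sup>2 * hardy_weight a u x) \<le> hardy_weight a u x"
              using cutoff_range[of "real (Suc m)" x] hardy_weight_nonneg[of a u x]
              by (simp add: abs_mult mult_left_le_one_le power_le_one)
          qed
        qed (use iu in measurable)
        thus ?thesis by (simp add: nu)
      qed
      define D where "D m = (1 + 1 / real (Suc m)) * E + (1 + 1 / (1 / real (Suc m))) * (C / real (Suc m))\<^sup>2" for m
      have "(\<lambda>m. 1 + 1 / real (Suc m)) \<longlonglongrightarrow> 1" by real_asymp
      moreover have "(\<lambda>m. (1 + 1 / (1 / real (Suc m))) / (real (Suc m))\<^sup>2) \<longlonglongrightarrow> 0" by real_asymp
      ultimately have "(\<lambda>m. (1 + 1 / real (Suc m)) * E + (1 + 1 / (1 / real (Suc m))) / (real (Suc m))\<^sup>2 * C\<^sup>2) \<longlonglongrightarrow> 1 * E + 0 * C\<^sup>2"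
        by (intro tendsto_intros)
      hence DE: "D \<longlonglongrightarrow> E" by (simp add: D_def[abs_def] power_divide)
      have lim: "(\<lambda>m. Nm (real (Suc m)) * (ln (Nm (real (Suc m))) + 2 * \<gamma> * ln (D m / Nm (real (Suc m))) + K)) \<longlonglongrightarrow>
        1 * (ln 1 + 2 * \<gamma> * ln (E / 1) + K)" using Epos by (intro tendsto_intros Nm1 DE) auto
      have "eventually (\<lambda>m. Nm (real (Suc m)) > 0) sequentially" using order_tendstoD(1)[OF Nm1, of 0] by simp
      hence "eventually (\<lambda>m. (entropy_int a (\<lambda>x. u x * cutoff (real (Suc m)) x)) \<le>
         Nm (real (Suc m)) * (ln (Nm (real (Suc m))) + 2 * \<gamma> * ln (D m / Nm (real (Suc m))) + K)) sequentially"
      proof eventually_elim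
        case (elim m)
        show ?case using cut(2)[of "real (Suc m)" "1 / real (Suc m)"] elim by (simp only: D_def) simp
      qed
      from tendsto_le[OF trivial_limit_sequentially lim dom this] show ?thesis by simp
    qed
    finally show ?thesis by (simp add: K_def)
  qed
qed

lemma normalized_iff: "normalized a u \<longleftrightarrow> (hardy_int a u) = 1" by (simp add: normalized_def hardy_weight_def)

lemma dirichlet_energy_eq: "dirichlet_energy a g = (energy_int a g)" by (simp add: dirichlet_energy_def energy_density_def)

lemma D12_WLH:
  fixes u :: "'a::euclidean_space \<Rightarrow> real"
  assumes D: "D12 a u g" and N: "normalized a u"
    and \<gamma>: "\<gamma> > 1 / 4" and \<Lambda>: "\<Lambda> > 0" "\<Lambda> \<le> (a_c DIM('a) - a)\<^sup>2" and ineq: "sphere_log_ineq TYPE('a) (2 * \<gamma> - 1 / 2) \<Lambda>"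
  shows "dirichlet_energy a g \<ge> \<Lambda>" "entropy a u \<le> ereal (2 * \<gamma> * ln (dirichlet_energy a g) + log_const TYPE('a) \<gamma> \<Lambda>)"
proof -
  have u: "u \<in> borel_measurable borel" using D by (simp add: D12_def)
  obtain \<phi> where \<phi>: "\<And>n. test_function (\<phi> n)" "integrable lborel (hardy_weight a u)"
    "(\<lambda>n. \<integral>x. \<bar>hardy_weight a (\<phi> n) x - hardy_weight a u x\<bar> \<partial>lborel) \<longlonglongrightarrow> 0"
    "(\<lambda>n. \<integral>x. energy_density a (gradient (\<phi> n)) x \<partial>lborel) \<longlonglongrightarrow> (energy_int a g)"
    "AE x in lborel. (\<lambda>n. \<phi> n x) \<longlonglongrightarrow> u x" using D12_sequence[OF D] by blast
  note W = WLH_limit[OF \<phi>(1) disjI1[OF ineq] u \<phi>(2) _ \<phi>(3) \<phi>(5) order_refl \<phi>(4) \<gamma> \<Lambda>]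
  show "dirichlet_energy a g \<ge> \<Lambda>" "entropy a u \<le> ereal (2 * \<gamma> * ln (dirichlet_energy a g) + log_const TYPE('a) \<gamma> \<Lambda>)"
    using W N by (simp_all add: normalized_iff dirichlet_energy_eq)
qed

lemma smooth_on_norm: "smooth_on (- {0}) (\<lambda>x::'a::euclidean_space. norm x)"
proof -
  have "smooth_on (- {0}) (\<lambda>x::'a. exp (ln (norm x)))" by (intro smooth_on_compose_real[OF _ _ _ smooth_on_exp smooth_on_ln_norm]) auto
  thus ?thesis by (rule smooth_on_cong[rotated]) auto
qed

lemma smooth_on_ray:
  fixes \<phi> :: "'a::euclidean_space \<Rightarrow> real"
  assumes \<phi>: "smooth_on (- {0}) \<phi>" and w: "w \<noteq> 0"
  shows "smooth_on (- {0}) (\<lambda>x::'a. \<phi> (norm x *\<^sub>R w))" unfolding smooth_on_def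
proof
  fix k
  show "Ck_on k (- {0}) (\<lambda>x::'a. \<phi> (norm x *\<^sub>R w))"
  proof (rule Ck_on_compose[where T = "- {0}" and f = \<phi> and F = "\<lambda>x::'a. norm x *\<^sub>R w"])
    fix b :: 'a
    have "smooth_on (- {0}) (\<lambda>x::'a. norm x * (w \<bullet> b))" by (intro smooth_on_mult smooth_on_const smooth_on_norm) auto
    thus "Ck_on k (- {0}) (\<lambda>x::'a. norm x *\<^sub>R w \<bullet> b)" by (simp add: smooth_on_def)
  qed (use \<phi> w in \<open>auto simp: smooth_on_def\<close>)
qed

lemma has_derivative_norm_inner:
  "x \<noteq> 0 \<Longrightarrow> ((\<lambda>x::'a::euclidean_space. norm x) has_derivative (\<lambda>h. h \<bullet> (x /\<^sub>R norm x))) (at x)"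
  using has_derivative_norm[of x] by (simp add: sgn_div_norm inner_commute)

lemma gradient_ray:
  fixes \<phi> :: "'a::euclidean_space \<Rightarrow> real"
  assumes \<phi>: "smooth_on (- {0}) \<phi>" and w: "w \<noteq> 0" and x: "x \<noteq> 0"
  shows "gradient (\<lambda>x::'a. \<phi> (norm x *\<^sub>R w)) x = (w \<bullet> gradient \<phi> (norm x *\<^sub>R w)) *\<^sub>R (x /\<^sub>R norm x)"
proof (rule gradient_unique)
  have d: "(\<phi> has_derivative (\<lambda>h. h \<bullet> gradient \<phi> (norm x *\<^sub>R w))) (at (norm x *\<^sub>R w))"
    by (rule smooth_on_gradient[of "- {0}"]) (use \<phi> w x in auto)
  have "((\<lambda>x. norm x *\<^sub>R w) has_derivative (\<lambda>h. (h \<bullet> (x /\<^sub>R norm x)) *\<^sub>R w)) (at x)"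
    by (rule has_derivative_scaleR_left[OF has_derivative_norm_inner[OF x]])
  from has_derivative_compose[OF this d]
  show "((\<lambda>x. \<phi> (norm x *\<^sub>R w)) has_derivative (\<lambda>h. h \<bullet> ((w \<bullet> gradient \<phi> (norm x *\<^sub>R w)) *\<^sub>R (x /\<^sub>R norm x)))) (at x)"
    by (simp add: mult_ac)
qed

lemma test_function_ray:
  fixes \<phi> :: "'a::euclidean_space \<Rightarrow> real"
  assumes \<phi>: "test_function \<phi>" and w: "norm w = 1"
  shows "test_function (\<lambda>x::'a. \<phi> (norm x *\<^sub>R w))"
proof -
  obtain L where L: "\<And>s w. norm w = 1 \<Longrightarrow> \<bar>s\<bar> > L \<Longrightarrow> exp s *\<^sub>R w \<notin> support \<phi>" using test_function_annulus[OF \<phi>] by metis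
  define m where "m = max L 1"
  have "(\<lambda>x::'a. \<phi> (norm x *\<^sub>R w)) = (\<lambda>x. \<phi> (norm x *\<^sub>R w) * cutoff m x)"
  proof
    fix x :: 'a
    show "\<phi> (norm x *\<^sub>R w) = \<phi> (norm x *\<^sub>R w) * cutoff m x"
  proof (cases "x = 0")
    case True
    have "\<phi> 0 = 0" using \<phi> gradient_zero_outside_support(1)[of 0 \<phi>] by (simp add: test_function_def)
    thus ?thesis using True by simp
  next
    case False
    show ?thesis
    proof (cases "\<bar>ln (norm x)\<bar> \<le> m")
      case True
      thus ?thesis using cutoff_eq_1[OF _ False True] by (simp add: m_def)
    next
      case F: False
      hence "exp (ln (norm x)) *\<^sub>R w \<notin> support \<phi>" by (intro L w) (auto simp: m_def)
      hence "\<phi> (norm x *\<^sub>R w) = 0" using gradient_zero_outside_support(1) False by simp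
      thus ?thesis by simp
    qed
  qed
  qed
  moreover have "w \<noteq> 0" using w by auto
  hence "test_function (\<lambda>x::'a. \<phi> (norm x *\<^sub>R w) * cutoff m x)"
    by (intro test_function_cutoff smooth_on_ray test_function_smooth(2)[OF \<phi>]) (auto simp: m_def)
  ultimately show ?thesis by (simp only:)
qed

lemma AE_cyl_polar:
  fixes P :: "'a::euclidean_space \<Rightarrow> bool"
  assumes "AE x in lborel. P x"
  shows "AE z in cyl. P (exp (fst z) *\<^sub>R snd z)"
proof -
  obtain N where N: "{x \<in> space lborel. \<not> P x} \<subseteq> N" "emeasure lborel N = 0" "N \<in> sets lborel" by (rule AE_E[OF assms])
  have [measurable]: "N \<in> sets borel" using N(3) by simp
  have "0 = (LBNN x. indicator N x)" using N(2,3) by simp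
  also have "\<dots> = (CYNN z. ennreal (sphere_area TYPE('a) * exp (real DIM('a) * fst z)) * indicator N (exp (fst z) *\<^sub>R snd z))"
    by (rule nn_integral_polar) measurable
  finally have "AE z in cyl. ennreal (sphere_area TYPE('a) * exp (real DIM('a) * fst z)) * indicator N (exp (fst z) *\<^sub>R snd z) = 0"
    by (subst (asm) eq_commute, subst (asm) nn_integral_0_iff_AE) auto
  thus ?thesis
  proof eventually_elim
    case (elim z)
    have "sphere_area TYPE('a) * exp (real DIM('a) * fst z) > 0" by (simp add: sphere_area_pos)
    hence "exp (fst z) *\<^sub>R snd z \<notin> N" using elim by (auto simp: indicator_def split: if_splits)
    thus ?case using N(1) by auto
  qed
qed

section \<open>Radial functions\<close>

lemma emeasure_usphere_UNIV: "emeasure (usphere :: 'a::euclidean_space measure) UNIV = 1"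
  using usphere.emeasure_space_1[where ?'a = 'a] by simp

lemma nn_integral_cyl_fst:
  assumes [measurable]: "f \<in> borel_measurable borel"
  shows "(\<integral>\<^sup>+z. f (fst z) \<partial>(cyl :: (real \<times> 'a::euclidean_space) measure)) = (LBNN s. f s)"
proof -
  have "(\<integral>\<^sup>+z. f (fst z) \<partial>(cyl :: (real \<times> 'a) measure)) = (LBNN s. (\<integral>\<^sup>+w. f s \<partial>(usphere :: 'a measure)))"
    using usphere.nn_integral_fst[of "\<lambda>z. f (fst z)" lborel, symmetric] by (simp add: emeasure_usphere_UNIV)
  thus ?thesis by (simp add: emeasure_usphere_UNIV)
qed

lemma exists_le_mean_usphere:
  fixes F :: "'a::euclidean_space \<Rightarrow> ennreal"
  assumes [measurable]: "F \<in> borel_measurable borel" and c: "(SPNN w. F w) \<le> ennreal c" "0 \<le> c" "c < c'"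
  obtains w where "norm w = 1" "F w \<le> ennreal c'"
proof (rule ccontr)
  assume "\<not> thesis"
  hence n: "ennreal c' \<le> F w" if "norm w = 1" for w using that \<open>\<not> thesis\<close> by (meson not_le less_imp_le \<open>\<And>w. norm w = 1 \<Longrightarrow> F w \<le> ennreal c' \<Longrightarrow> thesis\<close>)
  have "ennreal c' = (\<integral>\<^sup>+w. ennreal c' \<partial>(usphere :: 'a measure))" by (simp add: emeasure_usphere_UNIV)
  also have "\<dots> \<le> (SPNN w. F w)" by (rule nn_integral_mono_AE) (use AE_usphere_norm in \<open>eventually_elim, use n in auto\<close>)
  also have "\<dots> \<le> ennreal c" by (rule c(1))
  finally show False using c(2,3) by simp
qed

text \<open>A radial function is the limit of radial test functions whose energy does not exceed, in the
  limit, its own. Restricting a test function to a ray and rotating the ray around gives a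
  radial test function, and the restricted distances and energies average to at most the given
  ones; so a suitable ray serves both purposes.\<close>

lemma radial_approximation:
  fixes u :: "'a::euclidean_space \<Rightarrow> real"
  assumes D: "D12 a u g" and rad: "radially_symmetric u"
  obtains v e where "\<And>n. test_function (v n)" "\<And>n. radial_function (v n)"
    "(\<lambda>n. LBNN x. ennreal ((norm x powr (- (a + 1)) * \<bar>v n x - u x\<bar>)\<^sup>2)) \<longlonglongrightarrow> 0"
    "\<And>n. (energy_int a (gradient (v n))) \<le> e n" "e \<longlonglongrightarrow> dirichlet_energy a g"
proof -
  define d where "d = real DIM('a)"
  define S where "S = sphere_area TYPE('a)"
  have S: "S > 0" by (simp add: S_def sphere_area_pos)
  have [measurable]: "u \<in> borel_measurable borel" "g \<in> borel_measurable borel" using D by (auto simp: D12_def)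
  obtain \<phi> where t: "\<And>n. test_function (\<phi> n)" and
    c1: "(\<lambda>n. LBNN x. ennreal ((norm x powr (- a) * norm (gradient (\<phi> n) x - g x))\<^sup>2)) \<longlonglongrightarrow> 0" and
    c2: "(\<lambda>n. LBNN x. ennreal ((norm x powr (- (a + 1)) * \<bar>\<phi> n x - u x\<bar>)\<^sup>2)) \<longlonglongrightarrow> 0" using D unfolding D12_def by blast
  have [measurable]: "\<phi> n \<in> borel_measurable borel" "gradient (\<phi> n) \<in> borel_measurable borel" for n
    using test_function_smooth[OF t] by auto
  define \<epsilon> where "\<epsilon> n = (energy_int a (gradient (\<phi> n)))" for n
  have \<epsilon>: "\<epsilon> \<longlonglongrightarrow> dirichlet_energy a g"
    unfolding \<epsilon>_def[abs_def] dirichlet_energy_eq by (rule energy_density_convergence[OF t _ c1]) measurable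
  have \<epsilon>0: "\<epsilon> n \<ge> 0" for n unfolding \<epsilon>_def by (rule integral_nonneg_AE) (simp add: energy_density_nonneg)
  define \<Delta> where "\<Delta> n = (hardy_dist a (\<phi> n) u)" for n
  obtain n0 where n0: "\<And>n. n \<ge> n0 \<Longrightarrow> \<Delta> n < \<top>" using order_tendstoD(2)[OF c2, of \<top>] by (auto simp: eventually_sequentially \<Delta>_def)
  define \<delta> where "\<delta> n = enn2real (\<Delta> (n + n0))" for n
  have \<Delta>\<delta>: "\<Delta> (n + n0) = ennreal (\<delta> n)" for n using n0[of "n + n0"] by (simp add: \<delta>_def)
  have \<delta>0: "\<delta> n \<ge> 0" for n by (simp add: \<delta>_def)
  have "(\<lambda>n. \<Delta> (n + n0)) \<longlonglongrightarrow> 0" using LIMSEQ_ignore_initial_segment[OF c2, of n0] by (simp add: \<Delta>_def)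
  hence "(\<lambda>n. ennreal (\<delta> n)) \<longlonglongrightarrow> ennreal 0" by (simp add: \<Delta>\<delta>)
  hence \<delta>: "\<delta> \<longlonglongrightarrow> 0" by (rule tendsto_ennrealD) (auto simp: \<delta>0)
  define G where "G r = (SPINT w. u (r *\<^sub>R w))" for r :: real
  have Gm [measurable]: "G \<in> borel_measurable borel" unfolding G_def[abs_def] by measurable
  obtain f where f: "AE x in lborel. u x = f (norm x)" using rad by (auto simp: radially_symmetric_def)
  have uG: "AE z in cyl. u (exp (fst z) *\<^sub>R snd z) = G (exp (fst z))"
  proof -
    have "AE z in cyl. u (exp (fst z) *\<^sub>R snd z) = f (exp (fst z))" using AE_cyl_polar[OF f] AE_cyl_norm by eventually_elim simp
    hence "AE s in lborel. AE w in usphere. u (exp s *\<^sub>R w) = f (exp s)"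
      using cyl.AE_pair[of "\<lambda>z. u (exp (fst z) *\<^sub>R snd z) = f (exp (fst z))"] by simp
    hence "AE s in lborel. AE w in usphere. u (exp s *\<^sub>R w) = G (exp s)"
    proof eventually_elim
      case (elim s)
      have "G (exp s) = (\<integral>w. f (exp s) \<partial>(usphere :: 'a measure))" unfolding G_def by (rule integral_cong_AE) (use elim in auto)
      hence "G (exp s) = f (exp s)" by simp
      thus ?case using elim by simp
    qed
    moreover have "{z \<in> space cyl. u (exp (fst z) *\<^sub>R snd z) = G (exp (fst z))} \<in> sets cyl" by measurable
    ultimately show ?thesis by (intro cyl.AE_pair_measure) simp_all
  qed
  \<comment> \<open>The sum of energy and distance, the latter with the weight \<open>1/r\<close>, is averaged. As \<open>\<delta> \<le> r\<^sup>2\<close>, the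
    weighted mean distance \<open>\<delta>/r\<close> tends to zero although the weight tends to infinity.\<close>
  define r where "r n = sqrt (\<delta> n + 1 / real (Suc n))" for n
  define e where "e n = \<epsilon> (n + n0) + \<delta> n / r n + 1 / real (Suc n)" for n
  have r0: "r n > 0" for n unfolding r_def using \<delta>0[of n] by (simp add: add_nonneg_pos)
  have r: "r \<longlonglongrightarrow> 0"
  proof -
    have "(\<lambda>n. 1 / real (Suc n)) \<longlonglongrightarrow> 0" by real_asymp
    from tendsto_real_sqrt[OF tendsto_add[OF \<delta> this]] show ?thesis by (simp add: r_def[abs_def])
  qed
  have e: "e \<longlonglongrightarrow> dirichlet_energy a g"
  proof -
    have "(\<lambda>n. \<delta> n / r n) \<longlonglongrightarrow> 0"
    proof (rule tendsto_sandwich[OF _ _ tendsto_const r])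
      show "eventually (\<lambda>n. 0 \<le> \<delta> n / r n) sequentially" using \<delta>0 r0 by (auto intro!: always_eventually divide_nonneg_pos)
      have "\<delta> n \<le> r n * r n" for n using \<delta>0[of n] by (simp add: r_def add_nonneg_nonneg)
      thus "eventually (\<lambda>n. \<delta> n / r n \<le> r n) sequentially" using r0 by (auto intro!: always_eventually simp: divide_le_eq)
    qed
    moreover have "(\<lambda>n. 1 / real (Suc n)) \<longlonglongrightarrow> 0" by real_asymp
    ultimately have "(\<lambda>n. \<epsilon> (n + n0) + \<delta> n / r n + 1 / real (Suc n)) \<longlonglongrightarrow> dirichlet_energy a g + 0 + 0"
      by (intro tendsto_add LIMSEQ_ignore_initial_segment[OF \<epsilon>])
    thus ?thesis by (simp add: e_def[abs_def])
  qed
  define Ek where "Ek n s w = ennreal (S * exp (d * s)) * ennreal ((w \<bullet> gradient (\<phi> n) (exp s *\<^sub>R w))\<^sup>2 / exp s powr (2 * a))" for n s and w :: 'a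
  define Dk where "Dk n s w = ennreal (S * exp (d * s)) * ennreal ((exp s powr (- (a + 1)) * \<bar>\<phi> n (exp s *\<^sub>R w) - G (exp s)\<bar>)\<^sup>2)" for n s and w :: 'a
  have [measurable]: "(\<lambda>z. Ek n (fst z) (snd z)) \<in> borel_measurable borel" "(\<lambda>z. Dk n (fst z) (snd z)) \<in> borel_measurable borel" for n
    unfolding Ek_def Dk_def borel_prod[symmetric] by measurable
  have [measurable]: "(\<lambda>z. Ek n (fst z) (snd z)) \<in> borel_measurable cyl" "(\<lambda>z. Dk n (fst z) (snd z)) \<in> borel_measurable cyl" for n
    unfolding Ek_def Dk_def by measurable
  have [measurable]: "(\<lambda>s. Ek n s w) \<in> borel_measurable borel" "(\<lambda>s. Dk n s w) \<in> borel_measurable borel" for n w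
    unfolding Ek_def Dk_def by measurable
  define EE where "EE n w = (LBNN s. Ek n s w)" for n w
  define DD where "DD n w = (LBNN s. Dk n s w)" for n w
  have [measurable]: "EE n \<in> borel_measurable borel" "DD n \<in> borel_measurable borel" for n
    unfolding EE_def[abs_def] DD_def[abs_def] Ek_def Dk_def by measurable
  have EEi: "(SPNN w. EE n w) \<le> ennreal (\<epsilon> n)" for n
  proof -
    have "(SPNN w. EE n w) = (CYNN z. Ek n (fst z) (snd z))"
      unfolding EE_def using cyl.nn_integral_snd[of "\<lambda>z. Ek n (fst z) (snd z)"] by simp
    also have "\<dots> \<le> (CYNN z. ennreal (S * exp (d * fst z)) * ennreal (energy_density a (gradient (\<phi> n)) (exp (fst z) *\<^sub>R snd z)))"
    proof (rule nn_integral_mono_AE)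
      show "AE z in cyl. Ek n (fst z) (snd z) \<le> ennreal (S * exp (d * fst z)) * ennreal (energy_density a (gradient (\<phi> n)) (exp (fst z) *\<^sub>R snd z))"
        using AE_cyl_norm
      proof eventually_elim
        case (elim z)
        have "(snd z \<bullet> gradient (\<phi> n) (exp (fst z) *\<^sub>R snd z))\<^sup>2 \<le> (norm (gradient (\<phi> n) (exp (fst z) *\<^sub>R snd z)))\<^sup>2"
          using Cauchy_Schwarz_ineq2[of "snd z" "gradient (\<phi> n) (exp (fst z) *\<^sub>R snd z)"] elim
          by (intro abs_le_square_iff[THEN iffD1]) simp
        thus ?case unfolding Ek_def energy_density_def using elim by (intro mult_left_mono ennreal_leI) (auto intro: divide_right_mono)
      qed
    qed
    also have "\<dots> = (LBNN x. ennreal (energy_density a (gradient (\<phi> n)) x))"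
      unfolding S_def d_def by (rule nn_integral_polar[symmetric]) measurable
    also have "\<dots> = ennreal (\<epsilon> n)"
      unfolding \<epsilon>_def by (rule nn_integral_eq_integral[OF integrable_test_function(2)[OF t]]) (simp add: energy_density_nonneg)
    finally show ?thesis .
  qed
  have DDi: "(SPNN w. DD n w) = \<Delta> n" for n
  proof -
    have "(SPNN w. DD n w) = (CYNN z. Dk n (fst z) (snd z))"
      unfolding DD_def using cyl.nn_integral_snd[of "\<lambda>z. Dk n (fst z) (snd z)"] by simp
    also have "\<dots> = (CYNN z. ennreal (S * exp (d * fst z)) * ennreal ((norm (exp (fst z) *\<^sub>R snd z) powr (- (a + 1)) * \<bar>\<phi> n (exp (fst z) *\<^sub>R snd z) - u (exp (fst z) *\<^sub>R snd z)\<bar>)\<^sup>2))"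
      by (rule nn_integral_cong_AE) (use AE_cyl_norm uG in \<open>eventually_elim, simp add: Dk_def\<close>)
    also have "\<dots> = \<Delta> n" unfolding S_def d_def \<Delta>_def by (rule nn_integral_polar[symmetric]) measurable
    finally show ?thesis .
  qed
  have "\<exists>w. norm w = 1 \<and> EE (n + n0) w + ennreal (1 / r n) * DD (n + n0) w \<le> ennreal (e n)" for n
  proof -
    have "(SPNN w. EE (n + n0) w + ennreal (1 / r n) * DD (n + n0) w) \<le> ennreal (\<epsilon> (n + n0)) + ennreal (1 / r n) * ennreal (\<delta> n)"
      using EEi[of "n + n0"] DDi[of "n + n0"] by (simp add: nn_integral_add nn_integral_cmult \<Delta>\<delta>)
    also have "\<dots> = ennreal (\<epsilon> (n + n0) + \<delta> n / r n)"
      using \<epsilon>0[of "n + n0"] \<delta>0[of n] r0[of n] by (simp add: ennreal_mult'[symmetric] ennreal_plus[symmetric] del: ennreal_plus)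
    finally have le: "(SPNN w. EE (n + n0) w + ennreal (1 / r n) * DD (n + n0) w) \<le> ennreal (\<epsilon> (n + n0) + \<delta> n / r n)" .
    have m: "(\<lambda>w. EE (n + n0) w + ennreal (1 / r n) * DD (n + n0) w) \<in> borel_measurable borel" by measurable
    have "0 \<le> \<epsilon> (n + n0) + \<delta> n / r n" using \<epsilon>0[of "n + n0"] \<delta>0[of n] r0[of n] by simp
    moreover have "\<epsilon> (n + n0) + \<delta> n / r n < e n" by (simp add: e_def)
    ultimately show ?thesis using exists_le_mean_usphere[OF m le] by metis
  qed
  then obtain w where w: "\<And>n. norm (w n) = 1" and wn: "\<And>n. EE (n + n0) (w n) + ennreal (1 / r n) * DD (n + n0) (w n) \<le> ennreal (e n)" by metis
  define v where "v n x = \<phi> (n + n0) (norm x *\<^sub>R w n)" for n and x :: 'a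
  have e0: "e n \<ge> 0" for n unfolding e_def using \<epsilon>0[of "n + n0"] \<delta>0[of n] r0[of n] by (intro add_nonneg_nonneg) auto
  have tv: "test_function (v n)" for n unfolding v_def by (rule test_function_ray[OF t w])
  have [measurable]: "v n \<in> borel_measurable borel" "gradient (v n) \<in> borel_measurable borel" for n using test_function_smooth[OF tv] by auto
  have rv: "radial_function (v n)" for n by (auto simp: v_def radial_function_def)
  have "(LBNN x. ennreal (energy_density a (gradient (v n)) x)) = EE (n + n0) (w n)" for n
  proof -
    have "(LBNN x. ennreal (energy_density a (gradient (v n)) x)) =
      (CYNN z. ennreal (S * exp (d * fst z)) * ennreal (energy_density a (gradient (v n)) (exp (fst z) *\<^sub>R snd z)))"
      unfolding S_def d_def by (rule nn_integral_polar) measurable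
    also have "\<dots> = (\<integral>\<^sup>+z. Ek (n + n0) (fst z) (w n) \<partial>(cyl :: (real \<times> 'a) measure))"
    proof (rule nn_integral_cong_AE)
      show "AE z in cyl. ennreal (S * exp (d * fst z)) * ennreal (energy_density a (gradient (v n)) (exp (fst z) *\<^sub>R snd z)) = Ek (n + n0) (fst z) (w n)"
        using AE_cyl_norm
      proof eventually_elim
        case (elim z)
        have w0: "w n \<noteq> 0" using w[of n] by auto
        have x0: "exp (fst z) *\<^sub>R snd z \<noteq> 0" using elim by auto
        have "norm (gradient (v n) (exp (fst z) *\<^sub>R snd z)) = \<bar>w n \<bullet> gradient (\<phi> (n + n0)) (exp (fst z) *\<^sub>R w n)\<bar>"
          unfolding v_def gradient_ray[OF test_function_smooth(2)[OF t] w0 x0] using elim by simp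
        thus ?case using elim by (simp add: Ek_def energy_density_def)
      qed
    qed
    also have "\<dots> = EE (n + n0) (w n)" unfolding EE_def by (rule nn_integral_cyl_fst) measurable
    finally show ?thesis .
  qed
  moreover have "EE (n + n0) (w n) \<le> ennreal (e n)" for n using order_trans[OF _ wn[of n]] by simp
  moreover have "(LBNN x. ennreal (energy_density a (gradient (v n)) x)) = ennreal (energy_int a (gradient (v n)))" for n
    by (rule nn_integral_eq_integral[OF integrable_test_function(2)[OF tv]]) (simp add: energy_density_nonneg)
  ultimately have le: "ennreal (energy_int a (gradient (v n))) \<le> ennreal (e n)" for n by simp
  have ev: "(energy_int a (gradient (v n))) \<le> e n" for n by (rule ennreal_le_iff[OF e0, THEN iffD1, OF le])
  have vle: "(hardy_dist a (v n) u) \<le> ennreal (r n * e n)" for n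
  proof -
    have mm: "(\<lambda>x. ennreal ((norm x powr (- (a + 1)) * \<bar>v n x - u x\<bar>)\<^sup>2)) \<in> borel_measurable borel" by measurable
    have "(hardy_dist a (v n) u) =
      (CYNN z. ennreal (S * exp (d * fst z)) * ennreal ((norm (exp (fst z) *\<^sub>R snd z) powr (- (a + 1)) * \<bar>v n (exp (fst z) *\<^sub>R snd z) - u (exp (fst z) *\<^sub>R snd z)\<bar>)\<^sup>2))"
      unfolding S_def d_def by (rule nn_integral_polar[OF mm])
    also have "\<dots> = (\<integral>\<^sup>+z. Dk (n + n0) (fst z) (w n) \<partial>(cyl :: (real \<times> 'a) measure))"
      by (rule nn_integral_cong_AE) (use AE_cyl_norm uG in \<open>eventually_elim, simp add: Dk_def v_def\<close>)
    also have "\<dots> = DD (n + n0) (w n)" unfolding DD_def by (rule nn_integral_cyl_fst) measurable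
    also have "\<dots> = ennreal (r n) * (ennreal (1 / r n) * DD (n + n0) (w n))"
      using r0[of n] by (simp add: mult.assoc[symmetric] ennreal_mult'[symmetric])
    also have "\<dots> \<le> ennreal (r n) * ennreal (e n)"
      using order_trans[OF _ wn[of n], of "ennreal (1 / r n) * DD (n + n0) (w n)"] by (intro mult_left_mono) auto
    also have "\<dots> = ennreal (r n * e n)" using r0[of n] by (simp add: ennreal_mult')
    finally show ?thesis .
  qed
  have "(\<lambda>n. ennreal (r n * e n)) \<longlonglongrightarrow> ennreal (0 * dirichlet_energy a g)" by (intro tendsto_ennrealI tendsto_mult r e)
  hence "(\<lambda>n. ennreal (r n * e n)) \<longlonglongrightarrow> 0" by simp
  note rlim = this
  have cv: "(\<lambda>n. LBNN x. ennreal ((norm x powr (- (a + 1)) * \<bar>v n x - u x\<bar>)\<^sup>2)) \<longlonglongrightarrow> 0"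
  proof (rule tendsto_sandwich[OF _ _ tendsto_const rlim])
    show "eventually (\<lambda>n. (hardy_dist a (v n) u) \<le> ennreal (r n * e n)) sequentially" by (rule always_eventually) (rule allI, rule vle)
  qed simp
  show ?thesis by (rule that[OF tv rv cv ev e])
qed

text \<open>The approximating radial test functions have constant slices, for which the spherical estimate holds
  with \<open>\<Lambda> = (a\<^sub>c - a)\<^sup>2\<close> whatever the true range of \<open>\<Lambda>\<close> is.\<close>

lemma radial_WLH:
  fixes u :: "'a::euclidean_space \<Rightarrow> real"
  assumes D: "D12 a u g" and N: "normalized a u" and rad: "radially_symmetric u"
    and \<gamma>: "\<gamma> > 1 / 4" and a: "a < a_c DIM('a)"
  shows "entropy a u \<le> ereal (2 * \<gamma> * ln (dirichlet_energy a g) + log_const TYPE('a) \<gamma> ((a_c DIM('a) - a)\<^sup>2))"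
proof -
  have u: "u \<in> borel_measurable borel" using D by (simp add: D12_def)
  obtain v e where v: "\<And>n. test_function (v n)" "\<And>n. radial_function (v n)"
    "(\<lambda>n. LBNN x. ennreal ((norm x powr (- (a + 1)) * \<bar>v n x - u x\<bar>)\<^sup>2)) \<longlonglongrightarrow> 0"
    "\<And>n. (energy_int a (gradient (v n))) \<le> e n" "e \<longlonglongrightarrow> dirichlet_energy a g" using radial_approximation[OF D rad] by blast
  note H = hardy_weight_convergence[OF v(1) u v(3)]
  obtain r where r: "strict_mono r" "AE x in lborel. (\<lambda>n. v (r n) x) \<longlonglongrightarrow> u x" using H(3) by blast
  have c: "(\<lambda>n. \<integral>x. \<bar>hardy_weight a (v (r n)) x - hardy_weight a u x\<bar> \<partial>lborel) \<longlonglongrightarrow> 0"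
    using LIMSEQ_subseq_LIMSEQ[OF H(2) r(1)] by (simp add: o_def)
  have e: "(\<lambda>n. e (r n)) \<longlonglongrightarrow> dirichlet_energy a g" using LIMSEQ_subseq_LIMSEQ[OF v(5) r(1)] by (simp add: o_def)
  show ?thesis by (rule WLH_limit(2)[where v = "\<lambda>n. v (r n)", OF v(1) disjI2[OF v(2)] u H(1) _ c r(2) v(4) e \<gamma>])
      (use N a in \<open>auto simp: normalized_iff\<close>)
qed

section \<open>Product functions\<close>

lemma cyl_product:
  fixes f :: "real \<Rightarrow> real" and h :: "'a::euclidean_space \<Rightarrow> real"
  assumes f: "integrable lborel f" and h: "integrable usphere h"
  shows "integrable cyl (\<lambda>z. f (fst z) * h (snd z))"
    and "(CYINT z. f (fst z) * h (snd z)) = (LBINT s. f s) * (SPINT w. h w)"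
proof -
  have [measurable]: "f \<in> borel_measurable borel" "h \<in> borel_measurable usphere" using f h by auto
  show i: "integrable cyl (\<lambda>z. f (fst z) * h (snd z))"
  proof (rule cyl.Fubini_integrable)
    show "(\<lambda>z. f (fst z) * h (snd z)) \<in> borel_measurable cyl" by measurable
    have "integrable lborel (\<lambda>s. \<bar>f s\<bar> * (SPINT w. \<bar>h w\<bar>))" using f by auto
    thus "integrable lborel (\<lambda>s. SPINT w. norm (f (fst (s, w)) * h (snd (s, w))))" by (simp add: abs_mult)
    show "AE s in lborel. integrable usphere (\<lambda>w. f (fst (s, w)) * h (snd (s, w)))" using h by simp
  qed
  show "(CYINT z. f (fst z) * h (snd z)) = (LBINT s. f s) * (SPINT w. h w)" using cyl.integral_fst'[OF i] by simp
qed

lemma smooth_on_sphere_projection: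
  fixes \<psi> :: "'a::euclidean_space \<Rightarrow> real"
  assumes \<psi>: "smooth_on (- {0}) \<psi>"
  shows "smooth_on (- {0}) (\<lambda>x::'a. \<psi> (x /\<^sub>R norm x))" unfolding smooth_on_def
proof
  fix j
  have i: "smooth_on (- {0}) (\<lambda>x::'a. exp ((- 1) * ln (norm x)))"
    by (intro smooth_on_compose_real[OF _ _ _ smooth_on_exp] smooth_on_mult smooth_on_const smooth_on_ln_norm) auto
  show "Ck_on j (- {0}) (\<lambda>x::'a. \<psi> (x /\<^sub>R norm x))"
  proof (rule Ck_on_compose[where T = "- {0}" and f = \<psi> and F = "\<lambda>x::'a. x /\<^sub>R norm x"])
    fix b :: 'a
    have "smooth_on (- {0}) (\<lambda>x::'a. exp ((- 1) * ln (norm x)) * (x \<bullet> b))"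
      by (intro smooth_on_mult i smooth_on_linear bounded_linear_inner_left) auto
    hence "smooth_on (- {0}) (\<lambda>x::'a. (x /\<^sub>R norm x) \<bullet> b)" by (rule smooth_on_cong[rotated]) (auto simp: exp_minus)
    thus "Ck_on j (- {0}) (\<lambda>x::'a. (x /\<^sub>R norm x) \<bullet> b)" by (simp add: smooth_on_def)
  qed (use \<psi> in \<open>auto simp: smooth_on_def\<close>)
qed

lemma gradient_sphere_projection:
  fixes \<psi> :: "'a::euclidean_space \<Rightarrow> real"
  assumes \<psi>: "smooth_on (- {0}) \<psi>" and w: "norm w = 1" and r: "r > 0"
  shows "gradient (\<lambda>x::'a. \<psi> (x /\<^sub>R norm x)) (r *\<^sub>R w) = (1 / r) *\<^sub>R tgrad \<psi> w"
proof (rule gradient_unique)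
  let ?x = "r *\<^sub>R w"
  have nx: "norm ?x = r" and x0: "?x \<noteq> 0" using w r by auto
  have xw: "?x /\<^sub>R norm ?x = w" using nx r by simp
  have d: "(\<psi> has_derivative (\<lambda>h. h \<bullet> gradient \<psi> w)) (at (?x /\<^sub>R norm ?x))"
    unfolding xw by (rule smooth_on_gradient[of "- {0}"]) (use \<psi> w in auto)
  have dn: "((\<lambda>x::'a. norm x) has_derivative (\<lambda>h. h \<bullet> w)) (at ?x)" using has_derivative_norm_inner[OF x0] unfolding xw .
  have "((\<lambda>x::'a. inverse (norm x)) has_derivative (\<lambda>h. - (inverse r * (h \<bullet> w) * inverse r))) (at ?x)"
    using Deriv.has_derivative_inverse[OF _ dn] x0 w r by simp
  from has_derivative_scaleR[OF this has_derivative_ident]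
  have dF: "((\<lambda>x::'a. x /\<^sub>R norm x) has_derivative (\<lambda>h. inverse r *\<^sub>R h + (- (inverse r * (h \<bullet> w) * inverse r)) *\<^sub>R ?x)) (at ?x)"
    unfolding nx .
  have "(inverse r *\<^sub>R h + (- (inverse r * (h \<bullet> w) * inverse r)) *\<^sub>R ?x) \<bullet> gradient \<psi> w = h \<bullet> ((1 / r) *\<^sub>R tgrad \<psi> w)" for h
    using r by (simp add: tgrad_def inner_add_left inner_diff_left inner_diff_right field_simps)
  thus "((\<lambda>x::'a. \<psi> (x /\<^sub>R norm x)) has_derivative (\<lambda>h. h \<bullet> ((1 / r) *\<^sub>R tgrad \<psi> w))) (at ?x)"
    using has_derivative_compose[OF dF d] by simp
qed

lemma gaussian_moments:
  fixes \<tau> :: real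
  assumes "\<tau> > 0"
  defines "p \<equiv> normal_density 0 (sqrt \<tau>)"
  shows "integrable lborel p" "(LBINT s. p s) = 1"
    "integrable lborel (\<lambda>s. p s * s)" "(LBINT s. p s * s) = 0"
    "integrable lborel (\<lambda>s. p s * s\<^sup>2)" "(LBINT s. p s * s\<^sup>2) = \<tau>"
proof -
  have s: "0 < sqrt \<tau>" using assms by simp
  show "integrable lborel p" "(LBINT s. p s) = 1" using s by (auto simp: p_def)
  show "integrable lborel (\<lambda>s. p s * s)" "(LBINT s. p s * s) = 0"
    using integrable_normal_moment_nz_1[OF s, of 0] integral_normal_moment_nz_1[OF s, of 0] by (simp_all add: p_def)
  show "integrable lborel (\<lambda>s. p s * s\<^sup>2)" using integrable_normal_moment[OF s, of 0 2] by (simp add: p_def)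
  show "(LBINT s. p s * s\<^sup>2) = \<tau>" using integral_normal_moment_even[OF s, of 0 1] assms by (simp add: p_def)
qed

text \<open>The functions on the cylinder of the form \<open>sqrt p(s) \<psi>(w)\<close> with a Gaussian density \<open>p\<close>: among
  them are the optimizers of the radial problem, and by separation of variables they probe the
  spherical inequality.\<close>

definition product_function :: "real \<Rightarrow> real \<Rightarrow> ('a::euclidean_space \<Rightarrow> real) \<Rightarrow> 'a \<Rightarrow> real" where
  "product_function k \<tau> \<psi> x = sqrt (1 / (sphere_area TYPE('a) * sqrt (2 * pi * \<tau>))) *
     exp ((- k) * ln (norm x) + (- 1 / (4 * \<tau>)) * (ln (norm x) * ln (norm x))) * \<psi> (x /\<^sub>R norm x)"

lemma product_function:
  fixes \<psi> :: "'a::euclidean_space \<Rightarrow> real" and a \<tau> :: real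
  assumes \<psi>: "smooth_on (- {0}) \<psi>" and m: "(SPINT w. (\<psi> w)\<^sup>2) = 1" and \<tau>: "\<tau> > 0"
  defines "k \<equiv> a_c DIM('a) - a"
  defines "u \<equiv> product_function k \<tau> \<psi>"
  shows "D12 a u (gradient u)" "normalized a u"
    "dirichlet_energy a (gradient u) = 1 / (4 * \<tau>) + k\<^sup>2 + tangential_energy \<psi>"
    "entropy a u = ereal (- ln (2 * pi * \<tau>) / 2 - 1 / 2 + sphere_entropy \<psi> - ln (sphere_area TYPE('a)))"
proof -
  define S where "S = sphere_area TYPE('a)"
  have S: "S > 0" by (simp add: S_def sphere_area_pos)
  define p where "p = normal_density 0 (sqrt \<tau>)"
  note P = gaussian_moments[OF \<tau>, folded p_def]
  define c where "c = sqrt (1 / (S * sqrt (2 * pi * \<tau>)))"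
  have c2: "c\<^sup>2 = 1 / (S * sqrt (2 * pi * \<tau>))" using S \<tau> by (simp add: c_def)
  define \<eta> where "\<eta> s = c * exp ((- k) * s + (- 1 / (4 * \<tau>)) * (s * s))" for s
  define H where "H x = \<eta> (ln (norm x))" for x :: 'a
  have uH: "u = (\<lambda>x. H x * \<psi> (x /\<^sub>R norm x))" by (rule ext) (simp add: u_def product_function_def H_def \<eta>_def c_def S_def)
  have H: "smooth_on (- {0}) H" unfolding H_def[abs_def] \<eta>_def
    by (intro smooth_on_mult smooth_on_const smooth_on_compose_real[OF _ _ _ smooth_on_exp] smooth_on_add smooth_on_ln_norm) auto
  note \<psi>0 = smooth_on_sphere_projection[OF \<psi>]
  have u: "smooth_on (- {0}) u" unfolding uH by (intro smooth_on_mult H \<psi>0) auto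
  have [measurable]: "u \<in> borel_measurable borel" "gradient u \<in> borel_measurable borel" "\<psi> \<in> borel_measurable borel" "tgrad \<psi> \<in> borel_measurable borel"
    using u \<psi> borel_measurable_smooth borel_measurable_gradient borel_measurable_tgrad by blast+
  have d\<eta>: "(\<eta> has_real_derivative (- k - s / (2 * \<tau>)) * \<eta> s) (at s)" for s
    unfolding \<eta>_def using \<tau> by (auto intro!: derivative_eq_intros simp: field_simps)
  have gH: "gradient H (exp s *\<^sub>R w) = ((- k - s / (2 * \<tau>)) * \<eta> s / exp s) *\<^sub>R w" if w: "norm w = 1" for s and w :: 'a
  proof (rule gradient_unique)
    let ?x = "exp s *\<^sub>R w"
    have nx: "norm ?x = exp s" and x0: "?x \<noteq> 0" using w by auto
    have "((\<lambda>x::'a. norm x) has_derivative (\<lambda>h. h \<bullet> w)) (at ?x)" using has_derivative_norm_inner[OF x0] nx by simp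
    moreover have "(ln has_derivative (\<lambda>h. inverse (exp s) * h)) (at (norm ?x))"
      unfolding nx using DERIV_ln[OF exp_gt_zero[of s]] by (simp only: has_field_derivative_def)
    ultimately have "((\<lambda>x::'a. ln (norm x)) has_derivative (\<lambda>h. inverse (exp s) * (h \<bullet> w))) (at ?x)" by (rule has_derivative_compose)
    moreover have "(\<eta> has_derivative (*) ((- k - s / (2 * \<tau>)) * \<eta> s)) (at (ln (norm ?x)))"
      using d\<eta>[of s] by (simp add: has_field_derivative_def w)
    ultimately have "(H has_derivative (\<lambda>h. (- k - s / (2 * \<tau>)) * \<eta> s * (inverse (exp s) * (h \<bullet> w)))) (at ?x)"
      unfolding H_def[abs_def] by (rule has_derivative_compose)
    thus "(H has_derivative (\<lambda>h. h \<bullet> (((- k - s / (2 * \<tau>)) * \<eta> s / exp s) *\<^sub>R w))) (at ?x)"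
    proof (rule has_derivative_eq_rhs)
      show "(\<lambda>h. (- k - s / (2 * \<tau>)) * \<eta> s * (inverse (exp s) * (h \<bullet> w))) = (\<lambda>h. h \<bullet> (((- k - s / (2 * \<tau>)) * \<eta> s / exp s) *\<^sub>R w))"
        unfolding inner_scaleR_right divide_inverse mult.assoc ..
    qed
  qed
  have p\<eta>: "S * exp (2 * k * s) * (\<eta> s)\<^sup>2 = p s" for s
  proof -
    have "(\<eta> s)\<^sup>2 = c\<^sup>2 * exp (2 * ((- k) * s + (- 1 / (4 * \<tau>)) * (s * s)))" by (simp only: \<eta>_def power_mult_distrib exp_double)
    also have "2 * ((- k) * s + (- 1 / (4 * \<tau>)) * (s * s)) = - (2 * k * s) + - (s\<^sup>2 / (2 * \<tau>))"
      using \<tau> by (simp add: field_simps power2_eq_square)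
    also have "exp (- (2 * k * s) + - (s\<^sup>2 / (2 * \<tau>))) = exp (- (2 * k * s)) * exp (- (s\<^sup>2 / (2 * \<tau>)))" by (rule exp_add)
    finally have "S * exp (2 * k * s) * (\<eta> s)\<^sup>2 = (S * c\<^sup>2) * (exp (2 * k * s) * exp (- (2 * k * s))) * exp (- (s\<^sup>2 / (2 * \<tau>)))"
      by (simp only: mult_ac)
    also have "exp (2 * k * s) * exp (- (2 * k * s)) = 1" by (simp add: exp_minus)
    also have "S * c\<^sup>2 = 1 / sqrt (2 * pi * \<tau>)" using S by (simp add: c2)
    finally show ?thesis using \<tau> by (simp add: p_def normal_density_def)
  qed
  have pu: "S * exp (real DIM('a) * s) * hardy_weight a u (exp s *\<^sub>R w) = p s * (\<psi> w)\<^sup>2"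
    and W2: "(sqrt S * exp (k * s) * u (exp s *\<^sub>R w))\<^sup>2 = p s * (\<psi> w)\<^sup>2"
    if w: "norm w = 1" for s w
  proof -
    have "u (exp s *\<^sub>R w) = \<eta> s * \<psi> w" using w by (simp add: uH H_def)
    thus W: "(sqrt S * exp (k * s) * u (exp s *\<^sub>R w))\<^sup>2 = p s * (\<psi> w)\<^sup>2"
      using S by (simp add: power_mult_distrib exp_double[symmetric] p\<eta>[symmetric])
    show "S * exp (real DIM('a) * s) * hardy_weight a u (exp s *\<^sub>R w) = p s * (\<psi> w)\<^sup>2"
      using emden_fowler(1)[OF w, where a = a and u = u and s = s] W by (simp add: S_def k_def)
  qed
  have pe: "S * exp (real DIM('a) * s) * energy_density a (gradient u) (exp s *\<^sub>R w) =
     (p s * (k + s / (2 * \<tau>))\<^sup>2) * (\<psi> w)\<^sup>2 + p s * (norm (tgrad \<psi> w))\<^sup>2" if w: "norm w = 1" for s w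
  proof -
    have x0: "exp s *\<^sub>R w \<noteq> 0" using w by auto
    have "gradient u (exp s *\<^sub>R w) = \<psi> w *\<^sub>R (((- k - s / (2 * \<tau>)) * \<eta> s / exp s) *\<^sub>R w) + \<eta> s *\<^sub>R ((1 / exp s) *\<^sub>R tgrad \<psi> w)"
      unfolding uH gradient_mult[OF H \<psi>0 x0] gH[OF w] gradient_sphere_projection[OF \<psi> w exp_gt_zero] using w by (simp add: H_def)
    also have "\<dots> = (\<eta> s / exp s) *\<^sub>R ((\<psi> w * (- k - s / (2 * \<tau>))) *\<^sub>R w + tgrad \<psi> w)" by (simp add: scaleR_add_right mult_ac)
    finally have g: "gradient u (exp s *\<^sub>R w) = (\<eta> s / exp s) *\<^sub>R ((\<psi> w * (- k - s / (2 * \<tau>))) *\<^sub>R w + tgrad \<psi> w)" .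
    have orth: "w \<bullet> tgrad \<psi> w = 0" using w by (simp add: tgrad_def inner_diff_right norm_eq_1)
    have "orthogonal ((\<psi> w * (- k - s / (2 * \<tau>))) *\<^sub>R w) (tgrad \<psi> w)" by (simp add: orthogonal_def orth)
    from norm_add_Pythagorean[OF this]
    have "(norm ((\<psi> w * (- k - s / (2 * \<tau>))) *\<^sub>R w + tgrad \<psi> w))\<^sup>2 = (\<psi> w * (- k - s / (2 * \<tau>)))\<^sup>2 + (norm (tgrad \<psi> w))\<^sup>2"
      by (simp add: w)
    also have "(\<psi> w * (- k - s / (2 * \<tau>)))\<^sup>2 = (k + s / (2 * \<tau>))\<^sup>2 * (\<psi> w)\<^sup>2"
      using power2_minus[of "k + s / (2 * \<tau>)"] by (simp add: power_mult_distrib mult.commute)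
    finally have n: "(norm (gradient u (exp s *\<^sub>R w)))\<^sup>2 = (\<eta> s)\<^sup>2 / (exp s)\<^sup>2 * ((k + s / (2 * \<tau>))\<^sup>2 * (\<psi> w)\<^sup>2 + (norm (tgrad \<psi> w))\<^sup>2)"
      unfolding g by (simp add: power_mult_distrib power_divide)
    have e: "exp (real DIM('a) * s) / exp (2 * a * s) / (exp s)\<^sup>2 = exp (2 * k * s)"
      by (simp add: exp_diff[symmetric] exp_double[symmetric] k_def a_c_def field_simps)
    have "S * exp (real DIM('a) * s) * energy_density a (gradient u) (exp s *\<^sub>R w) =
      S * (exp (real DIM('a) * s) / exp (2 * a * s) / (exp s)\<^sup>2) * (\<eta> s)\<^sup>2 * ((k + s / (2 * \<tau>))\<^sup>2 * (\<psi> w)\<^sup>2 + (norm (tgrad \<psi> w))\<^sup>2)"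
      unfolding energy_density_def n using w by (simp add: powr_def mult_ac)
    also have "\<dots> = p s * ((k + s / (2 * \<tau>))\<^sup>2 * (\<psi> w)\<^sup>2 + (norm (tgrad \<psi> w))\<^sup>2)" unfolding e p\<eta> ..
    finally show ?thesis by (simp add: distrib_left)
  qed
  have pen: "S * exp (real DIM('a) * s) * entropy_density a u (exp s *\<^sub>R w) =
     (p s * (- ln (2 * pi * \<tau>) / 2 - ln S - s\<^sup>2 / (2 * \<tau>))) * (\<psi> w)\<^sup>2 + p s * ((\<psi> w)\<^sup>2 * ln ((\<psi> w)\<^sup>2))" if w: "norm w = 1" for s w
  proof -
    have p0: "p s > 0" using \<tau> by (simp add: p_def normal_density_pos)
    have lp: "ln (p s) = - ln (2 * pi * \<tau>) / 2 - s\<^sup>2 / (2 * \<tau>)"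
    proof -
      have "p s = exp (- s\<^sup>2 / (2 * \<tau>)) / sqrt (2 * pi * \<tau>)" using \<tau> by (simp add: p_def normal_density_def)
      moreover have "sqrt (2 * pi * \<tau>) > 0" using \<tau> by simp
      ultimately have "ln (p s) = ln (exp (- s\<^sup>2 / (2 * \<tau>))) - ln (sqrt (2 * pi * \<tau>))" by (simp add: ln_div)
      thus ?thesis using \<tau> by (simp add: ln_sqrt)
    qed
    have e: "p s * (\<psi> w)\<^sup>2 * ln (p s * (\<psi> w)\<^sup>2) = p s * ln (p s) * (\<psi> w)\<^sup>2 + p s * ((\<psi> w)\<^sup>2 * ln ((\<psi> w)\<^sup>2))"
    proof (cases "\<psi> w = 0")
      case False
      hence "ln (p s * (\<psi> w)\<^sup>2) = ln (p s) + ln ((\<psi> w)\<^sup>2)" by (intro ln_mult_pos p0) simp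
      thus ?thesis by (simp add: algebra_simps)
    qed simp
    have "S * exp (real DIM('a) * s) * entropy_density a u (exp s *\<^sub>R w) = p s * (\<psi> w)\<^sup>2 * ln (p s * (\<psi> w)\<^sup>2) - ln S * (p s * (\<psi> w)\<^sup>2)"
      using emden_fowler(2)[OF w, where a = a and u = u and s = s] by (simp only: S_def[symmetric] k_def[symmetric] W2[OF w])
    thus ?thesis unfolding e lp by (simp add: algebra_simps)
  qed
  have i\<psi>: "integrable usphere (\<lambda>w. (\<psi> w)\<^sup>2)" "integrable usphere (\<lambda>w. (norm (tgrad \<psi> w))\<^sup>2)" "integrable usphere (\<lambda>w. (\<psi> w)\<^sup>2 * ln ((\<psi> w)\<^sup>2))"
    using integrable_sphere_square[OF \<psi>] integrable_sphere_tgrad[OF \<psi>] integrable_sphere_entropy[OF \<psi>] by auto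
  have q1: "integrable lborel (\<lambda>s. p s * (k + s / (2 * \<tau>))\<^sup>2)" "(LBINT s. p s * (k + s / (2 * \<tau>))\<^sup>2) = k\<^sup>2 + 1 / (4 * \<tau>)"
  proof -
    have e: "p s * (k + s / (2 * \<tau>))\<^sup>2 = k\<^sup>2 * p s + (k / \<tau>) * (p s * s) + (1 / (4 * \<tau>\<^sup>2)) * (p s * s\<^sup>2)" for s
      using \<tau> by (simp add: power2_eq_square field_simps)
    show "integrable lborel (\<lambda>s. p s * (k + s / (2 * \<tau>))\<^sup>2)" unfolding e using P by auto
    have "1 / (4 * \<tau>\<^sup>2) * \<tau> = 1 / (4 * \<tau>)" using \<tau> by (simp add: power2_eq_square)
    thus "(LBINT s. p s * (k + s / (2 * \<tau>))\<^sup>2) = k\<^sup>2 + 1 / (4 * \<tau>)" unfolding e using P by simp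
  qed
  have q2: "integrable lborel (\<lambda>s. p s * (- ln (2 * pi * \<tau>) / 2 - ln S - s\<^sup>2 / (2 * \<tau>)))"
    "(LBINT s. p s * (- ln (2 * pi * \<tau>) / 2 - ln S - s\<^sup>2 / (2 * \<tau>))) = - ln (2 * pi * \<tau>) / 2 - ln S - 1 / 2"
  proof -
    have e: "p s * (- ln (2 * pi * \<tau>) / 2 - ln S - s\<^sup>2 / (2 * \<tau>)) = (- ln (2 * pi * \<tau>) / 2 - ln S) * p s - (1 / (2 * \<tau>)) * (p s * s\<^sup>2)" for s
      by (simp add: algebra_simps)
    show "integrable lborel (\<lambda>s. p s * (- ln (2 * pi * \<tau>) / 2 - ln S - s\<^sup>2 / (2 * \<tau>)))" unfolding e using P by auto
    show "(LBINT s. p s * (- ln (2 * pi * \<tau>) / 2 - ln S - s\<^sup>2 / (2 * \<tau>))) = - ln (2 * pi * \<tau>) / 2 - ln S - 1 / 2"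
      unfolding e using P \<tau> by simp
  qed
  note C1 = cyl_product[OF P(1) i\<psi>(1)]
  note C2 = cyl_product[OF q1(1) i\<psi>(1)] cyl_product[OF P(1) i\<psi>(2)]
  note C3 = cyl_product[OF q2(1) i\<psi>(1)] cyl_product[OF P(1) i\<psi>(3)]
  have transfer: "integrable lborel F \<and> (LBINT x. F x) = (CYINT z. G z)"
    if [measurable]: "F \<in> borel_measurable borel" and G: "integrable cyl G"
      and eq: "\<And>s w. norm w = 1 \<Longrightarrow> S * exp (real DIM('a) * s) * F (exp s *\<^sub>R w) = G (s, w)" for F :: "'a \<Rightarrow> real" and G
  proof -
    have ae: "AE z in cyl. G z = sphere_area TYPE('a) * exp (real DIM('a) * fst z) * F (exp (fst z) *\<^sub>R snd z)" using AE_cyl_norm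
    proof eventually_elim
      case (elim z)
      show ?case using eq[OF elim, of "fst z"] by (simp add: S_def)
    qed
    have [measurable]: "G \<in> borel_measurable cyl" using G by simp
    show ?thesis unfolding integrable_polar[OF that(1)] integral_polar[OF that(1)]
      using integrable_cong_AE_imp[OF G _ ae] integral_cong_AE[OF _ _ ae] by simp
  qed
  have h: "integrable lborel (hardy_weight a u)" "(hardy_int a u) = 1"
    using transfer[OF _ C1(1), of "hardy_weight a u"] C1(2) P(2) m pu by auto
  show "normalized a u" using h(2) by (simp add: normalized_iff)
  have "integrable lborel (energy_density a (gradient u)) \<and> (energy_int a (gradient u)) =
     (CYINT z. (p (fst z) * (k + fst z / (2 * \<tau>))\<^sup>2) * (\<psi> (snd z))\<^sup>2 + p (fst z) * (norm (tgrad \<psi> (snd z)))\<^sup>2)"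
    by (rule transfer) (use C2 pe in auto)
  moreover have "(CYINT z. (p (fst z) * (k + fst z / (2 * \<tau>))\<^sup>2) * (\<psi> (snd z))\<^sup>2 + p (fst z) * (norm (tgrad \<psi> (snd z)))\<^sup>2) =
     1 / (4 * \<tau>) + k\<^sup>2 + tangential_energy \<psi>" using C2 q1(2) P(2) m by (simp add: tangential_energy_def)
  ultimately have en: "integrable lborel (energy_density a (gradient u))"
    "(energy_int a (gradient u)) = 1 / (4 * \<tau>) + k\<^sup>2 + tangential_energy \<psi>" by auto
  show "D12 a u (gradient u)" by (rule D12_intro[OF u h(1) en(1)])
  show "dirichlet_energy a (gradient u) = 1 / (4 * \<tau>) + k\<^sup>2 + tangential_energy \<psi>" using en(2) by (simp add: dirichlet_energy_eq)
  have "integrable lborel (entropy_density a u) \<and> (entropy_int a u) =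
     (CYINT z. (p (fst z) * (- ln (2 * pi * \<tau>) / 2 - ln S - (fst z)\<^sup>2 / (2 * \<tau>))) * (\<psi> (snd z))\<^sup>2 + p (fst z) * ((\<psi> (snd z))\<^sup>2 * ln ((\<psi> (snd z))\<^sup>2)))"
    by (rule transfer) (use C3 pen in auto)
  moreover have "(CYINT z. (p (fst z) * (- ln (2 * pi * \<tau>) / 2 - ln S - (fst z)\<^sup>2 / (2 * \<tau>))) * (\<psi> (snd z))\<^sup>2 + p (fst z) * ((\<psi> (snd z))\<^sup>2 * ln ((\<psi> (snd z))\<^sup>2))) =
     - ln (2 * pi * \<tau>) / 2 - ln S - 1 / 2 + sphere_entropy \<psi>" using C3 q2(2) P(2) m by (simp add: sphere_entropy_def)
  ultimately have "integrable lborel (entropy_density a u)" "(entropy_int a u) = - ln (2 * pi * \<tau>) / 2 - ln S - 1 / 2 + sphere_entropy \<psi>" by auto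
  thus "entropy a u = ereal (- ln (2 * pi * \<tau>) / 2 - 1 / 2 + sphere_entropy \<psi> - ln (sphere_area TYPE('a)))"
    by (simp add: entropy_eq S_def)
qed

text \<open>For given \<open>\<psi>\<close> the optimal variance is \<open>\<gamma>\<close> divided by the energy. It turns the entropy of the
  product function into the radial constant plus the deficit of the spherical inequality.\<close>

lemma optimal_product_function:
  fixes \<psi> :: "'a::euclidean_space \<Rightarrow> real" and a \<gamma> :: real
  assumes \<psi>: "smooth_on (- {0}) \<psi>" and m: "(SPINT w. (\<psi> w)\<^sup>2) = 1"
    and \<gamma>: "\<gamma> > 1 / 4" and a: "a < a_c DIM('a)"
  defines "\<alpha> \<equiv> 2 * \<gamma> - 1 / 2"
  defines "\<Lambda> \<equiv> (a_c DIM('a) - a)\<^sup>2"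
  defines "E \<equiv> (\<Lambda> + tangential_energy \<psi>) * (2 * \<gamma> / \<alpha>)"
  defines "u \<equiv> product_function (a_c DIM('a) - a) (\<gamma> / E) \<psi>"
  shows "E > 0" "D12 a u (gradient u)" "normalized a u" "dirichlet_energy a (gradient u) = E"
    "entropy a u = ereal (2 * \<gamma> * ln E + log_const TYPE('a) \<gamma> \<Lambda> + (sphere_entropy \<psi> - \<alpha> * ln (1 + tangential_energy \<psi> / \<Lambda>)))"
proof -
  define b where "b = tangential_energy \<psi>"
  have b: "b \<ge> 0" by (simp add: b_def tangential_energy_nonneg)
  have \<alpha>: "\<alpha> > 0" using \<gamma> by (simp add: \<alpha>_def)
  have \<Lambda>: "\<Lambda> > 0" using a by (simp add: \<Lambda>_def)
  show E: "E > 0" unfolding E_def b_def[symmetric] using b \<alpha> \<Lambda> \<gamma> by (intro mult_pos_pos divide_pos_pos add_pos_nonneg) auto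
  have \<tau>: "\<gamma> / E > 0" using E \<gamma> by simp
  note P = product_function[OF \<psi> m \<tau>, of a, folded u_def]
  show "D12 a u (gradient u)" "normalized a u" by (rule P)+
  have "\<Lambda> + b = E * (\<alpha> / (2 * \<gamma>))" using \<alpha> \<gamma> by (simp add: E_def b_def)
  moreover have "1 / (4 * (\<gamma> / E)) = E / (4 * \<gamma>)" using E \<gamma> by simp
  moreover have "E / (4 * \<gamma>) + E * (\<alpha> / (2 * \<gamma>)) = E" using \<gamma> by (simp add: \<alpha>_def field_simps)
  ultimately show "dirichlet_energy a (gradient u) = E" using P(3) by (simp add: \<Lambda>_def b_def)
  have l1: "ln (2 * pi * (\<gamma> / E)) = ln (2 * pi * \<gamma>) - ln E" using E \<gamma> by (simp add: ln_div)
  have "1 + b / \<Lambda> = E * (\<alpha> / (2 * \<gamma> * \<Lambda>))" using \<alpha> \<gamma> \<Lambda> by (simp add: E_def b_def field_simps)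
  moreover have "\<alpha> / (2 * \<gamma> * \<Lambda>) > 0" using \<alpha> \<gamma> \<Lambda> by simp
  ultimately have l2: "ln (1 + b / \<Lambda>) = ln E + ln (\<alpha> / (2 * \<gamma> * \<Lambda>))" using E by (simp only: ln_mult_pos)
  have g2: "2 * \<gamma> * ln E = \<alpha> * ln E + ln E / 2" by (simp add: \<alpha>_def algebra_simps)
  have alg: "- (L - l) / 2 - 1 / 2 + e - s = \<alpha> * l + l / 2 + (- 1 / 2 - L / 2 + \<alpha> * Q - s) + (e - \<alpha> * (l + Q))" for L l e s Q
    by (simp add: distrib_left diff_divide_distrib)
  show "entropy a u = ereal (2 * \<gamma> * ln E + log_const TYPE('a) \<gamma> \<Lambda> + (sphere_entropy \<psi> - \<alpha> * ln (1 + tangential_energy \<psi> / \<Lambda>)))"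
    unfolding P(4) l1 b_def[symmetric] l2 g2 log_const_def \<alpha>_def[symmetric] by (rule arg_cong[where f = ereal, OF alg])
qed

section \<open>The critical parameter of the spherical inequality\<close>

lemma distr_usphere_uminus: "distr usphere borel uminus = (usphere :: 'a::euclidean_space measure)"
proof (rule measure_eqI)
  have "density (distr lborel borel (\<lambda>x::'a. 0 + (- 1) *\<^sub>R x)) (\<lambda>_. ennreal (\<bar>- 1\<bar> ^ DIM('a))) = distr lborel borel uminus"
    by (simp add: density_1)
  from trans[OF this[symmetric] lborel_affine[of "- 1" "0::'a", symmetric]]
  have sym: "distr lborel borel uminus = (lborel :: 'a measure)" by simp
  fix A assume "A \<in> sets (distr usphere borel (uminus :: 'a \<Rightarrow> 'a))"
  hence A [measurable]: "A \<in> sets borel" by simp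
  let ?F = "\<lambda>x::'a. indicator A (sgn x) * indicator (cball 0 1) x :: ennreal"
  have "emeasure (distr usphere borel uminus) A = (SPNN w. indicator A (- w))"
    by (subst nn_integral_indicator[symmetric], simp, subst nn_integral_distr) auto
  also have "\<dots> = (LBNN x. ?F (- x)) / ball_vol TYPE('a)"
    by (subst nn_integral_usphere) (auto simp: sgn_minus indicator_def intro!: arg_cong2[where f = divide] nn_integral_cong)
  also have "(LBNN x. ?F (- x)) = (\<integral>\<^sup>+x. ?F x \<partial>distr lborel borel uminus)" by (rule nn_integral_distr[symmetric]) measurable
  also have "\<dots> = (LBNN x. ?F x)" by (simp only: sym)
  also have "\<dots> / ball_vol TYPE('a) = (SPNN w. indicator A w)" by (subst nn_integral_usphere) auto
  finally show "emeasure (distr usphere borel uminus) A = emeasure usphere A" by simp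
qed simp

lemma integral_usphere_linear: "(SPINT w. w \<bullet> (e::'a::euclidean_space)) = 0"
proof -
  have "(SPINT w. w \<bullet> e) = (\<integral>w. w \<bullet> e \<partial>distr usphere borel (uminus :: 'a \<Rightarrow> 'a))" by (simp only: distr_usphere_uminus)
  also have "\<dots> = (SPINT w. (- w) \<bullet> e)" by (rule integral_distr) auto
  finally show ?thesis by simp
qed

lemma exists_coordinate_mean_square:
  obtains e :: "'a::euclidean_space" where "e \<in> Basis" "1 / real DIM('a) \<le> (SPINT w. (w \<bullet> e)\<^sup>2)"
proof -
  have i: "integrable usphere (\<lambda>w::'a. (w \<bullet> b)\<^sup>2)" for b by (rule integrable_usphere) (auto intro!: continuous_intros)
  have "(\<Sum>b\<in>Basis. \<integral>w. (w \<bullet> b)\<^sup>2 \<partial>(usphere :: 'a measure)) = (\<integral>w. (\<Sum>b\<in>Basis. (w \<bullet> b)\<^sup>2) \<partial>(usphere :: 'a measure))"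
    by (rule Bochner_Integration.integral_sum[symmetric]) (rule i)
  also have "\<dots> = (\<integral>w. 1 \<partial>(usphere :: 'a measure))"
  proof (rule integral_cong_AE)
    show "AE w in usphere. (\<Sum>b\<in>Basis. (w \<bullet> b)\<^sup>2) = (1::real)" using AE_usphere_norm
    proof eventually_elim
      case (elim w)
      have "w \<bullet> w = 1" using elim by (simp add: norm_eq_1)
      thus ?case unfolding euclidean_inner[of w w] by (simp add: power2_eq_square)
    qed
  qed auto
  finally have s: "(\<Sum>b\<in>Basis. \<integral>w. (w \<bullet> b)\<^sup>2 \<partial>(usphere :: 'a measure)) = 1" by simp
  have "\<exists>e\<in>Basis. 1 / real DIM('a) \<le> (\<integral>w. (w \<bullet> e)\<^sup>2 \<partial>(usphere :: 'a measure))"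
  proof (rule ccontr)
    assume "\<not> (\<exists>e\<in>Basis. 1 / real DIM('a) \<le> (\<integral>w. (w \<bullet> e)\<^sup>2 \<partial>(usphere :: 'a measure)))"
    hence "(\<Sum>b\<in>Basis. \<integral>w. (w \<bullet> b)\<^sup>2 \<partial>(usphere :: 'a measure)) < (\<Sum>b\<in>(Basis::'a set). 1 / real DIM('a))"
      by (intro sum_strict_mono) (auto simp: not_le)
    thus False using s by simp
  qed
  thus ?thesis using that by blast
qed

text \<open>Testing with \<open>1 + \<epsilon> w\<^sub>i\<close>: with \<open>v\<close> the mean of \<open>w\<^sub>i\<^sup>2\<close>, the excess entropy is \<open>2 \<epsilon>\<^sup>2 v\<close> up to higher
  order and the energy is \<open>\<epsilon>\<^sup>2 (1 - v)\<close>, which is at most \<open>(d - 1) \<epsilon>\<^sup>2 v\<close> for a coordinate with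
  \<open>v \<ge> 1/d\<close>.\<close>

lemma sphere_log_ineq_le:
  assumes \<alpha>: "\<alpha> > 0" and \<Lambda>: "\<Lambda> > 0" and ineq: "sphere_log_ineq TYPE('a::euclidean_space) \<alpha> \<Lambda>"
  shows "\<Lambda> \<le> (real DIM('a) - 1) * \<alpha> / 2"
proof -
  obtain e :: 'a where e: "e \<in> Basis" "1 / real DIM('a) \<le> (SPINT w. (w \<bullet> e)\<^sup>2)" by (rule exists_coordinate_mean_square)
  define v where "v = (\<integral>w. (w \<bullet> e)\<^sup>2 \<partial>(usphere :: 'a measure))"
  have i: "integrable usphere (\<lambda>w::'a. (w \<bullet> e)\<^sup>2)" "integrable usphere (\<lambda>w::'a. w \<bullet> e)"
    by (rule integrable_usphere; auto intro!: continuous_intros)+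
  have we: "\<bar>w \<bullet> e\<bar> \<le> 1" if "norm w = 1" for w using Cauchy_Schwarz_ineq2[of w e] that e(1) by simp
  have v0: "v > 0" "1 \<le> v * real DIM('a)" using e(2) by (auto simp: v_def[symmetric] divide_le_eq mult.commute intro: less_le_trans[of 0 "1 / real DIM('a)"])
  have v1: "v \<le> 1"
  proof -
    have "v \<le> (\<integral>w. 1 \<partial>(usphere :: 'a measure))" unfolding v_def
    proof (rule integral_mono_AE)
      show "AE w in usphere. (w \<bullet> e)\<^sup>2 \<le> (1::real)" using AE_usphere_norm by eventually_elim (use we in \<open>simp add: abs_square_le_1\<close>)
    qed (use i in auto)
    thus ?thesis by simp
  qed
  have main: "2 * v \<le> \<alpha> * (1 - v) / \<Lambda> + 2 * \<eta>" if \<eta>: "0 < \<eta>" "\<eta> \<le> 1" for \<eta>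
  proof -
    have "((\<lambda>t::real. (2 * (1 + t)^2 * ln (1 + t) - 2 * t - 3 * t^2) / t^2) \<longlongrightarrow> 0) (at 0)" by real_asymp
    hence "eventually (\<lambda>t::real. dist ((2 * (1 + t)^2 * ln (1 + t) - 2 * t - 3 * t^2) / t^2) 0 < \<eta>) (at 0)"
      by (rule tendstoD) (rule \<eta>(1))
    then obtain \<delta> where \<delta>: "\<delta> > 0" "\<And>t. t \<noteq> 0 \<Longrightarrow> \<bar>t\<bar> < \<delta> \<Longrightarrow> \<bar>(2 * (1 + t)^2 * ln (1 + t) - 2 * t - 3 * t^2) / t^2\<bar> < \<eta>"
      unfolding eventually_at by (auto simp: dist_real_def)
    have g: "2 * t + (3 - \<eta>) * t\<^sup>2 \<le> 2 * (1 + t)\<^sup>2 * ln (1 + t)" if "\<bar>t\<bar> < \<delta>" for t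
    proof (cases "t = 0")
      case False
      hence "- \<eta> \<le> (2 * (1 + t)^2 * ln (1 + t) - 2 * t - 3 * t^2) / t^2" using \<delta>(2)[OF False that] by linarith
      moreover have "t\<^sup>2 > 0" using False by simp
      ultimately have "- \<eta> * t\<^sup>2 \<le> 2 * (1 + t)^2 * ln (1 + t) - 2 * t - 3 * t^2" by (simp only: pos_le_divide_eq)
      thus ?thesis by (simp add: left_diff_distrib)
    qed simp
    define \<epsilon> where "\<epsilon> = min (\<delta> / 2) (\<eta> / 2)"
    have \<epsilon>: "\<epsilon> > 0" "\<epsilon> < \<delta>" "\<epsilon> < 1" "\<epsilon> \<le> \<eta>" using \<delta>(1) \<eta> by (auto simp: \<epsilon>_def min_def)
    have \<epsilon>2: "\<epsilon>\<^sup>2 \<le> \<eta>" using mult_mono[of \<epsilon> 1 \<epsilon> \<eta>] \<epsilon> by (simp add: power2_eq_square)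
    define \<psi> where "\<psi> w = \<epsilon> * (w \<bullet> e) + 1" for w :: 'a
    have \<psi>: "smooth_on (- {0}) \<psi>" unfolding \<psi>_def
      by (intro smooth_on_add smooth_on_mult smooth_on_const smooth_on_linear bounded_linear_inner_left) auto
    have gr: "gradient \<psi> w = \<epsilon> *\<^sub>R e" for w by (rule gradient_unique) (auto simp: \<psi>_def[abs_def] intro!: derivative_eq_intros)
    define m where "m = (SPINT w. (\<psi> w)\<^sup>2)"
    have m: "m = 1 + \<epsilon>\<^sup>2 * v"
    proof -
      have "(\<psi> w)\<^sup>2 = \<epsilon>\<^sup>2 * (w \<bullet> e)\<^sup>2 + 2 * \<epsilon> * (w \<bullet> e) + 1" for w by (simp add: \<psi>_def power2_eq_square algebra_simps)
      thus ?thesis using i by (simp add: m_def v_def integral_usphere_linear)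
    qed
    have b: "tangential_energy \<psi> = \<epsilon>\<^sup>2 * (1 - v)"
    proof -
      have "tangential_energy \<psi> = (SPINT w. \<epsilon>\<^sup>2 * (1 - (w \<bullet> e)\<^sup>2))" unfolding tangential_energy_def
      proof (rule integral_cong_AE)
        show "(\<lambda>w. (norm (tgrad \<psi> w))\<^sup>2) \<in> borel_measurable usphere" using borel_measurable_tgrad[OF \<psi>] by measurable
        show "AE w in usphere. (norm (tgrad \<psi> w))\<^sup>2 = \<epsilon>\<^sup>2 * (1 - (w \<bullet> e)\<^sup>2)" using AE_usphere_norm
          by eventually_elim (use e(1) in \<open>simp add: norm_tgrad_sq gr power_mult_distrib right_diff_distrib\<close>)
      qed auto
      thus ?thesis using i by (simp add: v_def)
    qed
    have "(3 - \<eta>) * (\<epsilon>\<^sup>2 * v) = (\<integral>w. 2 * (\<epsilon> * (w \<bullet> e)) + (3 - \<eta>) * (\<epsilon> * (w \<bullet> e))\<^sup>2 \<partial>(usphere :: 'a measure))"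
      using i by (simp add: power_mult_distrib v_def integral_usphere_linear)
    also have "\<dots> \<le> sphere_entropy \<psi>" unfolding sphere_entropy_def
    proof (rule integral_mono_AE)
      show "integrable usphere (\<lambda>w. 2 * (\<epsilon> * (w \<bullet> e)) + (3 - \<eta>) * (\<epsilon> * (w \<bullet> e))\<^sup>2)" using i by (simp add: power_mult_distrib)
      show "integrable usphere (\<lambda>w. (\<psi> w)\<^sup>2 * ln ((\<psi> w)\<^sup>2))" by (rule integrable_sphere_entropy[OF \<psi>])
      show "AE w in usphere. 2 * (\<epsilon> * (w \<bullet> e)) + (3 - \<eta>) * (\<epsilon> * (w \<bullet> e))\<^sup>2 \<le> (\<psi> w)\<^sup>2 * ln ((\<psi> w)\<^sup>2)" using AE_usphere_norm
      proof eventually_elim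
        case (elim w)
        have t: "\<bar>\<epsilon> * (w \<bullet> e)\<bar> \<le> \<epsilon>" using we[OF elim] \<epsilon>(1) by (simp add: abs_mult mult_left_le)
        hence p: "1 + \<epsilon> * (w \<bullet> e) > 0" using \<epsilon>(3) by linarith
        have "(\<psi> w)\<^sup>2 * ln ((\<psi> w)\<^sup>2) = 2 * (1 + \<epsilon> * (w \<bullet> e))\<^sup>2 * ln (1 + \<epsilon> * (w \<bullet> e))"
          using p by (simp add: \<psi>_def ln_realpow add.commute)
        thus ?case using g[of "\<epsilon> * (w \<bullet> e)"] t \<epsilon>(2) by linarith
      qed
    qed
    also have "\<dots> \<le> m * ln m + \<alpha> * (m * (ln (\<Lambda> / \<Lambda>) + \<Lambda> / \<Lambda> - 1) + tangential_energy \<psi> / \<Lambda>)"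
      by (rule sphere_log_ineq_linear[OF ineq \<alpha> \<Lambda> \<Lambda> \<psi> m_def])
    also have "\<dots> = m * ln m + \<epsilon>\<^sup>2 * (\<alpha> * (1 - v) / \<Lambda>)" using \<Lambda> by (simp add: b)
    also have "m * ln m \<le> m * (m - 1)" using m v0 by (intro mult_left_mono ln_le_minus_one) (auto simp: add_pos_nonneg)
    also have "m * (m - 1) = \<epsilon>\<^sup>2 * (v + \<epsilon>\<^sup>2 * v\<^sup>2)" by (simp add: m algebra_simps power2_eq_square)
    finally have "\<epsilon>\<^sup>2 * ((3 - \<eta>) * v) \<le> \<epsilon>\<^sup>2 * (v + \<epsilon>\<^sup>2 * v\<^sup>2 + \<alpha> * (1 - v) / \<Lambda>)" by (simp add: algebra_simps)
    hence "(3 - \<eta>) * v \<le> v + \<epsilon>\<^sup>2 * v\<^sup>2 + \<alpha> * (1 - v) / \<Lambda>" using \<epsilon>(1) by (simp only: mult_le_cancel_left_pos zero_less_power)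
    moreover have "\<epsilon>\<^sup>2 * v\<^sup>2 \<le> \<eta> * 1" using \<epsilon>2 v0 v1 \<eta> by (intro mult_mono) (auto simp: power_le_one)
    moreover have "\<eta> * v \<le> \<eta>" using \<eta> v1 by (simp add: mult_left_le)
    ultimately show ?thesis by (simp add: left_diff_distrib)
  qed
  have "2 * v \<le> \<alpha> * (1 - v) / \<Lambda>"
  proof (rule field_le_epsilon)
    fix x :: real assume "x > 0"
    thus "2 * v \<le> \<alpha> * (1 - v) / \<Lambda> + x" using main[of "x / 2"] main[of 1] by (cases "x \<le> 2") auto
  qed
  hence "2 * v * \<Lambda> \<le> \<alpha> * (1 - v)" using \<Lambda> by (simp add: pos_le_divide_eq)
  also have "\<dots> \<le> \<alpha> * (v * (real DIM('a) - 1))" using v0 \<alpha> by (intro mult_left_mono) (auto simp: right_diff_distrib)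
  finally have "v * (2 * \<Lambda>) \<le> v * (\<alpha> * (real DIM('a) - 1))" by (simp add: mult_ac)
  thus ?thesis using v0 by (simp add: mult.commute)
qed

lemma sphere_log_ineq_mono:
  assumes ineq: "sphere_log_ineq TYPE('a::euclidean_space) \<alpha> \<Lambda>" and \<Lambda>: "0 < \<Lambda>'" "\<Lambda>' \<le> \<Lambda>" and \<alpha>: "0 \<le> \<alpha>" "\<alpha> \<le> \<alpha>'"
  shows "sphere_log_ineq TYPE('a) \<alpha>' \<Lambda>'" unfolding sphere_log_ineq_def
proof (intro allI impI)
  fix \<psi> :: "'a \<Rightarrow> real" assume \<psi>: "smooth_on (- {0}) \<psi> \<and> (SPINT w. (\<psi> w)\<^sup>2) = 1"
  define b where "b = tangential_energy \<psi>"
  have b: "b \<ge> 0" by (simp add: b_def tangential_energy_nonneg)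
  have "b / \<Lambda> \<le> b / \<Lambda>'" using b \<Lambda> by (simp add: divide_left_mono)
  moreover have "0 \<le> b / \<Lambda>" using b \<Lambda> by simp
  ultimately have l: "0 \<le> ln (1 + b / \<Lambda>)" "ln (1 + b / \<Lambda>) \<le> ln (1 + b / \<Lambda>')" by auto
  have "sphere_entropy \<psi> \<le> \<alpha> * ln (1 + b / \<Lambda>)" using ineq \<psi> by (simp add: sphere_log_ineq_def b_def)
  also have "\<dots> \<le> \<alpha>' * ln (1 + b / \<Lambda>')" using l \<alpha> by (intro mult_mono) auto
  finally show "sphere_entropy \<psi> \<le> \<alpha>' * ln (1 + tangential_energy \<psi> / \<Lambda>')" by (simp add: b_def)
qed

lemma sphere_log_ineq_closed:
  assumes ineq: "\<And>n::nat. sphere_log_ineq TYPE('a::euclidean_space) (A n) (L n)"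
    and A: "A \<longlonglongrightarrow> \<alpha>" and L: "L \<longlonglongrightarrow> \<Lambda>" and \<Lambda>: "\<Lambda> > 0"
  shows "sphere_log_ineq TYPE('a) \<alpha> \<Lambda>" unfolding sphere_log_ineq_def
proof (intro allI impI)
  fix \<psi> :: "'a \<Rightarrow> real" assume \<psi>: "smooth_on (- {0}) \<psi> \<and> (SPINT w. (\<psi> w)\<^sup>2) = 1"
  have p: "1 + tangential_energy \<psi> / \<Lambda> > 0" using \<Lambda> tangential_energy_nonneg[of \<psi>] by (simp add: add_pos_nonneg)
  have "(\<lambda>n. A n * ln (1 + tangential_energy \<psi> / L n)) \<longlonglongrightarrow> \<alpha> * ln (1 + tangential_energy \<psi> / \<Lambda>)"
    by (intro tendsto_intros A L) (use \<Lambda> p in auto)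
  thus "sphere_entropy \<psi> \<le> \<alpha> * ln (1 + tangential_energy \<psi> / \<Lambda>)"
    by (rule LIMSEQ_le_const) (use ineq \<psi> in \<open>auto simp: sphere_log_ineq_def\<close>)
qed

definition critical_parameter :: "'a::euclidean_space itself \<Rightarrow> real \<Rightarrow> real" where
  "critical_parameter T \<alpha> = Sup {\<Lambda>. \<Lambda> > 0 \<and> sphere_log_ineq T \<alpha> \<Lambda>}"

context
  assumes dim: "DIM('a::euclidean_space) \<ge> 2"
begin

lemma critical_parameter:
  assumes \<alpha>: "\<alpha> > (real DIM('a) - 1) / 2"
  shows "critical_parameter TYPE('a) \<alpha> > 0" "sphere_log_ineq TYPE('a) \<alpha> (critical_parameter TYPE('a) \<alpha>)"
    "critical_parameter TYPE('a) \<alpha> \<le> (real DIM('a) - 1) * \<alpha> / 2"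
    "\<And>\<Lambda>. \<Lambda> > 0 \<Longrightarrow> sphere_log_ineq TYPE('a) \<alpha> \<Lambda> \<Longrightarrow> \<Lambda> \<le> critical_parameter TYPE('a) \<alpha>"
proof -
  let ?G = "{\<Lambda>. \<Lambda> > 0 \<and> sphere_log_ineq TYPE('a) \<alpha> \<Lambda>}" and ?L = "critical_parameter TYPE('a) \<alpha>"
  have \<alpha>0: "\<alpha> > 0" using \<alpha> dim by simp
  obtain \<Lambda>0 where \<Lambda>0: "\<Lambda>0 > 0" "sphere_log_ineq TYPE('a) \<alpha> \<Lambda>0" by (rule sphere_log_ineq_exists[OF dim \<alpha>])
  have ne: "?G \<noteq> {}" using \<Lambda>0 by blast
  have ub: "\<Lambda> \<le> (real DIM('a) - 1) * \<alpha> / 2" if "\<Lambda> \<in> ?G" for \<Lambda> using sphere_log_ineq_le[OF \<alpha>0, of \<Lambda>] that by blast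
  have bdd: "bdd_above ?G" using ub by (rule bdd_aboveI)
  show "?L \<le> (real DIM('a) - 1) * \<alpha> / 2" unfolding critical_parameter_def by (rule cSup_least[OF ne ub])
  show up: "\<Lambda> \<le> ?L" if "\<Lambda> > 0" "sphere_log_ineq TYPE('a) \<alpha> \<Lambda>" for \<Lambda>
    unfolding critical_parameter_def by (rule cSup_upper[OF _ bdd]) (use that in blast)
  show pos: "?L > 0" using up[OF \<Lambda>0] \<Lambda>0(1) by simp
  have "sphere_log_ineq TYPE('a) \<alpha> (?L * (1 - 1 / real (n + 2)))" for n
  proof -
    have "0 < 1 - 1 / real (n + 2)" by simp
    hence r: "0 < ?L * (1 - 1 / real (n + 2))" using pos by (simp only: mult_pos_pos)
    have "?L * (1 - 1 / real (n + 2)) < ?L * 1" using pos by (intro mult_strict_left_mono) auto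
    hence "?L * (1 - 1 / real (n + 2)) < Sup ?G" by (simp add: critical_parameter_def)
    then obtain \<Lambda> where "\<Lambda> \<in> ?G" "?L * (1 - 1 / real (n + 2)) < \<Lambda>" by (rule less_cSupE[OF _ ne])
    thus ?thesis using sphere_log_ineq_mono[of \<alpha> \<Lambda> "?L * (1 - 1 / real (n + 2))" \<alpha>] r \<alpha>0 by auto
  qed
  moreover have "(\<lambda>n. ?L * (1 - 1 / real (n + 2))) \<longlonglongrightarrow> ?L * (1 - 0)"
  proof -
    have "(\<lambda>n. 1 / real (n + 2)) \<longlonglongrightarrow> 0" by real_asymp
    thus ?thesis by (intro tendsto_intros)
  qed
  hence "(\<lambda>n. ?L * (1 - 1 / real (n + 2))) \<longlonglongrightarrow> ?L" by simp
  ultimately show "sphere_log_ineq TYPE('a) \<alpha> ?L" by (rule sphere_log_ineq_closed[OF _ tendsto_const _ pos])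
qed

text \<open>Lower semicontinuity from the left. For bounded energies the room between \<open>\<Lambda>\<close> and the
  critical parameter lets \<open>\<alpha>\<close> shrink a little; for large energies the parameter \<open>\<Lambda>\<close> hardly
  matters, and the inequality with a smaller exponent and some other parameter takes over.\<close>

lemma sphere_log_ineq_smaller_exponent:
  assumes \<alpha>: "\<alpha> > (real DIM('a) - 1) / 2" and \<Lambda>: "0 < \<Lambda>" "\<Lambda> < critical_parameter TYPE('a) \<alpha>"
  obtains \<alpha>' where "(real DIM('a) - 1) / 2 < \<alpha>'" "\<alpha>' < \<alpha>" "sphere_log_ineq TYPE('a) \<alpha>' \<Lambda>"
proof -
  define L where "L = critical_parameter TYPE('a) \<alpha>"
  note ineqL = critical_parameter(2)[OF \<alpha>, folded L_def]
  define \<alpha>2 where "\<alpha>2 = (\<alpha> + (real DIM('a) - 1) / 2) / 2"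
  have \<alpha>2: "\<alpha>2 > (real DIM('a) - 1) / 2" "\<alpha>2 < \<alpha>" "\<alpha>2 > 0"
  proof -
    define c where "c = (real DIM('a) - 1) / 2"
    have "0 < c" "c < \<alpha>" using dim \<alpha> by (simp_all add: c_def)
    hence "c < (\<alpha> + c) / 2" "(\<alpha> + c) / 2 < \<alpha>" "(\<alpha> + c) / 2 > 0" by simp_all
    thus "\<alpha>2 > (real DIM('a) - 1) / 2" "\<alpha>2 < \<alpha>" "\<alpha>2 > 0" by (simp_all only: c_def \<alpha>2_def)
  qed
  obtain \<Lambda>1 where \<Lambda>1: "\<Lambda>1 > 0" "sphere_log_ineq TYPE('a) \<alpha>2 \<Lambda>1" by (rule sphere_log_ineq_exists[OF dim \<alpha>2(1)])
  define \<Lambda>2 where "\<Lambda>2 = min \<Lambda>1 \<Lambda>"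
  have \<Lambda>2: "\<Lambda>2 > 0" "\<Lambda>2 \<le> \<Lambda>" using \<Lambda>1 \<Lambda> by (auto simp: \<Lambda>2_def)
  have ineq2: "sphere_log_ineq TYPE('a) \<alpha>2 \<Lambda>2" by (rule sphere_log_ineq_mono[OF \<Lambda>1(2)]) (use \<Lambda>1 \<Lambda> \<alpha>2 in \<open>auto simp: \<Lambda>2_def\<close>)
  define c where "c = ln (\<Lambda> / \<Lambda>2)"
  have c: "c \<ge> 0" using \<Lambda>2 by (simp add: c_def)
  define \<alpha>3 where "\<alpha>3 = (\<alpha> + \<alpha>2) / 2"
  have \<alpha>3: "\<alpha>2 < \<alpha>3" "\<alpha>3 < \<alpha>" using \<alpha>2 by (auto simp: \<alpha>3_def)
  \<comment> \<open>beyond the energy \<open>B\<close> the exponent \<open>\<alpha>3\<close> compensates the change from \<open>\<Lambda>2\<close> to \<open>\<Lambda>\<close>\<close>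
  define B where "B = \<Lambda> * exp (\<alpha>2 * c / (\<alpha>3 - \<alpha>2))"
  have B: "B > 0" using \<Lambda> by (simp add: B_def)
  define r where "r = L / \<Lambda>"
  have r: "r > 1" using \<Lambda> by (simp add: r_def L_def)
  define Y where "Y = B / L"
  have L0: "L > 0" using \<Lambda> by (simp add: L_def)
  have Y: "Y \<ge> 0" using B L0 by (simp add: Y_def)
  \<comment> \<open>by concavity \<open>(1 + \<kappa>) ln (1 + y) \<le> ln (1 + r y)\<close> for \<open>0 \<le> y \<le> Y\<close>, that is, up to the energy \<open>B\<close>\<close>
  define \<kappa> where "\<kappa> = (r - 1) / (1 + r * Y)"
  have \<kappa>: "\<kappa> > 0" using r Y by (simp add: \<kappa>_def add_pos_nonneg)
  define \<alpha>' where "\<alpha>' = max \<alpha>3 (\<alpha> / (1 + \<kappa>))"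
  have \<alpha>0: "\<alpha> > 0" using \<alpha>2 by simp
  have \<alpha>': "\<alpha>3 \<le> \<alpha>'" "\<alpha> / (1 + \<kappa>) \<le> \<alpha>'" "\<alpha>' < \<alpha>" using \<alpha>3 \<kappa> \<alpha>0 by (auto simp: \<alpha>'_def divide_less_eq)
  have "sphere_log_ineq TYPE('a) \<alpha>' \<Lambda>" unfolding sphere_log_ineq_def
  proof (intro allI impI)
    fix \<psi> :: "'a \<Rightarrow> real" assume \<psi>: "smooth_on (- {0}) \<psi> \<and> (SPINT w. (\<psi> w)\<^sup>2) = 1"
    define b where "b = tangential_energy \<psi>"
    have b: "b \<ge> 0" by (simp add: b_def tangential_energy_nonneg)
    have e1: "sphere_entropy \<psi> \<le> \<alpha> * ln (1 + b / L)" using ineqL \<psi> by (simp add: sphere_log_ineq_def b_def)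
    have e2: "sphere_entropy \<psi> \<le> \<alpha>2 * ln (1 + b / \<Lambda>2)" using ineq2 \<psi> by (simp add: sphere_log_ineq_def b_def)
    define l where "l = ln (1 + b / \<Lambda>)"
    have l0: "l \<ge> 0" using b \<Lambda> by (simp add: l_def)
    have "sphere_entropy \<psi> \<le> \<alpha>' * l"
    proof (cases "b \<ge> B")
      case True
      have "1 + b / \<Lambda>2 \<le> (\<Lambda> / \<Lambda>2) * (1 + b / \<Lambda>)" using \<Lambda>2 \<Lambda> b by (simp add: field_simps)
      hence "ln (1 + b / \<Lambda>2) \<le> ln ((\<Lambda> / \<Lambda>2) * (1 + b / \<Lambda>))" using b \<Lambda>2 \<Lambda> by (intro ln_mono) (auto simp: add_pos_nonneg)
      also have "\<dots> = c + l" unfolding c_def l_def using \<Lambda> \<Lambda>2 b by (intro ln_mult_pos) (auto simp: add_pos_nonneg)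
      finally have s: "sphere_entropy \<psi> \<le> \<alpha>2 * (c + l)" using e2 \<alpha>2(3) by (meson mult_left_mono less_imp_le order_trans)
      have "exp (\<alpha>2 * c / (\<alpha>3 - \<alpha>2)) \<le> b / \<Lambda>" using True \<Lambda> by (simp add: B_def pos_le_divide_eq mult.commute)
      hence "exp (\<alpha>2 * c / (\<alpha>3 - \<alpha>2)) \<le> 1 + b / \<Lambda>" by simp
      hence "ln (exp (\<alpha>2 * c / (\<alpha>3 - \<alpha>2))) \<le> l" unfolding l_def by (intro ln_mono) auto
      hence "\<alpha>2 * c \<le> l * (\<alpha>3 - \<alpha>2)" using \<alpha>3 by (simp add: pos_divide_le_eq)
      hence "\<alpha>2 * (c + l) \<le> \<alpha>3 * l" by (simp add: algebra_simps)
      also have "\<dots> \<le> \<alpha>' * l" using \<alpha>'(1) l0 by (rule mult_right_mono)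
      finally show ?thesis using s by simp
    next
      case False
      define y where "y = b / L"
      have y: "0 \<le> y" "y \<le> Y" using b L0 False by (auto simp: y_def Y_def divide_right_mono)
      have ry: "b / \<Lambda> = r * y" using L0 \<Lambda> by (simp add: r_def y_def)
      have yp: "1 + y > 0" "1 + r * y > 0" using y r by (auto simp: add_pos_nonneg)
      have "\<kappa> * ln (1 + y) \<le> \<kappa> * y" using \<kappa> y ln_le_minus_one[of "1 + y"] by (intro mult_left_mono) auto
      also have "\<kappa> * y \<le> (r - 1) * y / (1 + r * y)"
      proof -
        have "\<kappa> \<le> (r - 1) / (1 + r * y)" unfolding \<kappa>_def using r y yp
          by (intro divide_left_mono mult_pos_pos) (auto simp: add_pos_nonneg mult_left_mono)
        from mult_right_mono[OF this y(1)] show ?thesis by simp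
      qed
      also have "\<dots> = 1 - 1 / ((1 + r * y) / (1 + y))" using yp by (simp add: field_simps)
      also have "\<dots> \<le> ln ((1 + r * y) / (1 + y))" using yp by (intro one_minus_inverse_le_ln) simp
      also have "\<dots> = l - ln (1 + y)" using yp by (simp add: ln_div l_def ry)
      finally have "(1 + \<kappa>) * ln (1 + y) \<le> l" by (simp add: distrib_right)
      hence "\<alpha> / (1 + \<kappa>) * ((1 + \<kappa>) * ln (1 + y)) \<le> \<alpha> / (1 + \<kappa>) * l" using \<alpha>0 \<kappa> by (intro mult_left_mono) auto
      hence "\<alpha> * ln (1 + y) \<le> \<alpha> / (1 + \<kappa>) * l" using \<kappa> by simp
      also have "\<dots> \<le> \<alpha>' * l" using \<alpha>'(2) l0 by (rule mult_right_mono)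
      finally show ?thesis using e1 by (simp add: y_def)
    qed
    thus "sphere_entropy \<psi> \<le> \<alpha>' * ln (1 + tangential_energy \<psi> / \<Lambda>)" by (simp add: l_def b_def)
  qed
  thus ?thesis using that[of \<alpha>'] \<alpha>' \<alpha>2 \<alpha>3 by simp
qed

lemma critical_parameter_mono:
  assumes "(real DIM('a) - 1) / 2 < \<alpha>" "\<alpha> \<le> \<alpha>'"
  shows "critical_parameter TYPE('a) \<alpha> \<le> critical_parameter TYPE('a) \<alpha>'"
proof (rule critical_parameter(4))
  show "sphere_log_ineq TYPE('a) \<alpha>' (critical_parameter TYPE('a) \<alpha>)"
    by (rule sphere_log_ineq_mono[OF critical_parameter(2)[OF assms(1)]])
       (use assms dim critical_parameter(1)[OF assms(1)] in auto)
qed (use assms critical_parameter(1)[OF assms(1)] in auto)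

lemma continuous_critical_parameter:
  "continuous_on {(real DIM('a) - 1) / 2<..} (critical_parameter TYPE('a))"
proof -
  have "isCont (critical_parameter TYPE('a)) \<alpha>" if \<alpha>: "\<alpha> > (real DIM('a) - 1) / 2" for \<alpha> unfolding isCont_def
  proof (rule order_tendstoI)
    fix y assume y: "y < critical_parameter TYPE('a) \<alpha>"
    define \<Lambda> where "\<Lambda> = max ((y + critical_parameter TYPE('a) \<alpha>) / 2) (critical_parameter TYPE('a) \<alpha> / 2)"
    have \<Lambda>: "0 < \<Lambda>" "\<Lambda> < critical_parameter TYPE('a) \<alpha>" "y < \<Lambda>"
      using y critical_parameter(1)[OF \<alpha>] by (auto simp: \<Lambda>_def less_max_iff_disj)
    obtain \<alpha>' where \<alpha>': "(real DIM('a) - 1) / 2 < \<alpha>'" "\<alpha>' < \<alpha>" "sphere_log_ineq TYPE('a) \<alpha>' \<Lambda>"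
      by (rule sphere_log_ineq_smaller_exponent[OF \<alpha> \<Lambda>(1,2)])
    have "eventually (\<lambda>x. \<alpha>' < x) (at \<alpha>)" by (rule order_tendstoD(1)[OF tendsto_ident_at \<alpha>'(2)])
    thus "eventually (\<lambda>x. y < critical_parameter TYPE('a) x) (at \<alpha>)"
    proof eventually_elim
      case (elim x)
      have "y < \<Lambda>" by (rule \<Lambda>)
      also have "\<Lambda> \<le> critical_parameter TYPE('a) \<alpha>'" by (rule critical_parameter(4)[OF \<alpha>'(1) \<Lambda>(1) \<alpha>'(3)])
      also have "\<dots> \<le> critical_parameter TYPE('a) x" using elim \<alpha>' by (intro critical_parameter_mono) auto
      finally show ?case .
    qed
  next
    fix y assume y: "critical_parameter TYPE('a) \<alpha> < y"
    have "\<exists>n::nat. critical_parameter TYPE('a) (\<alpha> + 1 / real (Suc n)) < y"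
    proof (rule ccontr)
      assume "\<not> ?thesis"
      hence ge: "y \<le> critical_parameter TYPE('a) (\<alpha> + 1 / real (Suc n))" for n by (auto simp: not_less)
      have y0: "y > 0" using y critical_parameter(1)[OF \<alpha>] by simp
      have "sphere_log_ineq TYPE('a) (\<alpha> + 1 / real (Suc n)) y" for n
      proof -
        have a: "(real DIM('a) - 1) / 2 < \<alpha> + 1 / real (Suc n)" using \<alpha> by (simp add: add_strict_increasing2 less_le_trans)
        show ?thesis by (rule sphere_log_ineq_mono[OF critical_parameter(2)[OF a] y0 ge]) (use a dim in auto)
      qed
      moreover have "(\<lambda>n. 1 / real (Suc n)) \<longlonglongrightarrow> 0" by real_asymp
      hence "(\<lambda>n. \<alpha> + 1 / real (Suc n)) \<longlonglongrightarrow> \<alpha> + 0" by (intro tendsto_intros)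
      ultimately have "sphere_log_ineq TYPE('a) (\<alpha> + 0) y" by (rule sphere_log_ineq_closed[OF _ _ tendsto_const y0])
      thus False using critical_parameter(4)[OF \<alpha> y0] y by simp
    qed
    then obtain n where n: "critical_parameter TYPE('a) (\<alpha> + 1 / real (Suc n)) < y" by blast
    have "eventually (\<lambda>x. (real DIM('a) - 1) / 2 < x) (at \<alpha>)" "eventually (\<lambda>x. x < \<alpha> + 1 / real (Suc n)) (at \<alpha>)"
      by (rule order_tendstoD[OF tendsto_ident_at]; use \<alpha> in simp)+
    thus "eventually (\<lambda>x. critical_parameter TYPE('a) x < y) (at \<alpha>)"
    proof eventually_elim
      case (elim x)
      have "critical_parameter TYPE('a) x \<le> critical_parameter TYPE('a) (\<alpha> + 1 / real (Suc n))"
        using elim by (intro critical_parameter_mono) auto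
      thus ?case using n by simp
    qed
  qed
  thus ?thesis by (simp add: continuous_on_eq_continuous_at)
qed

end

section \<open>The optimal constant and radial extremals\<close>

text \<open>The optimal constant among radial functions for \<open>\<Lambda> = (a\<^sub>c - a)\<^sup>2\<close>.\<close>

definition WLH_const :: "'a::euclidean_space itself \<Rightarrow> real \<Rightarrow> real \<Rightarrow> real" where
  "WLH_const T \<gamma> \<Lambda> = exp (log_const T \<gamma> \<Lambda> / (2 * \<gamma>))"

lemma WLH_const_pos: "WLH_const T \<gamma> \<Lambda> > 0" by (simp add: WLH_const_def)

lemma ln_WLH_const: "\<gamma> > 0 \<Longrightarrow> E > 0 \<Longrightarrow> 2 * \<gamma> * ln (WLH_const T \<gamma> \<Lambda> * E) = 2 * \<gamma> * ln E + log_const T \<gamma> \<Lambda>"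
  unfolding ln_mult_pos[OF WLH_const_pos] by (simp add: WLH_const_def distrib_left)

lemma WLH_holds_const:
  assumes "\<gamma> > 1 / 4" "\<Lambda> > 0" "\<Lambda> \<le> (a_c DIM('a) - a)\<^sup>2" "sphere_log_ineq TYPE('a::euclidean_space) (2 * \<gamma> - 1 / 2) \<Lambda>"
  shows "WLH_holds TYPE('a) \<gamma> a (WLH_const TYPE('a) \<gamma> \<Lambda>)" unfolding WLH_holds_def
proof (intro allI impI)
  fix u :: "'a \<Rightarrow> real" and g assume ug: "D12 a u g \<and> normalized a u"
  note W = D12_WLH[OF _ _ assms, of u g]
  have "dirichlet_energy a g > 0" using W(1) ug assms(2) by simp
  thus "entropy a u \<le> ereal (2 * \<gamma> * ln (WLH_const TYPE('a) \<gamma> \<Lambda> * dirichlet_energy a g))"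
    using W(2) ug assms(1) by (simp add: ln_WLH_const)
qed

lemma WLH_holds_lower:
  fixes \<psi> :: "'a::euclidean_space \<Rightarrow> real"
  assumes \<psi>: "smooth_on (- {0}) \<psi>" "(SPINT w. (\<psi> w)\<^sup>2) = 1"
    and \<gamma>: "\<gamma> > 1 / 4" and a: "a < a_c DIM('a)" and C: "C > 0" "WLH_holds TYPE('a) \<gamma> a C"
  shows "log_const TYPE('a) \<gamma> ((a_c DIM('a) - a)\<^sup>2) +
    (sphere_entropy \<psi> - (2 * \<gamma> - 1 / 2) * ln (1 + tangential_energy \<psi> / (a_c DIM('a) - a)\<^sup>2)) \<le> 2 * \<gamma> * ln C"
proof -
  define E where "E = ((a_c DIM('a) - a)\<^sup>2 + tangential_energy \<psi>) * (2 * \<gamma> / (2 * \<gamma> - 1 / 2))"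
  define u where "u = product_function (a_c DIM('a) - a) (\<gamma> / E) \<psi>"
  note P = optimal_product_function[OF \<psi> \<gamma> a, folded E_def, folded u_def]
  from C(2)[unfolded WLH_holds_def, rule_format, OF conjI[OF P(2,3)], unfolded P(4,5)]
  show ?thesis unfolding ln_mult_pos[OF C(1) P(1)] by (simp add: distrib_left)
qed

lemma const_sphere:
  "tangential_energy (\<lambda>w::'a::euclidean_space. 1) = 0" "sphere_entropy (\<lambda>w::'a. 1) = 0" "(\<integral>w. (1::real)\<^sup>2 \<partial>(usphere :: 'a measure)) = 1"
proof -
  have "gradient (\<lambda>w::'a. 1) w = 0" for w by (rule gradient_unique) simp
  thus "tangential_energy (\<lambda>w::'a. 1) = 0" by (simp add: tangential_energy_def tgrad_def)
qed (simp_all add: sphere_entropy_def)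

lemma WLH_const_le:
  assumes "\<gamma> > 1 / 4" "a < a_c DIM('a)" "C > 0" "WLH_holds TYPE('a::euclidean_space) \<gamma> a C"
  shows "WLH_const TYPE('a) \<gamma> ((a_c DIM('a) - a)\<^sup>2) \<le> C"
proof -
  have "log_const TYPE('a) \<gamma> ((a_c DIM('a) - a)\<^sup>2) \<le> 2 * \<gamma> * ln C"
    using WLH_holds_lower[OF smooth_on_const const_sphere(3) assms] by (simp add: const_sphere open_Compl)
  hence "log_const TYPE('a) \<gamma> ((a_c DIM('a) - a)\<^sup>2) / (2 * \<gamma>) \<le> ln C" using assms(1) by (simp add: pos_divide_le_eq mult.commute)
  hence "WLH_const TYPE('a) \<gamma> ((a_c DIM('a) - a)\<^sup>2) \<le> exp (ln C)" unfolding WLH_const_def by (simp only: exp_le_cancel_iff)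
  thus ?thesis using assms(3) by simp
qed

lemma WLH_const_attained_iff:
  assumes \<gamma>: "\<gamma> > 1 / 4" and a: "a < a_c DIM('a)"
  shows "WLH_holds TYPE('a::euclidean_space) \<gamma> a (WLH_const TYPE('a) \<gamma> ((a_c DIM('a) - a)\<^sup>2)) \<longleftrightarrow>
    sphere_log_ineq TYPE('a) (2 * \<gamma> - 1 / 2) ((a_c DIM('a) - a)\<^sup>2)"
proof
  assume W: "WLH_holds TYPE('a) \<gamma> a (WLH_const TYPE('a) \<gamma> ((a_c DIM('a) - a)\<^sup>2))"
  have l: "2 * \<gamma> * ln (WLH_const TYPE('a) \<gamma> ((a_c DIM('a) - a)\<^sup>2)) = log_const TYPE('a) \<gamma> ((a_c DIM('a) - a)\<^sup>2)"
    using \<gamma> by (simp add: WLH_const_def)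
  show "sphere_log_ineq TYPE('a) (2 * \<gamma> - 1 / 2) ((a_c DIM('a) - a)\<^sup>2)" unfolding sphere_log_ineq_def
  proof (intro allI impI)
    fix \<psi> :: "'a \<Rightarrow> real" assume \<psi>: "smooth_on (- {0}) \<psi> \<and> (SPINT w. (\<psi> w)\<^sup>2) = 1"
    show "sphere_entropy \<psi> \<le> (2 * \<gamma> - 1 / 2) * ln (1 + tangential_energy \<psi> / (a_c DIM('a) - a)\<^sup>2)"
      using WLH_holds_lower[OF conjunct1[OF \<psi>] conjunct2[OF \<psi>] \<gamma> a WLH_const_pos W] unfolding l by linarith
  qed
next
  assume "sphere_log_ineq TYPE('a) (2 * \<gamma> - 1 / 2) ((a_c DIM('a) - a)\<^sup>2)"
  thus "WLH_holds TYPE('a) \<gamma> a (WLH_const TYPE('a) \<gamma> ((a_c DIM('a) - a)\<^sup>2))" by (intro WLH_holds_const[OF \<gamma>]) (use a in auto)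
qed

lemma radial_extremal_exists:
  assumes \<gamma>: "\<gamma> > 1 / 4" and a: "a < a_c DIM('a)"
    and ineq: "sphere_log_ineq TYPE('a::euclidean_space) (2 * \<gamma> - 1 / 2) ((a_c DIM('a) - a)\<^sup>2)"
  shows "\<exists>u :: 'a \<Rightarrow> real. WLH_extremal \<gamma> a u \<and> radially_symmetric u"
proof -
  let ?\<Lambda> = "(a_c DIM('a) - a)\<^sup>2"
  have C: "C_WLH TYPE('a) \<gamma> a = WLH_const TYPE('a) \<gamma> ?\<Lambda>" unfolding C_WLH_def
    by (rule cInf_eq_minimum) (use WLH_const_attained_iff[OF \<gamma> a] ineq WLH_const_pos WLH_const_le[OF \<gamma> a] in blast)+
  define E where "E = (?\<Lambda> + tangential_energy (\<lambda>w::'a. 1)) * (2 * \<gamma> / (2 * \<gamma> - 1 / 2))"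
  define u :: "'a \<Rightarrow> real" where "u = product_function (a_c DIM('a) - a) (\<gamma> / E) (\<lambda>w. 1)"
  have s: "smooth_on (- {0}) (\<lambda>w::'a. 1)" by (rule smooth_on_const) auto
  note P = optimal_product_function[OF s const_sphere(3) \<gamma> a, folded E_def, folded u_def]
  have "entropy a u = ereal (2 * \<gamma> * ln (C_WLH TYPE('a) \<gamma> a * dirichlet_energy a (gradient u)))"
    unfolding P(5) C P(4) using ln_WLH_const[of \<gamma> E "TYPE('a)" ?\<Lambda>] P(1) \<gamma> by (simp add: const_sphere)
  hence "WLH_extremal \<gamma> a u" using P(2,3) unfolding WLH_extremal_def by blast
  moreover have "radially_symmetric u" unfolding radially_symmetric_def
    by (intro exI[of _ "\<lambda>r. sqrt (1 / (sphere_area TYPE('a) * sqrt (2 * pi * (\<gamma> / E)))) *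
      exp ((- (a_c DIM('a) - a)) * ln r + (- 1 / (4 * (\<gamma> / E))) * (ln r * ln r))"] always_eventually allI)
      (simp add: u_def product_function_def)
  ultimately show ?thesis by blast
qed

text \<open>If the inequality holds with some constant, it holds with the optimal one. A radial extremal
  attains it, yet radial functions satisfy the inequality with the constant \<open>WLH_const\<close>, which
  is a lower bound of all constants. So the two constants agree.\<close>

lemma radial_extremal_imp:
  assumes \<gamma>: "\<gamma> > 1 / 4" and a: "a < a_c DIM('a)"
    and \<Lambda>: "\<Lambda> > 0" "\<Lambda> \<le> (a_c DIM('a) - a)\<^sup>2" and ineq: "sphere_log_ineq TYPE('a::euclidean_space) (2 * \<gamma> - 1 / 2) \<Lambda>"
    and ext: "WLH_extremal \<gamma> a u" "radially_symmetric (u :: 'a \<Rightarrow> real)"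
  shows "sphere_log_ineq TYPE('a) (2 * \<gamma> - 1 / 2) ((a_c DIM('a) - a)\<^sup>2)"
proof -
  let ?X = "{C. C > 0 \<and> WLH_holds TYPE('a) \<gamma> a C}" and ?C = "WLH_const TYPE('a) \<gamma> ((a_c DIM('a) - a)\<^sup>2)"
  define C where "C = C_WLH TYPE('a) \<gamma> a"
  have ne: "?X \<noteq> {}" using WLH_holds_const[OF \<gamma> \<Lambda> ineq] WLH_const_pos by blast
  have C1: "?C \<le> C" unfolding C_def C_WLH_def by (rule cInf_greatest[OF ne]) (use WLH_const_le[OF \<gamma> a] in blast)
  hence C0: "C > 0" using WLH_const_pos[of "TYPE('a)" \<gamma> "(a_c DIM('a) - a)\<^sup>2"] by linarith
  have E0: "dirichlet_energy a g > 0" if "D12 a v g" "normalized a v" for v :: "'a \<Rightarrow> real" and g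
    using D12_WLH(1)[OF that \<gamma> \<Lambda> ineq] \<Lambda>(1) by simp
  have WC: "WLH_holds TYPE('a) \<gamma> a C" unfolding WLH_holds_def
  proof (intro allI impI)
    fix v :: "'a \<Rightarrow> real" and g assume v: "D12 a v g \<and> normalized a v"
    let ?E = "dirichlet_energy a g"
    have E: "?E > 0" using E0 v by blast
    have le: "entropy a v \<le> ereal (2 * \<gamma> * ln (D * ?E))" if "D \<in> ?X" for D using that v by (auto simp: WLH_holds_def)
    show "entropy a v \<le> ereal (2 * \<gamma> * ln (C * ?E))"
    proof (cases "entropy a v")
      case (real r)
      have "exp (r / (2 * \<gamma>)) / ?E \<le> D" if "D \<in> ?X" for D
      proof -
        have "r \<le> 2 * \<gamma> * ln (D * ?E)" using le[OF that] real by simp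
        hence "r / (2 * \<gamma>) \<le> ln (D * ?E)" using \<gamma> by (simp add: pos_divide_le_eq mult.commute)
        hence "exp (r / (2 * \<gamma>)) \<le> exp (ln (D * ?E))" by (simp only: exp_le_cancel_iff)
        also have "exp (ln (D * ?E)) = D * ?E" using that E by simp
        finally show ?thesis using E by (simp add: pos_divide_le_eq)
      qed
      hence "exp (r / (2 * \<gamma>)) / ?E \<le> C" unfolding C_def C_WLH_def by (rule cInf_greatest[OF ne])
      hence "exp (r / (2 * \<gamma>)) \<le> C * ?E" using E by (simp add: pos_divide_le_eq)
      hence "ln (exp (r / (2 * \<gamma>))) \<le> ln (C * ?E)" by (intro ln_mono) auto
      hence "r \<le> 2 * \<gamma> * ln (C * ?E)" using \<gamma> by (simp add: pos_divide_le_eq mult.commute)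
      thus ?thesis by (simp add: real)
    next
      case PInf
      obtain D where "D \<in> ?X" using ne by blast
      from le[OF this] show ?thesis by (simp add: PInf)
    qed simp
  qed
  obtain g where g: "normalized a u" "D12 a u g" "entropy a u = ereal (2 * \<gamma> * ln (C * dirichlet_energy a g))"
    using ext(1) by (auto simp: WLH_extremal_def C_def)
  have E: "dirichlet_energy a g > 0" by (rule E0[OF g(2,1)])
  have "2 * \<gamma> * ln (C * dirichlet_energy a g) \<le> 2 * \<gamma> * ln (?C * dirichlet_energy a g)"
    using radial_WLH[OF g(2,1) ext(2) \<gamma> a] ln_WLH_const[OF _ E, of \<gamma> "TYPE('a)" "(a_c DIM('a) - a)\<^sup>2"] \<gamma> unfolding g(3) by simp
  hence "ln (C * dirichlet_energy a g) \<le> ln (?C * dirichlet_energy a g)" using \<gamma> by simp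
  moreover have "C * dirichlet_energy a g > 0" "?C * dirichlet_energy a g > 0" by (intro mult_pos_pos C0 E WLH_const_pos)+
  ultimately have "C * dirichlet_energy a g \<le> ?C * dirichlet_energy a g" by (simp only: ln_le_cancel_iff)
  hence "C \<le> ?C" using E by simp
  hence "C = ?C" using C1 by simp
  thus ?thesis using WC WLH_const_attained_iff[OF \<gamma> a] by simp
qed

theorem theorem4:
  assumes "DIM('a::euclidean_space) \<ge> 2"
  shows "\<exists>a_star :: real \<Rightarrow> real.
    continuous_on {real DIM('a) / 4 <..} a_star \<and>
    (\<forall>\<gamma> > real DIM('a) / 4. a_star \<gamma> < a_c DIM('a)) \<and>
    (\<forall>\<gamma> > real DIM('a) / 4.
      (\<forall>a. a_star \<gamma> \<le> a \<and> a < a_c DIM('a) \<longrightarrow>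
        (\<exists>u :: 'a \<Rightarrow> real. WLH_extremal \<gamma> a u \<and> radially_symmetric u)) \<and>
      (\<forall>a < a_star \<gamma>.
        \<not> (\<exists>u :: 'a \<Rightarrow> real. WLH_extremal \<gamma> a u \<and> radially_symmetric u))) \<and>
    (\<forall>\<gamma> > real DIM('a) / 4. a_star \<gamma> \<ge> a_tilde DIM('a) \<gamma>)"
proof -
  define L where "L \<gamma> = critical_parameter TYPE('a) (2 * \<gamma> - 1 / 2)" for \<gamma>
  define a_star where "a_star \<gamma> = a_c DIM('a) - sqrt (L \<gamma>)" for \<gamma>
  have \<alpha>: "2 * \<gamma> - 1 / 2 > (real DIM('a) - 1) / 2" and \<gamma>4: "\<gamma> > 1 / 4" if "\<gamma> > real DIM('a) / 4" for \<gamma>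
    using that assms by (auto simp: field_simps)
  note cp = critical_parameter[OF assms \<alpha>, folded L_def]
  have cont: "continuous_on {real DIM('a) / 4 <..} a_star"
    unfolding a_star_def L_def
    by (intro continuous_intros continuous_on_compose2[OF continuous_critical_parameter[OF assms]]) (use \<alpha> in auto)
  have below: "a_star \<gamma> < a_c DIM('a)" if "\<gamma> > real DIM('a) / 4" for \<gamma>
    using cp(1)[OF that] by (simp add: a_star_def)
  have ex: "\<exists>u :: 'a \<Rightarrow> real. WLH_extremal \<gamma> a u \<and> radially_symmetric u"
    if \<gamma>: "\<gamma> > real DIM('a) / 4" and a: "a_star \<gamma> \<le> a" "a < a_c DIM('a)" for \<gamma> a
  proof (rule radial_extremal_exists[OF \<gamma>4[OF \<gamma>] a(2)])
    have "(a_c DIM('a) - a)\<^sup>2 \<le> (sqrt (L \<gamma>))\<^sup>2" using a by (intro power_mono) (auto simp: a_star_def)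
    hence "(a_c DIM('a) - a)\<^sup>2 \<le> L \<gamma>" using cp(1)[OF \<gamma>] by simp
    thus "sphere_log_ineq TYPE('a) (2 * \<gamma> - 1 / 2) ((a_c DIM('a) - a)\<^sup>2)"
      by (intro sphere_log_ineq_mono[OF cp(2)[OF \<gamma>]]) (use a \<gamma>4[OF \<gamma>] in auto)
  qed
  have nex: "\<not> (\<exists>u :: 'a \<Rightarrow> real. WLH_extremal \<gamma> a u \<and> radially_symmetric u)"
    if \<gamma>: "\<gamma> > real DIM('a) / 4" and a: "a < a_star \<gamma>" for \<gamma> a
  proof
    assume "\<exists>u :: 'a \<Rightarrow> real. WLH_extremal \<gamma> a u \<and> radially_symmetric u"
    then obtain u :: "'a \<Rightarrow> real" where u: "WLH_extremal \<gamma> a u" "radially_symmetric u" by blast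
    have ac: "a < a_c DIM('a)" using below[OF \<gamma>] a by simp
    have "sqrt (L \<gamma>) < a_c DIM('a) - a" using a by (simp add: a_star_def)
    hence "(sqrt (L \<gamma>))\<^sup>2 < (a_c DIM('a) - a)\<^sup>2" using cp(1)[OF \<gamma>] by (intro power_strict_mono) auto
    hence lt: "L \<gamma> < (a_c DIM('a) - a)\<^sup>2" using cp(1)[OF \<gamma>] by simp
    have "sphere_log_ineq TYPE('a) (2 * \<gamma> - 1 / 2) ((a_c DIM('a) - a)\<^sup>2)"
      by (rule radial_extremal_imp[OF \<gamma>4[OF \<gamma>] ac cp(1)[OF \<gamma>] less_imp_le[OF lt] cp(2)[OF \<gamma>] u])
    hence "(a_c DIM('a) - a)\<^sup>2 \<le> L \<gamma>" by (intro cp(4)[OF \<gamma>]) (use ac in auto)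
    thus False using lt by simp
  qed
  have tilde: "a_star \<gamma> \<ge> a_tilde DIM('a) \<gamma>" if "\<gamma> > real DIM('a) / 4" for \<gamma>
  proof -
    have "L \<gamma> \<le> (real DIM('a) - 1) * (4 * \<gamma> - 1) / 2\<^sup>2" using cp(3)[OF that] by (simp add: field_simps)
    hence "sqrt (L \<gamma>) \<le> sqrt ((real DIM('a) - 1) * (4 * \<gamma> - 1) / 2\<^sup>2)" by (rule real_sqrt_le_mono)
    thus ?thesis by (simp add: a_star_def a_tilde_def real_sqrt_divide)
  qed
  show ?thesis using cont below ex nex tilde by (intro exI[of _ a_star]) blast
qed

end
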